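(* Let $\epsilon\in\{0,1,-1\}$ and let $u$ be the solution of the weak problem with $\mathbf{u}:=(u,u|_{\mathcal{F}_h})\in\mathbf{V}$, where $\mathbf{V}:=\big(H^s_0(\Omega)\cap H^2(\mathcal{T}_h)\big)\times L^2(\mathcal{F}_h)$ with $s>3/2$. Then for all $\mathbf{v}_h=(v_h,\hat v_h)\in\mathbf{V}_h$, $$\mathcal{B}_h^{(\epsilon)}(\mathbf{u},\mathbf{v}_h)=(f,v_h)_{\mathcal{T}_h}.$$
   Context: Continuous problem. $\Omega\subset\mathbb{R}^d$, $d\ge2$, is a bounded polyhedral domain with Lipschitz boundary; $\kappa\in[L^\infty(\Omega)]^{d\times d}$ is symmetric and uniformly positive definite; $f\in L^2(\Omega)$. The weak problem is: find $u\in H^1_0(\Omega)$ with $\int_\Omega\kappa\nabla u\cdot\nabla v\,dx=\int_\Omega fv\,dx$ for all $v\in H^1_0(\Omega)$. $H^s_0(\Omega)$ denotes functions of $H^s(\Omega)$ with zero trace on $\partial\Omega$. Meshes. $\mathcal{T}_h$, $0<h\le1$, is an affine (conforming, simplicial) triangulation of $\Omega$ with $h_T:=\mathrm{diam}(T)$, $h:=\max_Th_T$. $\kappa|_T=:\kappa_T$ is constant for each $T\in\mathcal{T}_h$. $\mathcal{F}_h$ is the set of all interfaces ($(d-1)$-dimensional faces), $\mathcal{F}_h^b$ the boundary ones, $\mathcal{F}_T:=\{F\in\mathcal{F}_h:F\subset\partial T\}$, and $\mathbf{n}_{T,F}$ is the unit normal to $F$ pointing out of $T$. $H^2(\mathcal{T}_h)$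 is the broken Sobolev space, $\nabla_h$ the broken gradient, $(\cdot,\cdot)_{\mathcal{T}_h}:=\sum_T(\cdot,\cdot)_{L^2(T)}$, $\langle\cdot,\cdot\rangle_{\partial\mathcal{T}_h}:=\sum_T\langle\cdot,\cdot\rangle_{L^2(\partial T)}$. Discrete spaces. $V_h:=\{v_h\in L^2(\Omega):v_h|_T\in\mathbb{P}_k(T)\ \forall T\in\mathcal{T}_h\}$, $\hat V_h:=\{\hat v_h\in L^2(\mathcal{F}_h):\hat v_h|_F\in\mathbb{P}_k(F)\ \forall F\in\mathcal{F}_h,\ \hat v_h|_F=0\ \forall F\in\mathcal{F}_h^b\}$, $\mathbf{V}_h:=V_h\times\hat V_h$, where $\mathbb{P}_k$ denotes polynomials of degree at most $k$. For a pair $\mathbf{v}=(v,\hat v)$ the jump on $F\in\mathcal{F}_T$ is $[\![\mathbf{v}]\!]_{T,F}:=(v|_T|_F-\hat v|_F)\,\mathbf{n}_{T,F}$. Bilinear form (defined by the same formula when an argument lies in $\mathbf{V}$). $$\mathcal{B}_h^{(\epsilon)}(\mathbf{w},\mathbf{v}):=(\kappa\nabla_hw,\nabla_hv)_{\mathcal{T}_h}+\langle\tau[\![\mathbf{w}]\!],[\![\mathbf{v}]\!]\rangle_{\partial\mathcal{T}_h}-\langle\kappa\nabla_hw,[\![\mathbf{v}]\!]\rangle_{\partial\mathcal{T}_h}-\epsilon\langle\kappa\nabla_hv,[\![\mathbf{w}]\!]\rangle_{\partial\mathcal{T}_h},$$ where on $F\in\mathcal{F}_T$ the penalty $\tau$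 equals $\tau_{T,F}:=\alpha_0C_{tr}^2\kappa_{T,F}/h_T^{1+\delta}$, with $\kappa_{T,F}:=\mathbf{n}_{T,F}\cdot\kappa_T\mathbf{n}_{T,F}$, $\delta\in\mathbb{R}$, a parameter $\alpha_0>0$ and a constant $C_{tr}>0$ (the constant of the discrete trace inequality $\|p\|_{L^2(F)}\le C_{tr}h_T^{-1/2}\|p\|_{L^2(T)}$, $p\in\mathbb{P}_k(T)$). *)

theory Defs
  imports "HOL-Analysis.Analysis"
begin

section \<open>Lebesgue and Sobolev spaces on open sets\<close>

text \<open>Elements of $L^2$ are represented by functions; all notions below are insensitive to
  changes on null sets.  Measures on domains are Lebesgue (complete) measures.\<close>

definition square_integrable :: "'a measure \<Rightarrow> ('a \<Rightarrow> real) \<Rightarrow> bool" where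
  "square_integrable M g \<longleftrightarrow> g \<in> borel_measurable M \<and> integrable M (\<lambda>x. (g x)\<^sup>2)"

definition pderivative :: "'n \<Rightarrow> (real^'n \<Rightarrow> real) \<Rightarrow> real^'n \<Rightarrow> real" where
  "pderivative i g x = frechet_derivative g (at x) (axis i 1)"

primrec Ck :: "nat \<Rightarrow> (real^'n \<Rightarrow> real) \<Rightarrow> bool" where
  "Ck 0 g \<longleftrightarrow> continuous_on UNIV g"
| "Ck (Suc m) g \<longleftrightarrow> (\<forall>x. g differentiable (at x)) \<and> (\<forall>i. Ck m (pderivative i g))"

definition smooth :: "(real^'n \<Rightarrow> real) \<Rightarrow> bool" where
  "smooth g \<longleftrightarrow> (\<forall>m. Ck m g)"

definition test_function :: "(real^'n) set \<Rightarrow> (real^'n \<Rightarrow> real) \<Rightarrow> bool" where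
  "test_function D \<phi> \<longleftrightarrow> smooth \<phi> \<and> compact (closure {x. \<phi> x \<noteq> 0}) \<and> closure {x. \<phi> x \<noteq> 0} \<subseteq> D"

definition locally_integrable :: "(real^'n) set \<Rightarrow> (real^'n \<Rightarrow> real) \<Rightarrow> bool" where
  "locally_integrable D g \<longleftrightarrow> (\<forall>K. compact K \<and> K \<subseteq> D \<longrightarrow> integrable (lebesgue_on K) g)"

definition has_weak_pderivative ::
    "(real^'n) set \<Rightarrow> 'n \<Rightarrow> (real^'n \<Rightarrow> real) \<Rightarrow> (real^'n \<Rightarrow> real) \<Rightarrow> bool" where
  "has_weak_pderivative D i w g \<longleftrightarrow>
     locally_integrable D w \<and> locally_integrable D g \<and>
     (\<forall>\<phi>. test_function D \<phi> \<longrightarrow>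
        (LINT x|lebesgue_on D. w x * pderivative i \<phi> x) = - (LINT x|lebesgue_on D. g x * \<phi> x))"

text \<open>The weak derivative is unique almost everywhere, so the choice of representative is
  immaterial.\<close>

definition weak_pderivative :: "(real^'n) set \<Rightarrow> 'n \<Rightarrow> (real^'n \<Rightarrow> real) \<Rightarrow> real^'n \<Rightarrow> real" where
  "weak_pderivative D i w = (SOME g. has_weak_pderivative D i w g)"

definition weak_grad :: "(real^'n) set \<Rightarrow> (real^'n \<Rightarrow> real) \<Rightarrow> real^'n \<Rightarrow> real^'n" where
  "weak_grad D w x = (\<chi> i. weak_pderivative D i w x)"

text \<open>Sobolev--Slobodeckij spaces: $H^{m+\theta}$ consists of the functions whose weak
  derivatives of order at most $m$ are in $L^2$ and, if $\theta > 0$, whose derivatives of order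
  $m$ have a finite Gagliardo seminorm of order $\theta$.\<close>

definition gagliardo :: "real \<Rightarrow> (real^'n) set \<Rightarrow> (real^'n \<Rightarrow> real) \<Rightarrow> ennreal" where
  "gagliardo \<theta> D w = (\<integral>\<^sup>+x. (\<integral>\<^sup>+y.
       ennreal ((w x - w y)\<^sup>2 / dist x y powr (real CARD('n) + 2 * \<theta>))
     \<partial>lebesgue_on D) \<partial>lebesgue_on D)"

primrec sobolev_aux :: "real \<Rightarrow> (real^'n) set \<Rightarrow> nat \<Rightarrow> (real^'n \<Rightarrow> real) \<Rightarrow> bool" where
  "sobolev_aux \<theta> D 0 w \<longleftrightarrow>
     square_integrable (lebesgue_on D) w \<and> (\<theta> > 0 \<longrightarrow> gagliardo \<theta> D w < \<infinity>)"
| "sobolev_aux \<theta> D (Suc m) w \<longleftrightarrow>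
     square_integrable (lebesgue_on D) w \<and>
     (\<forall>i. \<exists>g. has_weak_pderivative D i w g \<and> sobolev_aux \<theta> D m g)"

definition sobolev :: "real \<Rightarrow> (real^'n) set \<Rightarrow> (real^'n \<Rightarrow> real) \<Rightarrow> bool" where
  "sobolev s D w \<longleftrightarrow> sobolev_aux (frac s) D (nat \<lfloor>s\<rfloor>) w"


section \<open>Surface measure and traces\<close>

text \<open>The $(d-1)$-dimensional Lebesgue measure on the hyperplane $n \cdot x = c$, $|n| = 1$,
  obtained by projecting the slab of thickness 1 above the hyperplane orthogonally onto it:
  a subset $A$ of the hyperplane has the $d$-dimensional volume of the cylinder of height 1
  over $A$.\<close>

definition hyperplane_measure :: "real^'n \<Rightarrow> real \<Rightarrow> (real^'n) measure" where
  "hyperplane_measure n c =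
     completion (distr (restrict_space lborel {x. c \<le> n \<bullet> x \<and> n \<bullet> x \<le> c + 1}) borel
       (\<lambda>x. x - (n \<bullet> x - c) *\<^sub>R n))"

definition facet_measure :: "(real^'n) set \<Rightarrow> (real^'n) measure" where
  "facet_measure F =
     (let n = (SOME n. norm n = 1 \<and> (\<forall>x\<in>F. \<forall>y\<in>F. n \<bullet> x = n \<bullet> y));
          c = n \<bullet> (SOME x. x \<in> F)
      in restrict_space (hyperplane_measure n c) F)"

definition smooth_H1_approx ::
    "(real^'n) set \<Rightarrow> (nat \<Rightarrow> real^'n \<Rightarrow> real) \<Rightarrow> (real^'n \<Rightarrow> real) \<Rightarrow> bool" where
  "smooth_H1_approx D \<phi> w \<longleftrightarrow>
     (\<forall>j. smooth (\<phi> j)) \<and>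
     (\<lambda>j. (\<integral>\<^sup>+x. ennreal ((\<phi> j x - w x)\<^sup>2) \<partial>lebesgue_on D) +
          (\<Sum>i\<in>UNIV. \<integral>\<^sup>+x. ennreal ((pderivative i (\<phi> j) x - weak_pderivative D i w x)\<^sup>2)
             \<partial>lebesgue_on D))
       \<longlonglongrightarrow> 0"

text \<open>The trace operator on $H^1(D)$ is the continuous extension of the restriction
  $\phi \mapsto \phi|_F$, $\phi \in C^\infty(\overline D)$; \<open>has_trace\<close> is its graph, for a
  flat piece \<open>F\<close> of dimension $d-1$ in the closure of \<open>D\<close>.\<close>

definition has_trace ::
    "(real^'n) set \<Rightarrow> (real^'n) set \<Rightarrow> (real^'n \<Rightarrow> real) \<Rightarrow> (real^'n \<Rightarrow> real) \<Rightarrow> bool" where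
  "has_trace D F w g \<longleftrightarrow>
     sobolev 1 D w \<and> square_integrable (facet_measure F) g \<and>
     (\<exists>\<phi>. smooth_H1_approx D \<phi> w \<and>
        (\<lambda>j. \<integral>\<^sup>+x. ennreal ((\<phi> j x - g x)\<^sup>2) \<partial>facet_measure F) \<longlonglongrightarrow> 0)"

definition trace_on :: "(real^'n) set \<Rightarrow> (real^'n) set \<Rightarrow> (real^'n \<Rightarrow> real) \<Rightarrow> real^'n \<Rightarrow> real" where
  "trace_on D F w = (SOME g. has_trace D F w g)"

text \<open>Zero trace on the boundary of a polyhedral domain.  Such a boundary lies in finitely many
  hyperplanes, and distinct hyperplanes meet in surface null sets, so convergence in
  $L^2(\partial D)$ is convergence on the part of the boundary in each hyperplane.\<close>

definition zero_boundary_trace :: "(real^'n) set \<Rightarrow> (real^'n \<Rightarrow> real) \<Rightarrow> bool" where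
  "zero_boundary_trace D w \<longleftrightarrow>
     sobolev 1 D w \<and>
     (\<exists>\<phi>. smooth_H1_approx D \<phi> w \<and>
        (\<forall>n c. norm n = 1 \<longrightarrow>
          (\<lambda>j. \<integral>\<^sup>+x. ennreal ((\<phi> j x)\<^sup>2) \<partial>restrict_space (hyperplane_measure n c) (frontier D))
            \<longlonglongrightarrow> 0))"

text \<open>Used for $s \ge 1$ only.\<close>

definition sobolev0 :: "real \<Rightarrow> (real^'n) set \<Rightarrow> (real^'n \<Rightarrow> real) \<Rightarrow> bool" where
  "sobolev0 s D w \<longleftrightarrow> sobolev s D w \<and> zero_boundary_trace D w"


section \<open>The continuous problem\<close>

text \<open>Near each boundary point the domain is, in suitable orthogonal coordinates, the strict
  epigraph of a Lipschitz function \<open>\<gamma>\<close> over the hyperplane orthogonal to \<open>e\<close>.\<close>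

definition lipschitz_boundary :: "(real^'n) set \<Rightarrow> bool" where
  "lipschitz_boundary D \<longleftrightarrow>
     (\<forall>x\<in>frontier D. \<exists>r>0. \<exists>e \<gamma> L. norm e = 1 \<and> L-lipschitz_on {y. e \<bullet> y = 0} \<gamma> \<and>
        (\<forall>y\<in>ball x r. y \<in> D \<longleftrightarrow> e \<bullet> y > (\<gamma> (y - (e \<bullet> y) *\<^sub>R e) :: real)))"

definition polyhedral_lipschitz_domain :: "(real^'n) set \<Rightarrow> bool" where
  "polyhedral_lipschitz_domain D \<longleftrightarrow>
     open D \<and> connected D \<and> D \<noteq> {} \<and> bounded D \<and>
     (\<exists>P. finite P \<and> (\<forall>S\<in>P. polytope S) \<and> closure D = \<Union>P) \<and>
     lipschitz_boundary D"

definition admissible_coefficient :: "(real^'n) set \<Rightarrow> (real^'n \<Rightarrow> real^'n^'n) \<Rightarrow> bool" where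
  "admissible_coefficient D \<kappa> \<longleftrightarrow>
     (\<forall>i j. (\<lambda>x. \<kappa> x $ i $ j) \<in> borel_measurable (lebesgue_on D)) \<and>
     (\<exists>C. \<forall>i j. AE x in lebesgue_on D. \<bar>\<kappa> x $ i $ j\<bar> \<le> C) \<and>
     (AE x in lebesgue_on D. transpose (\<kappa> x) = \<kappa> x) \<and>
     (\<exists>c>0. AE x in lebesgue_on D. \<forall>\<xi>. \<xi> \<bullet> (\<kappa> x *v \<xi>) \<ge> c * (norm \<xi>)\<^sup>2)"

definition weak_solution ::
    "(real^'n) set \<Rightarrow> (real^'n \<Rightarrow> real^'n^'n) \<Rightarrow> (real^'n \<Rightarrow> real) \<Rightarrow> (real^'n \<Rightarrow> real) \<Rightarrow> bool" where
  "weak_solution D \<kappa> f u \<longleftrightarrow>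
     sobolev0 1 D u \<and>
     (\<forall>v. sobolev0 1 D v \<longrightarrow>
        (LINT x|lebesgue_on D. (\<kappa> x *v weak_grad D u x) \<bullet> weak_grad D v x) =
        (LINT x|lebesgue_on D. f x * v x))"


section \<open>Meshes\<close>

text \<open>A mesh is a set of closed simplices; the library's \<open>triangulation\<close> says that it is
  finite and that any two members meet in a common (possibly empty) face.\<close>

definition conforming_mesh :: "(real^'n) set \<Rightarrow> (real^'n) set set \<Rightarrow> bool" where
  "conforming_mesh D \<T> \<longleftrightarrow>
     triangulation \<T> \<and> (\<forall>T\<in>\<T>. int CARD('n) simplex T) \<and> \<Union>\<T> = closure D"

definition mesh_size :: "(real^'n) set set \<Rightarrow> real" where
  "mesh_size \<T> = Max (diameter ` \<T>)"

definition interfaces :: "(real^'n) set set \<Rightarrow> (real^'n) set set" where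
  "interfaces \<T> = {F. \<exists>T\<in>\<T>. F facet_of T}"

definition boundary_interfaces :: "(real^'n) set \<Rightarrow> (real^'n) set set \<Rightarrow> (real^'n) set set" where
  "boundary_interfaces D \<T> = {F \<in> interfaces \<T>. F \<subseteq> frontier D}"

definition interfaces_of :: "(real^'n) set set \<Rightarrow> (real^'n) set \<Rightarrow> (real^'n) set set" where
  "interfaces_of \<T> T = {F \<in> interfaces \<T>. F \<subseteq> frontier T}"

definition outward_normal :: "(real^'n) set \<Rightarrow> (real^'n) set \<Rightarrow> real^'n" where
  "outward_normal T F =
     (THE n. norm n = 1 \<and> (\<forall>x\<in>F. \<forall>y\<in>F. n \<bullet> (y - x) = 0) \<and> (\<forall>x\<in>F. \<forall>y\<in>T. n \<bullet> (y - x) \<le> 0))"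

definition piecewise_constant :: "(real^'n) set set \<Rightarrow> (real^'n \<Rightarrow> real^'n^'n) \<Rightarrow> bool" where
  "piecewise_constant \<T> \<kappa> \<longleftrightarrow> (\<forall>T\<in>\<T>. \<exists>M. AE x in lebesgue_on T. \<kappa> x = M)"

definition cell_value :: "(real^'n \<Rightarrow> real^'n^'n) \<Rightarrow> (real^'n) set \<Rightarrow> real^'n^'n" where
  "cell_value \<kappa> T = (THE M. AE x in lebesgue_on T. \<kappa> x = M)"


section \<open>Function spaces on the mesh\<close>

text \<open>A pair consists of a function on the domain and a function on the mesh skeleton (the union
  of the interfaces); values of the latter off the skeleton are irrelevant.\<close>

type_synonym 'n hybrid = "(real^'n \<Rightarrow> real) \<times> (real^'n \<Rightarrow> real)"

text \<open>Restricting these functions to an interface gives exactly the polynomials of degree at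
  most \<open>k\<close> in $d-1$ variables on it.\<close>

definition polynomial_le :: "nat \<Rightarrow> (real^'n \<Rightarrow> real) \<Rightarrow> bool" where
  "polynomial_le k p \<longleftrightarrow>
     (\<exists>c. \<forall>x. p x = (\<Sum>\<alpha> | (\<Sum>i\<in>UNIV. \<alpha> i) \<le> k. c \<alpha> * (\<Prod>i\<in>UNIV. (x $ i) ^ (\<alpha> i :: nat))))"

lemma finite_multi_indices: "finite {\<alpha> :: 'n::finite \<Rightarrow> nat. (\<Sum>i\<in>UNIV. \<alpha> i) \<le> k}"
proof (rule finite_subset)
  show "{\<alpha> :: 'n \<Rightarrow> nat. (\<Sum>i\<in>UNIV. \<alpha> i) \<le> k} \<subseteq> PiE UNIV (\<lambda>_. {..k})"
  proof
    fix \<alpha> :: "'n \<Rightarrow> nat"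
    assume "\<alpha> \<in> {\<alpha>. (\<Sum>i\<in>UNIV. \<alpha> i) \<le> k}"
    then have le: "(\<Sum>i\<in>UNIV. \<alpha> i) \<le> k" by simp
    have "\<alpha> i \<le> k" for i
    proof -
      have "\<alpha> i \<le> (\<Sum>i\<in>UNIV. \<alpha> i)" by (rule member_le_sum) simp_all
      with le show ?thesis by (rule order_trans[rotated])
    qed
    then show "\<alpha> \<in> PiE UNIV (\<lambda>_. {..k})" by (simp add: PiE_iff)
  qed
  show "finite (PiE (UNIV :: 'n set) (\<lambda>_. {..k}))"
    by (rule finite_PiE) simp_all
qed

definition L2_skeleton :: "(real^'n) set set \<Rightarrow> (real^'n \<Rightarrow> real) \<Rightarrow> bool" where
  "L2_skeleton \<T> g \<longleftrightarrow> (\<forall>F\<in>interfaces \<T>. square_integrable (facet_measure F) g)"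

definition broken_H2 :: "(real^'n) set set \<Rightarrow> (real^'n \<Rightarrow> real) \<Rightarrow> bool" where
  "broken_H2 \<T> w \<longleftrightarrow> (\<forall>T\<in>\<T>. sobolev 2 (interior T) w)"

definition continuous_space :: "real \<Rightarrow> (real^'n) set \<Rightarrow> (real^'n) set set \<Rightarrow> 'n hybrid set" where
  "continuous_space s D \<T> = {(w, wh). sobolev0 s D w \<and> broken_H2 \<T> w \<and> L2_skeleton \<T> wh}"

definition is_skeleton_restriction ::
    "(real^'n) set \<Rightarrow> (real^'n) set set \<Rightarrow> (real^'n \<Rightarrow> real) \<Rightarrow> (real^'n \<Rightarrow> real) \<Rightarrow> bool" where
  "is_skeleton_restriction D \<T> w wh \<longleftrightarrow>
     (\<forall>F\<in>interfaces \<T>. AE x in facet_measure F. wh x = trace_on D F w x)"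

definition cell_space :: "nat \<Rightarrow> (real^'n) set \<Rightarrow> (real^'n) set set \<Rightarrow> (real^'n \<Rightarrow> real) set" where
  "cell_space k D \<T> =
     {v. square_integrable (lebesgue_on D) v \<and>
         (\<forall>T\<in>\<T>. \<exists>p. polynomial_le k p \<and> (AE x in lebesgue_on T. v x = p x))}"

definition skeleton_space :: "nat \<Rightarrow> (real^'n) set \<Rightarrow> (real^'n) set set \<Rightarrow> (real^'n \<Rightarrow> real) set" where
  "skeleton_space k D \<T> =
     {vh. L2_skeleton \<T> vh \<and>
         (\<forall>F\<in>interfaces \<T>. \<exists>p. polynomial_le k p \<and> (AE x in facet_measure F. vh x = p x)) \<and>
         (\<forall>F\<in>boundary_interfaces D \<T>. AE x in facet_measure F. vh x = 0)}"

definition hybrid_space :: "nat \<Rightarrow> (real^'n) set \<Rightarrow> (real^'n) set set \<Rightarrow> 'n hybrid set" where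
  "hybrid_space k D \<T> = cell_space k D \<T> \<times> skeleton_space k D \<T>"


section \<open>The bilinear form\<close>

definition mesh_integral :: "(real^'n) set set \<Rightarrow> (real^'n \<Rightarrow> real) \<Rightarrow> real" where
  "mesh_integral \<T> g = (\<Sum>T\<in>\<T>. LINT x|lebesgue_on T. g x)"

text \<open>Integrands on the cell boundaries depend on the cell and the face as well.\<close>

definition mesh_boundary_integral ::
    "(real^'n) set set \<Rightarrow> ((real^'n) set \<Rightarrow> (real^'n) set \<Rightarrow> real^'n \<Rightarrow> real) \<Rightarrow> real" where
  "mesh_boundary_integral \<T> g =
     (\<Sum>T\<in>\<T>. \<Sum>F\<in>interfaces_of \<T> T. LINT x|facet_measure F. g T F x)"

definition discrete_trace_constant :: "nat \<Rightarrow> (real^'n) set set \<Rightarrow> real \<Rightarrow> bool" where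
  "discrete_trace_constant k \<T> C \<longleftrightarrow>
     (\<forall>T\<in>\<T>. \<forall>F\<in>interfaces_of \<T> T. \<forall>p. polynomial_le k p \<longrightarrow>
        sqrt (LINT x|facet_measure F. (p x)\<^sup>2)
          \<le> C * diameter T powr (- 1 / 2) * sqrt (LINT x|lebesgue_on T. (p x)\<^sup>2))"

definition broken_grad :: "(real^'n) set set \<Rightarrow> (real^'n \<Rightarrow> real) \<Rightarrow> real^'n \<Rightarrow> real^'n" where
  "broken_grad \<T> w x = (\<Sum>T\<in>\<T>. if x \<in> interior T then weak_grad (interior T) w x else 0)"

definition cell_flux ::
    "(real^'n \<Rightarrow> real^'n^'n) \<Rightarrow> (real^'n \<Rightarrow> real) \<Rightarrow> (real^'n) set \<Rightarrow> (real^'n) set \<Rightarrow> real^'n \<Rightarrow> real^'n" where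
  "cell_flux \<kappa> w T F x =
     cell_value \<kappa> T *v (\<chi> i. trace_on (interior T) F (weak_pderivative (interior T) i w) x)"

definition jump :: "'n hybrid \<Rightarrow> (real^'n) set \<Rightarrow> (real^'n) set \<Rightarrow> real^'n \<Rightarrow> real^'n" where
  "jump w T F x = (trace_on (interior T) F (fst w) x - snd w x) *\<^sub>R outward_normal T F"

definition penalty ::
    "real \<Rightarrow> real \<Rightarrow> real \<Rightarrow> (real^'n \<Rightarrow> real^'n^'n) \<Rightarrow> (real^'n) set \<Rightarrow> (real^'n) set \<Rightarrow> real" where
  "penalty \<alpha>0 C \<delta> \<kappa> T F =
     \<alpha>0 * C\<^sup>2 * (outward_normal T F \<bullet> (cell_value \<kappa> T *v outward_normal T F))
       / diameter T powr (1 + \<delta>)"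

definition bilinear_form ::
    "(real^'n) set set \<Rightarrow> (real^'n \<Rightarrow> real^'n^'n) \<Rightarrow> ((real^'n) set \<Rightarrow> (real^'n) set \<Rightarrow> real) \<Rightarrow> real
       \<Rightarrow> 'n hybrid \<Rightarrow> 'n hybrid \<Rightarrow> real" where
  "bilinear_form \<T> \<kappa> \<tau> \<epsilon> w v =
     mesh_integral \<T> (\<lambda>x. (\<kappa> x *v broken_grad \<T> (fst w) x) \<bullet> broken_grad \<T> (fst v) x)
     + mesh_boundary_integral \<T> (\<lambda>T F x. \<tau> T F * (jump w T F x \<bullet> jump v T F x))
     - mesh_boundary_integral \<T> (\<lambda>T F x. cell_flux \<kappa> (fst w) T F x \<bullet> jump v T F x)
     - \<epsilon> * mesh_boundary_integral \<T> (\<lambda>T F x. cell_flux \<kappa> (fst v) T F x \<bullet> jump w T F x)"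

end

theory Submission
  imports Defs
begin

text \<open>On each cell the flux \<open>\<kappa>\<nabla>u\<close> is in \<open>H\<^sup>1\<close>, so integration by parts against a smooth
  function is available there, with boundary terms in the traces of the flux.  Testing the weak
  problem with functions supported in one cell gives \<open>- div (\<kappa>\<nabla>u) = f\<close> almost everywhere in the
  cell; testing it with functions supported near the interior of one interface then shows that the
  normal fluxes from its two sides cancel.  As \<open>u\<close> has no jumps, the form reduces to the volume
  term and the consistency term.  Integration by parts turns the former into \<open>(f, v)\<close> plus
  boundary terms in the cell unknown, which the consistency term cancels up to the normal fluxes
  against the single-valued skeleton unknown; these vanish by flux continuity and because the
  skeleton unknown is zero on the boundary.

  The divergence theorem and the trace inequality on a simplex both come from one identity for a
  cone over a facet, obtained by dilating the cone about its apex.  Traces exist because smooth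
  functions are dense in \<open>H\<^sup>1\<close> of a convex set: averaging \<open>w((1 - e) x + e z)\<close> over \<open>z\<close> with a
  smooth weight supported in the set smooths \<open>w\<close> without leaving the set.\<close>

section \<open>Smooth functions\<close>

text \<open>\<open>weak_pderivative\<close>, \<open>trace_on\<close> and \<open>cell_value\<close>
  are choices, meaningful only once existence and uniqueness almost everywhere are known; much of
  the development serves that. Since a trace is a limit of restrictions of smooth functions, every
  fact on a facet is shown for smooth functions together with an estimate and then passed to the
  limit. Surface measure is the volume of a cylinder of height 1, so surface statements turn into
  volume statements; for example, the boundary of a facet is null because a convex cylinder has a
  negligible frontier. The domain may be nonconvex, but the zero-trace condition on \<open>u\<close>
  supplies a smooth sequence on the whole domain. Its restrictions approximate \<open>u\<close> on
  every cell, which makes the trace of \<open>u\<close> from the domain and those from the cells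
  agree. The Lipschitz boundary excludes slits: an interface either lies in the boundary or has its
  relative interior inside the domain, so flux cancellation and the zero boundary values of the
  skeleton unknown together cover every interface.\<close>

lemma smooth_imp_differentiable: "smooth g \<Longrightarrow> g differentiable (at x)"
  unfolding smooth_def by (metis Ck.simps(2))

lemma smooth_pderivative: "smooth g \<Longrightarrow> smooth (pderivative i g)"
  unfolding smooth_def by (metis Ck.simps(2))

text \<open>\<open>Ck\<close> passes to all partial derivatives at every order, so the induction on
  the order runs over a whole family at once. A concrete function is later proved smooth by placing
  it in a family of differentiable functions that is stable under partial derivatives.\<close>

lemma smooth_coinduct:
  assumes "g \<in> S"
    and "\<And>f x. f \<in> S \<Longrightarrow> f differentiable (at x)"
    and "\<And>f i. f \<in> S \<Longrightarrow> pderivative i f \<in> S"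
  shows "smooth g"
proof -
  have "\<forall>f\<in>S. Ck m f" for m
  proof (induction m)
    case 0
    then show ?case
      using assms(2) by (auto intro!: differentiable_imp_continuous_on simp: differentiable_on_def)
  next
    case (Suc m)
    then show ?case using assms by auto
  qed
  then show ?thesis using assms(1) by (auto simp: smooth_def)
qed

lemma smooth_continuous_on: "smooth g \<Longrightarrow> continuous_on S g"
  by (auto intro!: differentiable_imp_continuous_on differentiable_at_withinI
      smooth_imp_differentiable simp: differentiable_on_def)

lemma smooth_borel_measurable [measurable_dest]: "smooth g \<Longrightarrow> g \<in> borel_measurable borel"
  by (intro borel_measurable_continuous_onI smooth_continuous_on)

definition pgrad :: "(real^'n \<Rightarrow> real) \<Rightarrow> real^'n \<Rightarrow> real^'n" where
  "pgrad g x = (\<chi> i. pderivative i g x)"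

lemma pderivative_eqI: "(g has_derivative g') (at x) \<Longrightarrow> pderivative i g x = g' (axis i 1)"
  by (simp add: pderivative_def flip: frechet_derivative_at)

lemma differentiable_has_derivative_pgrad:
  assumes "g differentiable (at x)"
  shows "(g has_derivative (\<lambda>h. pgrad g x \<bullet> h)) (at x)"
proof -
  let ?D = "frechet_derivative g (at x)"
  have D: "(g has_derivative ?D) (at x)"
    using assms by (simp add: frechet_derivative_works)
  then have lin: "linear ?D" by (rule has_derivative_linear)
  have "?D h = pgrad g x \<bullet> h" for h
  proof -
    have "?D h = ?D (\<Sum>i\<in>UNIV. (h$i) *\<^sub>R axis i 1)"
      using basis_expansion[of h] by (simp add: scalar_mult_eq_scaleR)
    also have "\<dots> = (\<Sum>i\<in>UNIV. (h$i) * pderivative i g x)"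
      using lin by (simp add: linear_sum linear_cmul pderivative_def)
    finally show ?thesis by (simp add: inner_vec_def pgrad_def mult.commute)
  qed
  then have "?D = (\<lambda>h. pgrad g x \<bullet> h)" by auto
  with D show ?thesis by simp
qed

lemma smooth_has_derivative: "smooth g \<Longrightarrow> (g has_derivative (\<lambda>h. pgrad g x \<bullet> h)) (at x)"
  by (simp add: differentiable_has_derivative_pgrad smooth_imp_differentiable)

lemma continuous_on_pgrad: "smooth g \<Longrightarrow> continuous_on S (pgrad g)"
  unfolding pgrad_def
  by (intro continuous_on_vec_lambda smooth_continuous_on smooth_pderivative)

section \<open>Sums, products and polynomials of smooth functions\<close>

lemma pderivative_add:
  assumes "f differentiable (at x)" "g differentiable (at x)"
  shows "pderivative i (\<lambda>x. f x + g x) x = pderivative i f x + pderivative i g x"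
proof -
  have "((\<lambda>x. f x + g x) has_derivative
      (\<lambda>h. frechet_derivative f (at x) h + frechet_derivative g (at x) h)) (at x)"
    using assms by (intro has_derivative_add) (simp_all add: frechet_derivative_works)
  from pderivative_eqI[OF this] show ?thesis by (simp add: pderivative_def)
qed

lemma pderivative_mult:
  assumes "f differentiable (at x)" "g differentiable (at x)"
  shows "pderivative i (\<lambda>x. f x * g x) x = f x * pderivative i g x + pderivative i f x * g x"
proof -
  have "((\<lambda>x. f x * g x) has_derivative
      (\<lambda>h. f x * frechet_derivative g (at x) h + frechet_derivative f (at x) h * g x)) (at x)"
    using assms by (intro has_derivative_mult) (simp_all add: frechet_derivative_works)
  from pderivative_eqI[OF this] show ?thesis by (simp add: pderivative_def)
qed

lemma pderivative_const [simp]: "pderivative i (\<lambda>x. c) = (\<lambda>x. 0)"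
  by (auto intro!: ext pderivative_eqI[where g' = "\<lambda>h. 0", simplified])

text \<open>The derivative of a product is a sum of products, so products alone do not give a family
  stable under differentiation. Closing the smooth functions under both operations does.\<close>

inductive_set smooth_algebra :: "(real^'n \<Rightarrow> real) set" where
  base: "smooth f \<Longrightarrow> f \<in> smooth_algebra"
| add: "f \<in> smooth_algebra \<Longrightarrow> g \<in> smooth_algebra \<Longrightarrow> (\<lambda>x. f x + g x) \<in> smooth_algebra"
| mult: "f \<in> smooth_algebra \<Longrightarrow> g \<in> smooth_algebra \<Longrightarrow> (\<lambda>x. f x * g x) \<in> smooth_algebra"

lemma smooth_algebra_closed:
  assumes "f \<in> smooth_algebra"
  shows "(\<forall>x. f differentiable (at x)) \<and> (\<forall>i. pderivative i f \<in> smooth_algebra)"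
  using assms
proof induction
  case (base f)
  then show ?case
    by (auto intro: smooth_imp_differentiable smooth_pderivative smooth_algebra.base)
next
  case (add f g)
  then have "pderivative i (\<lambda>x. f x + g x) = (\<lambda>x. pderivative i f x + pderivative i g x)" for i
    by (auto intro!: ext pderivative_add)
  with add show ?case by (auto intro: smooth_algebra.add)
next
  case (mult f g)
  then have "pderivative i (\<lambda>x. f x * g x) =
      (\<lambda>x. f x * pderivative i g x + pderivative i f x * g x)" for i
    by (auto intro!: ext pderivative_mult)
  moreover have "(\<lambda>x. f x * pderivative i g x + pderivative i f x * g x) \<in> smooth_algebra" for i
    using mult by (intro smooth_algebra.add smooth_algebra.mult) auto
  ultimately show ?case using mult by auto
qed

lemma smooth_algebra_smooth: "f \<in> smooth_algebra \<Longrightarrow> smooth f"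
  using smooth_algebra_closed by (intro smooth_coinduct[of f smooth_algebra]) auto

lemma smooth_add: "smooth f \<Longrightarrow> smooth g \<Longrightarrow> smooth (\<lambda>x. f x + g x)"
  by (rule smooth_algebra_smooth, rule smooth_algebra.add) (simp_all add: smooth_algebra.base)

lemma smooth_mult: "smooth f \<Longrightarrow> smooth g \<Longrightarrow> smooth (\<lambda>x. f x * g x)"
  by (rule smooth_algebra_smooth, rule smooth_algebra.mult) (simp_all add: smooth_algebra.base)

lemma smooth_const: "smooth (\<lambda>x. c)"
  by (rule smooth_coinduct[of _ "range (\<lambda>c x. c)"]) auto

lemma smooth_diff: "smooth f \<Longrightarrow> smooth g \<Longrightarrow> smooth (\<lambda>x. f x - g x)"
  using smooth_add[of f "\<lambda>x. -1 * g x"] smooth_mult[OF smooth_const[of "-1"], of g] by simp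

lemma pderivative_diff:
  assumes "smooth f" "smooth g"
  shows "pderivative i (\<lambda>x. f x - g x) x = pderivative i f x - pderivative i g x"
proof -
  have "((\<lambda>x. f x - g x) has_derivative (\<lambda>h. pgrad f x \<bullet> h - pgrad g x \<bullet> h)) (at x)"
    using assms by (intro has_derivative_diff smooth_has_derivative)
  from pderivative_eqI[OF this] show ?thesis by (simp add: pgrad_def inner_axis)
qed

lemma smooth_component:
  fixes i :: "'n::finite"
  shows "smooth (\<lambda>x. x $ i)"
proof (rule smooth_coinduct[of _ "insert (\<lambda>x. x $ i) {f. smooth f}"])
  have "pderivative j (\<lambda>x. x $ i) = (\<lambda>x. axis j 1 $ i)" for j :: 'n
    by (intro ext pderivative_eqI bounded_linear.has_derivative[OF bounded_linear_vec_nth] has_derivative_ident)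
  then show "pderivative j f \<in> insert (\<lambda>x. x $ i) {f. smooth f}"
    if "f \<in> insert (\<lambda>x. x $ i) {f. smooth f}" for f and j :: 'n
    using that by (auto simp: smooth_const smooth_pderivative)
qed (auto intro: smooth_imp_differentiable bounded_linear_imp_differentiable bounded_linear_vec_nth)

lemma smooth_sum: "(\<And>a. a \<in> A \<Longrightarrow> smooth (f a)) \<Longrightarrow> smooth (\<lambda>x. \<Sum>a\<in>A. f a x)"
  by (induction A rule: infinite_finite_induct) (auto intro: smooth_const smooth_add)

lemma smooth_prod: "(\<And>a. a \<in> A \<Longrightarrow> smooth (f a)) \<Longrightarrow> smooth (\<lambda>x. \<Prod>a\<in>A. f a x)"
  by (induction A rule: infinite_finite_induct) (auto intro: smooth_const smooth_mult)

lemma smooth_power: "smooth f \<Longrightarrow> smooth (\<lambda>x. f x ^ m)"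
  by (induction m) (auto intro: smooth_const smooth_mult)

lemma polynomial_le_smooth:
  assumes "polynomial_le k p"
  shows "smooth p"
proof -
  obtain c where c: "\<And>x. p x = (\<Sum>\<alpha> | (\<Sum>i\<in>UNIV. \<alpha> i) \<le> k. c \<alpha> * (\<Prod>i\<in>UNIV. (x $ i) ^ (\<alpha> i :: nat)))"
    using assms unfolding polynomial_le_def by blast
  have "smooth (\<lambda>x. \<Sum>\<alpha> | (\<Sum>i\<in>UNIV. \<alpha> i) \<le> k. c \<alpha> * (\<Prod>i\<in>UNIV. (x $ i) ^ (\<alpha> i :: nat)))"
    by (intro smooth_sum smooth_mult smooth_const smooth_prod smooth_power smooth_component)
  with c show ?thesis by presburger
qed

section \<open>Bump functions\<close>

text \<open>The classical function \<open>exp (- 1 / x)\<close>, extended by zero. The polynomial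
  factor in \<open>1 / x\<close> makes the family closed under differentiation: the chain rule
  replaces \<open>p\<close> by \<open>X^2 (p - p')\<close>.\<close>

definition flat :: "real poly \<Rightarrow> real \<Rightarrow> real" where
  "flat p x = (if x > 0 then poly p (1 / x) * exp (- 1 / x) else 0)"

lemma poly_times_exp_minus_tendsto_0: "((\<lambda>y. poly p y * exp (- y)) \<longlongrightarrow> (0::real)) at_top"
proof -
  have "((\<lambda>y. \<Sum>i\<le>degree p. coeff p i * (y ^ i / exp y)) \<longlongrightarrow> (\<Sum>i\<le>degree p. coeff p i * 0)) at_top"
    by (intro tendsto_intros tendsto_power_div_exp_0)
  then show ?thesis
    by (simp add: poly_altdef exp_minus sum_distrib_right divide_inverse mult.assoc)
qed

text \<open>Away from zero this is the chain rule. At zero the difference quotient from the right is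
  a polynomial in \<open>1 / h\<close> times \<open>exp (- 1 / h)\<close>, with one more factor
  \<open>1 / h\<close>, and the exponential wins; from the left it is zero.\<close>

lemma flat_has_real_derivative:
  "(flat p has_real_derivative flat (monom 1 2 * (p - pderiv p)) x) (at x)"
proof (cases "x = 0")
  case False
  show ?thesis
  proof (cases "x > 0")
    case True
    have "((\<lambda>x. poly p (1 / x) * exp (- 1 / x)) has_real_derivative
        flat (monom 1 2 * (p - pderiv p)) x) (at x)"
      using True
      by (auto intro!: derivative_eq_intros simp: flat_def poly_monom field_simps power2_eq_square)
    moreover have "eventually (\<lambda>y. flat p y = poly p (1 / y) * exp (- 1 / y)) (nhds x)"
      using eventually_nhds_in_open[of "{0<..}" x] True
      by (auto simp: flat_def elim: eventually_mono)
    ultimately show ?thesis by (rule iffD2[OF DERIV_cong_ev[OF refl _ refl], rotated])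
  next
    case F: False
    with False have "x < 0" by simp
    have "((\<lambda>x. 0) has_real_derivative flat (monom 1 2 * (p - pderiv p)) x) (at x)"
      using F by (simp add: flat_def)
    moreover have "eventually (\<lambda>y. flat p y = 0) (nhds x)"
      using eventually_nhds_in_open[of "{..<0}" x] \<open>x < 0\<close>
      by (auto simp: flat_def elim: eventually_mono)
    ultimately show ?thesis by (rule iffD2[OF DERIV_cong_ev[OF refl _ refl], rotated])
  qed
next
  case True
  have "((\<lambda>h. flat p h / h) \<longlongrightarrow> 0) (at 0)"
    unfolding filterlim_at_split
  proof
    show "((\<lambda>h. flat p h / h) \<longlongrightarrow> 0) (at_left 0)"
      by (rule tendsto_eventually) (auto simp: flat_def eventually_at_filter)
    have "((\<lambda>h. poly (monom 1 1 * p) (inverse h) * exp (- inverse h)) \<longlongrightarrow> (0::real)) (at_right 0)"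
      by (rule filterlim_compose[OF poly_times_exp_minus_tendsto_0 filterlim_inverse_at_top_right])
    moreover have "eventually (\<lambda>h. poly (monom 1 1 * p) (inverse h) * exp (- inverse h)
        = flat p h / h) (at_right 0)"
      by (auto simp: eventually_at_filter flat_def poly_monom divide_inverse)
    ultimately show "((\<lambda>h. flat p h / h) \<longlongrightarrow> 0) (at_right 0)"
      by (rule Lim_transform_eventually)
  qed
  then show ?thesis using True by (simp add: DERIV_def flat_def)
qed

lemma flat_1_bounds: "0 \<le> flat 1 x" "flat 1 x \<le> 1" "flat 1 x \<noteq> 0 \<longleftrightarrow> x > 0"
  by (auto simp: flat_def)

text \<open>Differentiation in direction \<open>i\<close> changes the polynomial and produces the
  constant \<open>a $ i\<close>. Multiples by constants are therefore included in the family that is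
  shown to be stable.\<close>

lemma smooth_flat_affine:
  fixes a :: "real^'n"
  shows "smooth (\<lambda>x. flat p (b + a \<bullet> x))"
proof (rule smooth_coinduct[of _ "{f. \<exists>c p. f = (\<lambda>x. c * flat p (b + a \<bullet> x))}"])
  have D: "((\<lambda>x. c * flat p (b + a \<bullet> x)) has_derivative
     (\<lambda>h. c * (flat (monom 1 2 * (p - pderiv p)) (b + a \<bullet> x) * (a \<bullet> h)))) (at x)" for c p and x :: "real^'n"
  proof -
    have "((\<lambda>x. b + a \<bullet> x) has_derivative (\<lambda>h. a \<bullet> h)) (at x)"
      by (auto intro!: derivative_eq_intros)
    from diff_chain_at[OF this flat_has_real_derivative[of p, unfolded has_field_derivative_def]]
    have "((\<lambda>x. flat p (b + a \<bullet> x)) has_derivative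
       (\<lambda>h. flat (monom 1 2 * (p - pderiv p)) (b + a \<bullet> x) * (a \<bullet> h))) (at x)"
      by (simp add: o_def)
    then show ?thesis by (rule has_derivative_mult_right)
  qed
  show "(\<lambda>x. flat p (b + a \<bullet> x)) \<in> {f. \<exists>c p. f = (\<lambda>x. c * flat p (b + a \<bullet> x))}"
    by (auto intro!: exI[of _ 1] exI[of _ p])
  show "f differentiable (at x)" if "f \<in> {f. \<exists>c p. f = (\<lambda>x. c * flat p (b + a \<bullet> x))}" for f and x :: "real^'n"
    using that D by (auto simp: differentiable_def)
  show "pderivative i f \<in> {f. \<exists>c p. f = (\<lambda>x. c * flat p (b + a \<bullet> x))}"
    if "f \<in> {f. \<exists>c p. f = (\<lambda>x. c * flat p (b + a \<bullet> x))}" for f and i :: 'n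
  proof -
    from that obtain c p where f: "f = (\<lambda>x. c * flat p (b + a \<bullet> x))" by auto
    have "pderivative i f = (\<lambda>x. (c * a $ i) * flat (monom 1 2 * (p - pderiv p)) (b + a \<bullet> x))"
      unfolding f by (rule ext, subst pderivative_eqI[OF D]) (simp add: inner_axis mult_ac)
    then show ?thesis by blast
  qed
qed

text \<open>The parameter \<open>j\<close> only steepens the flanks: the function vanishes off
  \<open>box a b\<close> for every \<open>j\<close>, and as \<open>j\<close> grows it tends to the
  indicator of that open box.\<close>

definition bump :: "real^'n \<Rightarrow> real^'n \<Rightarrow> nat \<Rightarrow> real^'n \<Rightarrow> real" where
  "bump a b j x = (\<Prod>i\<in>UNIV. flat 1 (real j * (x $ i - a $ i)) * flat 1 (real j * (b $ i - x $ i)))"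

lemma smooth_bump: "smooth (bump a b j)"
proof -
  have "real j * (x $ i - a $ i) = - real j * a $ i + (real j *\<^sub>R axis i 1) \<bullet> x"
    "real j * (b $ i - x $ i) = real j * b $ i + (- real j *\<^sub>R axis i 1) \<bullet> x" for x i
    by (simp_all add: inner_axis' algebra_simps)
  then have "bump a b j = (\<lambda>x. \<Prod>i\<in>UNIV. flat 1 (- real j * a $ i + (real j *\<^sub>R axis i 1) \<bullet> x)
      * flat 1 (real j * b $ i + (- real j *\<^sub>R axis i 1) \<bullet> x))"
    unfolding bump_def by presburger
  moreover have "smooth \<dots>" by (intro smooth_prod smooth_mult smooth_flat_affine)
  ultimately show ?thesis by simp
qed

lemma bump_bounds: "0 \<le> bump a b j x" "bump a b j x \<le> 1"
  unfolding bump_def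
  using flat_1_bounds by (auto intro!: prod_nonneg prod_le_1 mult_nonneg_nonneg mult_le_one)

lemma bump_eq_0: "x \<notin> box a b \<Longrightarrow> bump a b j x = 0"
  by (auto simp: bump_def mem_box_cart flat_def zero_less_mult_iff)

lemma bump_pos: "x \<in> box a b \<Longrightarrow> j > 0 \<Longrightarrow> bump a b j x > 0"
  by (auto simp: bump_def mem_box_cart flat_def intro!: prod_pos)

lemma bump_tendsto: "(\<lambda>j. bump a b j x) \<longlonglongrightarrow> indicator (box a b) x"
proof (cases "x \<in> box a b")
  case True
  have 1: "(\<lambda>j. flat 1 (real j * r)) \<longlonglongrightarrow> 1" if "r > 0" for r
  proof -
    have "(\<lambda>j. exp (- (inverse r * inverse (real j)))) \<longlonglongrightarrow> exp (- (inverse r * 0))"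
      by (rule tendsto_exp, rule tendsto_minus, rule tendsto_mult_left, rule lim_inverse_n)
    moreover have "eventually (\<lambda>j. exp (- (inverse r * inverse (real j))) = flat 1 (real j * r)) sequentially"
      using eventually_gt_at_top[of 0]
      by eventually_elim (use that in \<open>auto simp: flat_def field_simps\<close>)
    ultimately show ?thesis by (simp add: Lim_transform_eventually)
  qed
  have "(\<lambda>j. bump a b j x) \<longlonglongrightarrow> (\<Prod>i::'a\<in>UNIV. 1 * 1)"
    unfolding bump_def using True by (intro tendsto_intros 1) (auto simp: mem_box_cart)
  with True show ?thesis by simp
qed (simp add: bump_eq_0)

section \<open>Test functions\<close>

lemma test_function_smooth: "test_function D \<phi> \<Longrightarrow> smooth \<phi>"
  by (simp add: test_function_def)

lemma test_function_mono: "test_function D \<phi> \<Longrightarrow> D \<subseteq> E \<Longrightarrow> test_function E \<phi>"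
  by (auto simp: test_function_def)

lemma test_function_eq_0: "test_function D \<phi> \<Longrightarrow> x \<notin> D \<Longrightarrow> \<phi> x = 0"
  using closure_subset[of "{x. \<phi> x \<noteq> 0}"] by (auto simp: test_function_def)

lemma test_functionI:
  assumes "smooth \<phi>" "compact K" "K \<subseteq> D" "\<And>x. x \<notin> K \<Longrightarrow> \<phi> x = 0"
  shows "test_function D \<phi>"
proof -
  have "closure {x. \<phi> x \<noteq> 0} \<subseteq> K"
    using assms by (intro closure_minimal) (auto simp: compact_imp_closed)
  then show ?thesis
    using assms compact_Int_closed[OF \<open>compact K\<close> closed_closure[of "{x. \<phi> x \<noteq> 0}"]]
    by (auto simp: test_function_def Int_absorb1)
qed

lemma test_functionE:
  assumes "test_function D \<phi>"
  obtains K where "compact K" "K \<subseteq> D" "\<And>x. x \<notin> K \<Longrightarrow> \<phi> x = 0"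
proof (rule that)
  show "\<phi> x = 0" if "x \<notin> closure {x. \<phi> x \<noteq> 0}" for x
    using that closure_subset[of "{x. \<phi> x \<noteq> 0}"] by auto
qed (use assms in \<open>auto simp: test_function_def\<close>)

lemma test_function_bump: "cbox a b \<subseteq> D \<Longrightarrow> test_function D (bump a b j)"
  by (rule test_functionI[OF smooth_bump compact_cbox])
    (auto intro!: bump_eq_0 simp: box_subset_cbox[THEN subsetD])

lemma test_function_mult_smooth:
  assumes "test_function D \<phi>" "smooth g"
  shows "test_function D (\<lambda>x. \<phi> x * g x)"
proof -
  obtain K where "compact K" "K \<subseteq> D" "\<And>x. x \<notin> K \<Longrightarrow> \<phi> x = 0"
    using assms test_functionE by metis
  then show ?thesis
    using assms by (intro test_functionI[of _ K]) (auto intro: smooth_mult simp: test_function_smooth)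
qed

lemma pderivative_eq_0_open:
  assumes "open S" "x \<in> S" "\<And>y. y \<in> S \<Longrightarrow> g y = 0"
  shows "pderivative i g x = 0"
proof -
  have "((\<lambda>x. 0) has_derivative (\<lambda>h. 0)) (at x)" by simp
  then have "(g has_derivative (\<lambda>h. 0)) (at x)"
    by (rule has_derivative_transform_within_open[OF _ assms(1,2)]) (simp add: assms(3))
  from pderivative_eqI[OF this] show ?thesis by simp
qed

lemma test_function_pderivative:
  assumes "test_function D \<phi>"
  shows "test_function D (pderivative i \<phi>)"
proof -
  obtain K where K: "compact K" "K \<subseteq> D" "\<And>x. x \<notin> K \<Longrightarrow> \<phi> x = 0"
    using assms test_functionE by metis
  show ?thesis
  proof (rule test_functionI[OF _ K(1,2)])
    show "pderivative i \<phi> x = 0" if "x \<notin> K" for x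
      by (rule pderivative_eq_0_open[of "- K"]) (use that K in \<open>auto simp: compact_imp_closed\<close>)
  qed (use assms in \<open>auto intro: smooth_pderivative simp: test_function_smooth\<close>)
qed

lemma continuous_compact_support_bounded:
  fixes \<phi> :: "'a::metric_space \<Rightarrow> 'b::real_normed_vector"
  assumes "continuous_on UNIV \<phi>" "compact K" "\<And>x. x \<notin> K \<Longrightarrow> \<phi> x = 0"
  obtains C where "C > 0" "\<And>x. norm (\<phi> x) \<le> C"
proof -
  have "bounded (\<phi> ` K)"
    by (intro compact_imp_bounded compact_continuous_image assms continuous_on_subset[OF assms(1)]) auto
  then obtain C where C: "C > 0" "\<And>x. x \<in> K \<Longrightarrow> norm (\<phi> x) \<le> C"
    by (auto simp: bounded_pos)
  have "norm (\<phi> x) \<le> C" for x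
    using C assms(3)[of x] by (cases "x \<in> K") auto
  with C that show thesis by blast
qed

lemma test_function_bounded:
  assumes "test_function D \<phi>"
  obtains C where "C > 0" "\<And>x. \<bar>\<phi> x\<bar> \<le> C"
proof -
  obtain K where K: "compact K" "K \<subseteq> D" "\<And>x. x \<notin> K \<Longrightarrow> \<phi> x = 0"
    using assms test_functionE by metis
  show thesis
    by (rule continuous_compact_support_bounded[of \<phi> K])
       (use K assms that in \<open>auto intro: smooth_continuous_on test_function_smooth\<close>)
qed

section \<open>Integrals over subsets and limits of difference quotients\<close>

lemma lebesgue_on_integral_eq:
  fixes f :: "'a::euclidean_space \<Rightarrow> real"
  assumes "S \<in> sets lebesgue"
  shows "(LINT x|lebesgue_on S. f x) = (LINT x|lebesgue. indicator S x * f x)"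
  using assms by (subst integral_restrict_space) auto

lemma lebesgue_on_integrable_eq:
  fixes f :: "'a::euclidean_space \<Rightarrow> real"
  assumes "S \<in> sets lebesgue"
  shows "integrable (lebesgue_on S) f \<longleftrightarrow> integrable lebesgue (\<lambda>x. indicator S x * f x)"
  using assms by (subst integrable_restrict_space) auto

lemma lebesgue_on_integral_lborel:
  fixes f :: "'a::euclidean_space \<Rightarrow> real"
  assumes "S \<in> sets borel" "f \<in> borel_measurable borel"
  shows "(LINT x|lebesgue_on S. f x) = (LINT x|lborel. indicator S x * f x)"
  using assms by (simp add: lebesgue_on_integral_eq integral_completion)

lemma AE_lebesgue_on:
  "S \<in> sets lebesgue \<Longrightarrow> (AE x in lebesgue_on S. P x) \<longleftrightarrow> (AE x in lebesgue. x \<in> S \<longrightarrow> P x)"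
  by (subst AE_restrict_space_iff) auto

lemma lebesgue_on_integral_subset:
  fixes f :: "'a::euclidean_space \<Rightarrow> real"
  assumes "S \<in> sets lebesgue" "T \<in> sets lebesgue" "S \<subseteq> T" "\<And>x. x \<in> T \<Longrightarrow> x \<notin> S \<Longrightarrow> f x = 0"
  shows "(LINT x|lebesgue_on T. f x) = (LINT x|lebesgue_on S. f x)"
  using assms by (auto simp: lebesgue_on_integral_eq indicator_def intro!: Bochner_Integration.integral_cong)

lemma integrable_indicator_continuous_bounded:
  fixes f :: "'a::euclidean_space \<Rightarrow> real"
  assumes "continuous_on UNIV f" "bounded S" "S \<in> sets borel"
  shows "integrable lborel (\<lambda>x. indicator S x * f x)"
proof -
  obtain a b where ab: "S \<subseteq> cbox a b" using bounded_subset_cbox_symmetric[OF assms(2)] by blast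
  have "compact (f ` cbox a b)"
    by (intro compact_continuous_image continuous_on_subset[OF assms(1)]) auto
  then obtain C where C: "C > 0" "\<And>x. x \<in> cbox a b \<Longrightarrow> \<bar>f x\<bar> \<le> C"
    using compact_imp_bounded bounded_pos by (metis imageI real_norm_def)
  have m [measurable]: "f \<in> borel_measurable borel" "S \<in> sets borel"
    using assms by (auto intro: borel_measurable_continuous_onI)
  show ?thesis
  proof (rule Bochner_Integration.integrable_bound)
    show "integrable lborel (\<lambda>x. indicator (cbox a b) x * C)"
      by (intro integrable_mult_left integrable_real_indicator) (auto simp: emeasure_lborel_cbox_eq)
    show "AE x in lborel. norm (indicator S x * f x) \<le> norm (indicator (cbox a b) x * C)"
      using ab C by (auto simp: indicator_def split: if_splits)
  qed simp
qed

lemma smooth_lipschitz_on_ball: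
  assumes "smooth \<psi>"
  obtains C where "C > 0" "\<And>x y. norm x \<le> r \<Longrightarrow> norm y \<le> r \<Longrightarrow> \<bar>\<psi> y - \<psi> x\<bar> \<le> C * norm (y - x)"
    "\<And>x. norm x \<le> r \<Longrightarrow> norm (pgrad \<psi> x) \<le> C"
proof -
  have "compact (pgrad \<psi> ` cball 0 r)"
    by (intro compact_continuous_image continuous_on_pgrad assms) auto
  then obtain C where C: "C > 0" "\<And>x. x \<in> cball 0 r \<Longrightarrow> norm (pgrad \<psi> x) \<le> C"
    using compact_imp_bounded bounded_pos by (metis imageI)
  have "norm (\<psi> y - \<psi> x) \<le> C * norm (y - x)" if "x \<in> cball 0 r" "y \<in> cball 0 r" for x y
  proof (rule differentiable_bound[where f' = "\<lambda>z h. pgrad \<psi> z \<bullet> h"])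
    fix z assume z: "z \<in> cball (0::real^'a) r"
    show "(\<psi> has_derivative (\<lambda>h. pgrad \<psi> z \<bullet> h)) (at z within cball 0 r)"
      using smooth_has_derivative[OF assms] has_derivative_at_withinI by blast
    have "onorm (\<lambda>h. pgrad \<psi> z \<bullet> h) \<le> norm (pgrad \<psi> z)"
      by (rule onorm_le) (simp add: Cauchy_Schwarz_ineq2)
    with C(2)[OF z] show "onorm (\<lambda>h. pgrad \<psi> z \<bullet> h) \<le> C" by simp
  qed (use that in auto)
  with C show thesis by (intro that[of C]) auto
qed

text \<open>A Lipschitz constant of \<open>\<psi>\<close> on a large ball dominates all the
  quotients. The vector field \<open>V\<close> is constant when integrals are translated, and equals
  \<open>x - a\<close> when cones are dilated about \<open>a\<close>.\<close>

lemma difference_quotient_integral: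
  fixes \<psi> :: "real^'n \<Rightarrow> real"
  assumes \<psi>: "smooth \<psi>" and B: "bounded B" "B \<in> sets borel" and V: "V \<in> borel_measurable borel"
    and R: "\<And>x. x \<in> B \<Longrightarrow> norm (V x) \<le> R"
  shows "(\<lambda>m. LINT x|lborel. indicator B x *
      (real (Suc m) * (\<psi> (x + (1 / real (Suc m)) *\<^sub>R V x) - \<psi> x)))
    \<longlonglongrightarrow> (LINT x|lborel. indicator B x * (pgrad \<psi> x \<bullet> V x))"
proof -
  obtain r where r: "\<And>x. x \<in> B \<Longrightarrow> norm x \<le> r" using B(1) by (auto simp: bounded_iff)
  \<comment> \<open>The step length is at most 1, so the ball of radius
    \<open>r + \<bar>R\<bar>\<close> contains each \<open>x\<close> in \<open>B\<close> together
    with all its displaced points.\<close>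
  obtain C where C: "C > 0" "\<And>x y. norm x \<le> r + \<bar>R\<bar> \<Longrightarrow> norm y \<le> r + \<bar>R\<bar> \<Longrightarrow> \<bar>\<psi> y - \<psi> x\<bar> \<le> C * norm (y - x)"
    using smooth_lipschitz_on_ball[OF \<psi>] by metis
  have [measurable]: "\<psi> \<in> borel_measurable borel" "pgrad \<psi> \<in> borel_measurable borel"
    "V \<in> borel_measurable borel" "B \<in> sets borel"
    using \<psi> V B by (auto intro!: borel_measurable_continuous_onI smooth_continuous_on continuous_on_pgrad)
  obtain a b where ab: "B \<subseteq> cbox a b" using bounded_subset_cbox_symmetric[OF B(1)] by blast
  show ?thesis
  proof (rule integral_dominated_convergence[where w = "\<lambda>x. indicator (cbox a b) x * (C * \<bar>R\<bar>)"])
    show "integrable lborel (\<lambda>x. indicator (cbox a b) x * (C * \<bar>R\<bar>))"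
      by (intro integrable_mult_left integrable_real_indicator) (auto simp: emeasure_lborel_cbox_eq)
    show "AE x in lborel. (\<lambda>m. indicator B x * (real (Suc m) * (\<psi> (x + (1 / real (Suc m)) *\<^sub>R V x) - \<psi> x)))
      \<longlonglongrightarrow> indicator B x * (pgrad \<psi> x \<bullet> V x)"
    proof (intro AE_I2 tendsto_mult_left)
      fix x
      have "((\<lambda>t. \<psi> (x + t *\<^sub>R V x)) has_real_derivative pgrad \<psi> x \<bullet> V x) (at 0)"
      proof -
        have "((\<lambda>t. x + t *\<^sub>R V x) has_derivative (\<lambda>t. t *\<^sub>R V x)) (at (0::real))"
          by (auto intro!: derivative_eq_intros)
        from diff_chain_at[OF this, of \<psi> "\<lambda>h. pgrad \<psi> x \<bullet> h"] smooth_has_derivative[OF \<psi>, of x]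
        have "((\<lambda>t. \<psi> (x + t *\<^sub>R V x)) has_derivative (\<lambda>t. t * (pgrad \<psi> x \<bullet> V x))) (at 0)"
          by (simp add: o_def)
        moreover have "(\<lambda>t. t * (pgrad \<psi> x \<bullet> V x)) = (*) (pgrad \<psi> x \<bullet> V x)" by auto
        ultimately show ?thesis by (simp add: has_field_derivative_def)
      qed
      then have "((\<lambda>t. (\<psi> (x + t *\<^sub>R V x) - \<psi> x) / t) \<longlongrightarrow> pgrad \<psi> x \<bullet> V x) (at 0)"
        by (simp add: DERIV_def)
      moreover have "filterlim (\<lambda>m. inverse (real (Suc m))) (at 0) sequentially"
        using LIMSEQ_inverse_real_of_nat by (auto simp: filterlim_at)
      ultimately have "(\<lambda>m. (\<psi> (x + inverse (real (Suc m)) *\<^sub>R V x) - \<psi> x) / inverse (real (Suc m)))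
          \<longlonglongrightarrow> pgrad \<psi> x \<bullet> V x"
        by (rule filterlim_compose)
      then show "(\<lambda>m. real (Suc m) * (\<psi> (x + (1 / real (Suc m)) *\<^sub>R V x) - \<psi> x)) \<longlonglongrightarrow> pgrad \<psi> x \<bullet> V x"
        by (simp add: inverse_eq_divide mult.commute)
    qed
    show "AE x in lborel. norm (indicator B x * (real (Suc m) * (\<psi> (x + (1 / real (Suc m)) *\<^sub>R V x) - \<psi> x)))
       \<le> indicator (cbox a b) x * (C * \<bar>R\<bar>)" for m
    proof (intro AE_I2)
      fix x
      show "norm (indicator B x * (real (Suc m) * (\<psi> (x + (1 / real (Suc m)) *\<^sub>R V x) - \<psi> x)))
       \<le> indicator (cbox a b) x * (C * \<bar>R\<bar>)"
      proof (cases "x \<in> B")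
        case True
        let ?t = "1 / real (Suc m)"
        have Vx: "norm (V x) \<le> \<bar>R\<bar>" using R[OF True] by simp
        have t: "norm (?t *\<^sub>R V x) \<le> 1 * norm (V x)"
          unfolding norm_scaleR by (intro mult_right_mono) auto
        have "norm (x + ?t *\<^sub>R V x) \<le> r + \<bar>R\<bar>"
          using norm_triangle_ineq[of x "?t *\<^sub>R V x"] r[OF True] t Vx by linarith
        moreover have "norm x \<le> r + \<bar>R\<bar>" using r[OF True] by simp
        ultimately have "\<bar>\<psi> (x + ?t *\<^sub>R V x) - \<psi> x\<bar> \<le> C * norm (?t *\<^sub>R V x)"
          using C(2)[of x "x + ?t *\<^sub>R V x"] by simp
        also have "\<dots> = ?t * (C * norm (V x))" by simp
        also have "\<dots> \<le> ?t * (C * \<bar>R\<bar>)" using C(1) Vx by (intro mult_left_mono) auto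
        finally have "real (Suc m) * \<bar>\<psi> (x + ?t *\<^sub>R V x) - \<psi> x\<bar> \<le> C * \<bar>R\<bar>"
          by (simp add: field_simps)
        then show ?thesis using True ab by (auto simp: abs_mult)
      qed (use C in \<open>auto simp: indicator_def\<close>)
    qed
  qed measurable
qed

lemma integral_translation:
  fixes f :: "'a::euclidean_space \<Rightarrow> real"
  assumes [measurable]: "f \<in> borel_measurable borel"
  shows "(LINT x|lborel. f (c + x)) = (LINT x|lborel. f x)"
  by (subst (2) lborel_distr_plus[symmetric, of c]) (simp add: integral_distr)

lemma test_function_integrable:
  assumes "test_function D \<phi>"
  shows "integrable lborel \<phi>"
proof -
  obtain K where K: "compact K" "K \<subseteq> D" "\<And>x. x \<notin> K \<Longrightarrow> \<phi> x = 0"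
    using assms test_functionE by metis
  have "integrable lborel (\<lambda>x. indicator K x * \<phi> x)"
    by (intro integrable_indicator_continuous_bounded smooth_continuous_on test_function_smooth[OF assms])
       (use K in \<open>auto simp: compact_imp_bounded compact_imp_closed\<close>)
  moreover have "(\<lambda>x. indicator K x * \<phi> x) = \<phi>"
  proof
    show "indicator K x * \<phi> x = \<phi> x" for x using K(3)[of x] by (cases "x \<in> K") auto
  qed
  ultimately show ?thesis by simp
qed

text \<open>Lebesgue measure is translation invariant, so the integral of every difference quotient
  of \<open>\<phi>\<close> vanishes, and so does the limit.\<close>

lemma integral_pderivative_test_function:
  fixes \<phi> :: "real^'n \<Rightarrow> real"
  assumes "test_function D \<phi>"
  shows "(LINT x|lborel. pderivative i \<phi> x) = 0"
proof -
  obtain K where K: "compact K" "K \<subseteq> D" "\<And>x. x \<notin> K \<Longrightarrow> \<phi> x = 0"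
    using assms test_functionE by metis
  obtain r where r: "\<And>x. x \<in> K \<Longrightarrow> norm x \<le> r"
    using compact_imp_bounded[OF K(1)] by (auto simp: bounded_iff)
  \<comment> \<open>The margin 1 covers the longest translation: if \<open>x\<close> is outside
    \<open>B\<close>, then neither \<open>x\<close> nor its translate lies in the support.\<close>
  define B where "B = cball (0::real^'n) (r + 1)"
  have \<phi>: "smooth \<phi>" using assms test_function_smooth by blast
  have [measurable]: "\<phi> \<in> borel_measurable borel" using smooth_borel_measurable[OF \<phi>] .
  have D: "pderivative i \<phi> x = 0" if "x \<notin> K" for x
    by (rule pderivative_eq_0_open[of "- K"]) (use that K in \<open>auto simp: compact_imp_closed\<close>)
  have KB: "K \<subseteq> B" using r by (fastforce simp: B_def)
  have "(\<lambda>m. LINT x|lborel. indicator B x *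
      (real (Suc m) * (\<phi> (x + (1 / real (Suc m)) *\<^sub>R axis i 1) - \<phi> x)))
    \<longlonglongrightarrow> (LINT x|lborel. indicator B x * (pgrad \<phi> x \<bullet> axis i 1))"
    by (intro difference_quotient_integral[where R = 1] \<phi>) (auto simp: B_def)
  moreover have "(LINT x|lborel. indicator B x *
      (real (Suc m) * (\<phi> (x + (1 / real (Suc m)) *\<^sub>R axis i 1) - \<phi> x))) = 0" for m
  proof -
    let ?c = "(1 / real (Suc m)) *\<^sub>R (axis i 1 :: real^'n)"
    have c: "norm ?c \<le> 1" by simp
    have "indicator B x * (real (Suc m) * (\<phi> (x + ?c) - \<phi> x)) = real (Suc m) * (\<phi> (?c + x) - \<phi> x)" for x
    proof (cases "x \<in> B")
      case False
      then have "x \<notin> K" using KB by auto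
      moreover have "x + ?c \<notin> K"
      proof
        assume "x + ?c \<in> K"
        then have "norm (x + ?c) \<le> r" by (rule r)
        then have "norm x \<le> r + 1" using c norm_diff_ineq[of x ?c] by linarith
        with False show False by (simp add: B_def)
      qed
      ultimately show ?thesis using K(3) by (simp add: add.commute)
    qed (simp add: add.commute)
    then have "(LINT x|lborel. indicator B x * (real (Suc m) * (\<phi> (x + ?c) - \<phi> x)))
       = (LINT x|lborel. real (Suc m) * (\<phi> (?c + x) - \<phi> x))" by presburger
    also have "\<dots> = real (Suc m) * ((LINT x|lborel. \<phi> (?c + x)) - (LINT x|lborel. \<phi> x))"
    proof -
      have "integrable lborel (\<lambda>x. \<phi> (?c + x))"
      proof -
        have "integrable (distr lborel borel ((+) ?c)) \<phi>"
          using test_function_integrable[OF assms] by (simp add: lborel_distr_plus)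
        then show ?thesis by (subst (asm) integrable_distr_eq) auto
      qed
      then show ?thesis
        by (subst integral_mult_right_zero, subst Bochner_Integration.integral_diff)
          (auto simp: test_function_integrable[OF assms])
    qed
    also have "\<dots> = 0" by (simp add: integral_translation)
    finally show ?thesis .
  qed
  ultimately have "(LINT x|lborel. indicator B x * (pgrad \<phi> x \<bullet> axis i 1)) = 0"
    by (simp add: LIMSEQ_const_iff)
  moreover have "indicator B x * (pgrad \<phi> x \<bullet> axis i 1) = pderivative i \<phi> x" for x
    using D[of x] KB by (auto simp: indicator_def pgrad_def inner_axis)
  ultimately show ?thesis by simp
qed

section \<open>The fundamental lemma of the calculus of variations\<close>

text \<open>Open boxes form an intersection-stable generator, so a Dynkin argument carries the
  vanishing of the integrals to all Borel sets, in particular to the sets where \<open>f\<close> is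
  positive or negative. The measure is left general because the result is applied to surface measure
  as well as to volume.\<close>

lemma AE_zero_if_box_integrals_zero:
  fixes f :: "real^'n \<Rightarrow> real"
  assumes M: "sets M = sets borel" and f: "integrable M f"
    and supp: "\<And>x. x \<notin> box a b \<Longrightarrow> f x = 0"
    and zero: "\<And>c d. (LINT x|M. indicator (box c d) x * f x) = 0"
  shows "AE x in M. f x = 0"
proof -
  have sp: "space M = UNIV" using sets_eq_imp_space_eq[OF M] by simp
  have zeroA: "set_lebesgue_integral M A f = 0" if "A \<in> sets M" for A
  proof -
    from that have A: "A \<in> sigma_sets UNIV (range (\<lambda>(c, d). box c d :: (real^'n) set))"
      by (simp add: M borel_eq_box)
    have IS: "Int_stable (range (\<lambda>(c, d). box c d :: (real^'n) set))"
    proof (rule Int_stableI, clarsimp)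
      fix c d c' d' :: "real^'n"
      have "box c d \<inter> box c' d' = box (\<chi> i. max (c$i) (c'$i)) (\<chi> i. min (d$i) (d'$i))"
        by (auto simp: mem_box_cart)
      then show "box c d \<inter> box c' d' \<in> range (\<lambda>(c, d). box c d)" by auto
    qed
    have "range (\<lambda>(c, d). box c d :: (real^'n) set) \<subseteq> Pow UNIV" by simp
    from IS this A show "set_lebesgue_integral M A f = 0"
    proof (induction rule: sigma_sets_induct_disjoint)
      case (basic A)
      then show ?case using zero by (auto simp: set_lebesgue_integral_def)
    next
      case empty
      then show ?case by (simp add: set_lebesgue_integral_def)
    next
      case (compl A)
      then have A: "A \<in> sets M" by (simp add: M borel_eq_box)
      \<comment> \<open>Complements require the integral over the whole space; as \<open>f\<close>
        is supported in a box, this is again a box integral.\<close>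
      have "(LINT x|M. indicator (box a b) x * f x) = (LINT x|M. f x)"
        using supp by (intro Bochner_Integration.integral_cong) (auto simp: indicator_def)
      then have tot: "(LINT x|M. f x) = 0" using zero by simp
      have "set_lebesgue_integral M (UNIV - A) f = (LINT x|M. f x - indicator A x *\<^sub>R f x)"
        unfolding set_lebesgue_integral_def
        by (intro Bochner_Integration.integral_cong) (auto simp: indicator_def)
      also have "\<dots> = (LINT x|M. f x) - set_lebesgue_integral M A f"
        unfolding set_lebesgue_integral_def
        by (intro Bochner_Integration.integral_diff f integrable_mult_indicator A)
      finally show ?case using tot compl by simp
    next
      case (union A)
      then have A: "A i \<in> sets M" for i by (auto simp: M borel_eq_box)
      have "set_lebesgue_integral M (\<Union>i. A i) f = (\<Sum>i. set_lebesgue_integral M (A i) f)"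
      proof (rule lebesgue_integral_countable_add[OF A])
        show "A i \<inter> A j = {}" if "i \<noteq> j" for i j
          using union(1) that by (auto simp: disjoint_family_on_def)
        show "set_integrable M (\<Union>i. A i) f"
          unfolding set_integrable_def by (intro integrable_mult_indicator f sets.countable_UN) (use A in auto)
      qed
      with union show ?case by simp
    qed
  qed
  have fm [measurable]: "f \<in> borel_measurable M" using f by auto
  have sg: "AE x in M. indicator A x * f x = 0"
    if A: "A \<in> sets M" "\<And>x. x \<in> A \<Longrightarrow> 0 \<le> s * f x" "s \<noteq> 0" for A s
  proof -
    have "integrable M (\<lambda>x. s * (indicator A x * f x))"
      using integrable_mult_indicator[OF A(1) f] by simp
    moreover have "AE x in M. 0 \<le> s * (indicator A x * f x)"
      using A(2) by (auto simp: indicator_def)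
    moreover have "(LINT x|M. s * (indicator A x * f x)) = 0"
      using zeroA[OF A(1)] by (simp add: set_lebesgue_integral_def)
    ultimately have "AE x in M. s * (indicator A x * f x) = 0"
      using integral_nonneg_eq_0_iff_AE by blast
    then show ?thesis using \<open>s \<noteq> 0\<close> by simp
  qed
  have "{x. f x > 0} \<in> sets M" "{x. f x < 0} \<in> sets M"
    using sp borel_measurable_less[of "\<lambda>_. 0" M f] borel_measurable_less[of f M "\<lambda>_. 0"] by simp_all
  from sg[OF this(1), of 1] sg[OF this(2), of "-1"]
  have "AE x in M. indicator {x. f x > 0} x * f x = 0" "AE x in M. indicator {x. f x < 0} x * f x = 0"
    by auto
  then show ?thesis by eventually_elim (auto simp: indicator_def split: if_splits)
qed

text \<open>Bump functions converge boundedly to indicators of boxes, so box integrals vanish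
  locally. With Lebesgue measure this yields uniqueness of weak derivatives and the equation on a
  cell; with the measure of a hyperplane, and test functions of the ambient space, it yields
  continuity of the flux.\<close>

proposition AE_zero_if_test_integrals_zero:
  fixes G :: "real^'n \<Rightarrow> real"
  assumes M: "sets M = sets borel" and U: "open U"
    and int: "\<And>K. compact K \<Longrightarrow> K \<subseteq> U \<Longrightarrow> integrable (completion M) (\<lambda>x. indicator K x * G x)"
    and test: "\<And>\<phi>. test_function U \<phi> \<Longrightarrow> (LINT x|completion M. G x * \<phi> x) = 0"
  shows "AE x in completion M. x \<in> U \<longrightarrow> G x = 0"
proof -
  have box0: "AE x in completion M. x \<in> box a b \<longrightarrow> G x = 0" if ab: "cbox a b \<subseteq> U" for a b
  proof -
    let ?N = "completion M"
    have bM: "B \<in> sets M" "B \<in> sets ?N" if "B \<in> sets borel" for B using that M by auto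
    have mM: "h \<in> borel_measurable M" if "h \<in> borel_measurable borel" for h :: "real^'n \<Rightarrow> real"
      using that by (simp add: measurable_cong_sets[OF M refl])
    have I: "integrable ?N (\<lambda>x. indicator (cbox a b) x * G x)" by (rule int) (use ab in auto)
    \<comment> \<open>The box argument needs the Borel sigma-algebra, so \<open>G\<close> is
      replaced by a Borel representative of its restriction to the compact box.\<close>
    then obtain g' where g': "g' \<in> borel_measurable M" "AE x in M. indicator (cbox a b) x * G x = g' x"
      using completion_ex_borel_measurable_real[OF borel_measurable_integrable] by blast
    have g'm: "g' \<in> borel_measurable ?N" using g'(1) by (rule measurable_completion)
    have "integrable ?N g'"
      by (rule Bochner_Integration.integrable_cong_AE_imp[OF I g'm])
        (use AE_completion[OF g'(2)] in \<open>auto elim: eventually_mono\<close>)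
    then have g'I: "integrable M g'"
      using g'(1) by (simp add: integrable_completion)
    define h where "h x = indicator (box a b) x * g' x" for x
    have hI: "integrable M h"
      unfolding h_def using integrable_mult_indicator[OF bM(1) g'I, of "box a b"] by simp
    have "AE x in M. h x = 0"
    proof (rule AE_zero_if_box_integrals_zero[OF M hI])
      show "h x = 0" if "x \<notin> box a b" for x using that by (simp add: h_def)
      fix c d :: "real^'n"
      \<comment> \<open>The corners of the intersection with \<open>box a b\<close>; its closed box
        stays in \<open>cbox a b\<close>, so its bumps are admissible test functions.\<close>
      define p q :: "real^'n" where "p = (\<chi> i. max (a$i) (c$i))" and "q = (\<chi> i. min (b$i) (d$i))"
      have pq: "box c d \<inter> box a b = box p q" "cbox p q \<subseteq> cbox a b"
        by (auto simp: mem_box_cart p_def q_def)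
      have bsub: "box p q \<subseteq> cbox a b" using pq(2) box_subset_cbox by blast
      have lim: "(\<lambda>j. LINT x|?N. indicator (cbox a b) x * G x * bump p q j x)
         \<longlonglongrightarrow> (LINT x|?N. indicator (cbox a b) x * G x * indicator (box p q) x)"
      proof (rule integral_dominated_convergence[where w = "\<lambda>x. \<bar>indicator (cbox a b) x * G x\<bar>"])
        show "(\<lambda>x. indicator (cbox a b) x * G x * indicator (box p q) x) \<in> borel_measurable ?N"
          by (intro borel_measurable_times borel_measurable_integrable[OF I] borel_measurable_indicator bM(2)) simp
        show "(\<lambda>x. indicator (cbox a b) x * G x * bump p q j x) \<in> borel_measurable ?N" for j
          by (intro borel_measurable_times borel_measurable_integrable[OF I]
             measurable_completion mM smooth_borel_measurable smooth_bump)
        show "AE x in ?N. norm (indicator (cbox a b) x * G x * bump p q j x) \<le> \<bar>indicator (cbox a b) x * G x\<bar>" for j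
        proof (intro AE_I2)
          fix x
          show "norm (indicator (cbox a b) x * G x * bump p q j x) \<le> \<bar>indicator (cbox a b) x * G x\<bar>"
            using mult_left_mono[of "bump p q j x" 1 "\<bar>indicator (cbox a b) x * G x\<bar>"] bump_bounds[of p q j x]
            by (simp add: abs_mult)
        qed
      qed (use I in \<open>auto intro!: AE_I2 tendsto_mult_left bump_tendsto\<close>)
      have "(LINT x|?N. indicator (cbox a b) x * G x * bump p q j x) = 0" for j
      proof -
        have "indicator (cbox a b) x * G x * bump p q j x = G x * bump p q j x" for x
          using bump_eq_0[of x p q j] bsub by (auto simp: indicator_def)
        moreover have "test_function U (bump p q j)"
          using test_function_bump[of p q U] pq(2) ab by blast
        ultimately show ?thesis using test[of "bump p q j"] by presburger
      qed
      with lim have z: "(LINT x|?N. indicator (cbox a b) x * G x * indicator (box p q) x) = 0"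
        by (simp add: LIMSEQ_const_iff)
      have "(LINT x|M. indicator (box c d) x * h x) = (LINT x|M. g' x * indicator (box p q) x)"
        using pq(1) by (intro Bochner_Integration.integral_cong) (auto simp: h_def indicator_def)
      also have "\<dots> = (LINT x|?N. g' x * indicator (box p q) x)"
        by (intro integral_completion[symmetric] borel_measurable_times g' borel_measurable_indicator bM) simp
      also have "\<dots> = (LINT x|?N. indicator (cbox a b) x * G x * indicator (box p q) x)"
        by (intro integral_cong_AE borel_measurable_times g'm borel_measurable_integrable[OF I]
          borel_measurable_indicator bM) (use AE_completion[OF g'(2)] in \<open>auto elim: eventually_mono\<close>)
      finally show "(LINT x|M. indicator (box c d) x * h x) = 0" using z by simp
    qed
    with g'(2) have "AE x in M. x \<in> box a b \<longrightarrow> G x = 0"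
    proof eventually_elim
      case (elim x)
      then show ?case using box_subset_cbox[of a b] by (auto simp: h_def indicator_def)
    qed
    then show ?thesis by (rule AE_completion)
  qed
  obtain \<D> where D: "countable \<D>" "\<D> \<subseteq> Pow U" "\<And>X. X \<in> \<D> \<Longrightarrow> \<exists>a b. X = box a b" "\<Union>\<D> = U"
    using open_countable_Union_open_box[OF U] by metis
  have "AE x in completion M. \<forall>X\<in>\<D>. x \<in> X \<longrightarrow> G x = 0"
  proof (subst AE_ball_countable[OF D(1)], intro ballI)
    fix X assume X: "X \<in> \<D>"
    then obtain a b where ab: "X = box a b" using D by blast
    \<comment> \<open>\<open>box0\<close> requires the closed box to lie in \<open>U\<close>, but
      only the open box \<open>X\<close> is known to. The shrunken boxes meet this requirement and
      exhaust \<open>X\<close>.\<close>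
    let ?a = "\<lambda>m::nat. \<chi> i. a$i + 1 / real (Suc m)" and ?b = "\<lambda>m::nat. \<chi> i. b$i - 1 / real (Suc m)"
    have "cbox (?a m) (?b m) \<subseteq> U" for m
    proof -
      have "cbox (?a m) (?b m) \<subseteq> box a b"
      proof
        fix x assume "x \<in> cbox (?a m) (?b m)"
        then have "a$i + 1 / real (Suc m) \<le> x$i \<and> x$i \<le> b$i - 1 / real (Suc m)" for i
          by (auto simp: mem_box_cart)
        moreover have "1 / real (Suc m) > 0" by simp
        ultimately have "a$i < x$i \<and> x$i < b$i" for i by (smt (verit))
        then show "x \<in> box a b" by (simp add: mem_box_cart)
      qed
      then show ?thesis using ab X D by blast
    qed
    then have "AE x in completion M. \<forall>m. x \<in> box (?a m) (?b m) \<longrightarrow> G x = 0"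
      by (subst AE_all_countable) (auto intro: box0)
    then show "AE x in completion M. x \<in> X \<longrightarrow> G x = 0"
    proof eventually_elim
      case (elim x)
      show ?case
      proof
        assume "x \<in> X"
        then have x: "\<And>i. a$i < x$i" "\<And>i. x$i < b$i" by (auto simp: ab mem_box_cart)
        define e where "e = Min (range (\<lambda>i. min (x$i - a$i) (b$i - x$i)))"
        have "e > 0" using x by (auto simp: e_def)
        then obtain m where m: "1 / real (Suc m) < e" using nat_approx_posE by blast
        have "e \<le> min (x$i - a$i) (b$i - x$i)" for i
            unfolding e_def by (rule Min_le) auto
        then have "e \<le> x$i - a$i" "e \<le> b$i - x$i" for i by (meson min.boundedE)+
        with m have "a$i + 1 / real (Suc m) < x$i" "x$i < b$i - 1 / real (Suc m)" for i
          by (smt (verit))+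
        then have "x \<in> box (?a m) (?b m)" by (auto simp: mem_box_cart)
        with elim show "G x = 0" by blast
      qed
    qed
  qed
  then show ?thesis by eventually_elim (use D(4) in blast)
qed

section \<open>Weak derivatives\<close>

lemma integrable_mult_bounded:
  fixes g \<phi> :: "'a \<Rightarrow> real"
  assumes "integrable M g" "\<phi> \<in> borel_measurable M" "\<And>x. \<bar>\<phi> x\<bar> \<le> C"
  shows "integrable M (\<lambda>x. g x * \<phi> x)"
proof (rule Bochner_Integration.integrable_bound)
  show "integrable M (\<lambda>x. C * g x)" using assms(1) by simp
  show "AE x in M. norm (g x * \<phi> x) \<le> norm (C * g x)"
  proof (intro AE_I2)
    fix x
    have "\<bar>\<phi> x\<bar> \<le> \<bar>C\<bar>" using assms(3)[of x] by linarith
    then show "norm (g x * \<phi> x) \<le> norm (C * g x)"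
      using mult_right_mono[of "\<bar>\<phi> x\<bar>" "\<bar>C\<bar>" "\<bar>g x\<bar>"] by (simp add: abs_mult mult.commute)
  qed
qed (use assms in auto)

text \<open>An open set is a countable union of closed boxes; on each of these the function is
  integrable, hence measurable.\<close>

lemma locally_integrable_borel_measurable:
  assumes D: "open D" and g: "locally_integrable D g"
  shows "g \<in> borel_measurable (lebesgue_on D)"
proof -
  obtain \<D> where \<D>: "countable \<D>" "\<D> \<subseteq> Pow D" "\<And>X. X \<in> \<D> \<Longrightarrow> \<exists>a b. X = cbox a b" "\<Union>\<D> = D"
    using open_countable_Union_open_cbox[OF D] by metis
  show ?thesis
  proof (rule measurable_piecewise_restrict[OF \<D>(1)])
    fix X assume X: "X \<in> \<D>"
    then have XD: "X \<subseteq> D" "compact X" using \<D>(2) \<D>(3)[OF X] by auto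
    then show "X \<inter> space (lebesgue_on D) \<in> sets (lebesgue_on D)"
      by (auto simp: sets_restrict_space_iff Int_absorb2 compact_imp_closed D)
    have "lebesgue_on X = restrict_space (lebesgue_on D) X"
      using XD D by (subst restrict_restrict_space) (auto simp: Int_absorb1 compact_imp_closed)
    then show "g \<in> borel_measurable (restrict_space (lebesgue_on D) X)"
      using g XD unfolding locally_integrable_def by (metis borel_measurable_integrable)
  qed (use \<D> in auto)
qed

lemma locally_integrable_diff:
  "locally_integrable D f \<Longrightarrow> locally_integrable D g \<Longrightarrow> locally_integrable D (\<lambda>x. f x - g x)"
  by (auto simp: locally_integrable_def)

lemma locally_integrable_mult_test:
  assumes D: "open D" and g: "locally_integrable D g" and \<phi>: "test_function D \<phi>"
  shows "integrable (lebesgue_on D) (\<lambda>x. g x * \<phi> x)"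
proof -
  obtain K where K: "compact K" "K \<subseteq> D" "\<And>x. x \<notin> K \<Longrightarrow> \<phi> x = 0"
    using \<phi> test_functionE by metis
  obtain C where C: "\<And>x. \<bar>\<phi> x\<bar> \<le> C" using test_function_bounded[OF \<phi>] by metis
  have KS: "K \<in> sets lebesgue" using K(1) by (simp add: compact_imp_closed)
  have "integrable lebesgue (\<lambda>x. indicator K x * g x)"
    using g K KS by (auto simp: locally_integrable_def lebesgue_on_integrable_eq)
  then have "integrable lebesgue (\<lambda>x. (indicator K x * g x) * \<phi> x)"
    by (rule integrable_mult_bounded[OF _ _ C])
      (intro measurable_completion, simp add: smooth_borel_measurable test_function_smooth[OF \<phi>])
  moreover have "(indicator K x * g x) * \<phi> x = indicator D x * (g x * \<phi> x)" for x
    using K(2) K(3)[of x] by (auto simp: indicator_def)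
  ultimately have "integrable lebesgue (\<lambda>x. indicator D x * (g x * \<phi> x))" by (simp only:)
  then show ?thesis using D by (simp add: lebesgue_on_integrable_eq)
qed

lemma AE_lebesgue_zero_if_test_integrals_zero:
  fixes G :: "real^'n \<Rightarrow> real"
  assumes D: "open D" and G: "locally_integrable D G"
    and test: "\<And>\<phi>. test_function D \<phi> \<Longrightarrow> (LINT x|lebesgue_on D. G x * \<phi> x) = 0"
  shows "AE x in lebesgue_on D. G x = 0"
proof -
  have "AE x in completion lborel. x \<in> D \<longrightarrow> G x = 0"
  proof (rule AE_zero_if_test_integrals_zero[OF sets_lborel D])
    fix K assume K: "compact K" "K \<subseteq> D"
    then show "integrable lebesgue (\<lambda>x. indicator K x * G x)"
      using G by (auto simp: locally_integrable_def lebesgue_on_integrable_eq compact_imp_closed)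
  next
    fix \<phi> assume \<phi>: "test_function D \<phi>"
    have "(LINT x|lebesgue. G x * \<phi> x) = (LINT x|lebesgue. indicator D x * (G x * \<phi> x))"
      using test_function_eq_0[OF \<phi>] by (intro Bochner_Integration.integral_cong) (auto simp: indicator_def)
    with test[OF \<phi>] show "(LINT x|lebesgue. G x * \<phi> x) = 0" using D by (simp add: lebesgue_on_integral_eq)
  qed
  then show ?thesis using D by (simp add: AE_lebesgue_on)
qed

lemma has_weak_pderivative_unique:
  assumes D: "open D" and "has_weak_pderivative D i w g" "has_weak_pderivative D i w g'"
  shows "AE x in lebesgue_on D. g x = g' x"
proof -
  have l: "locally_integrable D g" "locally_integrable D g'"
    using assms by (auto simp: has_weak_pderivative_def)
  have "AE x in lebesgue_on D. g x - g' x = 0"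
  proof (rule AE_lebesgue_zero_if_test_integrals_zero[OF D locally_integrable_diff[OF l]])
    fix \<phi> assume \<phi>: "test_function D \<phi>"
    have "(LINT x|lebesgue_on D. (g x - g' x) * \<phi> x)
       = (LINT x|lebesgue_on D. g x * \<phi> x - g' x * \<phi> x)" by (simp add: left_diff_distrib)
    also have "\<dots> = (LINT x|lebesgue_on D. g x * \<phi> x) - (LINT x|lebesgue_on D. g' x * \<phi> x)"
      by (intro Bochner_Integration.integral_diff locally_integrable_mult_test D l \<phi>)
    also have "\<dots> = 0" using assms \<phi> by (simp add: has_weak_pderivative_def)
    finally show "(LINT x|lebesgue_on D. (g x - g' x) * \<phi> x) = 0" .
  qed
  then show ?thesis by simp
qed

lemma has_weak_pderivative_weak_pderivative:
  "has_weak_pderivative D i w g \<Longrightarrow> has_weak_pderivative D i w (weak_pderivative D i w)"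
  unfolding weak_pderivative_def by (rule someI[of "has_weak_pderivative D i w"])

lemma weak_pderivative_AE_eq:
  "open D \<Longrightarrow> has_weak_pderivative D i w g \<Longrightarrow> AE x in lebesgue_on D. weak_pderivative D i w x = g x"
  using has_weak_pderivative_unique[OF _ has_weak_pderivative_weak_pderivative] by blast

lemma has_weak_pderivative_subset:
  assumes D: "open D" "open E" "E \<subseteq> D" and w: "has_weak_pderivative D i w g"
  shows "has_weak_pderivative E i w g"
proof -
  have "locally_integrable E w" "locally_integrable E g"
    using w D unfolding has_weak_pderivative_def locally_integrable_def by blast+
  moreover have "(LINT x|lebesgue_on E. w x * pderivative i \<phi> x) = - (LINT x|lebesgue_on E. g x * \<phi> x)"
    if \<phi>: "test_function E \<phi>" for \<phi>
  proof -
    have "(LINT x|lebesgue_on D. w x * pderivative i \<phi> x) = - (LINT x|lebesgue_on D. g x * \<phi> x)"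
      using w test_function_mono[OF \<phi> D(3)] by (simp add: has_weak_pderivative_def)
    then show ?thesis
      using D test_function_eq_0[OF \<phi>] test_function_eq_0[OF test_function_pderivative[OF \<phi>]]
      by (simp add: lebesgue_on_integral_subset[of E D])
  qed
  ultimately show ?thesis by (auto simp: has_weak_pderivative_def)
qed

lemma has_weak_pderivative_cong_AE:
  assumes D: "open D" and w: "has_weak_pderivative D i w g" and w': "locally_integrable D w'"
    and eq: "AE x in lebesgue_on D. w x = w' x"
  shows "has_weak_pderivative D i w' g"
proof -
  have "(LINT x|lebesgue_on D. w' x * pderivative i \<phi> x) = (LINT x|lebesgue_on D. w x * pderivative i \<phi> x)"
    if \<phi>: "test_function D \<phi>" for \<phi>
  proof (rule integral_cong_AE)
    show "AE x in lebesgue_on D. w' x * pderivative i \<phi> x = w x * pderivative i \<phi> x"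
      using eq by eventually_elim simp
  qed (intro borel_measurable_integrable locally_integrable_mult_test[OF D]
        test_function_pderivative \<phi> w' , use w in \<open>simp add: has_weak_pderivative_def\<close>)+
  with w w' show ?thesis by (auto simp: has_weak_pderivative_def)
qed

lemma continuous_locally_integrable:
  assumes "continuous_on UNIV g"
  shows "locally_integrable D g"
  unfolding locally_integrable_def
proof safe
  fix K :: "(real^'a) set" assume K: "compact K"
  have "integrable lborel (\<lambda>x. indicator K x * g x)"
    by (intro integrable_indicator_continuous_bounded assms)
      (use K in \<open>auto simp: compact_imp_bounded compact_imp_closed\<close>)
  moreover have "(\<lambda>x. indicator K x * g x) \<in> borel_measurable borel"
    using assms K by (intro borel_measurable_times borel_measurable_indicator borel_measurable_continuous_onI)
      (auto simp: compact_imp_closed)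
  ultimately have "integrable lebesgue (\<lambda>x. indicator K x * g x)" by (simp add: integrable_completion)
  then show "integrable (lebesgue_on K) g"
    using K by (simp add: lebesgue_on_integrable_eq compact_imp_closed)
qed

text \<open>The product of \<open>w\<close> with a test function is again a test function, so its
  derivative has integral zero; the product rule splits this into the two integrals of the
  definition.\<close>

lemma smooth_has_weak_pderivative:
  assumes D: "open D" and w: "smooth w"
  shows "has_weak_pderivative D i w (pderivative i w)"
proof -
  have l: "locally_integrable D w" "locally_integrable D (pderivative i w)"
    using w by (auto intro!: continuous_locally_integrable smooth_continuous_on smooth_pderivative)
  moreover have "(LINT x|lebesgue_on D. w x * pderivative i \<phi> x) = - (LINT x|lebesgue_on D. pderivative i w x * \<phi> x)"
    if \<phi>: "test_function D \<phi>" for \<phi>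
  proof -
    have d: "pderivative i (\<lambda>x. \<phi> x * w x) x = w x * pderivative i \<phi> x + pderivative i w x * \<phi> x" for x
      using pderivative_mult[of \<phi> x w i] w \<phi>
      by (simp add: smooth_imp_differentiable test_function_smooth mult.commute)
    have \<phi>w: "test_function D (\<lambda>x. \<phi> x * w x)" by (rule test_function_mult_smooth[OF \<phi> w])
    have sm: "smooth (pderivative i (\<lambda>x. \<phi> x * w x))"
      by (intro smooth_pderivative test_function_smooth[OF \<phi>w])
    have "(LINT x|lebesgue_on D. w x * pderivative i \<phi> x) + (LINT x|lebesgue_on D. pderivative i w x * \<phi> x)
      = (LINT x|lebesgue_on D. pderivative i (\<lambda>x. \<phi> x * w x) x)"
      unfolding d by (intro Bochner_Integration.integral_add[symmetric] locally_integrable_mult_test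
          D l \<phi> test_function_pderivative)
    also have "\<dots> = (LINT x|lborel. indicator D x * pderivative i (\<lambda>x. \<phi> x * w x) x)"
      using D sm by (intro lebesgue_on_integral_lborel smooth_borel_measurable) auto
    also have "\<dots> = (LINT x|lborel. pderivative i (\<lambda>x. \<phi> x * w x) x)"
      using test_function_eq_0[OF test_function_pderivative[OF \<phi>w]]
      by (intro Bochner_Integration.integral_cong) (auto simp: indicator_def)
    also have "\<dots> = 0" by (rule integral_pderivative_test_function[OF \<phi>w])
    finally show ?thesis by simp
  qed
  ultimately show ?thesis by (auto simp: has_weak_pderivative_def)
qed

section \<open>Sobolev spaces\<close>

lemma borel_measurable_lebesgue_on_borel:
  "f \<in> borel_measurable borel \<Longrightarrow> f \<in> borel_measurable (lebesgue_on S)"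
  by (intro measurable_restrict_space1 measurable_completion) simp

lemma square_integrable_cong_AE:
  assumes "square_integrable M f" "g \<in> borel_measurable M" "AE x in M. f x = g x"
  shows "square_integrable M g"
proof -
  have "integrable M (\<lambda>x. (g x)\<^sup>2)"
    by (rule Bochner_Integration.integrable_cong_AE_imp[of M "\<lambda>x. (f x)\<^sup>2"])
      (use assms in \<open>auto simp: square_integrable_def elim: eventually_mono\<close>)
  with assms(2) show ?thesis by (simp add: square_integrable_def)
qed

lemma square_integrable_mult:
  assumes "square_integrable M f" "square_integrable M g"
  shows "integrable M (\<lambda>x. f x * g x)"
proof (rule Bochner_Integration.integrable_bound)
  show "integrable M (\<lambda>x. (f x)\<^sup>2 + (g x)\<^sup>2)"
    using assms by (auto simp: square_integrable_def)
  have "\<bar>a * b\<bar> \<le> a\<^sup>2 + b\<^sup>2" for a b :: real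
    using sum_squares_bound[of "\<bar>a\<bar>" "\<bar>b\<bar>"] mult_nonneg_nonneg[OF abs_ge_zero[of a] abs_ge_zero[of b]]
    unfolding abs_mult power2_abs by linarith
  then show "AE x in M. norm (f x * g x) \<le> norm ((f x)\<^sup>2 + (g x)\<^sup>2)" by simp
qed (use assms in \<open>auto simp: square_integrable_def\<close>)

lemma square_integrable_bounded:
  assumes "finite_measure M" "f \<in> borel_measurable M" "\<And>x. x \<in> space M \<Longrightarrow> \<bar>f x\<bar> \<le> C"
  shows "square_integrable M f"
proof -
  interpret finite_measure M by fact
  have "integrable M (\<lambda>x. (f x)\<^sup>2)"
  proof (rule integrable_const_bound[where B = "C\<^sup>2"])
    show "AE x in M. norm ((f x)\<^sup>2) \<le> C\<^sup>2"
      using assms(3) by (intro AE_I2) (simp add: abs_le_square_iff[symmetric] order_trans[OF _ abs_ge_self])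
  qed (use assms in auto)
  with assms show ?thesis by (simp add: square_integrable_def)
qed

lemma square_integrable_imp_integrable_finite:
  assumes "finite_measure M" "square_integrable M f"
  shows "integrable M f"
  using square_integrable_mult[OF assms(2) square_integrable_bounded[OF assms(1), of "\<lambda>_. 1" 1]] by simp

lemma square_integrable_diff:
  assumes "square_integrable M f" "square_integrable M g"
  shows "square_integrable M (\<lambda>x. f x - g x)"
proof -
  have "integrable M (\<lambda>x. (f x)\<^sup>2 + (g x)\<^sup>2 - 2 * (f x * g x))"
    using assms square_integrable_mult[OF assms] by (auto simp: square_integrable_def)
  then show ?thesis using assms by (auto simp: square_integrable_def power2_diff mult.assoc)
qed

lemma bounded_lebesgue_finite_measure:
  fixes S :: "'a::euclidean_space set"
  assumes "bounded S" "S \<in> sets lebesgue"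
  shows "finite_measure (lebesgue_on S)"
  by (intro finite_measure_lebesgue_on bounded_set_imp_lmeasurable assms)

lemma smooth_square_integrable:
  assumes "smooth g" "bounded S" "S \<in> sets lebesgue"
  shows "square_integrable (lebesgue_on S) g"
proof -
  have "compact (g ` closure S)"
    by (intro compact_continuous_image smooth_continuous_on assms) (simp add: assms)
  then obtain C where C: "\<And>x. x \<in> closure S \<Longrightarrow> \<bar>g x\<bar> \<le> C"
    using compact_imp_bounded bounded_pos by (metis imageI real_norm_def)
  show ?thesis
    by (rule square_integrable_bounded[where C = C])
      (use assms C closure_subset in \<open>auto intro!: bounded_lebesgue_finite_measure
         borel_measurable_lebesgue_on_borel smooth_borel_measurable\<close>)
qed

text \<open>At an integer order the fractional part is zero, so the Gagliardo condition is void and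
  only square integrability remains.\<close>

lemma sobolev_1_exists_iff:
  "sobolev 1 D w \<longleftrightarrow> square_integrable (lebesgue_on D) w \<and>
     (\<forall>i. \<exists>g. has_weak_pderivative D i w g \<and> square_integrable (lebesgue_on D) g)"
  by (simp add: sobolev_def)

lemma sobolev_2_exists_iff:
  "sobolev 2 D w \<longleftrightarrow> square_integrable (lebesgue_on D) w \<and>
     (\<forall>i. \<exists>g. has_weak_pderivative D i w g \<and> sobolev 1 D g)"
proof -
  have "frac (2::real) = 0" "frac (1::real) = 0" "nat \<lfloor>2::real\<rfloor> = Suc (Suc 0)" "nat \<lfloor>1::real\<rfloor> = Suc 0"
    by (simp_all add: frac_def)
  then show ?thesis unfolding sobolev_def by (simp only: sobolev_aux.simps)
qed

text \<open>\<open>sobolev\<close> speaks of some weak derivative, whereas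
  \<open>weak_pderivative\<close> is a choice made by \<open>SOME\<close>; uniqueness almost
  everywhere transfers square integrability to the chosen one.\<close>

lemma sobolev_1_weak_pderivative:
  assumes D: "open D" and w: "sobolev 1 D w"
  shows "square_integrable (lebesgue_on D) w"
    "has_weak_pderivative D i w (weak_pderivative D i w)"
    "square_integrable (lebesgue_on D) (weak_pderivative D i w)"
proof -
  show "square_integrable (lebesgue_on D) w" using w by (simp add: sobolev_1_exists_iff)
  obtain g where g: "has_weak_pderivative D i w g" "square_integrable (lebesgue_on D) g"
    using w by (auto simp: sobolev_1_exists_iff)
  show *: "has_weak_pderivative D i w (weak_pderivative D i w)"
    by (rule has_weak_pderivative_weak_pderivative[OF g(1)])
  show "square_integrable (lebesgue_on D) (weak_pderivative D i w)"
    using * weak_pderivative_AE_eq[OF D g(1)]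
    by (intro square_integrable_cong_AE[OF g(2)] locally_integrable_borel_measurable[OF D])
      (auto simp: has_weak_pderivative_def elim: eventually_mono)
qed

lemma sobolev_1_smooth:
  "open D \<Longrightarrow> bounded D \<Longrightarrow> smooth w \<Longrightarrow> sobolev 1 D w"
  by (auto simp: sobolev_1_exists_iff intro!: smooth_square_integrable exI[of _ "pderivative _ w"]
      smooth_has_weak_pderivative smooth_pderivative)

lemma sobolev_1_cong_AE:
  assumes D: "open D" and w: "sobolev 1 D w" and w': "locally_integrable D w'"
    and eq: "AE x in lebesgue_on D. w x = w' x"
  shows "sobolev 1 D w'"
  unfolding sobolev_1_exists_iff
proof safe
  show "square_integrable (lebesgue_on D) w'"
    using w eq w' D by (auto intro: square_integrable_cong_AE locally_integrable_borel_measurable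
        simp: sobolev_1_exists_iff)
  show "\<exists>g. has_weak_pderivative D i w' g \<and> square_integrable (lebesgue_on D) g" for i
    using w has_weak_pderivative_cong_AE[OF D _ w' eq] by (meson sobolev_1_exists_iff)
qed

lemma sobolev_2_imp_sobolev_1:
  assumes D: "open D" and w: "sobolev 2 D w"
  shows "sobolev 1 D w" "sobolev 1 D (weak_pderivative D i w)"
proof -
  show "sobolev 1 D w" using w by (auto simp: sobolev_2_exists_iff) (metis sobolev_1_exists_iff)
  obtain g where g: "has_weak_pderivative D i w g" "sobolev 1 D g"
    using w by (auto simp: sobolev_2_exists_iff)
  show "sobolev 1 D (weak_pderivative D i w)"
    using weak_pderivative_AE_eq[OF D g(1)] has_weak_pderivative_weak_pderivative[OF g(1)]
    by (intro sobolev_1_cong_AE[OF D g(2)]) (auto simp: has_weak_pderivative_def elim: eventually_mono)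
qed

lemma sobolev_1_subset:
  assumes D: "open D" "open E" "E \<subseteq> D" and w: "sobolev 1 D w"
  shows "sobolev 1 E w" "AE x in lebesgue_on E. weak_pderivative E i w x = weak_pderivative D i w x"
proof -
  have si: "square_integrable (lebesgue_on E) g" if g: "square_integrable (lebesgue_on D) g" for g
  proof -
    have E: "lebesgue_on E = restrict_space (lebesgue_on D) E"
      using D by (subst restrict_restrict_space) (auto simp: Int_absorb1)
    have "integrable (lebesgue_on E) (\<lambda>x. (g x)\<^sup>2)"
    proof -
      have "integrable lebesgue (\<lambda>x. indicator E x *\<^sub>R (indicator D x * (g x)\<^sup>2))"
        using g D by (intro integrable_mult_indicator) (auto simp: square_integrable_def lebesgue_on_integrable_eq)
      moreover have "indicator E x *\<^sub>R (indicator D x * (g x)\<^sup>2) = indicator E x * (g x)\<^sup>2" for x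
        using D(3) by (auto simp: indicator_def)
      ultimately have "integrable lebesgue (\<lambda>x. indicator E x * (g x)\<^sup>2)" by (simp only:)
      then show ?thesis using D by (simp add: lebesgue_on_integrable_eq)
    qed
    then show ?thesis
      using g D unfolding square_integrable_def E by (auto intro: measurable_restrict_space1)
  qed
  show "sobolev 1 E w"
    using w si has_weak_pderivative_subset[OF D] by (meson sobolev_1_exists_iff)
  show "AE x in lebesgue_on E. weak_pderivative E i w x = weak_pderivative D i w x"
    by (intro weak_pderivative_AE_eq has_weak_pderivative_subset[OF D] D
        sobolev_1_weak_pderivative[OF D(1) w])
qed

section \<open>Smooth approximation in H1, term by term\<close>

lemma ennreal_add_tendsto_0_iff:
  fixes f g :: "nat \<Rightarrow> ennreal"
  shows "(\<lambda>j. f j + g j) \<longlonglongrightarrow> 0 \<longleftrightarrow> f \<longlonglongrightarrow> 0 \<and> g \<longlonglongrightarrow> 0"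
proof safe
  assume *: "(\<lambda>j. f j + g j) \<longlonglongrightarrow> 0"
  show "f \<longlonglongrightarrow> 0" "g \<longlonglongrightarrow> 0"
    by (rule tendsto_sandwich[OF _ _ tendsto_const *]; simp)+
next
  assume "f \<longlonglongrightarrow> 0" "g \<longlonglongrightarrow> 0"
  then have "(\<lambda>j. f j + g j) \<longlonglongrightarrow> 0 + 0" by (rule tendsto_add)
  then show "(\<lambda>j. f j + g j) \<longlonglongrightarrow> 0" by simp
qed

lemma ennreal_sum_tendsto_0_iff:
  fixes f :: "'a \<Rightarrow> nat \<Rightarrow> ennreal"
  assumes "finite I"
  shows "(\<lambda>j. \<Sum>i\<in>I. f i j) \<longlonglongrightarrow> 0 \<longleftrightarrow> (\<forall>i\<in>I. f i \<longlonglongrightarrow> 0)"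
  using assms by (induction I) (auto simp: ennreal_add_tendsto_0_iff)

lemma smooth_H1_approx_iff:
  "smooth_H1_approx D \<phi> w \<longleftrightarrow> (\<forall>j. smooth (\<phi> j)) \<and>
     (\<lambda>j. \<integral>\<^sup>+x. ennreal ((\<phi> j x - w x)\<^sup>2) \<partial>lebesgue_on D) \<longlonglongrightarrow> 0 \<and>
     (\<forall>i. (\<lambda>j. \<integral>\<^sup>+x. ennreal ((pderivative i (\<phi> j) x - weak_pderivative D i w x)\<^sup>2) \<partial>lebesgue_on D)
       \<longlonglongrightarrow> 0)"
  unfolding smooth_H1_approx_def ennreal_add_tendsto_0_iff
  by (subst ennreal_sum_tendsto_0_iff) auto

lemma nn_integral_lebesgue_on_mono:
  assumes "S \<in> sets lebesgue" "T \<in> sets lebesgue" "S \<subseteq> T"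
  shows "(\<integral>\<^sup>+x. f x \<partial>lebesgue_on S) \<le> (\<integral>\<^sup>+x. f x \<partial>lebesgue_on T)"
  using assms by (auto simp: nn_integral_restrict_space indicator_def intro!: nn_integral_mono)

text \<open>One and the same sequence serves the smaller set, where the weak derivatives are chosen
  anew but agree almost everywhere. This is the link between traces taken from the domain and traces
  taken from a cell.\<close>

lemma smooth_H1_approx_subset:
  assumes D: "open D" "open E" "E \<subseteq> D" and w: "sobolev 1 D w" and \<phi>: "smooth_H1_approx D \<phi> w"
  shows "smooth_H1_approx E \<phi> w"
proof -
  have mono: "f' \<longlonglongrightarrow> 0" if "f \<longlonglongrightarrow> 0" "\<And>j. f' j \<le> f j" for f f' :: "nat \<Rightarrow> ennreal"
    by (rule tendsto_sandwich[OF _ _ tendsto_const that(1)]) (use that(2) in auto)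
  have "(\<integral>\<^sup>+x. ennreal ((pderivative i (\<phi> j) x - weak_pderivative E i w x)\<^sup>2) \<partial>lebesgue_on E)
    = (\<integral>\<^sup>+x. ennreal ((pderivative i (\<phi> j) x - weak_pderivative D i w x)\<^sup>2) \<partial>lebesgue_on E)" for i j
    using sobolev_1_subset(2)[OF D w, of i] by (intro nn_integral_cong_AE) (auto elim: eventually_mono)
  then show ?thesis
    using \<phi> D unfolding smooth_H1_approx_iff
    by (auto intro: mono[OF _ nn_integral_lebesgue_on_mono])
qed

section \<open>Surface measure on a hyperplane\<close>

lemma nn_integral_translation:
  fixes f :: "'a::euclidean_space \<Rightarrow> ennreal"
  assumes [measurable]: "f \<in> borel_measurable borel"
  shows "(\<integral>\<^sup>+x. f (c + x) \<partial>lborel) = (\<integral>\<^sup>+x. f x \<partial>lborel)"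
  by (subst (2) lborel_distr_plus[symmetric, of c]) (simp add: nn_integral_distr)

text \<open>Uniqueness of translation-invariant measures: by Tonelli,
  \<open>\<integral>\<integral> 1\<^sub>A(f x) 1\<^sub>B(y - f x) dy dx\<close> can be evaluated in two ways, and the unit ball \<open>B\<close>
  is invariant under \<open>f\<close>.\<close>

lemma lborel_distr_orthogonal:
  fixes f :: "'a::euclidean_space \<Rightarrow> 'a"
  assumes f: "orthogonal_transformation f"
  shows "distr lborel borel f = lborel"
proof (rule measure_eqI)
  have lin: "linear f" using f by (rule orthogonal_transformation_linear)
  have fm [measurable]: "f \<in> borel_measurable borel"
    using lin by (intro borel_measurable_continuous_onI linear_continuous_on) (simp add: linear_conv_bounded_linear)
  fix A assume "A \<in> sets (distr lborel borel f)"
  then have [measurable]: "A \<in> sets borel" by simp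
  obtain g where g: "\<And>y. f (g y) = y"
    using orthogonal_transformation_surj[OF f] by (metis surj_def)
  define B where "B = ball (0::'a) 1"
  have Bm [measurable]: "B \<in> sets borel" by (simp add: B_def)
  have fB: "- f x \<in> B \<longleftrightarrow> x \<in> B" for x
    using f by (simp add: B_def orthogonal_transformation_norm)
  have "(\<integral>\<^sup>+x. indicator A (f x) \<partial>lborel) * emeasure lborel B
      = (\<integral>\<^sup>+x. (\<integral>\<^sup>+y. indicator A (f x) * indicator B (- f x + y) \<partial>lborel) \<partial>lborel)"
  proof -
    have "(\<integral>\<^sup>+y. indicator A (f x) * indicator B (- f x + y) \<partial>lborel) = indicator A (f x) * emeasure lborel B" for x
      using nn_integral_translation[of "indicator B" "- f x"] by (subst nn_integral_cmult) (auto simp del: minus_add_distrib)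
    then show ?thesis by (simp add: nn_integral_multc)
  qed
  also have "\<dots> = (\<integral>\<^sup>+y. (\<integral>\<^sup>+x. indicator A (f x) * indicator B (- f x + y) \<partial>lborel) \<partial>lborel)"
    by (rule lborel_pair.Fubini') measurable
  also have "\<dots> = (\<integral>\<^sup>+y. (\<integral>\<^sup>+x. indicator A (y + f x) * indicator B (- f x) \<partial>lborel) \<partial>lborel)"
  proof (rule nn_integral_cong)
    fix y :: 'a
    have "(\<integral>\<^sup>+x. indicator A (f x) * indicator B (- f x + y) \<partial>lborel)
       = (\<integral>\<^sup>+x. indicator A (f (g y + x)) * indicator B (- f (g y + x) + y) \<partial>lborel :: ennreal)"
      by (rule nn_integral_translation[symmetric]) measurable
    also have "\<dots> = (\<integral>\<^sup>+x. indicator A (y + f x) * indicator B (- f x) \<partial>lborel)"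
      using lin g by (simp add: linear_add)
    finally show "(\<integral>\<^sup>+x. indicator A (f x) * indicator B (- f x + y) \<partial>lborel)
       = (\<integral>\<^sup>+x. indicator A (y + f x) * indicator B (- f x) \<partial>lborel :: ennreal)" .
  qed
  also have "\<dots> = (\<integral>\<^sup>+x. (\<integral>\<^sup>+y. indicator A (y + f x) * indicator B (- f x) \<partial>lborel) \<partial>lborel)"
    by (rule lborel_pair.Fubini'[symmetric]) measurable
  also have "\<dots> = (\<integral>\<^sup>+x. (\<integral>\<^sup>+y. indicator A (f x + y) \<partial>lborel) * indicator B x \<partial>lborel)"
    by (simp add: nn_integral_multc add.commute indicator_def fB)
  also have "\<dots> = emeasure lborel A * emeasure lborel B"
    by (simp add: nn_integral_translation nn_integral_cmult)
  finally have "(\<integral>\<^sup>+x. indicator A (f x) \<partial>lborel) * emeasure lborel B = emeasure lborel A * emeasure lborel B" .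
  moreover have "emeasure lborel B \<noteq> 0" "emeasure lborel B \<noteq> \<infinity>"
    unfolding B_def using emeasure_lborel_ball_finite[of "0::'a" 1] open_not_negligible[of "ball (0::'a) 1"]
    by (auto simp: negligible_iff_emeasure0 emeasure_completion)
  ultimately have "(\<integral>\<^sup>+x. indicator A (f x) \<partial>lborel) = emeasure lborel A"
    by (simp add: mult.commute[of _ "emeasure lborel B"] ennreal_mult_cancel_left)
  then show "emeasure (distr lborel borel f) A = emeasure lborel A"
    using nn_integral_distr[of f lborel borel "indicator A"] by simp
qed simp

text \<open>Multiplies the signed distance from the hyperplane \<open>n \<bullet> x = c\<close> by
  \<open>t\<close> and keeps the foot of the perpendicular, for a unit vector \<open>n\<close>. At
  \<open>t = 0\<close> it is the orthogonal projection that occurs in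
  \<open>hyperplane_measure\<close>.\<close>

definition hyper_scale :: "real^'n \<Rightarrow> real \<Rightarrow> real \<Rightarrow> real^'n \<Rightarrow> real^'n" where
  "hyper_scale n c t x = x - ((1 - t) * (n \<bullet> x - c)) *\<^sub>R n"

lemma hyper_scale_0: "hyper_scale n c 0 x = x - (n \<bullet> x - c) *\<^sub>R n"
  by (simp add: hyper_scale_def)

lemma continuous_on_hyper_scale: "continuous_on S (hyper_scale n c t)"
  unfolding hyper_scale_def by (intro continuous_intros)

lemma hyper_scale_measurable [measurable]: "hyper_scale n c t \<in> borel_measurable borel"
  by (intro borel_measurable_continuous_onI continuous_on_hyper_scale)

lemma inner_hyper_scale: "norm n = 1 \<Longrightarrow> n \<bullet> hyper_scale n c t x - c = t * (n \<bullet> x - c)"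
  by (simp add: hyper_scale_def inner_diff_right dot_square_norm algebra_simps)

text \<open>An orthogonal map that takes \<open>n\<close> to a coordinate axis turns
  \<open>hyper_scale\<close> into an affine map with diagonal matrix, for which the Jacobian
  \<open>t\<close> is available.\<close>

lemma nn_integral_hyper_scale:
  fixes n :: "real^'n" and g :: "real^'n \<Rightarrow> ennreal"
  assumes n: "norm n = 1" and t: "t > 0" and g [measurable]: "g \<in> borel_measurable borel"
  shows "(\<integral>\<^sup>+x. g x \<partial>lborel) = ennreal t * (\<integral>\<^sup>+x. g (hyper_scale n c t x) \<partial>lborel)"
proof -
  fix i :: 'n
  let ?e = "axis i 1 :: real^'n"
  have e: "?e \<in> Basis" by simp
  obtain R where R: "orthogonal_transformation R" "R n = ?e"
    using orthogonal_transformation_exists[of n ?e] n by auto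
  have linR: "linear R" using R(1) by (rule orthogonal_transformation_linear)
  have Rm [measurable]: "R \<in> borel_measurable borel"
    using linR by (intro borel_measurable_continuous_onI linear_continuous_on) (simp add: linear_conv_bounded_linear)
  define Q where "Q = inv R"
  have Q: "orthogonal_transformation Q" unfolding Q_def by (rule orthogonal_transformation_inv[OF R(1)])
  have QR: "Q (R x) = x" for x
    unfolding Q_def using orthogonal_transformation_inj[OF R(1)] by simp
  have linQ: "linear Q" using Q by (rule orthogonal_transformation_linear)
  have Qm [measurable]: "Q \<in> borel_measurable borel"
    using linQ by (intro borel_measurable_continuous_onI linear_continuous_on) (simp add: linear_conv_bounded_linear)
  define d where "d j = (if j = ?e then t else 1)" for j :: "real^'n"
  define D where "D x = ((1 - t) * c) *\<^sub>R ?e + (\<Sum>j\<in>Basis. (d j * (x \<bullet> j)) *\<^sub>R j)" for x :: "real^'n"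
  have Deq: "D x = x - ((1 - t) * (?e \<bullet> x - c)) *\<^sub>R ?e" for x
  proof -
    have "(\<Sum>j\<in>Basis. (d j * (x \<bullet> j)) *\<^sub>R j) = (\<Sum>j\<in>Basis. (x \<bullet> j) *\<^sub>R j - (if j = ?e then ((1 - t) * (x \<bullet> j)) *\<^sub>R j else 0))"
      by (intro sum.cong) (auto simp: d_def algebra_simps)
    also have "\<dots> = x - ((1 - t) * (x \<bullet> ?e)) *\<^sub>R ?e"
      using e by (simp add: sum_subtractf euclidean_representation)
    finally show ?thesis by (simp add: D_def algebra_simps inner_commute)
  qed
  have Dm [measurable]: "D \<in> borel_measurable borel" unfolding D_def by measurable
  have RS: "hyper_scale n c t x = Q (D (R x))" for x
  proof -
    have "R (hyper_scale n c t x) = R x - ((1 - t) * (?e \<bullet> R x - c)) *\<^sub>R ?e"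
      using R by (simp add: hyper_scale_def linear_diff[OF linR] linear_cmul[OF linR] orthogonal_transformation_def flip: R(2))
    then show ?thesis using QR by (metis Deq)
  qed
  have dprod: "(\<Prod>j\<in>Basis. \<bar>d j\<bar>) = t"
    using e t by (simp add: d_def if_distrib prod.delta cong: if_cong)
  have "(\<integral>\<^sup>+x. g (hyper_scale n c t x) \<partial>lborel) = (\<integral>\<^sup>+x. g (Q (D (R x))) \<partial>lborel)"
    by (simp add: RS)
  also have "\<dots> = (\<integral>\<^sup>+x. g (Q (D x)) \<partial>distr lborel borel R)"
    by (subst nn_integral_distr) auto
  also have "\<dots> = (\<integral>\<^sup>+x. g (Q (D x)) \<partial>lborel)" by (simp add: lborel_distr_orthogonal[OF R(1)])
  finally have 1: "(\<integral>\<^sup>+x. g (hyper_scale n c t x) \<partial>lborel) = (\<integral>\<^sup>+x. g (Q (D x)) \<partial>lborel)" .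
  have "lborel = density (distr lborel borel D) (\<lambda>_. ennreal t)"
    using lborel_affine_euclidean[of d "((1 - t) * c) *\<^sub>R ?e"] t dprod
    unfolding D_def[abs_def] by (simp add: d_def)
  then have "(\<integral>\<^sup>+x. g (Q x) \<partial>lborel) = (\<integral>\<^sup>+x. g (Q x) \<partial>density (distr lborel borel D) (\<lambda>_. ennreal t))"
    by simp
  also have "\<dots> = ennreal t * (\<integral>\<^sup>+x. g (Q (D x)) \<partial>lborel)"
    by (simp add: nn_integral_density nn_integral_distr nn_integral_cmult)
  finally have 2: "(\<integral>\<^sup>+x. g (Q x) \<partial>lborel) = ennreal t * (\<integral>\<^sup>+x. g (Q (D x)) \<partial>lborel)" .
  have "(\<integral>\<^sup>+x. g (Q x) \<partial>lborel) = (\<integral>\<^sup>+x. g x \<partial>distr lborel borel Q)"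
    by (subst nn_integral_distr) auto
  then have "(\<integral>\<^sup>+x. g x \<partial>lborel) = (\<integral>\<^sup>+x. g (Q x) \<partial>lborel)"
    by (simp add: lborel_distr_orthogonal[OF Q])
  with 1 2 show ?thesis by simp
qed

lemma lborel_hyper_scale:
  fixes n :: "real^'n"
  assumes "norm n = 1" "t > 0"
  shows "lborel = density (distr lborel borel (hyper_scale n c t)) (\<lambda>_. ennreal t)"
proof (rule measure_eqI)
  fix A :: "(real^'n) set" assume "A \<in> sets lborel"
  then have A: "A \<in> sets borel" by simp
  then have "emeasure (density (distr lborel borel (hyper_scale n c t)) (\<lambda>_. ennreal t)) A
     = ennreal t * (\<integral>\<^sup>+x. indicator A (hyper_scale n c t x) \<partial>lborel)"
    by (subst nn_integral_distr[symmetric, of _ lborel borel]) (auto simp: emeasure_density nn_integral_cmult)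
  then show "emeasure lborel A = emeasure (density (distr lborel borel (hyper_scale n c t)) (\<lambda>_. ennreal t)) A"
    using nn_integral_hyper_scale[OF assms, of "indicator A" c] A by simp
qed simp

lemma integral_hyper_scale:
  fixes n :: "real^'n" and g :: "real^'n \<Rightarrow> real"
  assumes n: "norm n = 1" and t: "t > 0" and g [measurable]: "g \<in> borel_measurable borel"
  shows "(LINT x|lborel. g x) = t * (LINT x|lborel. g (hyper_scale n c t x))"
  by (subst lborel_hyper_scale[OF n t, of c]) (use t in \<open>simp add: integral_density integral_distr\<close>)

text \<open>The surface measure before completion: a plain image of Lebesgue measure on a slab, so
  that integrals of Borel functions can be computed by substitution.\<close>

definition hyperplane_borel_measure :: "real^'n \<Rightarrow> real \<Rightarrow> (real^'n) measure" where
  "hyperplane_borel_measure n c =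
     distr (restrict_space lborel {x. c \<le> n \<bullet> x \<and> n \<bullet> x \<le> c + 1}) borel (hyper_scale n c 0)"

lemma hyperplane_measure_eq_completion:
  "hyperplane_measure n c = completion (hyperplane_borel_measure n c)"
  unfolding hyperplane_measure_def hyperplane_borel_measure_def hyper_scale_0[abs_def] ..

lemma sets_hyperplane_borel_measure [simp, measurable_cong]:
  "sets (hyperplane_borel_measure n c) = sets borel"
  by (simp add: hyperplane_borel_measure_def)

lemma space_hyperplane_measure [simp]:
  "space (hyperplane_borel_measure n c) = UNIV" "space (hyperplane_measure n c) = UNIV"
  by (simp_all add: hyperplane_borel_measure_def hyperplane_measure_eq_completion)

abbreviation slab :: "real^'n \<Rightarrow> real \<Rightarrow> (real^'n) set" where
  "slab n c \<equiv> {x. c \<le> n \<bullet> x \<and> n \<bullet> x \<le> c + 1}"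

lemma slab_borel [measurable]: "slab n c \<in> sets borel"
  by measurable

lemma hyper_scale_restrict_measurable: "hyper_scale n c t \<in> borel_measurable (restrict_space lborel S)"
  by (intro measurable_restrict_space1) simp

lemma nn_integral_hyperplane_borel:
  assumes [measurable]: "f \<in> borel_measurable borel"
  shows "(\<integral>\<^sup>+x. f x \<partial>hyperplane_borel_measure n c)
     = (\<integral>\<^sup>+x. indicator (slab n c) x * f (hyper_scale n c 0 x) \<partial>lborel)"
  unfolding hyperplane_borel_measure_def
  by (subst nn_integral_distr) (auto simp: nn_integral_restrict_space mult.commute
      intro!: hyper_scale_restrict_measurable)

lemma integral_hyperplane_borel:
  fixes f :: "real^'n \<Rightarrow> real"
  assumes [measurable]: "f \<in> borel_measurable borel"
  shows "(LINT x|hyperplane_borel_measure n c. f x)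
     = (LINT x|lborel. indicator (slab n c) x * f (hyper_scale n c 0 x))"
  unfolding hyperplane_borel_measure_def
  by (subst integral_distr) (auto simp: integral_restrict_space intro!: hyper_scale_restrict_measurable)

lemma emeasure_hyperplane_borel:
  assumes [measurable]: "A \<in> sets borel"
  shows "emeasure (hyperplane_borel_measure n c) A = emeasure lborel {x \<in> slab n c. hyper_scale n c 0 x \<in> A}"
proof -
  have "emeasure (hyperplane_borel_measure n c) A = (\<integral>\<^sup>+x. indicator A x \<partial>hyperplane_borel_measure n c)"
    by simp
  also have "\<dots> = (\<integral>\<^sup>+x. indicator (slab n c) x * indicator A (hyper_scale n c 0 x) \<partial>lborel)"
    by (subst nn_integral_hyperplane_borel) auto
  also have "\<dots> = (\<integral>\<^sup>+x. indicator {x \<in> slab n c. hyper_scale n c 0 x \<in> A} x \<partial>lborel)"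
    by (intro nn_integral_cong) (auto simp: indicator_def)
  also have "\<dots> = emeasure lborel {x \<in> slab n c. hyper_scale n c 0 x \<in> A}"
    by (intro nn_integral_indicator) measurable
  finally show ?thesis .
qed

text \<open>The slabs on the two sides of the hyperplane are translates of each other by \<open>n\<close>.\<close>

lemma hyperplane_measure_uminus:
  assumes "norm n = 1"
  shows "hyperplane_measure (- n) (- c) = hyperplane_measure n c"
proof -
  have "hyperplane_borel_measure (- n) (- c) = hyperplane_borel_measure n c"
  proof (rule measure_eqI)
    fix A assume "A \<in> sets (hyperplane_borel_measure (- n) (- c))"
    then have [measurable]: "A \<in> sets borel" by simp
    have nn: "n \<bullet> n = 1" using assms by (simp add: dot_square_norm)
    have p: "hyper_scale (- n) (- c) 0 x = hyper_scale n c 0 (n + x)" for x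
      using nn by (simp add: hyper_scale_def inner_add_right algebra_simps)
    have s: "x \<in> slab (- n) (- c) \<longleftrightarrow> n + x \<in> slab n c" for x
      using nn by (auto simp: inner_add_right)
    have "emeasure (hyperplane_borel_measure (- n) (- c)) A
       = (\<integral>\<^sup>+x. indicator (slab n c) (n + x) * indicator A (hyper_scale n c 0 (n + x)) \<partial>lborel)"
    proof -
      have "emeasure (hyperplane_borel_measure m e) A
        = (\<integral>\<^sup>+x. indicator (slab m e) x * indicator A (hyper_scale m e 0 x) \<partial>lborel)" for m e
        using nn_integral_hyperplane_borel[of "indicator A" m e] by simp
      then have "emeasure (hyperplane_borel_measure (- n) (- c)) A
        = (\<integral>\<^sup>+x. indicator (slab (- n) (- c)) x * indicator A (hyper_scale (- n) (- c) 0 x) \<partial>lborel)" .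
      also have "\<dots> = (\<integral>\<^sup>+x. indicator (slab n c) (n + x) * indicator A (hyper_scale n c 0 (n + x)) \<partial>lborel)"
        using s p by (intro nn_integral_cong) (simp add: indicator_def)
      finally show ?thesis .
    qed
    also have "\<dots> = (\<integral>\<^sup>+x. indicator (slab n c) x * indicator A (hyper_scale n c 0 x) \<partial>lborel)"
      by (rule nn_integral_translation) measurable
    also have "\<dots> = emeasure (hyperplane_borel_measure n c) A"
      using nn_integral_hyperplane_borel[of "indicator A" n c] by simp
    finally show "emeasure (hyperplane_borel_measure (- n) (- c)) A = emeasure (hyperplane_borel_measure n c) A" .
  qed simp
  then show ?thesis by (simp add: hyperplane_measure_eq_completion)
qed

text \<open>Points of the slab are at distance at most 1 from their projections, so the cylinder
  over a bounded set is bounded.\<close>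

lemma emeasure_hyperplane_bounded_finite:
  assumes n: "norm n = 1" and A: "bounded A" "A \<in> sets borel"
  shows "emeasure (hyperplane_borel_measure n c) A < \<infinity>"
proof -
  obtain r where r: "\<And>x. x \<in> A \<Longrightarrow> norm x \<le> r" using A(1) by (auto simp: bounded_iff)
  have "norm x \<le> r + 1" if "x \<in> slab n c" "hyper_scale n c 0 x \<in> A" for x
  proof -
    have "x = hyper_scale n c 0 x + (n \<bullet> x - c) *\<^sub>R n" by (simp add: hyper_scale_def)
    then have "norm x \<le> norm (hyper_scale n c 0 x) + norm ((n \<bullet> x - c) *\<^sub>R n)"
      by (metis norm_triangle_ineq)
    also have "norm ((n \<bullet> x - c) *\<^sub>R n) \<le> 1" using n that(1) by auto
    finally show ?thesis using r[OF that(2)] by simp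
  qed
  then have "bounded {x \<in> slab n c. hyper_scale n c 0 x \<in> A}" by (auto simp: bounded_iff)
  then show ?thesis
    using A(2) emeasure_bounded_finite by (simp add: emeasure_hyperplane_borel)
qed

section \<open>Integration by parts on a simplex\<close>

lemma integral_dilation:
  fixes g :: "'a::euclidean_space \<Rightarrow> real"
  assumes l: "l > 0" and [measurable]: "g \<in> borel_measurable borel"
  shows "(LINT x|lborel. g x) = l ^ DIM('a) * (LINT x|lborel. g (a + l *\<^sub>R (x - a)))"
proof -
  have eq: "lborel = density (distr lborel borel (\<lambda>x. (a - l *\<^sub>R a) + l *\<^sub>R x)) (\<lambda>_. ennreal (l ^ DIM('a)))"
    using lborel_affine[of l "a - l *\<^sub>R a"] l by simp
  have "(LINT x|lborel. g x) = l ^ DIM('a) * (LINT x|lborel. g ((a - l *\<^sub>R a) + l *\<^sub>R x))"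
    by (subst eq) (use l in \<open>simp add: integral_density integral_distr\<close>)
  also have "(\<lambda>x. g ((a - l *\<^sub>R a) + l *\<^sub>R x)) = (\<lambda>x. g (a + l *\<^sub>R (x - a)))"
    by (simp add: algebra_simps)
  finally show ?thesis .
qed

section \<open>Cylinders over a convex piece of a hyperplane\<close>

lemma cylinder_convex_closed:
  assumes "convex F" "closed F"
  shows "convex {x. hyper_scale n c 0 x \<in> F}" "closed {x. hyper_scale n c 0 x \<in> F}"
proof -
  show "convex {x. hyper_scale n c 0 x \<in> F}"
  proof (rule convexI, simp)
    fix x y u v assume *: "hyper_scale n c 0 x \<in> F" "hyper_scale n c 0 y \<in> F" "0 \<le> (u::real)" "0 \<le> v" "u + v = 1"
    have u: "u = 1 - v" using * by simp
    have "hyper_scale n c 0 (u *\<^sub>R x + v *\<^sub>R y) = u *\<^sub>R hyper_scale n c 0 x + v *\<^sub>R hyper_scale n c 0 y"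
      unfolding u by (simp add: hyper_scale_def algebra_simps)
    with * show "hyper_scale n c 0 (u *\<^sub>R x + v *\<^sub>R y) \<in> F"
      using assms(1) by (simp add: convexD)
  qed
  have "closed (hyper_scale n c 0 -` F)"
    by (rule continuous_closed_vimage[OF assms(2)]) (use continuous_on_hyper_scale[of UNIV n c 0] in \<open>simp add: continuous_on_eq_continuous_at\<close>)
  then show "closed {x. hyper_scale n c 0 x \<in> F}" by (simp add: vimage_def)
qed

text \<open>A point of the hyperplane near the projection of \<open>x\<close> can be lifted to the
  height of \<open>x\<close> without changing the distance. So interior points of the cylinder lie
  over points that are interior to \<open>F\<close> within the hyperplane.\<close>

lemma interior_cylinder:
  assumes n: "norm n = 1" and x: "x \<in> interior {x. hyper_scale n c 0 x \<in> F}"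
  obtains e where "e > 0" "\<And>z. dist z (hyper_scale n c 0 x) < e \<Longrightarrow> n \<bullet> z = c \<Longrightarrow> z \<in> F"
proof -
  from x obtain e where e: "e > 0" "ball x e \<subseteq> {x. hyper_scale n c 0 x \<in> F}"
    by (auto simp: mem_interior)
  have "z \<in> F" if z: "dist z (hyper_scale n c 0 x) < e" "n \<bullet> z = c" for z
  proof -
    let ?w = "z + (n \<bullet> x - c) *\<^sub>R n"
    have "dist x ?w = dist z (hyper_scale n c 0 x)"
      by (simp add: hyper_scale_def dist_norm norm_minus_commute algebra_simps)
    then have "hyper_scale n c 0 ?w \<in> F" using e(2) z by (auto simp: subset_iff)
    moreover have "hyper_scale n c 0 ?w = z"
      using n z(2) by (simp add: hyper_scale_def inner_add_right dot_square_norm)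
    ultimately show ?thesis by simp
  qed
  with e(1) show thesis by (rule that)
qed

text \<open>The cylinder is convex, and convex sets have negligible frontier. Seen on the
  hyperplane, this says that the relative boundary of \<open>F\<close> is a surface null
  set.\<close>

lemma AE_cylinder_frontier:
  assumes F: "convex F" "closed F"
  shows "AE x in lborel. x \<notin> frontier {x. hyper_scale n c 0 x \<in> F}"
proof -
  have "negligible (frontier {x. hyper_scale n c 0 x \<in> F})"
    by (rule negligible_convex_frontier) (rule cylinder_convex_closed[OF F])
  then have "AE x in lebesgue. x \<notin> frontier {x. hyper_scale n c 0 x \<in> F}"
    by (simp add: negligible_iff_null_sets AE_not_in)
  then show ?thesis by (simp add: AE_completion_iff)
qed

text \<open>Central projection from \<open>a\<close> onto the hyperplane \<open>n \<bullet> x = n \<bullet> a + h\<close>.\<close>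

definition cproj :: "real^'n \<Rightarrow> real^'n \<Rightarrow> real \<Rightarrow> real^'n \<Rightarrow> real^'n" where
  "cproj a n h x = a + (h / (n \<bullet> (x - a))) *\<^sub>R (x - a)"

lemma cproj_measurable [measurable]: "cproj a n h \<in> borel_measurable borel"
  unfolding cproj_def by measurable

lemma cproj_dilation: "l > 0 \<Longrightarrow> cproj a n h (a + l *\<^sub>R (x - a)) = cproj a n h x"
  by (simp add: cproj_def)

lemma inner_cproj: "n \<bullet> (x - a) \<noteq> 0 \<Longrightarrow> n \<bullet> cproj a n h x = n \<bullet> a + h"
  by (simp add: cproj_def inner_add_right)

text \<open>The cone over \<open>F\<close> with apex \<open>a\<close>, cut off at \<open>l\<close>
  times the height \<open>h\<close>. Membership is expressed through the central projection, which
  dilations about \<open>a\<close> leave unchanged; the strict inequality avoids the level of the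
  apex, where \<open>cproj\<close> divides by zero.\<close>

definition tcone :: "real^'n \<Rightarrow> real^'n \<Rightarrow> real \<Rightarrow> (real^'n) set \<Rightarrow> real \<Rightarrow> (real^'n) set" where
  "tcone a n h F l = {x. 0 < n \<bullet> (x - a) \<and> n \<bullet> (x - a) \<le> l * h \<and> cproj a n h x \<in> F}"

text \<open>A point at height \<open>s\<close> above the apex is the central projection scaled by
  \<open>s / h\<close>, and this factor is at most \<open>l\<close>.\<close>

lemma tcone_norm_bound:
  assumes h: "h > 0" and r: "\<And>y. y \<in> F \<Longrightarrow> norm (y - a) \<le> r" and x: "x \<in> tcone a n h F l"
  shows "norm (x - a) \<le> l * r"
proof -
  let ?s = "n \<bullet> (x - a)"
  have s: "0 < ?s" "?s \<le> l * h" "cproj a n h x \<in> F" using x by (auto simp: tcone_def)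
  have "x - a = (?s / h) *\<^sub>R (cproj a n h x - a)"
    using s h by (simp add: cproj_def)
  then have "norm (x - a) = (?s / h) * norm (cproj a n h x - a)"
    using s h by (metis abs_of_pos divide_pos_pos norm_scaleR)
  also have "\<dots> \<le> l * r"
  proof (intro mult_mono)
    have "0 < l * h" using s by linarith
    then show "0 \<le> l" using h by (simp add: zero_less_mult_iff)
  qed (use s h r[OF s(3)] in \<open>auto simp: divide_le_eq\<close>)
  finally show ?thesis .
qed

lemma tcone_borel:
  assumes [measurable]: "F \<in> sets borel"
  shows "tcone a n h F l \<in> sets borel"
  unfolding tcone_def by measurable

text \<open>The derivative of \<open>(1 + t)^d\<close> at zero, that is, of the Jacobian of a
  dilation. The dimension in the cone formula comes from here.\<close>

lemma power_quotient_tendsto: "(\<lambda>m. real (Suc m) * ((1 + 1 / real (Suc m)) ^ d - 1)) \<longlonglongrightarrow> real d"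
proof -
  have "((\<lambda>t. (1 + t) ^ d) has_real_derivative real d * 1 ^ (d - 1) * 1) (at (0::real))"
    by (auto intro!: derivative_eq_intros)
  then have "((\<lambda>t. ((1 + t) ^ d - 1) / t) \<longlongrightarrow> real d) (at 0)"
    by (simp add: DERIV_def)
  moreover have "filterlim (\<lambda>m. inverse (real (Suc m))) (at 0) sequentially"
    using LIMSEQ_inverse_real_of_nat by (auto simp: filterlim_at)
  ultimately have "(\<lambda>m. ((1 + inverse (real (Suc m))) ^ d - 1) / inverse (real (Suc m))) \<longlonglongrightarrow> real d"
    by (rule filterlim_compose)
  then show ?thesis by (simp add: inverse_eq_divide mult.commute)
qed

lemma AE_inner_neq:
  fixes n :: "'a::euclidean_space"
  assumes "n \<noteq> 0"
  shows "AE x in lborel. n \<bullet> x \<noteq> c"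
proof -
  have "negligible {x. n \<bullet> x = c}" using assms by (intro negligible_hyperplane) auto
  then have "AE x in lebesgue. x \<notin> {x. n \<bullet> x = c}"
    unfolding negligible_iff_null_sets by (rule AE_not_in)
  then show ?thesis by (simp add: AE_completion_iff)
qed

text \<open>Both sides are the derivative of \<open>l \<mapsto> \<integral> \<psi>\<close> over the cone of height \<open>l * h\<close> at \<open>l = 1\<close>:
  on the left the increments are thin layers over \<open>F\<close>, on the right the cones are dilated to
  the one with \<open>l = 1\<close>.\<close>

proposition cone_formula:
  fixes \<psi> :: "real^'n \<Rightarrow> real" and F :: "(real^'n) set"
  assumes n: "norm n = 1" and F: "convex F" "compact F" "\<And>x. x \<in> F \<Longrightarrow> n \<bullet> x = c"
    and h: "h = c - n \<bullet> a" "h > 0" and \<psi>: "smooth \<psi>"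
  shows "h * (LINT x|hyperplane_borel_measure n c. indicator F x * \<psi> x)
    = (LINT x|lborel. indicator (tcone a n h F 1) x * (pgrad \<psi> x \<bullet> (x - a)))
      + real CARD('n) * (LINT x|lborel. indicator (tcone a n h F 1) x * \<psi> x)"
proof -
  let ?C = "tcone a n h F"
  let ?d = "CARD('n)"
  let ?I = "LINT x|lborel. indicator (?C 1) x * \<psi> x"
  let ?S = "\<lambda>m. hyper_scale n c (h / real (Suc m))"
  define M where "M m = real (Suc m)" for m
  have M: "M m > 0" "M m \<ge> 1" for m by (simp_all add: M_def)
  have Fm [measurable]: "F \<in> sets borel" using F(2) by (simp add: compact_imp_closed)
  have Cm [measurable]: "?C l \<in> sets borel" for l by (rule tcone_borel) simp
  have \<psi>c: "continuous_on S \<psi>" for S using \<psi> by (rule smooth_continuous_on)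
  have \<psi>m [measurable]: "\<psi> \<in> borel_measurable borel" using \<psi> by (rule smooth_borel_measurable)
  obtain r where r: "\<And>y. y \<in> F \<Longrightarrow> norm (y - a) \<le> r" "r > 0"
  proof -
    have "bounded ((\<lambda>y. y - a) ` F)" using compact_imp_bounded[OF F(2)] by (rule bounded_translation_minus)
    then show thesis using that by (auto simp: bounded_pos)
  qed
  have Cb: "bounded (?C l)" for l
  proof -
    have "norm (x - a) \<le> l * r" if "x \<in> ?C l" for x by (rule tcone_norm_bound[OF h(2) r(1) that])
    then have "?C l \<subseteq> cball a (l * r)" by (auto simp: dist_norm norm_minus_commute)
    then show ?thesis using bounded_cball bounded_subset by blast
  qed
  \<comment> \<open>The difference quotient at \<open>l = 1\<close> with increment
    \<open>1 / M m\<close>. It is evaluated in two ways, as \<open>A1\<close> by dilation and as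
    \<open>A2\<close> by thin layers.\<close>
  define A where "A m = M m * ((LINT x|lborel. indicator (?C (1 + 1 / M m)) x * \<psi> x) - ?I)" for m
  have int: "integrable lborel (\<lambda>x. indicator (?C l) x * \<psi> (x + t *\<^sub>R (x - a)))" for l t
    by (intro integrable_indicator_continuous_bounded Cb Cm continuous_on_compose2[OF \<psi>c] continuous_intros) auto
  have int0: "integrable lborel (\<lambda>x. indicator (?C l) x * \<psi> x)" for l
    using int[of l 0] by simp
  have A1: "A m = (1 + 1 / M m) ^ ?d * (LINT x|lborel. indicator (?C 1) x * (M m * (\<psi> (x + (1 / M m) *\<^sub>R (x - a)) - \<psi> x)))
     + M m * ((1 + 1 / M m) ^ ?d - 1) * ?I" for m
  proof -
    let ?l = "1 + 1 / M m"
    have l: "?l > 0" using M[of m] by (simp add: add_pos_pos)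
    have ind: "a + ?l *\<^sub>R (x - a) \<in> ?C ?l \<longleftrightarrow> x \<in> ?C 1" for x
      using l by (simp add: tcone_def cproj_dilation zero_less_mult_iff)
    have pt: "a + ?l *\<^sub>R (x - a) = x + (1 / M m) *\<^sub>R (x - a)" for x by (simp add: algebra_simps)
    have "(LINT x|lborel. indicator (?C ?l) x * \<psi> x)
       = ?l ^ DIM(real^'n) * (LINT x|lborel. indicator (?C ?l) (a + ?l *\<^sub>R (x - a)) * \<psi> (a + ?l *\<^sub>R (x - a)))"
      by (rule integral_dilation[OF l]) measurable
    also have "\<dots> = ?l ^ ?d * (LINT x|lborel. indicator (?C 1) x * \<psi> (x + (1 / M m) *\<^sub>R (x - a)))"
      using ind pt by (simp add: indicator_def)
    finally have 1: "(LINT x|lborel. indicator (?C ?l) x * \<psi> x)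
      = ?l ^ ?d * (LINT x|lborel. indicator (?C 1) x * \<psi> (x + (1 / M m) *\<^sub>R (x - a)))" .
    have "(LINT x|lborel. indicator (?C 1) x * (M m * (\<psi> (x + (1 / M m) *\<^sub>R (x - a)) - \<psi> x)))
       = (LINT x|lborel. M m * (indicator (?C 1) x * \<psi> (x + (1 / M m) *\<^sub>R (x - a)) - indicator (?C 1) x * \<psi> x))"
      by (simp add: algebra_simps)
    also have "\<dots> = M m * ((LINT x|lborel. indicator (?C 1) x * \<psi> (x + (1 / M m) *\<^sub>R (x - a))) - ?I)"
      using int int0 by (simp only: integral_mult_right_zero Bochner_Integration.integral_diff)
    finally have 2: "(LINT x|lborel. indicator (?C 1) x * (M m * (\<psi> (x + (1 / M m) *\<^sub>R (x - a)) - \<psi> x)))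
       = M m * ((LINT x|lborel. indicator (?C 1) x * \<psi> (x + (1 / M m) *\<^sub>R (x - a))) - ?I)" .
    show ?thesis unfolding A_def 1 2 by (simp add: algebra_simps)
  qed
  have lim1: "A \<longlonglongrightarrow> 1 ^ ?d * (LINT x|lborel. indicator (?C 1) x * (pgrad \<psi> x \<bullet> (x - a))) + real ?d * ?I"
  proof -
    have "(\<lambda>m. 1 / M m) \<longlonglongrightarrow> 0" unfolding M_def using LIMSEQ_inverse_real_of_nat by (simp add: inverse_eq_divide)
    then have "(\<lambda>m. (1 + 1 / M m) ^ ?d) \<longlonglongrightarrow> (1 + 0) ^ ?d" by (intro tendsto_intros)
    moreover have "(\<lambda>m. LINT x|lborel. indicator (?C 1) x * (M m * (\<psi> (x + (1 / M m) *\<^sub>R (x - a)) - \<psi> x)))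
       \<longlonglongrightarrow> (LINT x|lborel. indicator (?C 1) x * (pgrad \<psi> x \<bullet> (x - a)))"
      unfolding M_def
      by (rule difference_quotient_integral[OF \<psi> Cb Cm, where R = "1 * r"])
         (use tcone_norm_bound[OF h(2) r(1), where l = 1] in auto)
    ultimately show ?thesis
      unfolding A1[abs_def] using power_quotient_tendsto[of ?d, folded M_def]
      by (intro tendsto_add tendsto_mult tendsto_const) simp_all
  qed
  \<comment> \<open>The layer between the two cones has thickness \<open>h / M m\<close>;
    \<open>?S m\<close> stretches it to the unit slab used by the surface measure. Its Jacobian
    \<open>h / M m\<close> meets the factor \<open>M m\<close> in \<open>A\<close> and leaves
    \<open>h\<close>.\<close>
  define G where "G m x = indicator (slab n c) x * (indicator F (cproj a n h (?S m x)) * \<psi> (?S m x))" for m x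
  have A2: "A m = h * (LINT x|lborel. G m x)" for m
  proof -
    let ?l = "1 + 1 / M m" and ?t = "h / M m"
    have t: "?t > 0" using h M[of m] by simp
    have n0: "n \<noteq> 0" using n by auto
    have "(LINT x|lborel. indicator (?C ?l) x * \<psi> x) - ?I
       = (LINT x|lborel. indicator (?C ?l) x * \<psi> x - indicator (?C 1) x * \<psi> x)"
      by (intro Bochner_Integration.integral_diff[symmetric] int0)
    also have "\<dots> = (LINT x|lborel. indicator {x. c \<le> n \<bullet> x \<and> n \<bullet> x \<le> c + ?t} x *
         (indicator F (cproj a n h x) * \<psi> x))"
    \<comment> \<open>The larger cone minus the smaller one is the closed layer without its bottom
      hyperplane, since that belongs to the smaller cone already; the hyperplane is null.\<close>
    proof (rule integral_cong_AE)
      show "AE x in lborel. indicator (?C ?l) x * \<psi> x - indicator (?C 1) x * \<psi> x =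
         indicator {x. c \<le> n \<bullet> x \<and> n \<bullet> x \<le> c + ?t} x * (indicator F (cproj a n h x) * \<psi> x)"
        using AE_inner_neq[OF n0, of c]
      proof eventually_elim
        case (elim x)
        have e1: "?l * h = h + ?t" by (simp add: algebra_simps)
        have e2: "n \<bullet> (x - a) = n \<bullet> x - c + h" using h by (simp add: inner_diff_right)
        show ?case
          unfolding tcone_def e1 using elim t h(2) by (auto simp: indicator_def e2)
      qed
    qed measurable
    also have "\<dots> = ?t * (LINT x|lborel. indicator {x. c \<le> n \<bullet> x \<and> n \<bullet> x \<le> c + ?t} (?S m x) *
         (indicator F (cproj a n h (?S m x)) * \<psi> (?S m x)))"
      unfolding M_def[symmetric] by (rule integral_hyper_scale[OF n t]) measurable
    also have "(\<lambda>x. indicator {x. c \<le> n \<bullet> x \<and> n \<bullet> x \<le> c + ?t} (?S m x) *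
         (indicator F (cproj a n h (?S m x)) * \<psi> (?S m x))) = G m"
    proof
      fix x
      have "n \<bullet> ?S m x = c + ?t * (n \<bullet> x - c)" using inner_hyper_scale[OF n, of c ?t x] by (simp add: M_def)
      then have "?S m x \<in> {x. c \<le> n \<bullet> x \<and> n \<bullet> x \<le> c + ?t} \<longleftrightarrow> x \<in> slab n c"
        using t mult_le_cancel_left_pos[OF t, of "n \<bullet> x - c" 1] mult_le_cancel_left_pos[OF t, of 0 "n \<bullet> x - c"]
        by (auto simp: algebra_simps)
      then show "indicator {x. c \<le> n \<bullet> x \<and> n \<bullet> x \<le> c + ?t} (?S m x) *
         (indicator F (cproj a n h (?S m x)) * \<psi> (?S m x)) = G m x"
        by (simp add: G_def indicator_def)
    qed
    finally have "(LINT x|lborel. indicator (?C ?l) x * \<psi> x) - ?I = ?t * (LINT x|lborel. G m x)" .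
    then show ?thesis unfolding A_def using M[of m] by simp
  qed
  let ?G = "\<lambda>x. indicator (slab n c) x * (indicator F (hyper_scale n c 0 x) * \<psi> (hyper_scale n c 0 x))"
  obtain K where K: "K > 0" "\<And>x. norm (x - a) \<le> 2 * r \<Longrightarrow> \<bar>\<psi> x\<bar> \<le> K"
  proof -
    have "compact (\<psi> ` cball a (2 * r))" by (intro compact_continuous_image \<psi>c) auto
    then obtain K where "K > 0" "\<And>x. x \<in> cball a (2 * r) \<Longrightarrow> \<bar>\<psi> x\<bar> \<le> K"
      using compact_imp_bounded bounded_pos by (metis imageI real_norm_def)
    then show thesis by (intro that[of K]) (auto simp: dist_norm norm_minus_commute)
  qed
  \<comment> \<open>Points of the layer lie in the cone with \<open>l = 2\<close>, hence within
    \<open>2 * r\<close> of the apex, and \<open>?S m\<close> moves points of the slab by at most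
    \<open>1 + h\<close>.\<close>
  define B where "B = cball a (2 * r + 1 + h)"
  have lim2: "(\<lambda>m. LINT x|lborel. G m x) \<longlonglongrightarrow> (LINT x|lborel. ?G x)"
  proof (rule integral_dominated_convergence[where w = "\<lambda>x. indicator B x * K"])
    show "integrable lborel (\<lambda>x. indicator B x * K)"
      by (intro integrable_mult_left integrable_real_indicator) (auto simp: B_def intro!: emeasure_bounded_finite[unfolded infinity_ennreal_def])
    show "?G \<in> borel_measurable lborel" by measurable
    show "G m \<in> borel_measurable lborel" for m unfolding G_def by measurable
    show "AE x in lborel. norm (G m x) \<le> indicator B x * K" for m
    proof (rule AE_I2)
      fix x
      show "norm (G m x) \<le> indicator B x * K"
      proof (cases "x \<in> slab n c \<and> cproj a n h (?S m x) \<in> F")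
        case True
        let ?t = "h / M m"
        have t: "0 < ?t" "?t \<le> h" using h M[of m] by (auto simp: divide_le_eq)
        have i: "n \<bullet> (?S m x - a) = ?t * (n \<bullet> x - c) + h"
          using inner_hyper_scale[OF n, of c ?t x] h(1) by (simp add: M_def inner_diff_right)
        have u: "0 \<le> n \<bullet> x - c" "n \<bullet> x - c \<le> 1" using True by auto
        have "0 \<le> ?t * (n \<bullet> x - c)" "?t * (n \<bullet> x - c) \<le> h * 1"
          using t u by (intro mult_nonneg_nonneg mult_mono; simp)+
        with i h(2) True have S2: "?S m x \<in> ?C 2" by (auto simp: tcone_def)
        have b: "norm (?S m x - a) \<le> 2 * r" by (rule tcone_norm_bound[OF h(2) r(1) S2])
        have "x - ?S m x = ((1 - ?t) * (n \<bullet> x - c)) *\<^sub>R n" by (simp add: hyper_scale_def M_def)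
        then have "norm (x - ?S m x) = \<bar>1 - ?t\<bar> * (n \<bullet> x - c)" using n u by (simp add: abs_mult)
        also have "\<dots> \<le> (1 + h) * 1" using t u by (intro mult_mono) auto
        finally have "norm (x - a) \<le> 2 * r + (1 + h)"
          using b norm_triangle_ineq[of "x - ?S m x" "?S m x - a"] by simp
        then have "x \<in> B" by (simp add: B_def dist_norm norm_minus_commute)
        then show ?thesis using True K(2)[OF b] by (simp add: G_def)
      qed (use K(1) in \<open>auto simp: G_def indicator_def\<close>)
    qed
    show "AE x in lborel. (\<lambda>m. G m x) \<longlonglongrightarrow> ?G x"
      using AE_cylinder_frontier[OF F(1) compact_imp_closed[OF F(2)], of n c]
    proof eventually_elim
      case (elim x)
      let ?y = "hyper_scale n c 0 x" and ?Z = "{x. hyper_scale n c 0 x \<in> F}"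
      have "(\<lambda>m. inverse (real (Suc m))) \<longlonglongrightarrow> 0" by (rule LIMSEQ_inverse_real_of_nat)
      then have "(\<lambda>m. h * inverse (real (Suc m))) \<longlonglongrightarrow> h * 0" by (intro tendsto_intros)
      then have t0: "(\<lambda>m. h / real (Suc m)) \<longlonglongrightarrow> 0" by (simp add: divide_inverse)
      then have S: "(\<lambda>m. ?S m x) \<longlonglongrightarrow> ?y" unfolding hyper_scale_def by (intro tendsto_intros)
      have yc: "n \<bullet> ?y = c" using inner_hyper_scale[OF n, of c 0 x] by simp
      then have ya: "n \<bullet> (?y - a) = h" using h by (simp add: inner_diff_right)
      have Z: "(\<lambda>m. cproj a n h (?S m x)) \<longlonglongrightarrow> a + (h / (n \<bullet> (?y - a))) *\<^sub>R (?y - a)"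
        unfolding cproj_def using ya h(2) by (intro tendsto_intros S) auto
      have Z: "(\<lambda>m. cproj a n h (?S m x)) \<longlonglongrightarrow> ?y"
        using Z ya h(2) by simp
      have ev: "eventually (\<lambda>m. n \<bullet> (?S m x - a) > 0) sequentially"
      proof (rule order_tendstoD(1))
        show "(\<lambda>m. n \<bullet> (?S m x - a)) \<longlonglongrightarrow> n \<bullet> (?y - a)" by (intro tendsto_intros S)
      qed (use ya h in simp)
      \<comment> \<open>Off the frontier of the cylinder, the limit \<open>?y\<close> is either
        interior to \<open>F\<close> within the hyperplane or outside the closed set
        \<open>F\<close>. The projections stay in the hyperplane, so the indicator is eventually
        constant.\<close>
      have "eventually (\<lambda>m. indicator F (cproj a n h (?S m x)) = (indicator F ?y :: real)) sequentially"
      proof (cases "?y \<in> F")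
        case True
        then have "x \<in> ?Z" by simp
        then have "x \<in> interior ?Z"
          using elim closure_subset[of ?Z] unfolding frontier_def by blast
        then obtain e where e: "e > 0" "\<And>z. dist z ?y < e \<Longrightarrow> n \<bullet> z = c \<Longrightarrow> z \<in> F"
          using interior_cylinder[OF n] by metis
        show ?thesis
          using tendstoD[OF Z e(1)] ev
        proof eventually_elim
          case (elim m)
          then have "n \<bullet> cproj a n h (?S m x) = c" using h(1) by (subst inner_cproj) auto
          with e(2) elim True show ?case by simp
        qed
      next
        case False
        have "open (- F)" using F(2) by (simp add: compact_imp_closed open_Compl)
        from topological_tendstoD[OF Z this] False show ?thesis by (auto elim: eventually_mono)
      qed
      then have "(\<lambda>m. indicator F (cproj a n h (?S m x))) \<longlonglongrightarrow> (indicator F ?y :: real)"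
        by (rule tendsto_eventually)
      moreover have "(\<lambda>m. \<psi> (?S m x)) \<longlonglongrightarrow> \<psi> ?y"
        by (rule continuous_on_tendsto_compose[OF \<psi>c[of UNIV] S]) auto
      ultimately show ?case unfolding G_def by (intro tendsto_intros)
    qed
  qed
  have "A \<longlonglongrightarrow> h * (LINT x|lborel. ?G x)"
    unfolding A2[abs_def] by (intro tendsto_intros lim2)
  from LIMSEQ_unique[OF this lim1]
  have "h * (LINT x|lborel. ?G x) = (LINT x|lborel. indicator (?C 1) x * (pgrad \<psi> x \<bullet> (x - a))) + real ?d * ?I"
    by simp
  moreover have "(LINT x|hyperplane_borel_measure n c. indicator F x * \<psi> x) = (LINT x|lborel. ?G x)"
    by (rule integral_hyperplane_borel) measurable
  ultimately show ?thesis by simp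
qed

section \<open>Unit normals and facets of a full-dimensional simplex\<close>

lemma unit_normal_unique:
  fixes n n' :: "'a::euclidean_space"
  assumes n: "norm n = 1" "norm n' = 1" and F: "affine hull F = {x. n \<bullet> x = c}"
    and const: "\<And>x y. x \<in> F \<Longrightarrow> y \<in> F \<Longrightarrow> n' \<bullet> x = n' \<bullet> y"
  shows "n' = n \<or> n' = - n"
proof -
  have nn: "n \<bullet> n = 1" "n' \<bullet> n' = 1" using n by (simp_all add: dot_square_norm)
  have "F \<noteq> {}"
  proof
    assume "F = {}"
    have "c *\<^sub>R n \<in> affine hull F" unfolding F using nn by simp
    with \<open>F = {}\<close> show False by simp
  qed
  then obtain x0 where x0: "x0 \<in> F" by blast
  have "F \<subseteq> {x. n' \<bullet> x = n' \<bullet> x0}" using const[OF _ x0] by blast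
  then have sub: "affine hull F \<subseteq> {x. n' \<bullet> x = n' \<bullet> x0}"
    by (rule hull_minimal) (rule affine_hyperplane)
  \<comment> \<open>The part of \<open>n'\<close> orthogonal to \<open>n\<close>. Moving along it
    stays in the hyperplane, where \<open>n'\<close> is constant, so
    \<open>n' \<bullet> v = 0\<close>, and this says that \<open>n' \<bullet> n\<close> has square
    1.\<close>
  define v where "v = n' - (n' \<bullet> n) *\<^sub>R n"
  have x0F: "n \<bullet> x0 = c" using x0 F hull_subset[of F affine] by auto
  have "n \<bullet> (x0 + v) = c" using nn x0F by (simp add: v_def inner_add_right inner_diff_right inner_commute)
  then have "n' \<bullet> (x0 + v) = n' \<bullet> x0" using sub F by auto
  then have "n' \<bullet> v = 0" by (simp add: inner_add_right)
  then have sq: "(n' \<bullet> n)\<^sup>2 = 1" using nn by (simp add: v_def inner_diff_right power2_eq_square)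
  then have "n' \<bullet> n = 1 \<or> n' \<bullet> n = - 1" by (simp add: power2_eq_1_iff)
  then show ?thesis
  proof
    assume "n' \<bullet> n = 1"
    then have "(n' - n) \<bullet> (n' - n) = 0" using nn by (simp add: inner_diff_left inner_diff_right inner_commute)
    then show ?thesis by simp
  next
    assume "n' \<bullet> n = - 1"
    then have "(n' + n) \<bullet> (n' + n) = 0" using nn by (simp add: inner_add_left inner_add_right inner_commute)
    then show ?thesis by (simp add: eq_neg_iff_add_eq_0)
  qed
qed

text \<open>The normal chosen inside \<open>facet_measure\<close> is determined only up to sign; the
  measures built on the two sides of the hyperplane coincide, so the sign is immaterial.\<close>

lemma facet_measure_eq:
  assumes n: "norm n = 1" and F: "affine hull F = {x. n \<bullet> x = c}"
  shows "facet_measure F = restrict_space (hyperplane_measure n c) F"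
proof -
  let ?P = "\<lambda>n. norm n = 1 \<and> (\<forall>x\<in>F. \<forall>y\<in>F. n \<bullet> x = n \<bullet> y)"
  define n' where "n' = (SOME n. ?P n)"
  define x0 where "x0 = (SOME x. x \<in> F)"
  have Fc: "n \<bullet> x = c" if "x \<in> F" for x using that F hull_subset[of F affine] by auto
  then have "?P n" using n by auto
  then have P: "?P n'" unfolding n'_def by (rule someI)
  have "F \<noteq> {}"
  proof
    assume "F = {}"
    have "c *\<^sub>R n \<in> affine hull F" unfolding F using n by (simp add: dot_square_norm)
    with \<open>F = {}\<close> show False by simp
  qed
  then have x0: "x0 \<in> F" unfolding x0_def by (simp add: some_in_eq)
  have "n' = n \<or> n' = - n" using unit_normal_unique[OF n _ F] P by blast
  then have "hyperplane_measure n' (n' \<bullet> x0) = hyperplane_measure n c"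
    using Fc[OF x0] hyperplane_measure_uminus[OF n] by auto
  then show ?thesis by (simp add: facet_measure_def n'_def[symmetric] x0_def[symmetric] Let_def)
qed

text \<open>A facet \<open>F\<close> of a full-dimensional simplex \<open>T\<close>: opposite vertex \<open>a\<close>, outward unit
  normal \<open>n\<close>, supporting hyperplane \<open>n \<bullet> x = c\<close>.\<close>

definition facet_data :: "(real^'n) set \<Rightarrow> (real^'n) set \<Rightarrow> real^'n \<Rightarrow> real^'n \<Rightarrow> real \<Rightarrow> bool" where
  "facet_data T F a n c \<longleftrightarrow> norm n = 1 \<and> affine hull F = {x. n \<bullet> x = c} \<and> n \<bullet> a < c \<and>
     convex F \<and> compact F \<and> F \<noteq> {} \<and> T = convex hull (insert a F)"

text \<open>The remaining vertices are affinely independent and one fewer, so their affine hull has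
  codimension 1; affine independence also keeps \<open>a\<close> off it.\<close>

lemma simplex_facet_data:
  fixes C :: "(real^'n) set"
  assumes C: "\<not> affine_dependent C" "card C = CARD('n) + 1" and a: "a \<in> C"
  shows "\<exists>n c. facet_data (convex hull C) (convex hull (C - {a})) a n c"
proof -
  have fin: "finite C" using C(1) by (rule aff_independent_finite)
  have ne: "C - {a} \<noteq> {}" using C(2) a fin by (metis One_nat_def Suc_eq_plus1 card_Diff_singleton card.empty diff_Suc_1 zero_less_card_finite less_irrefl)
  have ai: "\<not> affine_dependent (C - {a})" using C(1) affine_independent_Diff by blast
  have "aff_dim (C - {a}) = int (card (C - {a})) - 1" using aff_dim_affine_independent[OF ai] by simp
  then have "aff_dim (C - {a}) = DIM(real^'n) - 1" using C(2) a fin by simp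
  then obtain m e where m: "m \<noteq> 0" "affine hull (C - {a}) = {x. m \<bullet> x = e}"
    using aff_dim_eq_hyperplane by blast
  have na: "a \<notin> affine hull (C - {a})" using C(1) a by (auto simp: affine_dependent_def)
  \<comment> \<open>Normalizes \<open>m\<close> and picks the sign that puts the vertex
    \<open>a\<close> on the negative side, so the normal points outwards.\<close>
  define s where "s = (if m \<bullet> a < e then 1 else - 1) / norm m"
  have s: "s \<noteq> 0" using m by (simp add: s_def)
  have H: "affine hull (C - {a}) = {x. (s *\<^sub>R m) \<bullet> x = s * e}" using m s by simp
  moreover have "norm (s *\<^sub>R m) = 1" using m by (simp add: s_def)
  moreover have "(s *\<^sub>R m) \<bullet> a < s * e"
    using na m by (auto simp: s_def divide_strict_right_mono)
  moreover have "convex hull C = convex hull (insert a (convex hull (C - {a})))"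
    using a by (metis hull_insert insert_Diff)
  ultimately have "facet_data (convex hull C) (convex hull (C - {a})) a (s *\<^sub>R m) (s * e)"
    using fin ne unfolding facet_data_def
    by (auto simp: affine_hull_convex_hull finite_imp_compact_convex_hull)
  then show ?thesis by blast
qed

lemma facet_data_facet_of:
  fixes T :: "(real^'n) set"
  assumes T: "int CARD('n) simplex T" and F: "F facet_of T"
  obtains a n c where "facet_data T F a n c"
proof -
  obtain C where C: "\<not> affine_dependent C" "int (card C) = int CARD('n) + 1" "T = convex hull C"
    using T by (auto simp: simplex_def)
  obtain a where "a \<in> C" "F = convex hull (C - {a})"
    using F facet_of_convex_hull_affine_independent[OF C(1)] C(3) by auto
  then show thesis using simplex_facet_data[OF C(1), of a] C that by auto
qed

context
  fixes T F :: "(real^'n) set" and a n c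
  assumes fd: "facet_data T F a n c"
begin

lemma facet_dataD:
  shows "norm n = 1" "affine hull F = {x. n \<bullet> x = c}" "n \<bullet> a < c"
    "convex F" "compact F" "F \<noteq> {}" "T = convex hull (insert a F)"
  using fd by (auto simp: facet_data_def)

lemma facet_level: "x \<in> F \<Longrightarrow> n \<bullet> x = c"
  using facet_dataD(2) hull_subset[of F affine] by auto

lemma facet_cell_cases: "x \<in> T \<longleftrightarrow> (\<exists>y\<in>F. \<exists>s. 0 \<le> s \<and> s \<le> 1 \<and> x = a + s *\<^sub>R (y - a))"
proof -
  have "T = (\<Union>y\<in>F. closed_segment a y)"
    using facet_dataD(4,6,7) by (simp add: convex_hull_insert_segments hull_same)
  moreover have "x \<in> closed_segment a y \<longleftrightarrow> (\<exists>s. 0 \<le> s \<and> s \<le> 1 \<and> x = a + s *\<^sub>R (y - a))" for y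
    by (auto simp: closed_segment_def algebra_simps)
  ultimately show ?thesis by auto
qed

lemma facet_cell_le: "x \<in> T \<Longrightarrow> n \<bullet> x \<le> c"
proof -
  assume "x \<in> T"
  then obtain y s where y: "y \<in> F" "0 \<le> s" "s \<le> 1" "x = a + s *\<^sub>R (y - a)" using facet_cell_cases by blast
  have "n \<bullet> x = n \<bullet> a + s * (c - n \<bullet> a)"
    unfolding y(4) using facet_level[OF y(1)] by (simp add: inner_add_right inner_diff_right)
  then have "n \<bullet> x = c - (1 - s) * (c - n \<bullet> a)" by (simp add: algebra_simps)
  moreover have "0 \<le> (1 - s) * (c - n \<bullet> a)" using \<open>s \<le> 1\<close> facet_dataD(3) by simp
  ultimately show ?thesis by simp
qed

lemma facet_eq_Int: "F = T \<inter> {x. n \<bullet> x = c}"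
proof
  show "F \<subseteq> T \<inter> {x. n \<bullet> x = c}"
    using facet_level facet_dataD(7) hull_subset[of "insert a F" convex] by auto
  show "T \<inter> {x. n \<bullet> x = c} \<subseteq> F"
  proof
    fix x assume x: "x \<in> T \<inter> {x. n \<bullet> x = c}"
    then obtain y s where y: "y \<in> F" "0 \<le> s" "s \<le> 1" "x = a + s *\<^sub>R (y - a)" using facet_cell_cases by blast
    have "(1 - s) * (c - n \<bullet> a) = c - n \<bullet> x"
    proof -
      have "n \<bullet> x = n \<bullet> a + s * (c - n \<bullet> a)"
        unfolding y(4) using facet_level[OF y(1)] by (simp add: inner_add_right inner_diff_right)
      then show ?thesis by (simp add: algebra_simps)
    qed
    then have "s = 1" using x facet_dataD(3) by simp
    then show "x \<in> F" using y by simp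
  qed
qed

lemma facet_cell_subset: "F \<subseteq> T"
  using facet_eq_Int by auto

lemma facet_borel: "F \<in> sets borel"
  using facet_dataD(5) by (simp add: compact_imp_closed)

lemma facet_cell_compact: "compact T" "convex T"
  unfolding facet_dataD(7) by (intro compact_convex_hull compact_insert facet_dataD(5) convex_convex_hull)+

text \<open>A unit vector orthogonal to the facet is \<open>n\<close> or \<open>- n\<close>, and the
  opposite vertex, which lies strictly below the facet, rules out \<open>- n\<close>.\<close>

lemma facet_outward_normal: "outward_normal T F = n"
  unfolding outward_normal_def
proof (rule the_equality)
  show "norm n = 1 \<and> (\<forall>x\<in>F. \<forall>y\<in>F. n \<bullet> (y - x) = 0) \<and> (\<forall>x\<in>F. \<forall>y\<in>T. n \<bullet> (y - x) \<le> 0)"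
    using facet_dataD(1) facet_level facet_cell_le by (auto simp: inner_diff_right)
next
  fix m assume m: "norm m = 1 \<and> (\<forall>x\<in>F. \<forall>y\<in>F. m \<bullet> (y - x) = 0) \<and> (\<forall>x\<in>F. \<forall>y\<in>T. m \<bullet> (y - x) \<le> 0)"
  have "m = n \<or> m = - n"
  proof (rule unit_normal_unique[OF facet_dataD(1) _ facet_dataD(2)])
    show "m \<bullet> x = m \<bullet> y" if "x \<in> F" "y \<in> F" for x y
    proof -
      have "m \<bullet> (y - x) = 0" using m that by blast
      then show ?thesis by (simp add: inner_diff_right)
    qed
  qed (use m in blast)
  moreover have "m \<noteq> - n"
  proof
    assume mn: "m = - n"
    obtain x where x: "x \<in> F" using facet_dataD(6) by blast
    have "a \<in> T" using facet_dataD(7) hull_subset[of "insert a F" convex] by auto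
    then have "m \<bullet> (a - x) \<le> 0" using m x by blast
    then show False using mn facet_level[OF x] facet_dataD(3) by (simp add: inner_diff_right)
  qed
  ultimately show "m = n" by blast
qed

lemma facet_measure_data: "facet_measure F = restrict_space (hyperplane_measure n c) F"
  by (rule facet_measure_eq[OF facet_dataD(1,2)])

lemma facet_sets: "F \<in> sets (hyperplane_measure n c)"
  using facet_borel by (simp add: hyperplane_measure_eq_completion)

lemma facet_finite_measure: "finite_measure (facet_measure F)"
proof
  have "emeasure (facet_measure F) F = emeasure (hyperplane_borel_measure n c) F"
    unfolding facet_measure_data
    using facet_sets facet_borel by (simp add: emeasure_restrict_space hyperplane_measure_eq_completion)
  then show "emeasure (facet_measure F) (space (facet_measure F)) \<noteq> \<infinity>"
    using emeasure_hyperplane_bounded_finite[OF facet_dataD(1) compact_imp_bounded[OF facet_dataD(5)] facet_borel, of c]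
    by (simp add: facet_measure_data space_restrict_space)
qed

lemma facet_space: "space (facet_measure F) = F"
  by (simp add: facet_measure_data space_restrict_space)

lemma facet_borel_measurable: "f \<in> borel_measurable borel \<Longrightarrow> f \<in> borel_measurable (facet_measure F)"
  for f :: "real^'n \<Rightarrow> 'b::topological_space"
  unfolding facet_measure_data hyperplane_measure_eq_completion
  by (intro measurable_restrict_space1 measurable_completion) (simp add: measurable_cong_sets[OF sets_hyperplane_borel_measure refl])

lemma facet_integral_borel:
  fixes f :: "real^'n \<Rightarrow> real"
  assumes "f \<in> borel_measurable borel"
  shows "(LINT x|facet_measure F. f x) = (LINT x|hyperplane_borel_measure n c. indicator F x * f x)"
proof -
  have "(LINT x|facet_measure F. f x) = (LINT x|hyperplane_measure n c. indicator F x * f x)"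
    unfolding facet_measure_data using facet_sets by (subst integral_restrict_space) auto
  also have "\<dots> = (LINT x|hyperplane_borel_measure n c. indicator F x * f x)"
    unfolding hyperplane_measure_eq_completion
    using assms facet_borel by (intro integral_completion) (simp add: measurable_cong_sets[OF sets_hyperplane_borel_measure refl])
  finally show ?thesis .
qed

lemma facet_smooth_square_integrable:
  assumes "smooth \<psi>"
  shows "square_integrable (facet_measure F) \<psi>"
proof -
  have "compact (\<psi> ` F)" by (intro compact_continuous_image smooth_continuous_on assms facet_dataD)
  then obtain K where "\<And>x. x \<in> F \<Longrightarrow> \<bar>\<psi> x\<bar> \<le> K"
    using compact_imp_bounded bounded_pos by (metis imageI real_norm_def)
  then show ?thesis
    by (intro square_integrable_bounded[where C = K] facet_finite_measure facet_borel_measurable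
        smooth_borel_measurable assms) (simp add: facet_space)
qed

text \<open>The two sets can differ only on the hyperplane through the apex parallel to the facet,
  where the central projection degenerates.\<close>

lemma AE_tcone_eq: "AE x in lborel. x \<in> tcone a n (c - n \<bullet> a) F 1 \<longleftrightarrow> x \<in> T"
proof -
  let ?h = "c - n \<bullet> a"
  have h: "?h > 0" using facet_dataD(3) by simp
  have "n \<noteq> 0" using facet_dataD(1) by auto
  from AE_inner_neq[OF this, of "n \<bullet> a"] show ?thesis
  proof eventually_elim
    case (elim x)
    show ?case
    proof
      assume "x \<in> tcone a n ?h F 1"
      then have x: "0 < n \<bullet> (x - a)" "n \<bullet> (x - a) \<le> ?h" "cproj a n ?h x \<in> F" by (auto simp: tcone_def)
      have "x = a + (n \<bullet> (x - a) / ?h) *\<^sub>R (cproj a n ?h x - a)"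
        using x h by (simp add: cproj_def)
      moreover have "0 \<le> n \<bullet> (x - a) / ?h" "n \<bullet> (x - a) / ?h \<le> 1" using x h by (auto simp: divide_le_eq)
      ultimately show "x \<in> T" using x(3) facet_cell_cases by blast
    next
      assume "x \<in> T"
      then obtain y s where y: "y \<in> F" "0 \<le> s" "s \<le> 1" "x = a + s *\<^sub>R (y - a)" using facet_cell_cases by blast
      have i: "n \<bullet> (x - a) = s * ?h" using facet_level[OF y(1)] by (simp add: y(4) inner_diff_right)
      have "s \<noteq> 0" using elim y by auto
      then have s: "s > 0" using y by simp
      have "cproj a n ?h x = y" unfolding cproj_def i using s h by (simp add: y(4))
      then show "x \<in> tcone a n ?h F 1" using y s h i by (simp add: tcone_def mult_le_cancel_right1)
    qed
  qed
qed

lemma facet_cone_formula: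
  assumes \<psi>: "smooth \<psi>"
  shows "(c - n \<bullet> a) * (LINT x|facet_measure F. \<psi> x)
    = (LINT x|lebesgue_on T. pgrad \<psi> x \<bullet> (x - a)) + real CARD('n) * (LINT x|lebesgue_on T. \<psi> x)"
proof -
  have Tb: "T \<in> sets borel" using facet_cell_compact(1) by (simp add: compact_imp_closed)
  have [measurable]: "\<psi> \<in> borel_measurable borel" "pgrad \<psi> \<in> borel_measurable borel" "F \<in> sets borel" "T \<in> sets borel"
    using \<psi> facet_borel Tb by (auto intro!: borel_measurable_continuous_onI smooth_continuous_on continuous_on_pgrad)
  have C [measurable]: "tcone a n (c - n \<bullet> a) F 1 \<in> sets borel" by (rule tcone_borel[OF facet_borel])
  have *: "(LINT x|lborel. indicator (tcone a n (c - n \<bullet> a) F 1) x * g x) = (LINT x|lebesgue_on T. g x)"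
    if [measurable]: "g \<in> borel_measurable borel" for g :: "real^'n \<Rightarrow> real"
  proof -
    have "(LINT x|lborel. indicator (tcone a n (c - n \<bullet> a) F 1) x * g x) = (LINT x|lborel. indicator T x * g x)"
    proof (rule integral_cong_AE)
      show "AE x in lborel. indicator (tcone a n (c - n \<bullet> a) F 1) x * g x = indicator T x * g x"
        using AE_tcone_eq by eventually_elim (auto simp: indicator_def)
    qed measurable
    then show ?thesis using that by (simp add: lebesgue_on_integral_lborel Tb)
  qed
  show ?thesis
    using cone_formula[OF facet_dataD(1,4,5) facet_level refl _ \<psi>, of a] facet_dataD(3)
    by (simp add: * facet_integral_borel)
qed

end

text \<open>With barycentric coordinates \<open>\<lambda>\<^sub>a\<close>, the outward normals are \<open>n\<^sub>a = - h\<^sub>a \<nabla>\<lambda>\<^sub>a\<close>.  The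
  divergence theorem is the combination of the cone formulas of all vertices with weights
  \<open>- \<nabla>\<lambda>\<^sub>a\<close>, because \<open>\<Sum> \<nabla>\<lambda>\<^sub>a = 0\<close> and \<open>\<Sum> (\<xi> \<bullet> \<nabla>\<lambda>\<^sub>a) a = \<xi>\<close>.\<close>

theorem simplex_divergence:
  fixes T :: "(real^'n) set"
  assumes T: "int CARD('n) simplex T" and \<psi>: "smooth \<psi>"
  shows "(LINT x|lebesgue_on T. pgrad \<psi> x \<bullet> \<xi>)
    = (\<Sum>F | F facet_of T. (outward_normal T F \<bullet> \<xi>) * (LINT x|facet_measure F. \<psi> x))"
proof -
  obtain C where C: "\<not> affine_dependent C" "int (card C) = int CARD('n) + 1" "T = convex hull C"
    using T by (auto simp: simplex_def)
  have cC: "card C = CARD('n) + 1" using C(2) by linarith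
  have fin: "finite C" using C(1) by (rule aff_independent_finite)
  define Fc where "Fc a = convex hull (C - {a})" for a
  have "\<forall>a\<in>C. \<exists>n c. facet_data T (Fc a) a n c"
    using simplex_facet_data[OF C(1) cC] by (simp add: C(3) Fc_def)
  then obtain N L where NL: "\<And>a. a \<in> C \<Longrightarrow> facet_data T (Fc a) a (N a) (L a)" by metis
  define H where "H a = L a - N a \<bullet> a" for a
  have H: "H a > 0" if "a \<in> C" for a using facet_dataD(3)[OF NL[OF that]] by (simp add: H_def)
  have inj: "inj_on Fc C"
  proof (rule inj_onI, rule ccontr)
    fix a b assume ab: "a \<in> C" "b \<in> C" "Fc a = Fc b" "a \<noteq> b"
    then have "a \<in> Fc b" unfolding Fc_def by (intro hull_inc) auto
    then have "N a \<bullet> a = L a" using facet_level[OF NL[OF ab(1)]] ab(3) by simp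
    then show False using H[OF ab(1)] by (simp add: H_def)
  qed
  have facets: "{F. F facet_of T} = Fc ` C"
  proof -
    have "Fc a \<noteq> {}" if "a \<in> C" for a using facet_dataD(6)[OF NL[OF that]] .
    then show ?thesis
      by (auto simp: C(3) facet_of_convex_hull_affine_independent[OF C(1)] Fc_def)
  qed
  \<comment> \<open>The affine function that is 1 at the vertex \<open>a\<close> and 0 on the
    opposite facet; \<open>H a\<close> is the height of the simplex over that facet.\<close>
  define lam where "lam a x = (L a - N a \<bullet> x) / H a" for a x
  have lam_sum: "(\<Sum>a\<in>C. lam a x) = 1" "(\<Sum>a\<in>C. lam a x *\<^sub>R a) = x" for x
  proof -
    have "x \<in> affine hull C" using affine_independent_span_eq[OF C(1)] cC by simp
    then obtain u where u: "sum u C = 1" "(\<Sum>v\<in>C. u v *\<^sub>R v) = x"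
      unfolding affine_hull_finite[OF fin] by auto
    have "lam a x = u a" if a: "a \<in> C" for a
    proof -
      have "N a \<bullet> b = (if b = a then L a - H a else L a)" if "b \<in> C" for b
      proof (cases "b = a")
        case False
        then have "b \<in> Fc a" using that by (simp add: Fc_def hull_inc)
        then show ?thesis using facet_level[OF NL[OF a]] False by simp
      qed (simp add: H_def)
      then have "N a \<bullet> x = (\<Sum>b\<in>C. u b * (if b = a then L a - H a else L a))"
        unfolding u(2)[symmetric] inner_sum_right by (intro sum.cong) auto
      also have "\<dots> = (\<Sum>b\<in>C. u b * L a - (if b = a then u b * H a else 0))"
        by (intro sum.cong) (auto simp: algebra_simps)
      also have "\<dots> = L a - u a * H a"
        using fin a u(1) by (simp add: sum_subtractf flip: sum_distrib_right)
      finally show ?thesis using H[OF a] by (simp add: lam_def)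
    qed
    then show "(\<Sum>a\<in>C. lam a x) = 1" "(\<Sum>a\<in>C. lam a x *\<^sub>R a) = x" using u by simp_all
  qed
  \<comment> \<open>The coordinates are affine, so \<open>mu a\<close> is the difference of their
    values at 0 and at \<open>\<xi>\<close>. Both sums over the vertices then follow from
    \<open>lam_sum\<close> at these two points.\<close>
  define mu where "mu a = (N a \<bullet> \<xi>) / H a" for a
  have mu: "mu a = lam a 0 - lam a \<xi>" for a by (simp add: mu_def lam_def diff_divide_distrib[symmetric])
  have mu0: "(\<Sum>a\<in>C. mu a) = 0" by (simp add: mu sum_subtractf lam_sum)
  have mu1: "(\<Sum>a\<in>C. mu a *\<^sub>R a) = - \<xi>" by (simp add: mu scaleR_diff_left sum_subtractf lam_sum)
  have Tc: "compact T" using C(3) fin by (simp add: finite_imp_compact_convex_hull)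
  have Tb: "T \<in> sets borel" "bounded T" using Tc by (auto simp: compact_imp_closed compact_imp_bounded)
  have int: "integrable (lebesgue_on T) g" if "continuous_on UNIV g" for g :: "real^'n \<Rightarrow> real"
    using continuous_locally_integrable[OF that, of T] Tc by (auto simp: locally_integrable_def)
  have "(\<Sum>F | F facet_of T. (outward_normal T F \<bullet> \<xi>) * (LINT x|facet_measure F. \<psi> x))
     = (\<Sum>a\<in>C. (outward_normal T (Fc a) \<bullet> \<xi>) * (LINT x|facet_measure (Fc a). \<psi> x))"
    unfolding facets by (simp add: sum.reindex[OF inj])
  also have "\<dots> = (\<Sum>a\<in>C. mu a * ((LINT x|lebesgue_on T. pgrad \<psi> x \<bullet> (x - a)) + real CARD('n) * (LINT x|lebesgue_on T. \<psi> x)))"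
  proof (rule sum.cong[OF refl])
    fix a assume a: "a \<in> C"
    show "(outward_normal T (Fc a) \<bullet> \<xi>) * (LINT x|facet_measure (Fc a). \<psi> x)
      = mu a * ((LINT x|lebesgue_on T. pgrad \<psi> x \<bullet> (x - a)) + real CARD('n) * (LINT x|lebesgue_on T. \<psi> x))"
      unfolding facet_cone_formula[OF NL[OF a] \<psi>, symmetric] facet_outward_normal[OF NL[OF a]]
      using H[OF a] by (simp add: mu_def H_def)
  qed
  also have "\<dots> = (\<Sum>a\<in>C. mu a * (LINT x|lebesgue_on T. pgrad \<psi> x \<bullet> (x - a)))"
    using mu0 by (simp add: distrib_left sum.distrib flip: sum_distrib_right)
  also have "\<dots> = (LINT x|lebesgue_on T. (\<Sum>a\<in>C. mu a * (pgrad \<psi> x \<bullet> (x - a))))"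
    by (subst Bochner_Integration.integral_sum)
      (auto intro!: integrable_mult_right int continuous_intros continuous_on_pgrad \<psi>)
  also have "(\<lambda>x. \<Sum>a\<in>C. mu a * (pgrad \<psi> x \<bullet> (x - a))) = (\<lambda>x. pgrad \<psi> x \<bullet> \<xi>)"
  proof
    fix x
    have "(\<Sum>a\<in>C. mu a * (pgrad \<psi> x \<bullet> (x - a))) = pgrad \<psi> x \<bullet> (\<Sum>a\<in>C. mu a *\<^sub>R x - mu a *\<^sub>R a)"
      by (simp add: inner_sum_right inner_diff_right algebra_simps)
    also have "(\<Sum>a\<in>C. mu a *\<^sub>R x - mu a *\<^sub>R a) = \<xi>"
      using mu0 mu1 by (simp add: sum_subtractf flip: scaleR_left.sum)
    finally show "(\<Sum>a\<in>C. mu a * (pgrad \<psi> x \<bullet> (x - a))) = pgrad \<psi> x \<bullet> \<xi>" .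
  qed
  finally show ?thesis by simp
qed

corollary simplex_integration_by_parts_smooth:
  fixes T :: "(real^'n) set"
  assumes T: "int CARD('n) simplex T" and "smooth \<psi>" "smooth p"
  shows "(LINT x|lebesgue_on T. pderivative i \<psi> x * p x + \<psi> x * pderivative i p x)
    = (\<Sum>F | F facet_of T. (outward_normal T F $ i) * (LINT x|facet_measure F. \<psi> x * p x))"
proof -
  have "pgrad (\<lambda>x. \<psi> x * p x) x \<bullet> axis i 1 = pderivative i \<psi> x * p x + \<psi> x * pderivative i p x" for x
    using pderivative_mult[of \<psi> x p i] assms(2,3)
    by (simp add: pgrad_def inner_axis smooth_imp_differentiable)
  with simplex_divergence[OF T smooth_mult[OF assms(2,3)], of "axis i 1"] show ?thesis
    by (simp add: inner_axis)
qed

section \<open>The trace inequality\<close>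

text \<open>The cone formula for the square of \<open>\<psi>\<close> already expresses the facet
  integral by volume integrals; it remains to split the mixed term
  \<open>2 * \<psi> * (pgrad \<psi> \<bullet> (x - a))\<close> into squares.\<close>

lemma facet_trace_inequality:
  fixes T :: "(real^'n) set"
  assumes fd: "facet_data T F a n c"
  obtains K where "\<And>\<psi>. smooth \<psi> \<Longrightarrow> (\<integral>\<^sup>+x. ennreal ((\<psi> x)\<^sup>2) \<partial>facet_measure F)
     \<le> ennreal K * ((\<integral>\<^sup>+x. ennreal ((\<psi> x)\<^sup>2) \<partial>lebesgue_on T) +
        (\<Sum>i\<in>UNIV. \<integral>\<^sup>+x. ennreal ((pderivative i \<psi> x)\<^sup>2) \<partial>lebesgue_on T))"
proof -
  note fdD = facet_dataD[OF fd]
  have Tc: "compact T" by (rule facet_cell_compact(1)[OF fd])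
  define h where "h = c - n \<bullet> a"
  have h: "h > 0" using fdD(3) by (simp add: h_def)
  have "bounded ((\<lambda>x. x - a) ` T)" using compact_imp_bounded[OF Tc] by (rule bounded_translation_minus)
  then obtain R where R: "R > 0" "\<And>x. x \<in> T \<Longrightarrow> norm (x - a) \<le> R" by (auto simp: bounded_pos)
  \<comment> \<open>The dimension comes from the cone formula, 1 and the square of \<open>R\<close>
    from splitting the mixed term with \<open>R\<close> bounding the distance from the apex, and
    \<open>h\<close> is the factor on the left of the cone formula.\<close>
  define K where "K = (real CARD('n) + 1 + R\<^sup>2) / h"
  show thesis
  proof (rule that)
    fix \<psi> :: "real^'n \<Rightarrow> real" assume \<psi>: "smooth \<psi>"
    have sc: "continuous_on S \<psi>" "continuous_on S (pgrad \<psi>)" "continuous_on S (pderivative i \<psi>)" for S i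
      using \<psi> by (auto intro: smooth_continuous_on continuous_on_pgrad smooth_pderivative)
    have int: "integrable (lebesgue_on T) g" if "continuous_on UNIV g" for g :: "real^'n \<Rightarrow> real"
      using continuous_locally_integrable[OF that, of T] Tc by (auto simp: locally_integrable_def)
    have i1: "integrable (lebesgue_on T) (\<lambda>x. (\<psi> x)\<^sup>2)" by (intro int continuous_intros sc)
    have i2: "integrable (lebesgue_on T) (\<lambda>x. (pderivative i \<psi> x)\<^sup>2)" for i by (intro int continuous_intros sc)
    have i3: "integrable (lebesgue_on T) (\<lambda>x. 2 * \<psi> x * (pgrad \<psi> x \<bullet> (x - a)))" by (intro int continuous_intros sc)
    have iF: "integrable (facet_measure F) (\<lambda>x. (\<psi> x)\<^sup>2)"
      using facet_smooth_square_integrable[OF fd \<psi>] by (simp add: square_integrable_def)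
    let ?I = "LINT x|lebesgue_on T. (\<psi> x)\<^sup>2" and ?J = "\<Sum>i\<in>UNIV. LINT x|lebesgue_on T. (pderivative i \<psi> x)\<^sup>2"
    have g: "pgrad (\<lambda>x. \<psi> x ^ 2) x \<bullet> y = 2 * \<psi> x * (pgrad \<psi> x \<bullet> y)" for x y
    proof -
      have "pgrad (\<lambda>x. \<psi> x ^ 2) x = (2 * \<psi> x) *\<^sub>R pgrad \<psi> x"
        using pderivative_mult[of \<psi> x \<psi>] \<psi>
        by (simp add: pgrad_def vec_eq_iff power2_eq_square smooth_imp_differentiable)
      then show ?thesis by simp
    qed
    have eq: "h * (LINT x|facet_measure F. (\<psi> x)\<^sup>2) =
       (LINT x|lebesgue_on T. 2 * \<psi> x * (pgrad \<psi> x \<bullet> (x - a))) + real CARD('n) * ?I"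
      using facet_cone_formula[OF fd smooth_power[OF \<psi>, of 2]] by (simp add: h_def g)
    have "(LINT x|lebesgue_on T. 2 * \<psi> x * (pgrad \<psi> x \<bullet> (x - a)))
       \<le> (LINT x|lebesgue_on T. (\<psi> x)\<^sup>2 + R\<^sup>2 * (\<Sum>i\<in>UNIV. (pderivative i \<psi> x)\<^sup>2))"
    proof (rule integral_mono)
      fix x assume "x \<in> space (lebesgue_on T)"
      then have x: "x \<in> T" by simp
      have "2 * \<psi> x * (pgrad \<psi> x \<bullet> (x - a)) \<le> (\<psi> x)\<^sup>2 + (pgrad \<psi> x \<bullet> (x - a))\<^sup>2" by (rule sum_squares_bound)
      also have "(pgrad \<psi> x \<bullet> (x - a))\<^sup>2 \<le> (R * norm (pgrad \<psi> x))\<^sup>2"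
      proof -
        have "\<bar>pgrad \<psi> x \<bullet> (x - a)\<bar> \<le> norm (pgrad \<psi> x) * norm (x - a)" by (rule Cauchy_Schwarz_ineq2)
        also have "\<dots> \<le> norm (pgrad \<psi> x) * R" by (intro mult_left_mono R x) simp
        finally show ?thesis using R(1) by (intro abs_le_square_iff[THEN iffD1]) (simp add: abs_mult mult.commute)
      qed
      also have "(R * norm (pgrad \<psi> x))\<^sup>2 = R\<^sup>2 * (\<Sum>i\<in>UNIV. (pderivative i \<psi> x)\<^sup>2)"
      proof -
        have "(norm (pgrad \<psi> x))\<^sup>2 = (\<Sum>i\<in>UNIV. (pderivative i \<psi> x)\<^sup>2)"
          unfolding power2_norm_eq_inner inner_vec_def by (simp add: pgrad_def power2_eq_square)
        then show ?thesis by (simp add: power_mult_distrib)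
      qed
      finally show "2 * \<psi> x * (pgrad \<psi> x \<bullet> (x - a)) \<le> (\<psi> x)\<^sup>2 + R\<^sup>2 * (\<Sum>i\<in>UNIV. (pderivative i \<psi> x)\<^sup>2)" by simp
    qed (intro i3 Bochner_Integration.integrable_add i1 integrable_mult_right Bochner_Integration.integrable_sum i2)+
    also have "\<dots> = ?I + R\<^sup>2 * ?J"
      by (subst Bochner_Integration.integral_add) (auto intro!: i1 i2 simp: Bochner_Integration.integral_sum[OF i2])
    finally have le: "h * (LINT x|facet_measure F. (\<psi> x)\<^sup>2) \<le> ?I + R\<^sup>2 * ?J + real CARD('n) * ?I"
      unfolding eq by simp
    have nn: "?I \<ge> 0" "?J \<ge> 0" by (auto intro!: sum_nonneg)
    have "?I + R\<^sup>2 * ?J + real CARD('n) * ?I \<le> (real CARD('n) + 1 + R\<^sup>2) * (?I + ?J)"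
      using nn mult_nonneg_nonneg[OF zero_le_power2[of R] nn(1)] mult_nonneg_nonneg[of "real CARD('n)" ?J]
      by (simp add: algebra_simps)
    with le have "h * (LINT x|facet_measure F. (\<psi> x)\<^sup>2) \<le> (real CARD('n) + 1 + R\<^sup>2) * (?I + ?J)" by linarith
    then have le2: "(LINT x|facet_measure F. (\<psi> x)\<^sup>2) \<le> K * (?I + ?J)"
      using h by (simp add: K_def field_simps)
    have K: "K \<ge> 0" using h by (simp add: K_def)
    have "(\<integral>\<^sup>+x. ennreal ((\<psi> x)\<^sup>2) \<partial>facet_measure F) = ennreal (LINT x|facet_measure F. (\<psi> x)\<^sup>2)"
      by (intro nn_integral_eq_integral iF) simp
    also have "\<dots> \<le> ennreal (K * (?I + ?J))" using le2 by (rule ennreal_leI)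
    also have "\<dots> = ennreal K * (ennreal ?I + ennreal ?J)" using K nn by (simp add: ennreal_mult)
    also have "ennreal ?I = (\<integral>\<^sup>+x. ennreal ((\<psi> x)\<^sup>2) \<partial>lebesgue_on T)"
      by (intro nn_integral_eq_integral[symmetric] i1) simp
    also have "ennreal ?J = (\<Sum>i\<in>UNIV. ennreal (LINT x|lebesgue_on T. (pderivative i \<psi> x)\<^sup>2))"
      by (intro sum_ennreal[symmetric]) simp
    also have "\<dots> = (\<Sum>i\<in>UNIV. \<integral>\<^sup>+x. ennreal ((pderivative i \<psi> x)\<^sup>2) \<partial>lebesgue_on T)"
      by (intro sum.cong nn_integral_eq_integral[symmetric] i2) auto
    finally show "(\<integral>\<^sup>+x. ennreal ((\<psi> x)\<^sup>2) \<partial>facet_measure F)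
     \<le> ennreal K * ((\<integral>\<^sup>+x. ennreal ((\<psi> x)\<^sup>2) \<partial>lebesgue_on T) +
        (\<Sum>i\<in>UNIV. \<integral>\<^sup>+x. ennreal ((pderivative i \<psi> x)\<^sup>2) \<partial>lebesgue_on T))" .
  qed
qed

section \<open>Smoothing by convolution\<close>

lemma pgrad_test_function_bounded:
  assumes "test_function D \<rho>"
  obtains C where "C > 0" "\<And>x. norm (pgrad \<rho> x) \<le> C"
proof -
  obtain K where K: "compact K" "K \<subseteq> D" "\<And>x. x \<notin> K \<Longrightarrow> \<rho> x = 0"
    using assms test_functionE by metis
  have "pgrad \<rho> x = 0" if "x \<notin> K" for x
  proof -
    have "pderivative i \<rho> x = 0" for i
      by (rule pderivative_eq_0_open[of "- K"]) (use that K in \<open>auto simp: compact_imp_closed\<close>)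
    then show ?thesis by (simp add: pgrad_def vec_eq_iff)
  qed
  then show thesis
    using continuous_compact_support_bounded[OF continuous_on_pgrad K(1)] that
      test_function_smooth[OF assms] by metis
qed

text \<open>Compact support bounds the second derivatives, so the gradient is Lipschitz on the whole
  space, with the sum of the constants of its components. The mean value inequality then gives a
  quadratic remainder that is uniform in \<open>z\<close>.\<close>

lemma test_function_taylor:
  assumes "test_function D \<rho>"
  obtains C where "C > 0" "\<And>z k. \<bar>\<rho> (z + k) - \<rho> z - pgrad \<rho> z \<bullet> k\<bar> \<le> C * (norm k)\<^sup>2"
proof -
  have \<rho>: "smooth \<rho>" using assms by (rule test_function_smooth)
  have "\<exists>c>0. \<forall>x y. \<bar>pderivative i \<rho> y - pderivative i \<rho> x\<bar> \<le> c * norm (y - x)" for i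
  proof -
    obtain c where c: "c > 0" "\<And>x. norm (pgrad (pderivative i \<rho>) x) \<le> c"
      using pgrad_test_function_bounded[OF test_function_pderivative[OF assms]] by metis
    have "norm (pderivative i \<rho> y - pderivative i \<rho> x) \<le> c * norm (y - x)" for x y
    proof (rule differentiable_bound[where f' = "\<lambda>z h. pgrad (pderivative i \<rho>) z \<bullet> h" and S = UNIV])
      show "(pderivative i \<rho> has_derivative (\<lambda>h. pgrad (pderivative i \<rho>) z \<bullet> h)) (at z)" for z
        by (intro smooth_has_derivative smooth_pderivative \<rho>)
      have "onorm (\<lambda>h. pgrad (pderivative i \<rho>) z \<bullet> h) \<le> norm (pgrad (pderivative i \<rho>) z)" for z
        by (rule onorm_le) (simp add: Cauchy_Schwarz_ineq2)
      then show "onorm (\<lambda>h. pgrad (pderivative i \<rho>) z \<bullet> h) \<le> c" for z using c(2) order_trans by blast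
    qed auto
    with c(1) show ?thesis by auto
  qed
  then obtain c where c: "\<And>i. c i > 0" "\<And>i x y. \<bar>pderivative i \<rho> y - pderivative i \<rho> x\<bar> \<le> c i * norm (y - x)"
    by metis
  define C where "C = (\<Sum>i\<in>UNIV. c i)"
  have "C > 0" unfolding C_def by (intro sum_pos c) auto
  have lip: "norm (pgrad \<rho> y - pgrad \<rho> x) \<le> C * norm (y - x)" for x y
  proof -
    have "norm (pgrad \<rho> y - pgrad \<rho> x) \<le> (\<Sum>i\<in>UNIV. \<bar>(pgrad \<rho> y - pgrad \<rho> x) $ i\<bar>)"
      by (rule norm_le_l1_cart)
    also have "\<dots> \<le> (\<Sum>i\<in>UNIV. c i * norm (y - x))"
      using c(2) by (intro sum_mono) (simp add: pgrad_def)
    finally show ?thesis by (simp add: C_def sum_distrib_right)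
  qed
  have "\<bar>\<rho> (z + k) - \<rho> z - pgrad \<rho> z \<bullet> k\<bar> \<le> C * (norm k)\<^sup>2" for z k
  proof -
    have "norm (\<rho> (z + k) - \<rho> z - pgrad \<rho> z \<bullet> ((z + k) - z)) \<le> norm ((z + k) - z) * (C * norm k)"
    proof (rule differentiable_bound_linearization[where S = "cball z (norm k)" and f' = "\<lambda>x h. pgrad \<rho> x \<bullet> h"])
      show "z + t *\<^sub>R (z + k - z) \<in> cball z (norm k)" if "t \<in> {0..1}" for t
        using that mult_right_mono[of t 1 "norm k"] by (auto simp: dist_norm)
      show "(\<rho> has_derivative (\<lambda>h. pgrad \<rho> x \<bullet> h)) (at x within cball z (norm k))" for x
        using smooth_has_derivative[OF \<rho>] has_derivative_at_withinI by blast
      show "onorm ((\<lambda>h. pgrad \<rho> x \<bullet> h) - (\<lambda>h. pgrad \<rho> z \<bullet> h)) \<le> C * norm k" if "x \<in> cball z (norm k)" for x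
      proof (rule onorm_le)
        fix h
        have "norm (((\<lambda>h. pgrad \<rho> x \<bullet> h) - (\<lambda>h. pgrad \<rho> z \<bullet> h)) h) \<le> norm (pgrad \<rho> x - pgrad \<rho> z) * norm h"
          by (simp add: Cauchy_Schwarz_ineq2 flip: inner_diff_left)
        also have "norm (pgrad \<rho> x - pgrad \<rho> z) \<le> C * norm (x - z)" by (rule lip)
        also have "C * norm (x - z) \<le> C * norm k"
          using that \<open>C > 0\<close> by (auto simp: dist_norm norm_minus_commute)
        finally show "norm (((\<lambda>h. pgrad \<rho> x \<bullet> h) - (\<lambda>h. pgrad \<rho> z \<bullet> h)) h) \<le> C * norm k * norm h"
          by (simp add: mult_right_mono)
      qed
    qed auto
    then show ?thesis by (simp add: power2_eq_square mult_ac)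
  qed
  with \<open>C > 0\<close> show thesis by (rule that)
qed

text \<open>The variable \<open>x\<close> enters only through the argument of \<open>\<rho>\<close>,
  so smoothness in \<open>x\<close> is inherited from \<open>\<rho>\<close>. With
  \<open>\<alpha> = 1 / e\<close> and \<open>\<beta> = - (1 - e) / e\<close>, substituting
  \<open>y = (1 - e) x + e z\<close> turns it into a multiple of the average of \<open>g\<close>
  over the points \<open>(1 - e) x + e z\<close>.\<close>

definition mollify :: "(real^'n \<Rightarrow> real) \<Rightarrow> real \<Rightarrow> real \<Rightarrow> (real^'n \<Rightarrow> real) \<Rightarrow> real^'n \<Rightarrow> real" where
  "mollify g \<alpha> \<beta> \<rho> x = (LINT y|lborel. g y * \<rho> (\<alpha> *\<^sub>R y + \<beta> *\<^sub>R x))"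

lemma test_function_affine_measurable:
  assumes "test_function D \<rho>"
  shows "(\<lambda>y. \<rho> (\<alpha> *\<^sub>R y + v)) \<in> borel_measurable borel"
proof -
  have "continuous_on UNIV (\<lambda>y. \<rho> (\<alpha> *\<^sub>R y + v))"
    by (rule continuous_on_compose2[OF smooth_continuous_on[OF test_function_smooth[OF assms], of UNIV]])
      (auto intro!: continuous_intros)
  then show ?thesis by (rule borel_measurable_continuous_onI)
qed

lemma mollify_integrable:
  assumes g: "integrable lborel g" and \<rho>: "test_function D \<rho>"
  shows "integrable lborel (\<lambda>y. g y * \<rho> (\<alpha> *\<^sub>R y + v))"
proof -
  obtain C where "\<And>x. \<bar>\<rho> x\<bar> \<le> C" using test_function_bounded[OF \<rho>] by metis
  then show ?thesis
    by (intro integrable_mult_bounded[OF g, where C = C]) (use test_function_affine_measurable[OF \<rho>] in auto)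
qed

text \<open>The Taylor remainder of the kernel is quadratic in the increment, uniformly in
  \<open>y\<close>, so its integral against \<open>g\<close> is at most a constant times the
  integral of \<open>\<bar>g\<bar>\<close> times the squared increment.\<close>

lemma mollify_has_derivative:
  assumes g: "integrable lborel g" and \<rho>: "test_function D \<rho>"
  shows "(mollify g \<alpha> \<beta> \<rho> has_derivative
    (\<lambda>h. (\<chi> i. \<beta> * mollify g \<alpha> \<beta> (pderivative i \<rho>) x) \<bullet> h)) (at x)"
proof -
  let ?v = "\<chi> i. \<beta> * mollify g \<alpha> \<beta> (pderivative i \<rho>) x"
  let ?z = "\<lambda>y. \<alpha> *\<^sub>R y + \<beta> *\<^sub>R x"
  obtain C where C: "C > 0" "\<And>z k. \<bar>\<rho> (z + k) - \<rho> z - pgrad \<rho> z \<bullet> k\<bar> \<le> C * (norm k)\<^sup>2"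
    using test_function_taylor[OF \<rho>] by metis
  define G where "G = (LINT y|lborel. \<bar>g y\<bar>)"
  have G: "G \<ge> 0" by (simp add: G_def)
  have bound: "\<bar>mollify g \<alpha> \<beta> \<rho> (x + h) - mollify g \<alpha> \<beta> \<rho> x - ?v \<bullet> h\<bar> \<le> (G * C * \<beta>\<^sup>2) * (norm h)\<^sup>2" for h
  proof -
    have i1: "integrable lborel (\<lambda>y. g y * \<rho> (\<alpha> *\<^sub>R y + \<beta> *\<^sub>R (x + h)))"
      "integrable lborel (\<lambda>y. g y * \<rho> (?z y))"
      "integrable lborel (\<lambda>y. g y * pderivative i \<rho> (?z y))" for i
      by (rule mollify_integrable[OF g \<rho>] mollify_integrable[OF g test_function_pderivative[OF \<rho>]])+
    have v: "?v \<bullet> h = (LINT y|lborel. g y * (pgrad \<rho> (?z y) \<bullet> (\<beta> *\<^sub>R h)))"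
    proof -
      have "?v \<bullet> h = (\<Sum>i\<in>UNIV. LINT y|lborel. (g y * pderivative i \<rho> (?z y)) * (\<beta> * h $ i))"
        unfolding integral_mult_left_zero by (simp add: inner_vec_def mollify_def mult_ac)
      also have "\<dots> = (LINT y|lborel. (\<Sum>i\<in>UNIV. (g y * pderivative i \<rho> (?z y)) * (\<beta> * h $ i)))"
        by (intro Bochner_Integration.integral_sum[symmetric] integrable_mult_left i1)
      also have "\<dots> = (LINT y|lborel. g y * (pgrad \<rho> (?z y) \<bullet> (\<beta> *\<^sub>R h)))"
        by (simp add: inner_vec_def pgrad_def sum_distrib_left mult_ac)
      finally show ?thesis .
    qed
    have iv: "integrable lborel (\<lambda>y. g y * (pgrad \<rho> (?z y) \<bullet> (\<beta> *\<^sub>R h)))"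
    proof -
      have "integrable lborel (\<lambda>y. \<Sum>i\<in>UNIV. (g y * pderivative i \<rho> (?z y)) * (\<beta> * h $ i))"
        by (intro Bochner_Integration.integrable_sum integrable_mult_left i1)
      then show ?thesis by (simp add: inner_vec_def pgrad_def sum_distrib_left mult_ac)
    qed
    have "mollify g \<alpha> \<beta> \<rho> (x + h) - mollify g \<alpha> \<beta> \<rho> x - ?v \<bullet> h
       = (LINT y|lborel. g y * (\<rho> (?z y + \<beta> *\<^sub>R h) - \<rho> (?z y) - pgrad \<rho> (?z y) \<bullet> (\<beta> *\<^sub>R h)))"
    proof -
      have "(LINT y|lborel. g y * (\<rho> (?z y + \<beta> *\<^sub>R h) - \<rho> (?z y) - pgrad \<rho> (?z y) \<bullet> (\<beta> *\<^sub>R h)))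
        = (LINT y|lborel. g y * \<rho> (\<alpha> *\<^sub>R y + \<beta> *\<^sub>R (x + h)) - g y * \<rho> (?z y) - g y * (pgrad \<rho> (?z y) \<bullet> (\<beta> *\<^sub>R h)))"
        by (simp add: right_diff_distrib scaleR_add_right add.assoc)
      also have "\<dots> = mollify g \<alpha> \<beta> \<rho> (x + h) - mollify g \<alpha> \<beta> \<rho> x - ?v \<bullet> h"
        unfolding v
        unfolding mollify_def
        by (subst Bochner_Integration.integral_diff, intro Bochner_Integration.integrable_diff i1 iv, rule iv,
            subst Bochner_Integration.integral_diff[OF i1(1,2)]) simp
      finally show ?thesis by simp
    qed
    also have "\<bar>\<dots>\<bar> \<le> (LINT y|lborel. \<bar>g y\<bar> * (C * (norm (\<beta> *\<^sub>R h))\<^sup>2))"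
    proof (rule integral_abs_bound[THEN order_trans], rule integral_mono')
      show "integrable lborel (\<lambda>y. \<bar>g y\<bar> * (C * (norm (\<beta> *\<^sub>R h))\<^sup>2))" using g by auto
      show "\<bar>g y * (\<rho> (?z y + \<beta> *\<^sub>R h) - \<rho> (?z y) - pgrad \<rho> (?z y) \<bullet> (\<beta> *\<^sub>R h))\<bar>
        \<le> \<bar>g y\<bar> * (C * (norm (\<beta> *\<^sub>R h))\<^sup>2)" for y
        unfolding abs_mult by (rule mult_left_mono[OF C(2)]) simp
    qed (use C in auto)
    also have "\<dots> = (G * C * \<beta>\<^sup>2) * (norm h)\<^sup>2" by (simp add: G_def power_mult_distrib)
    finally show ?thesis .
  qed
  show ?thesis
    unfolding has_derivative_at_alt
  proof (intro conjI allI impI)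
    show "bounded_linear (\<lambda>h. ?v \<bullet> h)" by (rule bounded_linear_inner_right)
    fix e :: real assume e: "e > 0"
    let ?B = "G * C * \<beta>\<^sup>2"
    have B: "?B \<ge> 0" using G C by simp
    show "\<exists>d>0. \<forall>y. norm (y - x) < d \<longrightarrow>
       norm (mollify g \<alpha> \<beta> \<rho> y - mollify g \<alpha> \<beta> \<rho> x - ?v \<bullet> (y - x)) \<le> e * norm (y - x)"
    proof (intro exI[of _ "e / (?B + 1)"] conjI allI impI)
      show "e / (?B + 1) > 0" using e B by simp
      fix y assume y: "norm (y - x) < e / (?B + 1)"
      have "?B * norm (y - x) \<le> (?B + 1) * norm (y - x)" by (simp add: mult_right_mono)
      also have "\<dots> \<le> e" using y B by (simp add: pos_less_divide_eq mult.commute add_nonneg_pos)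
      finally have "?B * norm (y - x) * norm (y - x) \<le> e * norm (y - x)" by (rule mult_right_mono) simp
      with bound[of "y - x"] show "norm (mollify g \<alpha> \<beta> \<rho> y - mollify g \<alpha> \<beta> \<rho> x - ?v \<bullet> (y - x)) \<le> e * norm (y - x)"
        by (simp add: power2_eq_square mult.assoc)
    qed
  qed
qed

lemma pderivative_mollify:
  assumes "integrable lborel g" "test_function D \<rho>"
  shows "pderivative i (mollify g \<alpha> \<beta> \<rho>) x = \<beta> * mollify g \<alpha> \<beta> (pderivative i \<rho>) x"
  using pderivative_eqI[OF mollify_has_derivative[OF assms]] by (simp add: inner_axis)

lemma smooth_cmult: "smooth f \<Longrightarrow> smooth (\<lambda>x. c * f x)"
  by (intro smooth_mult smooth_const)

lemma pderivative_cmult: "smooth f \<Longrightarrow> pderivative i (\<lambda>x. c * f x) x = c * pderivative i f x"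
  using pderivative_mult[of "\<lambda>_. c" x f i] by (simp add: smooth_imp_differentiable)

lemma test_function_cmult: "test_function D \<rho> \<Longrightarrow> test_function D (\<lambda>x. c * \<rho> x)"
  using test_function_mult_smooth[OF _ smooth_const, of D \<rho> c] by (simp add: mult.commute)

lemma mollify_cmult: "mollify g \<alpha> \<beta> (\<lambda>x. c * \<rho> x) x = c * mollify g \<alpha> \<beta> \<rho> x"
  by (simp add: mollify_def mult.left_commute)

text \<open>Differentiation only replaces the kernel by \<open>\<beta>\<close> times its partial
  derivative, which is again a test function on \<open>D\<close>.\<close>

lemma smooth_mollify:
  fixes g :: "real^'n \<Rightarrow> real"
  assumes g: "integrable lborel g" and \<rho>: "test_function D \<rho>"
  shows "smooth (mollify g \<alpha> \<beta> \<rho>)"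
proof (rule smooth_coinduct[of _ "{f. \<exists>\<rho>. test_function D \<rho> \<and> f = mollify g \<alpha> \<beta> \<rho>}"])
  show "mollify g \<alpha> \<beta> \<rho> \<in> {f. \<exists>\<rho>. test_function D \<rho> \<and> f = mollify g \<alpha> \<beta> \<rho>}" using \<rho> by blast
  show "f differentiable (at x)" if "f \<in> {f. \<exists>\<rho>. test_function D \<rho> \<and> f = mollify g \<alpha> \<beta> \<rho>}" for f x
    using that mollify_has_derivative[OF g] unfolding differentiable_def by blast
  show "pderivative i f \<in> {f. \<exists>\<rho>. test_function D \<rho> \<and> f = mollify g \<alpha> \<beta> \<rho>}"
    if "f \<in> {f. \<exists>\<rho>. test_function D \<rho> \<and> f = mollify g \<alpha> \<beta> \<rho>}" for f and i :: 'n
  proof -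
    from that obtain \<rho> where \<rho>: "test_function D \<rho>" "f = mollify g \<alpha> \<beta> \<rho>" by auto
    have "pderivative i f = mollify g \<alpha> \<beta> (\<lambda>x. \<beta> * pderivative i \<rho> x)"
      unfolding \<rho>(2) by (rule ext) (simp add: pderivative_mollify[OF g \<rho>(1)] mollify_cmult)
    then show ?thesis using test_function_cmult[OF test_function_pderivative[OF \<rho>(1)]] by blast
  qed
qed

lemma pderivative_affine:
  fixes \<rho> :: "real^'n \<Rightarrow> real"
  assumes "smooth \<rho>"
  shows "pderivative i (\<lambda>y. \<rho> (\<alpha> *\<^sub>R y + v)) y = \<alpha> * pderivative i \<rho> (\<alpha> *\<^sub>R y + v)"
    "(\<lambda>y. \<rho> (\<alpha> *\<^sub>R y + v)) differentiable (at y)"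
proof -
  have "((\<lambda>y. \<alpha> *\<^sub>R y + v) has_derivative (\<lambda>h. \<alpha> *\<^sub>R h)) (at y)"
    by (auto intro!: derivative_eq_intros)
  from diff_chain_at[OF this smooth_has_derivative[OF assms]]
  have D: "((\<lambda>y. \<rho> (\<alpha> *\<^sub>R y + v)) has_derivative (\<lambda>h. pgrad \<rho> (\<alpha> *\<^sub>R y + v) \<bullet> (\<alpha> *\<^sub>R h))) (at y)"
    by (simp add: o_def)
  show "pderivative i (\<lambda>y. \<rho> (\<alpha> *\<^sub>R y + v)) y = \<alpha> * pderivative i \<rho> (\<alpha> *\<^sub>R y + v)"
    using pderivative_eqI[OF D] by (simp add: inner_axis pgrad_def)
  show "(\<lambda>y. \<rho> (\<alpha> *\<^sub>R y + v)) differentiable (at y)" using D by (auto simp: differentiable_def)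
qed

lemma smooth_affine:
  fixes \<rho> :: "real^'n \<Rightarrow> real"
  assumes "smooth \<rho>"
  shows "smooth (\<lambda>y. \<rho> (\<alpha> *\<^sub>R y + v))"
proof (rule smooth_coinduct[of _ "{f. \<exists>\<rho>. smooth \<rho> \<and> f = (\<lambda>y. \<rho> (\<alpha> *\<^sub>R y + v))}"])
  show "(\<lambda>y. \<rho> (\<alpha> *\<^sub>R y + v)) \<in> {f. \<exists>\<rho>. smooth \<rho> \<and> f = (\<lambda>y. \<rho> (\<alpha> *\<^sub>R y + v))}"
    using assms by blast
  show "f differentiable (at x)" if "f \<in> {f. \<exists>\<rho>. smooth \<rho> \<and> f = (\<lambda>y. \<rho> (\<alpha> *\<^sub>R y + v))}" for f x
    using that pderivative_affine(2) by blast
  show "pderivative i f \<in> {f. \<exists>\<rho>. smooth \<rho> \<and> f = (\<lambda>y. \<rho> (\<alpha> *\<^sub>R y + v))}"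
    if "f \<in> {f. \<exists>\<rho>. smooth \<rho> \<and> f = (\<lambda>y. \<rho> (\<alpha> *\<^sub>R y + v))}" for f and i :: 'n
  proof -
    from that obtain \<rho> where \<rho>: "smooth \<rho>" "f = (\<lambda>y. \<rho> (\<alpha> *\<^sub>R y + v))" by auto
    have "pderivative i f = (\<lambda>y. (\<lambda>x. \<alpha> * pderivative i \<rho> x) (\<alpha> *\<^sub>R y + v))"
      unfolding \<rho>(2) by (rule ext) (simp add: pderivative_affine(1)[OF \<rho>(1)])
    then show ?thesis using smooth_cmult[OF smooth_pderivative[OF \<rho>(1)]] by blast
  qed
qed

text \<open>The kernel \<open>y \<mapsto> \<rho>((y - (1 - e) x) / e)\<close> is supported in the set of all
  \<open>(1 - e) x + e z\<close> with \<open>z\<close> in the support of \<open>\<rho>\<close>, which is inside the convex set \<open>D\<close>.  So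
  no cut-off at the boundary of \<open>D\<close> is needed.\<close>

lemma test_function_kernel:
  fixes D :: "(real^'n) set"
  assumes D: "convex D" and \<rho>: "test_function D \<rho>" and e: "0 < e" "e < 1" and x: "x \<in> D"
  shows "test_function D (\<lambda>y. \<rho> ((1 / e) *\<^sub>R y + (- (1 - e) / e) *\<^sub>R x))"
proof -
  obtain K where K: "compact K" "K \<subseteq> D" "\<And>x. x \<notin> K \<Longrightarrow> \<rho> x = 0"
    using \<rho> test_functionE by metis
  let ?f = "\<lambda>z. (1 - e) *\<^sub>R x + e *\<^sub>R z"
  show ?thesis
  proof (rule test_functionI)
    show "smooth (\<lambda>y. \<rho> ((1 / e) *\<^sub>R y + (- (1 - e) / e) *\<^sub>R x))"
      by (intro smooth_affine test_function_smooth[OF \<rho>])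
    show "compact (?f ` K)" by (intro compact_continuous_image K continuous_intros)
    show "?f ` K \<subseteq> D" using K D x e by (auto intro!: convexD)
    fix y assume y: "y \<notin> ?f ` K"
    let ?z = "(1 / e) *\<^sub>R y + (- (1 - e) / e) *\<^sub>R x"
    have c: "e * (1 / e) = 1" "e * (- (1 - e) / e) = - (1 - e)" using e by auto
    have "?f ?z = y" unfolding scaleR_add_right scaleR_scaleR c by (simp add: algebra_simps)
    then have "?z \<notin> K" using y by (metis imageI)
    then show "\<rho> ?z = 0" by (rule K(3))
  qed
qed

text \<open>For \<open>x\<close> in \<open>D\<close> the kernel is a test function of
  \<open>y\<close>, so the definition of the weak derivative applies directly. Differentiating it in
  \<open>y\<close> produces \<open>1 / e\<close>, in \<open>x\<close> it produces
  \<open>- (1 - e) / e\<close>; their ratio combines with the sign of the weak derivative to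
  \<open>1 - e\<close>.\<close>

lemma mollify_weak_pderivative:
  fixes D :: "(real^'n) set"
  assumes D: "convex D" "open D" and \<rho>: "test_function D \<rho>" and e: "0 < e" "e < 1"
    and w: "has_weak_pderivative D i w g"
    and w': "integrable lborel w'" "\<And>x. x \<notin> D \<Longrightarrow> w' x = 0" "AE x in lebesgue_on D. w x = w' x"
    and g': "integrable lborel g'" "\<And>x. x \<notin> D \<Longrightarrow> g' x = 0" "AE x in lebesgue_on D. g x = g' x"
    and x: "x \<in> D"
  shows "pderivative i (mollify w' (1 / e) (- (1 - e) / e) \<rho>) x = (1 - e) * mollify g' (1 / e) (- (1 - e) / e) \<rho> x"
proof -
  let ?a = "1 / e" and ?b = "- (1 - e) / e"
  let ?\<theta> = "\<lambda>y. \<rho> (?a *\<^sub>R y + ?b *\<^sub>R x)"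
  have \<theta>: "test_function D ?\<theta>" by (rule test_function_kernel[OF D(1) \<rho> e x])
  have l: "locally_integrable D w" "locally_integrable D g"
    using w by (auto simp: has_weak_pderivative_def)
  have conv: "(LINT y|lebesgue_on D. f y * \<phi> y) = (LINT y|lborel. f' y * \<phi> y)"
    if f: "locally_integrable D f" "integrable lborel f'" "\<And>x. x \<notin> D \<Longrightarrow> f' x = 0" "AE x in lebesgue_on D. f x = f' x"
      and \<phi>: "test_function D \<phi>" for f f' \<phi>
  proof -
    have m: "(\<lambda>y. f' y * \<phi> y) \<in> borel_measurable borel"
      using f(2) smooth_borel_measurable[OF test_function_smooth[OF \<phi>]] by auto
    have "(LINT y|lebesgue_on D. f y * \<phi> y) = (LINT y|lebesgue_on D. f' y * \<phi> y)"
    proof (rule integral_cong_AE)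
      show "(\<lambda>y. f y * \<phi> y) \<in> borel_measurable (lebesgue_on D)"
        using locally_integrable_mult_test[OF D(2) f(1) \<phi>] by auto
      show "(\<lambda>y. f' y * \<phi> y) \<in> borel_measurable (lebesgue_on D)" using m by (rule borel_measurable_lebesgue_on_borel)
      show "AE y in lebesgue_on D. f y * \<phi> y = f' y * \<phi> y" using f(4) by eventually_elim simp
    qed
    also have "\<dots> = (LINT y|lborel. indicator D y * (f' y * \<phi> y))"
      using m D(2) by (intro lebesgue_on_integral_lborel) auto
    also have "\<dots> = (LINT y|lborel. f' y * \<phi> y)"
      using f(3) by (intro Bochner_Integration.integral_cong) (auto simp: indicator_def)
    finally show ?thesis .
  qed
  have pd: "pderivative i ?\<theta> y = ?a * pderivative i \<rho> (?a *\<^sub>R y + ?b *\<^sub>R x)" for y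
    by (rule pderivative_affine(1)[OF test_function_smooth[OF \<rho>]])
  have "(LINT y|lebesgue_on D. w y * pderivative i ?\<theta> y) = - (LINT y|lebesgue_on D. g y * ?\<theta> y)"
    using w \<theta> by (simp add: has_weak_pderivative_def)
  moreover have "(LINT y|lebesgue_on D. w y * pderivative i ?\<theta> y) = (LINT y|lborel. w' y * pderivative i ?\<theta> y)"
    by (rule conv[OF l(1) w' test_function_pderivative[OF \<theta>]])
  moreover have "(LINT y|lebesgue_on D. g y * ?\<theta> y) = (LINT y|lborel. g' y * ?\<theta> y)"
    by (rule conv[OF l(2) g' \<theta>])
  ultimately have "(LINT y|lborel. w' y * pderivative i ?\<theta> y) = - (LINT y|lborel. g' y * ?\<theta> y)" by linarith
  then have "?a * mollify w' ?a ?b (pderivative i \<rho>) x = - mollify g' ?a ?b \<rho> x"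
    unfolding pd mollify_def by (simp add: mult.left_commute)
  then have "mollify w' ?a ?b (pderivative i \<rho>) x = - e * mollify g' ?a ?b \<rho> x"
    using e by (simp add: field_simps)
  then show ?thesis
    using e by (simp add: pderivative_mollify[OF w'(1) \<rho>] field_simps)
qed

section \<open>Approximation by smooth functions on convex sets\<close>

lemma ennreal_tendsto_0I:
  fixes f :: "'a \<Rightarrow> ennreal"
  assumes "\<And>e. e > 0 \<Longrightarrow> eventually (\<lambda>x. f x \<le> ennreal e) F"
  shows "(f \<longlongrightarrow> 0) F"
proof (rule order_tendstoI)
  fix a :: ennreal assume "0 < a"
  then obtain b where b: "0 < b" "b < a" using dense by blast
  then obtain e where "b = ennreal e" "0 \<le> e" by (cases b) auto
  with b have e: "0 < e" "ennreal e < a" by auto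
  show "eventually (\<lambda>x. f x < a) F"
    using assms[OF e(1)] by eventually_elim (use e(2) in order)
qed simp

lemma sum_3_squares_le: "(a + b + c)\<^sup>2 \<le> 3 * (a\<^sup>2 + b\<^sup>2 + (c::real)\<^sup>2)"
  using zero_le_power2[of "a - b"] zero_le_power2[of "a - c"] zero_le_power2[of "b - c"]
  by (simp add: power2_eq_square algebra_simps)

lemma sum_2_squares_le: "(a + b)\<^sup>2 \<le> 2 * (a\<^sup>2 + (b::real)\<^sup>2)"
  using zero_le_power2[of "a - b"] by (simp add: power2_eq_square algebra_simps)

text \<open>Cauchy-Schwarz with the weight split into two square roots. If the product is not
  integrable, the integral on the left has the default value 0.\<close>

lemma weighted_jensen:
  fixes \<rho> q :: "'a \<Rightarrow> real"
  assumes m: "\<rho> \<in> borel_measurable M" "q \<in> borel_measurable M" and \<rho>: "\<And>z. \<rho> z \<ge> 0" "(\<integral>\<^sup>+z. ennreal (\<rho> z) \<partial>M) = 1"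
  shows "ennreal ((LINT z|M. \<rho> z * q z)\<^sup>2) \<le> (\<integral>\<^sup>+z. ennreal (\<rho> z * (q z)\<^sup>2) \<partial>M)"
proof (cases "integrable M (\<lambda>z. \<rho> z * q z)")
  case True
  note [measurable] = m
  have "ennreal \<bar>LINT z|M. \<rho> z * q z\<bar> \<le> (\<integral>\<^sup>+z. ennreal (\<bar>\<rho> z * q z\<bar>) \<partial>M)"
    using integral_norm_bound_ennreal[OF True] by simp
  also have "\<dots> = (\<integral>\<^sup>+z. ennreal (sqrt (\<rho> z)) * ennreal (sqrt (\<rho> z) * \<bar>q z\<bar>) \<partial>M)"
    using \<rho>(1) by (intro nn_integral_cong) (simp add: abs_mult flip: ennreal_mult mult.assoc)
  finally have "(ennreal \<bar>LINT z|M. \<rho> z * q z\<bar>)\<^sup>2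
     \<le> (\<integral>\<^sup>+z. ennreal (sqrt (\<rho> z)) * ennreal (sqrt (\<rho> z) * \<bar>q z\<bar>) \<partial>M)\<^sup>2"
    by (rule power_mono) simp
  also have "\<dots> \<le> (\<integral>\<^sup>+z. (ennreal (sqrt (\<rho> z)))\<^sup>2 \<partial>M) * (\<integral>\<^sup>+z. (ennreal (sqrt (\<rho> z) * \<bar>q z\<bar>))\<^sup>2 \<partial>M)"
    by (rule Cauchy_Schwarz_nn_integral) measurable
  also have "\<dots> = (\<integral>\<^sup>+z. ennreal (\<rho> z * (q z)\<^sup>2) \<partial>M)"
    using \<rho> by (simp add: ennreal_power power_mult_distrib)
  finally show ?thesis by (simp add: ennreal_power)
qed (simp add: not_integrable_integral_eq)

text \<open>First \<open>g\<close> is truncated, then the truncation is approximated by continuous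
  functions almost everywhere. These are truncated at the same level, so that dominated convergence
  applies on the bounded set. Each error is below \<open>e / 4\<close>, because the square of a sum
  of two terms costs a factor 2.\<close>

lemma L2_continuous_dense:
  fixes g :: "'a::euclidean_space \<Rightarrow> real"
  assumes D: "bounded D" "D \<in> sets borel" and g [measurable]: "g \<in> borel_measurable borel"
    and gI: "integrable lborel (\<lambda>x. indicator D x * (g x)\<^sup>2)" and e: "e > 0"
  obtains k where "continuous_on UNIV k"
    "(\<integral>\<^sup>+x. ennreal (indicator D x * (g x - k x)\<^sup>2) \<partial>lborel) \<le> ennreal e"
proof -
  note [measurable] = D(2)
  define cl where "cl N y = max (- N) (min N y)" for N y :: real
  have cl_bound: "\<bar>cl N y\<bar> \<le> \<bar>N\<bar>" for N y by (auto simp: cl_def)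
  have cl_abs: "\<bar>y - cl N y\<bar> \<le> \<bar>y\<bar>" if "N \<ge> 0" for N y using that by (auto simp: cl_def)
  have cl_cont: "continuous_on S (cl N)" for S N unfolding cl_def by (intro continuous_intros)
  have cl_m [measurable]: "cl N \<in> borel_measurable borel" for N unfolding cl_def by measurable
  have cl_lim: "(\<lambda>N. cl (real N) y) \<longlonglongrightarrow> y" for y
  proof (rule tendsto_eventually)
    obtain n where "\<bar>y\<bar> \<le> real n" using real_arch_simple by blast
    then have "cl (real N) y = y" if "N \<ge> n" for N
      using that of_nat_mono[of n N, where 'a = real] by (auto simp: cl_def)
    then show "eventually (\<lambda>N. cl (real N) y = y) sequentially" by (auto simp: eventually_sequentially)
  qed
  obtain a b where ab: "D \<subseteq> cbox a b" using bounded_subset_cbox_symmetric[OF D(1)] by blast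
  have "(\<lambda>N. LINT x|lborel. indicator D x * (g x - cl (real N) (g x))\<^sup>2) \<longlonglongrightarrow> (LINT x|(lborel::'a measure). 0)"
  proof (rule integral_dominated_convergence[OF _ _ gI])
    show "AE x in lborel. (\<lambda>N. indicator D x * (g x - cl (real N) (g x))\<^sup>2) \<longlonglongrightarrow> 0"
    proof (intro AE_I2)
      fix x
      have "(\<lambda>N. indicator D x * (g x - cl (real N) (g x))\<^sup>2) \<longlonglongrightarrow> indicator D x * (g x - g x)\<^sup>2"
        by (intro tendsto_intros cl_lim)
      then show "(\<lambda>N. indicator D x * (g x - cl (real N) (g x))\<^sup>2) \<longlonglongrightarrow> 0" by simp
    qed
    show "AE x in lborel. norm (indicator D x * (g x - cl (real N) (g x))\<^sup>2) \<le> indicator D x * (g x)\<^sup>2" for N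
      using cl_abs[of "real N"] by (auto simp: indicator_def abs_le_square_iff)
  qed measurable
  then have "eventually (\<lambda>N. (LINT x|lborel. indicator D x * (g x - cl (real N) (g x))\<^sup>2) < e / 4) sequentially"
    using e by (intro order_tendstoD(2)) auto
  then obtain N where N: "(LINT x|lborel. indicator D x * (g x - cl (real N) (g x))\<^sup>2) < e / 4"
    by (auto simp: eventually_sequentially)
  let ?c = "cl (real N)"
  \<comment> \<open>\<open>measurable_on\<close> is defined by continuous functions converging off a
    negligible set, which provides the approximants.\<close>
  have "(\<lambda>x. ?c (g x)) measurable_on UNIV"
    by (intro lebesgue_measurable_imp_measurable_on measurable_completion) auto
  then obtain Z k where Z: "negligible Z" "\<And>n. continuous_on UNIV (k n)"
    "\<And>x. x \<notin> Z \<Longrightarrow> (\<lambda>n. k n x) \<longlonglongrightarrow> ?c (g x)"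
    unfolding measurable_on_def by auto
  have kc: "continuous_on UNIV (\<lambda>x. ?c (k n x))" for n
    by (rule continuous_on_compose2[OF cl_cont[of UNIV] Z(2)]) auto
  have [measurable]: "(\<lambda>x. ?c (k n x)) \<in> borel_measurable borel" for n
    by (rule borel_measurable_continuous_onI[OF kc])
  have AEZ: "AE x in lborel. x \<notin> Z"
  proof -
    have "AE x in lebesgue. x \<notin> Z" using Z(1) unfolding negligible_iff_null_sets by (rule AE_not_in)
    then show ?thesis by (simp add: AE_completion_iff)
  qed
  have cc: "?c (?c y) = ?c y" for y by (auto simp: cl_def)
  have "(\<lambda>n. LINT x|lborel. indicator D x * (?c (g x) - ?c (k n x))\<^sup>2) \<longlonglongrightarrow> (LINT x|(lborel::'a measure). 0)"
  proof (rule integral_dominated_convergence[where w = "\<lambda>x. indicator (cbox a b) x * (2 * real N)\<^sup>2"])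
    show "integrable lborel (\<lambda>x::'a. indicator (cbox a b) x * (2 * real N)\<^sup>2)"
      by (intro integrable_mult_left integrable_real_indicator) (auto simp: emeasure_lborel_cbox_eq)
    show "AE x in lborel. (\<lambda>n. indicator D x * (?c (g x) - ?c (k n x))\<^sup>2) \<longlonglongrightarrow> 0"
      using AEZ
    proof eventually_elim
      case (elim x)
      have "(\<lambda>n. ?c (k n x)) \<longlonglongrightarrow> ?c (?c (g x))"
        by (rule continuous_on_tendsto_compose[OF cl_cont[of UNIV] Z(3)[OF elim]]) auto
      then have "(\<lambda>n. indicator D x * (?c (g x) - ?c (k n x))\<^sup>2) \<longlonglongrightarrow> indicator D x * (?c (g x) - ?c (g x))\<^sup>2"
        unfolding cc by (intro tendsto_intros)
      then show ?case by simp
    qed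
    show "AE x in lborel. norm (indicator D x * (?c (g x) - ?c (k n x))\<^sup>2) \<le> indicator (cbox a b) x * (2 * real N)\<^sup>2" for n
    proof (intro AE_I2)
      fix x
      have "\<bar>?c (g x) - ?c (k n x)\<bar> \<le> \<bar>2 * real N\<bar>"
        using cl_bound[of "real N" "g x"] cl_bound[of "real N" "k n x"] by simp
      then have "(?c (g x) - ?c (k n x))\<^sup>2 \<le> (2 * real N)\<^sup>2" by (simp only: abs_le_square_iff)
      then show "norm (indicator D x * (?c (g x) - ?c (k n x))\<^sup>2) \<le> indicator (cbox a b) x * (2 * real N)\<^sup>2"
        using ab by (auto simp: indicator_def)
    qed
  qed measurable
  then have "eventually (\<lambda>n. (LINT x|lborel. indicator D x * (?c (g x) - ?c (k n x))\<^sup>2) < e / 4) sequentially"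
    using e by (intro order_tendstoD(2)) auto
  then obtain n where n: "(LINT x|lborel. indicator D x * (?c (g x) - ?c (k n x))\<^sup>2) < e / 4"
    by (auto simp: eventually_sequentially)
  let ?k = "\<lambda>x. ?c (k n x)"
  have i1: "integrable lborel (\<lambda>x. indicator D x * (g x - ?c (g x))\<^sup>2)"
  proof (rule Bochner_Integration.integrable_bound[OF gI])
    show "AE x in lborel. norm (indicator D x * (g x - ?c (g x))\<^sup>2) \<le> norm (indicator D x * (g x)\<^sup>2)"
      using cl_abs[of "real N"] by (auto simp: indicator_def abs_le_square_iff)
  qed measurable
  have i2: "integrable lborel (\<lambda>x. indicator D x * (?c (g x) - ?k x)\<^sup>2)"
  proof (rule Bochner_Integration.integrable_bound[where f = "\<lambda>x. indicator (cbox a b) x * (2 * real N)\<^sup>2"])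
    show "integrable lborel (\<lambda>x::'a. indicator (cbox a b) x * (2 * real N)\<^sup>2)"
      by (intro integrable_mult_left integrable_real_indicator) (auto simp: emeasure_lborel_cbox_eq)
    show "AE x in lborel. norm (indicator D x * (?c (g x) - ?k x)\<^sup>2) \<le> norm (indicator (cbox a b) x * (2 * real N)\<^sup>2)"
    proof (intro AE_I2)
      fix x
      have "\<bar>?c (g x) - ?c (k n x)\<bar> \<le> \<bar>2 * real N\<bar>"
        using cl_bound[of "real N" "g x"] cl_bound[of "real N" "k n x"] by simp
      then have "(?c (g x) - ?c (k n x))\<^sup>2 \<le> (2 * real N)\<^sup>2" by (simp only: abs_le_square_iff)
      then show "norm (indicator D x * (?c (g x) - ?k x)\<^sup>2) \<le> norm (indicator (cbox a b) x * (2 * real N)\<^sup>2)"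
        using ab by (auto simp: indicator_def)
    qed
  qed measurable
  have "(\<integral>\<^sup>+x. ennreal (indicator D x * (g x - ?k x)\<^sup>2) \<partial>lborel)
     \<le> (\<integral>\<^sup>+x. ennreal (2 * (indicator D x * (g x - ?c (g x))\<^sup>2 + indicator D x * (?c (g x) - ?k x)\<^sup>2)) \<partial>lborel)"
  proof (intro nn_integral_mono ennreal_leI)
    fix x
    show "indicator D x * (g x - ?k x)\<^sup>2 \<le> 2 * (indicator D x * (g x - ?c (g x))\<^sup>2 + indicator D x * (?c (g x) - ?k x)\<^sup>2)"
      using sum_2_squares_le[of "g x - ?c (g x)" "?c (g x) - ?k x"] by (auto simp: indicator_def)
  qed
  also have "\<dots> = ennreal (LINT x|lborel. 2 * (indicator D x * (g x - ?c (g x))\<^sup>2 + indicator D x * (?c (g x) - ?k x)\<^sup>2))"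
    using i1 i2 by (intro nn_integral_eq_integral) auto
  also have "\<dots> \<le> ennreal e" using i1 i2 N n by (intro ennreal_leI) simp
  finally show thesis using kc[of n] that by blast
qed

lemma nn_integral_dilation:
  fixes g :: "'a::euclidean_space \<Rightarrow> ennreal"
  assumes l: "l > 0" and [measurable]: "g \<in> borel_measurable borel"
  shows "(\<integral>\<^sup>+x. g x \<partial>lborel) = ennreal (l ^ DIM('a)) * (\<integral>\<^sup>+x. g (v + l *\<^sub>R x) \<partial>lborel)"
proof -
  have eq: "lborel = density (distr lborel borel (\<lambda>x. v + l *\<^sub>R x)) (\<lambda>_. ennreal (l ^ DIM('a)))"
    using lborel_affine[of l v] l by simp
  show ?thesis by (subst eq) (simp add: nn_integral_density nn_integral_distr nn_integral_cmult)
qed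

text \<open>The difference is compared through a continuous \<open>k\<close>: \<open>k\<close>
  itself is uniformly continuous on a ball containing \<open>D\<close>, and the error of
  \<open>k\<close> at the contracted point is controlled by substitution. The point \<open>z\<close>
  enters only through being in \<open>D\<close>, whence the uniformity.\<close>

lemma L2_contraction_convergence:
  fixes g :: "'a::euclidean_space \<Rightarrow> real"
  assumes D: "convex D" "bounded D" "D \<in> sets borel" and g [measurable]: "g \<in> borel_measurable borel"
    and gI: "integrable lborel (\<lambda>x. indicator D x * (g x)\<^sup>2)" and \<eta>: "\<eta> > 0"
  obtains e0 where "0 < e0" "\<And>e z. 0 < e \<Longrightarrow> e < e0 \<Longrightarrow> z \<in> D \<Longrightarrow>
     (\<integral>\<^sup>+x. ennreal (indicator D x * (g ((1 - e) *\<^sub>R x + e *\<^sub>R z) - g x)\<^sup>2) \<partial>lborel) \<le> ennreal \<eta>"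
proof -
  note [measurable] = D(3)
  define d where "d = DIM('a)"
  \<comment> \<open>The square of three terms costs a factor 3, and each term gets a third of the
    rest, hence 9. The inverse Jacobian of the contraction is at most \<open>2 ^ d\<close>, as
    \<open>e\<close> stays below \<open>1 / 2\<close>.\<close>
  define \<eta>' where "\<eta>' = \<eta> / (9 * 2 ^ d)"
  have \<eta>': "\<eta>' > 0" using \<eta> by (simp add: \<eta>'_def)
  obtain k where k: "continuous_on UNIV k"
    "(\<integral>\<^sup>+x. ennreal (indicator D x * (g x - k x)\<^sup>2) \<partial>lborel) \<le> ennreal \<eta>'"
    using L2_continuous_dense[OF D(2,3) g gI \<eta>'] by metis
  have [measurable]: "k \<in> borel_measurable borel" by (rule borel_measurable_continuous_onI[OF k(1)])
  obtain r where r: "r > 0" "\<And>x. x \<in> D \<Longrightarrow> norm x \<le> r" using D(2) by (auto simp: bounded_pos)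
  have fin: "emeasure lborel D < \<infinity>" by (rule emeasure_bounded_finite[OF D(2)])
  define m where "m = measure lborel D"
  have em: "emeasure lborel D = ennreal m" unfolding m_def
    using fin by (intro emeasure_eq_ennreal_measure) auto
  have m: "m \<ge> 0" by (simp add: m_def)
  \<comment> \<open>Chosen so that the square of \<open>s\<close> times the measure \<open>m\<close>
    of \<open>D\<close> is at most \<open>\<eta> / 9\<close>; the summand 1 keeps the denominator
    positive when \<open>m\<close> is zero.\<close>
  define s where "s = sqrt (\<eta> / (9 * (m + 1)))"
  have s: "s > 0" "s\<^sup>2 = \<eta> / (9 * (m + 1))" using \<eta> m by (simp_all add: s_def)
  have "uniformly_continuous_on (cball 0 r) k"
    by (intro compact_uniformly_continuous continuous_on_subset[OF k(1)]) auto
  then obtain \<delta> where \<delta>: "\<delta> > 0" "\<And>x y. x \<in> cball 0 r \<Longrightarrow> y \<in> cball 0 r \<Longrightarrow> dist y x < \<delta> \<Longrightarrow> dist (k y) (k x) < s"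
    using s(1) unfolding uniformly_continuous_on_def by metis
  \<comment> \<open>The bound \<open>1 / 2\<close> is for the Jacobian. The other one keeps the
    displacement, at most \<open>e * (2 * r)\<close>, below the modulus of continuity
    \<open>\<delta>\<close>.\<close>
  define e0 where "e0 = min (1 / 2) (\<delta> / (2 * r))"
  have e0: "e0 > 0" using \<delta> r by (simp add: e0_def)
  show thesis
  proof (rule that[OF e0])
    fix e :: real and z :: 'a assume e: "0 < e" "e < e0" and z: "z \<in> D"
    have e1: "e < 1 / 2" "e * (2 * r) < \<delta>" using e r by (auto simp: e0_def pos_less_divide_eq)
    let ?y = "\<lambda>x. (1 - e) *\<^sub>R x + e *\<^sub>R z"
    have yD: "?y x \<in> D" if "x \<in> D" for x using D(1) that z e e1 by (intro convexD) auto
    let ?A = "\<lambda>x. ennreal (indicator D (?y x) * (g (?y x) - k (?y x))\<^sup>2)"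
    let ?B = "\<lambda>x. ennreal (indicator D x * s\<^sup>2)"
    let ?C = "\<lambda>x. ennreal (indicator D x * (g x - k x)\<^sup>2)"
    have "(\<integral>\<^sup>+x. ennreal (indicator D x * (g (?y x) - g x)\<^sup>2) \<partial>lborel)
      \<le> (\<integral>\<^sup>+x. 3 * (?A x + ?B x + ?C x) \<partial>lborel)"
    proof (rule nn_integral_mono)
      fix x
      show "ennreal (indicator D x * (g (?y x) - g x)\<^sup>2) \<le> 3 * (?A x + ?B x + ?C x)"
      proof (cases "x \<in> D")
        case True
        have "?y x - x = e *\<^sub>R (z - x)" by (simp add: algebra_simps)
        then have "norm (?y x - x) = e * norm (z - x)" using e by simp
        also have "\<dots> \<le> e * (2 * r)" using e r(2)[OF True] r(2)[OF z] norm_triangle_ineq4[of z x]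
          by (intro mult_left_mono) auto
        finally have "dist (?y x) x < \<delta>" using e1 by (simp add: dist_norm)
        then have "dist (k (?y x)) (k x) < s" using r(2)[OF True] r(2)[OF yD[OF True]] by (intro \<delta>) auto
        then have "\<bar>k (?y x) - k x\<bar> \<le> \<bar>s\<bar>" by (simp add: dist_real_def)
        then have ks: "(k (?y x) - k x)\<^sup>2 \<le> s\<^sup>2" by (simp only: abs_le_square_iff)
        have "(g (?y x) - g x)\<^sup>2 \<le> 3 * ((g (?y x) - k (?y x))\<^sup>2 + (k (?y x) - k x)\<^sup>2 + (k x - g x)\<^sup>2)"
          using sum_3_squares_le[of "g (?y x) - k (?y x)" "k (?y x) - k x" "k x - g x"] by simp
        also have "\<dots> \<le> 3 * ((g (?y x) - k (?y x))\<^sup>2 + s\<^sup>2 + (g x - k x)\<^sup>2)"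
          using ks by (simp add: power2_commute[of "k x"])
        finally have "ennreal ((g (?y x) - g x)\<^sup>2) \<le> ennreal (3 * ((g (?y x) - k (?y x))\<^sup>2 + s\<^sup>2 + (g x - k x)\<^sup>2))"
          by (rule ennreal_leI)
        also have "\<dots> = 3 * (?A x + ?B x + ?C x)" using True yD by (simp add: ennreal_mult)
        finally show ?thesis using True by simp
      qed simp
    qed
    also have "\<dots> = 3 * ((\<integral>\<^sup>+x. ?A x \<partial>lborel) + (\<integral>\<^sup>+x. ?B x \<partial>lborel) + (\<integral>\<^sup>+x. ?C x \<partial>lborel))"
      by (subst nn_integral_cmult) (auto simp: nn_integral_add)
    also have "(\<integral>\<^sup>+x. ?A x \<partial>lborel) \<le> ennreal (2 ^ d * \<eta>')"
    proof -
      have "(\<integral>\<^sup>+x. ?C x \<partial>lborel) = ennreal ((1 - e) ^ d) * (\<integral>\<^sup>+x. ?A x \<partial>lborel)"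
        using nn_integral_dilation[of "1 - e" ?C "e *\<^sub>R z"] e1 by (simp add: add.commute d_def)
      then have le: "ennreal ((1 - e) ^ d) * (\<integral>\<^sup>+x. ?A x \<partial>lborel) \<le> ennreal \<eta>'" using k(2) by simp
      have "(1 / 2) ^ d \<le> (1 - e) ^ d" using e1 by (intro power_mono) auto
      then have "1 \<le> 2 ^ d * (1 - e) ^ d" by (simp add: power_divide field_simps)
      then have "1 \<le> ennreal (2 ^ d * (1 - e) ^ d)" using ennreal_leI by fastforce
      then have "1 * (\<integral>\<^sup>+x. ?A x \<partial>lborel) \<le> ennreal (2 ^ d * (1 - e) ^ d) * (\<integral>\<^sup>+x. ?A x \<partial>lborel)"
        by (rule mult_right_mono) simp
      also have "\<dots> = ennreal (2 ^ d) * (ennreal ((1 - e) ^ d) * (\<integral>\<^sup>+x. ?A x \<partial>lborel))"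
        using e1 by (simp add: ennreal_mult mult.assoc)
      also have "\<dots> \<le> ennreal (2 ^ d) * ennreal \<eta>'" by (intro mult_left_mono le) simp
      finally show ?thesis using \<eta>' by (simp add: ennreal_mult)
    qed
    also have "(\<integral>\<^sup>+x. ?B x \<partial>lborel) = ennreal (s\<^sup>2 * m)"
    proof -
      have "?B = (\<lambda>x. ennreal (s\<^sup>2) * indicator D x)" by (auto simp: indicator_def)
      then show ?thesis using em m by (simp add: nn_integral_cmult_indicator ennreal_mult)
    qed
    also have "3 * (ennreal (2 ^ d * \<eta>') + ennreal (s\<^sup>2 * m) + (\<integral>\<^sup>+x. ?C x \<partial>lborel))
       \<le> 3 * (ennreal (2 ^ d * \<eta>') + ennreal (s\<^sup>2 * m) + ennreal \<eta>')"
      by (intro mult_left_mono add_left_mono k(2)) simp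
    also have "\<dots> = ennreal (3 * (2 ^ d * \<eta>' + s\<^sup>2 * m + \<eta>'))"
      using \<eta>' m by (simp add: ennreal_mult)
    also have "\<dots> \<le> ennreal \<eta>"
    proof (rule ennreal_leI)
      have 1: "2 ^ d * \<eta>' = \<eta> / 9" by (simp add: \<eta>'_def)
      have "\<eta>' \<le> \<eta> / 9" unfolding \<eta>'_def using \<eta> by (intro divide_left_mono) auto
      moreover have "s\<^sup>2 * m \<le> \<eta> / 9"
        unfolding s(2) using \<eta> m by (simp add: field_simps)
      moreover have "3 * (p + q + t) \<le> \<eta>" if "p = \<eta> / 9" "q \<le> \<eta> / 9" "t \<le> \<eta> / 9" for p q t
      proof -
        have "3 * (p + q + t) \<le> 3 * (\<eta> / 9 + \<eta> / 9 + \<eta> / 9)"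
          using that by (intro mult_left_mono add_mono) auto
        then show ?thesis by simp
      qed
      ultimately show "3 * (2 ^ d * \<eta>' + s\<^sup>2 * m + \<eta>') \<le> \<eta>" using 1 by blast
    qed
    finally show "(\<integral>\<^sup>+x. ennreal (indicator D x * (g (?y x) - g x)\<^sup>2) \<partial>lborel) \<le> ennreal \<eta>"
      by (simp add: add_mono mult_left_mono)
  qed
qed

text \<open>Tonelli and the affine substitutions are carried out over \<open>lborel\<close>, which
  calls for a Borel function on the whole space; extension by zero keeps it square
  integrable.\<close>

lemma square_integrable_borel_representative:
  assumes D: "open D" and w: "square_integrable (lebesgue_on D) w"
  obtains w' where "w' \<in> borel_measurable borel" "\<And>x. x \<notin> D \<Longrightarrow> w' x = 0"
    "AE x in lebesgue_on D. w x = w' x" "integrable lborel (\<lambda>x. (w' x)\<^sup>2)"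
proof -
  have "(\<lambda>x. indicator D x *\<^sub>R w x) \<in> borel_measurable lebesgue"
    using w D by (subst borel_measurable_restrict_space_iff[symmetric]) (auto simp: square_integrable_def)
  then obtain w0 where w0: "w0 \<in> borel_measurable lborel" "AE x in lborel. indicator D x *\<^sub>R w x = w0 x"
    using completion_ex_borel_measurable_real by blast
  define w' where "w' x = indicator D x * w0 x" for x
  have m [measurable]: "w' \<in> borel_measurable borel" using w0(1) D unfolding w'_def by auto
  have ae: "AE x in lebesgue. indicator D x * w x = w' x"
    using AE_completion[OF w0(2)] by eventually_elim (auto simp: w'_def indicator_def)
  have "integrable lebesgue (\<lambda>x. indicator D x * (w x)\<^sup>2)"
    using w D by (simp add: square_integrable_def lebesgue_on_integrable_eq)
  then have "integrable lebesgue (\<lambda>x. (w' x)\<^sup>2)"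
  proof (rule Bochner_Integration.integrable_cong_AE_imp)
    show "(\<lambda>x. (w' x)\<^sup>2) \<in> borel_measurable lebesgue" by (intro measurable_completion) simp
    show "AE x in lebesgue. indicator D x * (w x)\<^sup>2 = (w' x)\<^sup>2"
      using ae by eventually_elim (auto simp: indicator_def split: if_splits)
  qed
  then have "integrable lborel (\<lambda>x. (w' x)\<^sup>2)" by (simp add: integrable_completion)
  moreover have "AE x in lebesgue_on D. w x = w' x"
    using ae D by (auto simp: AE_lebesgue_on indicator_def elim!: eventually_mono)
  moreover have "w' x = 0" if "x \<notin> D" for x using that by (simp add: w'_def)
  ultimately show thesis using m that by blast
qed

text \<open>By Jensen's inequality and Tonelli, the average of \<open>g\<close> over the contractions converges in
  \<open>L\<^sup>2(D)\<close> as soon as the contractions do, uniformly in \<open>z\<close>.\<close>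

lemma L2_average_convergence:
  fixes g :: "real^'n \<Rightarrow> real"
  assumes D: "convex D" "bounded D" "D \<in> sets borel"
    and g [measurable]: "g \<in> borel_measurable borel" and gI: "integrable lborel g" "integrable lborel (\<lambda>x. (g x)\<^sup>2)"
    and \<rho>: "test_function D \<rho>" "\<And>z. \<rho> z \<ge> 0" "(LINT z|lborel. \<rho> z) = 1" and \<eta>: "\<eta> > 0"
  obtains e0 where "0 < e0" "\<And>e. 0 < e \<Longrightarrow> e < e0 \<Longrightarrow>
     (\<integral>\<^sup>+x. ennreal (indicator D x * ((LINT z|lborel. \<rho> z * g ((1 - e) *\<^sub>R x + e *\<^sub>R z)) - g x)\<^sup>2) \<partial>lborel) \<le> ennreal \<eta>"
proof -
  note [measurable] = D(3)
  have [measurable]: "\<rho> \<in> borel_measurable borel" by (rule smooth_borel_measurable[OF test_function_smooth[OF \<rho>(1)]])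
  have \<rho>i: "integrable lborel \<rho>" by (rule test_function_integrable[OF \<rho>(1)])
  have \<rho>1: "(\<integral>\<^sup>+z. ennreal (\<rho> z) \<partial>lborel) = 1"
    using \<rho>(2,3) nn_integral_eq_integral[OF \<rho>i] by simp
  obtain C where C: "\<And>x. \<bar>\<rho> x\<bar> \<le> C" using test_function_bounded[OF \<rho>(1)] by metis
  have gI': "integrable lborel (\<lambda>x. indicator D x * (g x)\<^sup>2)"
    using integrable_mult_indicator[OF _ gI(2), of D] by simp
  obtain e0 where e0: "0 < e0" "\<And>e z. 0 < e \<Longrightarrow> e < e0 \<Longrightarrow> z \<in> D \<Longrightarrow>
     (\<integral>\<^sup>+x. ennreal (indicator D x * (g ((1 - e) *\<^sub>R x + e *\<^sub>R z) - g x)\<^sup>2) \<partial>lborel) \<le> ennreal \<eta>"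
    by (rule L2_contraction_convergence[OF D g gI' \<eta>]) (rule that)
  show thesis
  proof (rule that[OF e0(1)])
    fix e assume e: "0 < e" "e < e0"
    let ?y = "\<lambda>x z. (1 - e) *\<^sub>R x + e *\<^sub>R z"
    have int: "integrable lborel (\<lambda>z. \<rho> z * g (?y x z))" for x
    proof -
      have eq: "lborel = density (distr lborel borel (\<lambda>z. ?y x z)) (\<lambda>_. ennreal (e ^ DIM(real^'n)))"
        using lborel_affine[of e "(1 - e) *\<^sub>R x"] e by simp
      have "integrable (density (distr lborel borel (\<lambda>z. ?y x z)) (\<lambda>_. ennreal (e ^ DIM(real^'n)))) g"
        using gI(1) eq by metis
      then have "integrable lborel (\<lambda>z. e ^ CARD('n) * g (?y x z))"
        using e by (simp add: integrable_density integrable_distr_eq)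
      then have "integrable lborel (\<lambda>z. g (?y x z))" using e by simp
      then have "integrable lborel (\<lambda>z. g (?y x z) * \<rho> z)"
        by (rule integrable_mult_bounded[OF _ _ C]) simp
      then show ?thesis by (simp add: mult.commute)
    qed
    have "(\<integral>\<^sup>+x. ennreal (indicator D x * ((LINT z|lborel. \<rho> z * g (?y x z)) - g x)\<^sup>2) \<partial>lborel)
       \<le> (\<integral>\<^sup>+x. (\<integral>\<^sup>+z. ennreal (\<rho> z * (indicator D x * (g (?y x z) - g x)\<^sup>2)) \<partial>lborel) \<partial>lborel)"
    proof (rule nn_integral_mono)
      fix x
      show "ennreal (indicator D x * ((LINT z|lborel. \<rho> z * g (?y x z)) - g x)\<^sup>2)
        \<le> (\<integral>\<^sup>+z. ennreal (\<rho> z * (indicator D x * (g (?y x z) - g x)\<^sup>2)) \<partial>lborel)"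
      proof (cases "x \<in> D")
        case True
        have "(LINT z|lborel. \<rho> z * (g (?y x z) - g x)) = (LINT z|lborel. \<rho> z * g (?y x z) - \<rho> z * g x)"
          by (simp add: right_diff_distrib)
        also have "\<dots> = (LINT z|lborel. \<rho> z * g (?y x z)) - g x"
          using \<rho>i \<rho>(3) int by (subst Bochner_Integration.integral_diff) auto
        finally have "ennreal (((LINT z|lborel. \<rho> z * g (?y x z)) - g x)\<^sup>2)
           \<le> (\<integral>\<^sup>+z. ennreal (\<rho> z * (g (?y x z) - g x)\<^sup>2) \<partial>lborel)"
          using weighted_jensen[of \<rho> lborel "\<lambda>z. g (?y x z) - g x", OF _ _ \<rho>(2) \<rho>1] by simp
        then show ?thesis using True by simp
      qed simp
    qed
    also have "\<dots> = (\<integral>\<^sup>+z. (\<integral>\<^sup>+x. ennreal (\<rho> z * (indicator D x * (g (?y x z) - g x)\<^sup>2)) \<partial>lborel) \<partial>lborel)"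
      by (rule lborel_pair.Fubini') measurable
    also have "\<dots> \<le> (\<integral>\<^sup>+z. ennreal (\<rho> z) * ennreal \<eta> \<partial>lborel)"
    proof (rule nn_integral_mono)
      fix z
      show "(\<integral>\<^sup>+x. ennreal (\<rho> z * (indicator D x * (g (?y x z) - g x)\<^sup>2)) \<partial>lborel) \<le> ennreal (\<rho> z) * ennreal \<eta>"
      \<comment> \<open>The contraction estimate holds for \<open>z\<close> in \<open>D\<close>;
        elsewhere the weight \<open>\<rho>\<close> vanishes.\<close>
      proof (cases "z \<in> D")
        case True
        have "(\<integral>\<^sup>+x. ennreal (\<rho> z * (indicator D x * (g (?y x z) - g x)\<^sup>2)) \<partial>lborel)
          = ennreal (\<rho> z) * (\<integral>\<^sup>+x. ennreal (indicator D x * (g (?y x z) - g x)\<^sup>2) \<partial>lborel)"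
          using \<rho>(2)[of z] by (simp add: ennreal_mult' nn_integral_cmult)
        also have "\<dots> \<le> ennreal (\<rho> z) * ennreal \<eta>" by (intro mult_left_mono e0(2) e True) simp
        finally show ?thesis .
      qed (simp add: test_function_eq_0[OF \<rho>(1)])
    qed
    also have "\<dots> = ennreal \<eta>" by (simp add: nn_integral_multc \<rho>1)
    finally show "(\<integral>\<^sup>+x. ennreal (indicator D x * ((LINT z|lborel. \<rho> z * g (?y x z)) - g x)\<^sup>2) \<partial>lborel) \<le> ennreal \<eta>" .
  qed
qed

lemma mollify_eq_average:
  fixes g :: "real^'n \<Rightarrow> real"
  assumes [measurable]: "g \<in> borel_measurable borel" and \<rho>: "test_function D \<rho>" and e: "0 < e"
  shows "mollify g (1 / e) (- (1 - e) / e) \<rho> x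
    = e ^ CARD('n) * (LINT z|lborel. \<rho> z * g ((1 - e) *\<^sub>R x + e *\<^sub>R z))"
proof -
  have [measurable]: "\<rho> \<in> borel_measurable borel" by (rule smooth_borel_measurable[OF test_function_smooth[OF \<rho>]])
  let ?y = "\<lambda>z. (1 - e) *\<^sub>R x + e *\<^sub>R z"
  have eq: "lborel = density (distr lborel borel ?y) (\<lambda>_. ennreal (e ^ DIM(real^'n)))"
    using lborel_affine[of e "(1 - e) *\<^sub>R x"] e by simp
  have "(1 / e) *\<^sub>R ?y z + (- (1 - e) / e) *\<^sub>R x = z" for z
  proof -
    have c: "(1 / e) * (1 - e) + - (1 - e) / e = 0" "(1 / e) * e = 1" using e by (auto simp: field_simps)
    have "(1 / e) *\<^sub>R ?y z + (- (1 - e) / e) *\<^sub>R x = ((1 / e) * (1 - e) + - (1 - e) / e) *\<^sub>R x + ((1 / e) * e) *\<^sub>R z"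
      by (simp only: scaleR_add_right scaleR_add_left scaleR_scaleR add_ac)
    then show ?thesis unfolding c by simp
  qed
  then show ?thesis
    unfolding mollify_def
    by (subst eq) (use e in \<open>simp add: integral_density integral_distr mult.commute\<close>)
qed

lemma test_function_unit_mass:
  fixes D :: "(real^'n) set"
  assumes D: "open D" "D \<noteq> {}"
  obtains \<rho> where "test_function D \<rho>" "\<And>z. \<rho> z \<ge> 0" "(LINT z|lborel. \<rho> z) = 1"
proof -
  obtain x where "x \<in> D" using D by blast
  then obtain a b where ab: "cbox a b \<subseteq> D" "x \<in> box a b" using open_contains_cbox[OF D(1)] by metis
  have tf: "test_function D (bump a b 1)" by (rule test_function_bump[OF ab(1)])
  have bi: "integrable lborel (bump a b 1)" by (rule test_function_integrable[OF tf])
  define c where "c = (LINT z|lborel. bump a b 1 z)"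
  have "c \<noteq> 0"
  proof
    assume "c = 0"
    then have "AE z in lborel. bump a b 1 z = 0"
      using integral_nonneg_eq_0_iff_AE[OF bi AE_I2[OF bump_bounds(1)]] unfolding c_def by simp
    then have "AE z in lborel. z \<notin> box a b"
      by eventually_elim (use bump_pos[of _ a b 1] in force)
    then have "AE z in lebesgue. z \<notin> box a b" by (simp add: AE_completion_iff)
    then have "negligible (box a b)"
      unfolding negligible_iff_null_sets using AE_iff_null_sets[of "box a b" lebesgue] by simp
    with open_not_negligible[OF open_box] ab(2) show False by blast
  qed
  moreover have "c \<ge> 0" unfolding c_def by (rule integral_nonneg_AE[OF AE_I2[OF bump_bounds(1)]])
  ultimately have c: "c > 0" by simp
  show thesis
  proof (rule that[of "\<lambda>z. (1 / c) * bump a b 1 z"])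
    show "test_function D (\<lambda>z. (1 / c) * bump a b 1 z)" by (rule test_function_cmult[OF tf])
    show "0 \<le> (1 / c) * bump a b 1 z" for z using c by (intro mult_nonneg_nonneg bump_bounds) simp
    show "(LINT z|lborel. (1 / c) * bump a b 1 z) = 1"
      using c by (simp only: integral_mult_right_zero c_def[symmetric]) simp
  qed
qed

text \<open>The partial derivative of the average of \<open>w\<close> is \<open>1 - e\<close> times
  the average of the weak derivative. So one convergence statement for averages serves the function
  and all its derivatives, up to the factor \<open>1 - e\<close>, which tends to 1.\<close>

theorem smooth_dense_H1_convex:
  fixes D :: "(real^'n) set"
  assumes D: "convex D" "open D" "bounded D" "D \<noteq> {}" and w: "sobolev 1 D w"
  shows "\<exists>\<phi>. smooth_H1_approx D \<phi> w"
proof -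
  have Db: "D \<in> sets borel" using D(2) by simp
  note wD = sobolev_1_weak_pderivative[OF D(2) w]
  obtain \<rho> where \<rho>: "test_function D \<rho>" "\<And>z. \<rho> z \<ge> 0" "(LINT z|lborel. \<rho> z) = 1"
    using test_function_unit_mass[OF D(2,4)] by metis
  \<comment> \<open>On a bounded set square integrability implies integrability, by
    \<open>\<bar>t\<bar> \<le> t^2 + 1\<close>; outside \<open>D\<close> the function is
    zero.\<close>
  have L1: "integrable lborel g" if g: "g \<in> borel_measurable borel" "\<And>x. x \<notin> D \<Longrightarrow> g x = 0" "integrable lborel (\<lambda>x. (g x)\<^sup>2)"
    for g :: "real^'n \<Rightarrow> real"
  proof -
    have "emeasure lborel D < \<infinity>" by (rule emeasure_bounded_finite[OF D(3)])
    then have "integrable lborel (\<lambda>x. (g x)\<^sup>2 + indicator D x)"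
      using Db by (intro Bochner_Integration.integrable_add g(3) integrable_real_indicator) auto
    then show ?thesis
    proof (rule Bochner_Integration.integrable_bound)
      have "\<bar>t\<bar> \<le> t\<^sup>2 + 1" for t :: real using sum_squares_bound[of "\<bar>t\<bar>" 1] by simp
      then show "AE x in lborel. norm (g x) \<le> norm ((g x)\<^sup>2 + indicator D x)"
        using g(2) by (intro AE_I2) (auto simp: indicator_def)
    qed (use g in simp)
  qed
  obtain w' where w': "w' \<in> borel_measurable borel" "\<And>x. x \<notin> D \<Longrightarrow> w' x = 0"
    "AE x in lebesgue_on D. w x = w' x" "integrable lborel (\<lambda>x. (w' x)\<^sup>2)"
    by (rule square_integrable_borel_representative[OF D(2) wD(1)]) (rule that)
  have "\<forall>i. \<exists>g'. g' \<in> borel_measurable borel \<and> (\<forall>x. x \<notin> D \<longrightarrow> g' x = 0) \<and>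
    (AE x in lebesgue_on D. weak_pderivative D i w x = g' x) \<and> integrable lborel (\<lambda>x. (g' x)\<^sup>2)"
  proof
    fix i
    obtain g' where "g' \<in> borel_measurable borel" "\<And>x. x \<notin> D \<Longrightarrow> g' x = 0"
      "AE x in lebesgue_on D. weak_pderivative D i w x = g' x" "integrable lborel (\<lambda>x. (g' x)\<^sup>2)"
      by (rule square_integrable_borel_representative[OF D(2) wD(3)]) (rule that)
    then show "\<exists>g'. g' \<in> borel_measurable borel \<and> (\<forall>x. x \<notin> D \<longrightarrow> g' x = 0) \<and>
      (AE x in lebesgue_on D. weak_pderivative D i w x = g' x) \<and> integrable lborel (\<lambda>x. (g' x)\<^sup>2)"
      by blast
  qed
  then obtain g' where g': "\<And>i. g' i \<in> borel_measurable borel" "\<And>i x. x \<notin> D \<Longrightarrow> g' i x = 0"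
    "\<And>i. AE x in lebesgue_on D. weak_pderivative D i w x = g' i x" "\<And>i. integrable lborel (\<lambda>x. (g' i x)\<^sup>2)"
    unfolding choice_iff by blast
  have w'I: "integrable lborel w'" by (rule L1[OF w'(1,2,4)])
  have g'I: "integrable lborel (g' i)" for i by (rule L1[OF g'(1,2,4)])
  define A where "A e g x = (LINT z|lborel. \<rho> z * g ((1 - e) *\<^sub>R x + e *\<^sub>R z))" for e g and x :: "real^'n"
  \<comment> \<open>The shift by 2 keeps every \<open>e j\<close> strictly below 1, as the kernels
    require.\<close>
  define e where "e j = 1 / real (j + 2)" for j
  have e: "0 < e j" "e j < 1" for j by (simp_all add: e_def)
  have e_lim: "eventually (\<lambda>j. e j < c) sequentially" if "c > 0" for c
  proof -
    have "e \<longlonglongrightarrow> 0"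
      using LIMSEQ_ignore_initial_segment[OF lim_inverse_n, of 2] by (simp add: e_def[abs_def] inverse_eq_divide)
    then show ?thesis using that by (rule order_tendstoD(2))
  qed
  \<comment> \<open>Division by the Jacobian of the substitution turns \<open>mollify\<close> into
    the average \<open>A\<close>.\<close>
  define \<phi> where "\<phi> j x = (1 / e j ^ CARD('n)) * mollify w' (1 / e j) (- (1 - e j) / e j) \<rho> x" for j x
  have avg: "(1 / e j ^ CARD('n)) * mollify g (1 / e j) (- (1 - e j) / e j) \<rho> x = A (e j) g x"
    if "g \<in> borel_measurable borel" for g j x
    unfolding A_def mollify_eq_average[OF that \<rho>(1) e(1)] using e(1)[of j] by simp
  have \<phi>A: "\<phi> j x = A (e j) w' x" for j x
    unfolding \<phi>_def by (rule avg[OF w'(1)])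
  have sm: "smooth (\<phi> j)" for j
    unfolding \<phi>_def by (intro smooth_cmult smooth_mollify[OF w'I \<rho>(1)])
  have pd: "pderivative i (\<phi> j) x = (1 - e j) * A (e j) (g' i) x" if x: "x \<in> D" for i j x
  proof -
    have "pderivative i (\<phi> j) x = (1 / e j ^ CARD('n)) * pderivative i (mollify w' (1 / e j) (- (1 - e j) / e j) \<rho>) x"
      unfolding \<phi>_def by (intro pderivative_cmult smooth_mollify[OF w'I \<rho>(1)])
    also have "pderivative i (mollify w' (1 / e j) (- (1 - e j) / e j) \<rho>) x
       = (1 - e j) * mollify (g' i) (1 / e j) (- (1 - e j) / e j) \<rho> x"
      by (rule mollify_weak_pderivative[OF D(1,2) \<rho>(1) e wD(2) w'I w'(2,3) g'I g'(2,3) x])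
    also have "(1 / e j ^ CARD('n)) * ((1 - e j) * mollify (g' i) (1 / e j) (- (1 - e j) / e j) \<rho> x)
       = (1 - e j) * ((1 / e j ^ CARD('n)) * mollify (g' i) (1 / e j) (- (1 - e j) / e j) \<rho> x)"
      by (rule mult.left_commute)
    finally show ?thesis unfolding avg[OF g'(1)] .
  qed
  have conv: "(\<lambda>j. \<integral>\<^sup>+x. ennreal (indicator D x * (A (e j) g x - g x)\<^sup>2) \<partial>lborel) \<longlonglongrightarrow> 0"
    if g: "g \<in> borel_measurable borel" "integrable lborel g" "integrable lborel (\<lambda>x. (g x)\<^sup>2)" for g
  proof (rule ennreal_tendsto_0I)
    fix \<eta> :: real assume "\<eta> > 0"
    obtain e0 where e0: "0 < e0" "\<And>e. 0 < e \<Longrightarrow> e < e0 \<Longrightarrow>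
     (\<integral>\<^sup>+x. ennreal (indicator D x * (A e g x - g x)\<^sup>2) \<partial>lborel) \<le> ennreal \<eta>"
      unfolding A_def by (rule L2_average_convergence[OF D(1,3) Db g \<rho> \<open>\<eta> > 0\<close>]) (rule that[unfolded A_def])
    show "eventually (\<lambda>j. (\<integral>\<^sup>+x. ennreal (indicator D x * (A (e j) g x - g x)\<^sup>2) \<partial>lborel) \<le> ennreal \<eta>) sequentially"
      using e_lim[OF e0(1)] by eventually_elim (intro e0 e)
  qed
  have toD: "(\<integral>\<^sup>+x. ennreal ((p x - q x)\<^sup>2) \<partial>lebesgue_on D) = (\<integral>\<^sup>+x. ennreal (indicator D x * (p x - q' x)\<^sup>2) \<partial>lborel)"
    if "AE x in lebesgue_on D. q x = q' x" for p q q' :: "real^'n \<Rightarrow> real"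
  proof -
    have "(\<integral>\<^sup>+x. ennreal ((p x - q x)\<^sup>2) \<partial>lebesgue_on D) = (\<integral>\<^sup>+x. ennreal ((p x - q' x)\<^sup>2) \<partial>lebesgue_on D)"
      using that by (intro nn_integral_cong_AE) (auto elim: eventually_mono)
    also have "\<dots> = (\<integral>\<^sup>+x. ennreal ((p x - q' x)\<^sup>2) * indicator D x \<partial>lebesgue)"
      using D(2) by (subst nn_integral_restrict_space) auto
    also have "\<dots> = (\<integral>\<^sup>+x. ennreal (indicator D x * (p x - q' x)\<^sup>2) \<partial>lborel)"
      by (subst nn_integral_completion) (auto intro!: nn_integral_cong simp: indicator_def)
    finally show ?thesis .
  qed
  have "smooth_H1_approx D \<phi> w"
    unfolding smooth_H1_approx_iff
  proof (intro conjI allI)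
    show "smooth (\<phi> j)" for j by (rule sm)
    show "(\<lambda>j. \<integral>\<^sup>+x. ennreal ((\<phi> j x - w x)\<^sup>2) \<partial>lebesgue_on D) \<longlonglongrightarrow> 0"
      using conv[OF w'(1) w'I w'(4)] by (simp add: toD[OF w'(3)] \<phi>A)
    fix i
    let ?q = "\<lambda>j. \<integral>\<^sup>+x. ennreal (indicator D x * (A (e j) (g' i) x - g' i x)\<^sup>2) \<partial>lborel"
    let ?G = "\<integral>\<^sup>+x. ennreal ((g' i x)\<^sup>2) \<partial>lborel"
    have G: "?G = ennreal (LINT x|lborel. (g' i x)\<^sup>2)"
      using g'(4) by (intro nn_integral_eq_integral) auto
    \<comment> \<open>With average \<open>a\<close> and limit \<open>b\<close>, the error is
      \<open>(1 - e) a - b = (1 - e) (a - b) - e b\<close>: the error of the average plus a term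
      that vanishes with \<open>e\<close>.\<close>
    have le: "(\<integral>\<^sup>+x. ennreal (indicator D x * (pderivative i (\<phi> j) x - g' i x)\<^sup>2) \<partial>lborel)
      \<le> 2 * ?q j + ennreal (2 * (e j)\<^sup>2) * ?G" for j
    proof -
      have m [measurable]: "D \<in> sets borel" "g' i \<in> borel_measurable borel" "A (e j) (g' i) \<in> borel_measurable borel"
      proof -
        have "A (e j) (g' i) = (\<lambda>x. (1 / e j ^ CARD('n)) * mollify (g' i) (1 / e j) (- (1 - e j) / e j) \<rho> x)"
          by (rule ext) (rule avg[OF g'(1), symmetric])
        moreover have "smooth \<dots>" by (intro smooth_cmult smooth_mollify[OF g'I \<rho>(1)])
        ultimately show "A (e j) (g' i) \<in> borel_measurable borel" by (metis smooth_borel_measurable)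
      qed (use Db g' in auto)
      have "(\<integral>\<^sup>+x. ennreal (indicator D x * (pderivative i (\<phi> j) x - g' i x)\<^sup>2) \<partial>lborel)
        \<le> (\<integral>\<^sup>+x. 2 * ennreal (indicator D x * (A (e j) (g' i) x - g' i x)\<^sup>2) + ennreal (2 * (e j)\<^sup>2) * ennreal ((g' i x)\<^sup>2) \<partial>lborel)"
      proof (rule nn_integral_mono)
        fix x
        show "ennreal (indicator D x * (pderivative i (\<phi> j) x - g' i x)\<^sup>2)
          \<le> 2 * ennreal (indicator D x * (A (e j) (g' i) x - g' i x)\<^sup>2) + ennreal (2 * (e j)\<^sup>2) * ennreal ((g' i x)\<^sup>2)"
        proof (cases "x \<in> D")
          case True
          let ?a = "A (e j) (g' i) x" and ?b = "g' i x"
          have "((1 - e j) * (?a - ?b) + (- e j * ?b))\<^sup>2 \<le> 2 * (((1 - e j) * (?a - ?b))\<^sup>2 + (- e j * ?b)\<^sup>2)"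
            by (rule sum_2_squares_le)
          also have "((1 - e j) * (?a - ?b))\<^sup>2 \<le> (?a - ?b)\<^sup>2"
            unfolding power_mult_distrib using e[of j] power_le_one[of "1 - e j" 2]
            by (intro mult_left_le_one_le) auto
          finally have "((1 - e j) * ?a - ?b)\<^sup>2 \<le> 2 * (?a - ?b)\<^sup>2 + 2 * (e j)\<^sup>2 * ?b\<^sup>2"
            by (simp add: algebra_simps power_mult_distrib)
          then have "ennreal (((1 - e j) * ?a - ?b)\<^sup>2) \<le> ennreal (2 * (?a - ?b)\<^sup>2 + 2 * (e j)\<^sup>2 * ?b\<^sup>2)"
            by (rule ennreal_leI)
          also have "\<dots> = 2 * ennreal ((?a - ?b)\<^sup>2) + ennreal (2 * (e j)\<^sup>2) * ennreal (?b\<^sup>2)"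
            by (simp add: ennreal_mult)
          finally show ?thesis using True by (simp add: pd[OF True])
        qed simp
      qed
      also have "\<dots> = 2 * ?q j + ennreal (2 * (e j)\<^sup>2) * ?G"
        by (simp add: nn_integral_add nn_integral_cmult)
      finally show ?thesis .
    qed
    have "(\<lambda>j. 2 * ?q j + ennreal (2 * (e j)\<^sup>2) * ?G) \<longlonglongrightarrow> 2 * 0 + ennreal (2 * 0\<^sup>2 * (LINT x|lborel. (g' i x)\<^sup>2))"
    proof (intro tendsto_add)
      show "(\<lambda>j. 2 * ?q j) \<longlonglongrightarrow> 2 * 0"
        by (intro ennreal_tendsto_cmult conv[OF g'(1) g'I g'(4)]) auto
      have "e \<longlonglongrightarrow> 0"
        using LIMSEQ_ignore_initial_segment[OF lim_inverse_n, of 2] by (simp add: e_def[abs_def] inverse_eq_divide)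
      then have "(\<lambda>j. ennreal (2 * (e j)\<^sup>2 * (LINT x|lborel. (g' i x)\<^sup>2))) \<longlonglongrightarrow> ennreal (2 * 0\<^sup>2 * (LINT x|lborel. (g' i x)\<^sup>2))"
        by (intro tendsto_ennrealI tendsto_intros)
      then show "(\<lambda>j. ennreal (2 * (e j)\<^sup>2) * ?G) \<longlonglongrightarrow> ennreal (2 * 0\<^sup>2 * (LINT x|lborel. (g' i x)\<^sup>2))"
        unfolding G by (simp add: ennreal_mult)
    qed
    then have "(\<lambda>j. 2 * ?q j + ennreal (2 * (e j)\<^sup>2) * ?G) \<longlonglongrightarrow> 0" by simp
    then have "(\<lambda>j. \<integral>\<^sup>+x. ennreal (indicator D x * (pderivative i (\<phi> j) x - g' i x)\<^sup>2) \<partial>lborel) \<longlonglongrightarrow> 0"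
      by (rule tendsto_sandwich[rotated 3]) (use le in auto)
    then show "(\<lambda>j. \<integral>\<^sup>+x. ennreal ((pderivative i (\<phi> j) x - weak_pderivative D i w x)\<^sup>2) \<partial>lebesgue_on D) \<longlonglongrightarrow> 0"
      by (simp add: toD[OF g'(3)])
  qed
  then show ?thesis by blast
qed

section \<open>Convergence in \<open>L\<^sup>2\<close>\<close>

lemma square_integrable_nn_integral:
  "square_integrable M f \<Longrightarrow> (\<integral>\<^sup>+x. ennreal ((f x)\<^sup>2) \<partial>M) = ennreal (LINT x|M. (f x)\<^sup>2)"
  by (intro nn_integral_eq_integral) (auto simp: square_integrable_def)

lemma L2_tendsto_imp_L1:
  fixes h :: "nat \<Rightarrow> 'a \<Rightarrow> real"
  assumes M: "finite_measure M" and h: "\<And>j. square_integrable M (h j)"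
    and lim: "(\<lambda>j. \<integral>\<^sup>+x. ennreal ((h j x)\<^sup>2) \<partial>M) \<longlonglongrightarrow> 0"
  shows "(\<lambda>j. LINT x|M. \<bar>h j x\<bar>) \<longlonglongrightarrow> 0"
proof -
  interpret finite_measure M by fact
  let ?m = "measure M (space M)"
  have int: "integrable M (\<lambda>x. (h j x)\<^sup>2)" "integrable M (h j)" for j
    using h square_integrable_imp_integrable_finite[OF M h] by (auto simp: square_integrable_def)
  have "(\<lambda>j. LINT x|M. (h j x)\<^sup>2) \<longlonglongrightarrow> 0"
  proof -
    have "(\<lambda>j. ennreal (LINT x|M. (h j x)\<^sup>2)) \<longlonglongrightarrow> ennreal 0"
      using lim by (simp add: square_integrable_nn_integral[OF h])
    then show ?thesis by (rule tendsto_ennrealD) auto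
  qed
  then have "(\<lambda>j. sqrt (LINT x|M. (h j x)\<^sup>2) * sqrt ?m) \<longlonglongrightarrow> sqrt 0 * sqrt ?m" by (intro tendsto_intros)
  then have lim': "(\<lambda>j. sqrt (LINT x|M. (h j x)\<^sup>2) * sqrt ?m) \<longlonglongrightarrow> 0" by simp
  have "(LINT x|M. \<bar>h j x\<bar>) \<le> sqrt (LINT x|M. (h j x)\<^sup>2) * sqrt ?m" for j
  proof -
    have m: "(\<lambda>x. ennreal \<bar>h j x\<bar>) \<in> borel_measurable M" using int(2)[of j] by auto
    have "(\<integral>\<^sup>+x. ennreal \<bar>h j x\<bar> * 1 \<partial>M)\<^sup>2 \<le> (\<integral>\<^sup>+x. (ennreal \<bar>h j x\<bar>)\<^sup>2 \<partial>M) * (\<integral>\<^sup>+x. 1\<^sup>2 \<partial>M)"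
      by (rule Cauchy_Schwarz_nn_integral[OF m]) simp
    moreover have "(\<integral>\<^sup>+x. ennreal \<bar>h j x\<bar> * 1 \<partial>M) = ennreal (LINT x|M. \<bar>h j x\<bar>)"
      using int(2)[of j] by (simp add: nn_integral_eq_integral)
    moreover have "(\<integral>\<^sup>+x. (ennreal \<bar>h j x\<bar>)\<^sup>2 \<partial>M) = ennreal (LINT x|M. (h j x)\<^sup>2)"
      using square_integrable_nn_integral[OF h] by (simp add: ennreal_power)
    moreover have "(\<integral>\<^sup>+x. 1\<^sup>2 \<partial>M) = ennreal ?m" by (simp add: emeasure_eq_measure)
    ultimately have "ennreal ((LINT x|M. \<bar>h j x\<bar>)\<^sup>2) \<le> ennreal ((LINT x|M. (h j x)\<^sup>2) * ?m)"
      by (simp add: ennreal_power ennreal_mult)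
    then have "(LINT x|M. \<bar>h j x\<bar>)\<^sup>2 \<le> (LINT x|M. (h j x)\<^sup>2) * ?m"
      by (subst (asm) ennreal_le_iff) auto
    then show ?thesis by (simp add: real_le_rsqrt flip: real_sqrt_mult)
  qed
  then show ?thesis by (intro tendsto_sandwich[OF _ _ tendsto_const lim']) auto
qed

lemma L2_tendsto_integral_mult:
  fixes h :: "nat \<Rightarrow> 'a \<Rightarrow> real"
  assumes M: "finite_measure M" and h: "\<And>j. square_integrable M (h j)" "square_integrable M g"
    and lim: "(\<lambda>j. \<integral>\<^sup>+x. ennreal ((h j x - g x)\<^sup>2) \<partial>M) \<longlonglongrightarrow> 0"
    and p: "p \<in> borel_measurable M" "\<And>x. x \<in> space M \<Longrightarrow> \<bar>p x\<bar> \<le> C"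
  shows "(\<lambda>j. LINT x|M. h j x * p x) \<longlonglongrightarrow> (LINT x|M. g x * p x)"
proof -
  have p2: "square_integrable M p" by (rule square_integrable_bounded[OF M p])
  have L1: "(\<lambda>j. LINT x|M. \<bar>h j x - g x\<bar>) \<longlonglongrightarrow> 0"
    by (intro L2_tendsto_imp_L1[OF M] square_integrable_diff h lim)
  then have lim': "(\<lambda>j. \<bar>C\<bar> * (LINT x|M. \<bar>h j x - g x\<bar>)) \<longlonglongrightarrow> \<bar>C\<bar> * 0" by (intro tendsto_intros)
  have bd: "norm ((LINT x|M. h j x * p x) - (LINT x|M. g x * p x)) \<le> \<bar>C\<bar> * (LINT x|M. \<bar>h j x - g x\<bar>)" for j
  proof -
    have i: "integrable M (\<lambda>x. h j x - g x)"
      by (intro square_integrable_imp_integrable_finite[OF M] square_integrable_diff h)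
    have "(LINT x|M. h j x * p x) - (LINT x|M. g x * p x) = (LINT x|M. h j x * p x - g x * p x)"
      by (intro Bochner_Integration.integral_diff[symmetric] square_integrable_mult h p2)
    also have "\<bar>\<dots>\<bar> \<le> (LINT x|M. \<bar>C\<bar> * \<bar>h j x - g x\<bar>)"
    proof (rule integral_abs_bound[THEN order_trans], rule integral_mono')
      show "integrable M (\<lambda>x. \<bar>C\<bar> * \<bar>h j x - g x\<bar>)" using i by auto
      fix x assume "x \<in> space M"
      then have "\<bar>p x\<bar> \<le> \<bar>C\<bar>" using p(2)[of x] by linarith
      then have "\<bar>p x\<bar> * \<bar>h j x - g x\<bar> \<le> \<bar>C\<bar> * \<bar>h j x - g x\<bar>" by (rule mult_right_mono) simp
      then show "\<bar>h j x * p x - g x * p x\<bar> \<le> \<bar>C\<bar> * \<bar>h j x - g x\<bar>"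
      proof -
        have "h j x * p x - g x * p x = p x * (h j x - g x)" by (simp add: algebra_simps)
        then show ?thesis using \<open>\<bar>p x\<bar> * \<bar>h j x - g x\<bar> \<le> \<bar>C\<bar> * \<bar>h j x - g x\<bar>\<close> by (simp only: abs_mult)
      qed
    qed simp
    finally show ?thesis by simp
  qed
  have "(\<lambda>j. (LINT x|M. h j x * p x) - (LINT x|M. g x * p x)) \<longlonglongrightarrow> 0"
    by (rule Lim_null_comparison[OF always_eventually]) (use bd lim' in auto)
  then show ?thesis by (simp add: LIM_zero_iff)
qed

text \<open>A subsequence converges almost everywhere, and Fatou's lemma identifies its limit as the
  \<open>L\<^sup>2\<close> limit.\<close>

lemma L2_complete:
  fixes f :: "nat \<Rightarrow> 'a \<Rightarrow> real" and b :: "nat \<Rightarrow> ennreal"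
  assumes M: "finite_measure M" and f: "\<And>j. square_integrable M (f j)"
    and b: "\<And>i j. (\<integral>\<^sup>+x. ennreal ((f i x - f j x)\<^sup>2) \<partial>M) \<le> b i + b j" "b \<longlonglongrightarrow> 0"
  shows "\<exists>g. square_integrable M g \<and> (\<lambda>j. \<integral>\<^sup>+x. ennreal ((f j x - g x)\<^sup>2) \<partial>M) \<longlonglongrightarrow> 0"
proof -
  have fm [measurable]: "f j \<in> borel_measurable M" for j using f by (auto simp: square_integrable_def)
  have fi: "integrable M (f j)" for j by (rule square_integrable_imp_integrable_finite[OF M f])
  \<comment> \<open>The Cauchy property in L1, from which the subsequence is obtained. If it failed,
    two index sequences tending to infinity would stay apart in L1, although \<open>b\<close> forces
    their distance in L2 to zero.\<close>
  have "\<exists>N. \<forall>i\<ge>N. \<forall>j\<ge>N. (LINT x|M. norm (f i x - f j x)) < e" if e: "e > 0" for e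
  proof (rule ccontr)
    assume "\<not> ?thesis"
    then have "\<forall>N. \<exists>i j. N \<le> i \<and> N \<le> j \<and> \<not> (LINT x|M. norm (f i x - f j x)) < e" by meson
    then obtain p q where pq: "\<And>N. N \<le> p N" "\<And>N. N \<le> q N"
      "\<And>N. \<not> (LINT x|M. norm (f (p N) x - f (q N) x)) < e" by metis
    have "filterlim p at_top sequentially" "filterlim q at_top sequentially"
      using pq(1,2) by (auto intro: filterlim_at_top_mono[OF filterlim_ident])
    then have "(\<lambda>N. b (p N) + b (q N)) \<longlonglongrightarrow> 0 + 0"
      by (intro tendsto_add filterlim_compose[OF b(2)])
    then have "(\<lambda>N. b (p N) + b (q N)) \<longlonglongrightarrow> 0" by simp
    then have "(\<lambda>N. \<integral>\<^sup>+x. ennreal ((f (p N) x - f (q N) x)\<^sup>2) \<partial>M) \<longlonglongrightarrow> 0"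
      by (rule tendsto_sandwich[rotated 3]) (use b(1) in auto)
    then have "(\<lambda>N. LINT x|M. \<bar>f (p N) x - f (q N) x\<bar>) \<longlonglongrightarrow> 0"
      by (intro L2_tendsto_imp_L1[OF M] square_integrable_diff f)
    then have "eventually (\<lambda>N. (LINT x|M. \<bar>f (p N) x - f (q N) x\<bar>) < e) sequentially"
      using e by (rule order_tendstoD(2))
    with pq(3) show False by (auto simp: eventually_sequentially)
  qed
  then obtain r where r: "strict_mono r" "AE x in M. Cauchy (\<lambda>i. f (r i) x)"
    using cauchy_L1_AE_cauchy_subseq[of M f, OF fi] by blast
  define g where "g x = lim (\<lambda>i. f (r i) x)" for x
  have gm [measurable]: "g \<in> borel_measurable M"
    unfolding g_def by (intro borel_measurable_lim_metric) simp
  have ae: "AE x in M. (\<lambda>i. f (r i) x) \<longlonglongrightarrow> g x"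
    using r(2) by eventually_elim (simp add: g_def Cauchy_convergent_iff convergent_LIMSEQ_iff)
  have le: "(\<integral>\<^sup>+x. ennreal ((f j x - g x)\<^sup>2) \<partial>M) \<le> b j" for j
  proof -
    have "(\<integral>\<^sup>+x. ennreal ((f j x - g x)\<^sup>2) \<partial>M) = (\<integral>\<^sup>+x. liminf (\<lambda>i. ennreal ((f j x - f (r i) x)\<^sup>2)) \<partial>M)"
    proof (rule nn_integral_cong_AE)
      show "AE x in M. ennreal ((f j x - g x)\<^sup>2) = liminf (\<lambda>i. ennreal ((f j x - f (r i) x)\<^sup>2))"
        using ae
      proof eventually_elim
        case (elim x)
        then have "(\<lambda>i. ennreal ((f j x - f (r i) x)\<^sup>2)) \<longlonglongrightarrow> ennreal ((f j x - g x)\<^sup>2)"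
          by (intro tendsto_ennrealI tendsto_intros)
        then show ?case by (intro lim_imp_Liminf[symmetric]) auto
      qed
    qed
    also have "\<dots> \<le> liminf (\<lambda>i. \<integral>\<^sup>+x. ennreal ((f j x - f (r i) x)\<^sup>2) \<partial>M)"
      by (rule nn_integral_liminf) measurable
    also have "\<dots> \<le> liminf (\<lambda>i. b j + b (r i))"
      by (intro Liminf_mono always_eventually allI b(1))
    also have "\<dots> = b j"
    proof (rule lim_imp_Liminf)
      have "(\<lambda>i. b (r i)) \<longlonglongrightarrow> 0" using LIMSEQ_subseq_LIMSEQ[OF b(2) r(1)] by (simp add: o_def)
      then have "(\<lambda>i. b j + b (r i)) \<longlonglongrightarrow> b j + 0" by (intro tendsto_add tendsto_const)
      then show "(\<lambda>i. b j + b (r i)) \<longlonglongrightarrow> b j" by simp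
    qed simp
    finally show ?thesis .
  qed
  have "(\<lambda>j. \<integral>\<^sup>+x. ennreal ((f j x - g x)\<^sup>2) \<partial>M) \<longlonglongrightarrow> 0"
    by (rule tendsto_sandwich[OF _ _ tendsto_const b(2)]) (use le in auto)
  moreover have "square_integrable M g"
  proof -
    have "eventually (\<lambda>j. b j < 1) sequentially" by (rule order_tendstoD(2)[OF b(2)]) simp
    then obtain j where j: "b j < 1" by (auto simp: eventually_sequentially)
    then have "(\<integral>\<^sup>+x. ennreal ((f j x - g x)\<^sup>2) \<partial>M) < \<infinity>"
      using le[of j] by (metis ennreal_one_less_top infinity_ennreal_def order_le_less_trans order_less_trans)
    then have "square_integrable M (\<lambda>x. f j x - g x)"
      unfolding square_integrable_def by (intro conjI integrableI_bounded) auto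
    from square_integrable_diff[OF f[of j] this] show ?thesis by simp
  qed
  ultimately show ?thesis by blast
qed

lemma nn_integral_add_squares_le:
  fixes p q :: "'a \<Rightarrow> real"
  assumes [measurable]: "p \<in> borel_measurable M" "q \<in> borel_measurable M" "r \<in> borel_measurable M"
  shows "(\<integral>\<^sup>+x. ennreal ((p x - q x)\<^sup>2) \<partial>M)
    \<le> 2 * (\<integral>\<^sup>+x. ennreal ((p x - r x)\<^sup>2) \<partial>M) + 2 * (\<integral>\<^sup>+x. ennreal ((q x - r x)\<^sup>2) \<partial>M)"
proof -
  have "(\<integral>\<^sup>+x. ennreal ((p x - q x)\<^sup>2) \<partial>M) \<le> (\<integral>\<^sup>+x. 2 * ennreal ((p x - r x)\<^sup>2) + 2 * ennreal ((q x - r x)\<^sup>2) \<partial>M)"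
  proof (rule nn_integral_mono)
    fix x
    have "(p x - q x)\<^sup>2 \<le> 2 * (p x - r x)\<^sup>2 + 2 * (q x - r x)\<^sup>2"
      using sum_2_squares_le[of "p x - r x" "r x - q x"] by (simp add: power2_commute[of "r x"])
    then have "ennreal ((p x - q x)\<^sup>2) \<le> ennreal (2 * (p x - r x)\<^sup>2 + 2 * (q x - r x)\<^sup>2)" by (rule ennreal_leI)
    then show "ennreal ((p x - q x)\<^sup>2) \<le> 2 * ennreal ((p x - r x)\<^sup>2) + 2 * ennreal ((q x - r x)\<^sup>2)"
      by (simp add: ennreal_mult)
  qed
  also have "\<dots> = 2 * (\<integral>\<^sup>+x. ennreal ((p x - r x)\<^sup>2) \<partial>M) + 2 * (\<integral>\<^sup>+x. ennreal ((q x - r x)\<^sup>2) \<partial>M)"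
    by (simp add: nn_integral_add nn_integral_cmult)
  finally show ?thesis .
qed

section \<open>Traces on the facets of a simplex\<close>

lemma AE_interior_convex:
  fixes T :: "'a::euclidean_space set"
  assumes "convex T" "closed T"
  shows "AE x in lebesgue. x \<in> T \<longleftrightarrow> x \<in> interior T"
proof -
  have "AE x in lebesgue. x \<notin> frontier T"
    using negligible_convex_frontier[OF assms(1)] unfolding negligible_iff_null_sets by (rule AE_not_in)
  then show ?thesis
    by eventually_elim (use assms(2) interior_subset[of T] in \<open>auto simp: frontier_def\<close>)
qed

lemma nn_integral_lebesgue_on_interior:
  fixes T :: "'a::euclidean_space set"
  assumes "convex T" "closed T"
  shows "(\<integral>\<^sup>+x. f x \<partial>lebesgue_on (interior T)) = (\<integral>\<^sup>+x. f x \<partial>lebesgue_on T)"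
proof -
  have "(\<integral>\<^sup>+x. f x * indicator (interior T) x \<partial>lebesgue) = (\<integral>\<^sup>+x. f x * indicator T x \<partial>lebesgue)"
    using AE_interior_convex[OF assms] by (intro nn_integral_cong_AE) (auto simp: indicator_def elim: eventually_mono)
  with assms show ?thesis by (simp add: nn_integral_restrict_space)
qed

lemma measurable_completion_cong_AE:
  assumes f: "f \<in> measurable (completion M) N" and eq: "AE x in completion M. f x = g x"
    and g: "\<And>x. x \<in> space M \<Longrightarrow> g x \<in> space N"
  shows "g \<in> measurable (completion M) N"
proof (rule measurableI)
  show "g x \<in> space N" if "x \<in> space (completion M)" for x using that g by simp
  fix B assume B: "B \<in> sets N"
  show "g -` B \<inter> space (completion M) \<in> sets (completion M)"
  proof (rule completion.in_sets_AE)
    show "f -` B \<inter> space (completion M) \<in> sets (completion M)" using f B by (rule measurable_sets)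
    show "AE x in completion M. (x \<in> f -` B \<inter> space (completion M)) = (x \<in> g -` B \<inter> space (completion M))"
      using eq by eventually_elim auto
  qed auto
qed

text \<open>Completeness makes two functions that agree almost everywhere measurable together or not
  at all; in the latter case both integrals have the default value 0.\<close>

lemma integral_lebesgue_cong_AE:
  fixes f g :: "'a::euclidean_space \<Rightarrow> real"
  assumes eq: "AE x in lebesgue. f x = g x"
  shows "(LINT x|lebesgue. f x) = (LINT x|lebesgue. g x)"
proof (cases "f \<in> borel_measurable lebesgue")
  case True
  moreover have "g \<in> borel_measurable lebesgue"
    by (rule measurable_completion_cong_AE[OF True eq]) simp
  ultimately show ?thesis using eq by (intro integral_cong_AE)
next
  case False
  moreover have "g \<notin> borel_measurable lebesgue"
  proof
    assume g: "g \<in> borel_measurable lebesgue"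
    have "f \<in> borel_measurable lebesgue"
      by (rule measurable_completion_cong_AE[OF g]) (use eq in \<open>auto elim: eventually_mono\<close>)
    with False show False by simp
  qed
  ultimately show ?thesis using borel_measurable_integrable not_integrable_integral_eq by metis
qed

lemma integral_lebesgue_on_interior:
  fixes T :: "'a::euclidean_space set" and f :: "'a \<Rightarrow> real"
  assumes "convex T" "closed T"
  shows "(LINT x|lebesgue_on T. f x) = (LINT x|lebesgue_on (interior T). f x)"
proof -
  have "(LINT x|lebesgue. indicator T x * f x) = (LINT x|lebesgue. indicator (interior T) x * f x)"
    using AE_interior_convex[OF assms]
    by (intro integral_lebesgue_cong_AE) (auto simp: indicator_def elim: eventually_mono)
  with assms show ?thesis by (simp add: lebesgue_on_integral_eq)
qed

definition H1_error :: "(real^'n) set \<Rightarrow> (real^'n \<Rightarrow> real) \<Rightarrow> (real^'n \<Rightarrow> real) \<Rightarrow> ennreal" where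
  "H1_error D w \<psi> = (\<integral>\<^sup>+x. ennreal ((\<psi> x - w x)\<^sup>2) \<partial>lebesgue_on D) +
     (\<Sum>i\<in>UNIV. \<integral>\<^sup>+x. ennreal ((pderivative i \<psi> x - weak_pderivative D i w x)\<^sup>2) \<partial>lebesgue_on D)"

lemma smooth_H1_approx_H1_error:
  "smooth_H1_approx D \<phi> w \<longleftrightarrow> (\<forall>j. smooth (\<phi> j)) \<and> (\<lambda>j. H1_error D w (\<phi> j)) \<longlonglongrightarrow> 0"
  by (simp add: smooth_H1_approx_def H1_error_def)

text \<open>The trace inequality is applied to the difference, and both functions are then compared
  with \<open>w\<close> in H1. A sum of one term for each function is the form of Cauchy estimate
  that \<open>L2_complete\<close> takes.\<close>

lemma facet_trace_difference:
  fixes T :: "(real^'n) set"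
  assumes fd: "facet_data T F a n c" and w: "sobolev 1 (interior T) w"
  obtains K where "\<And>\<psi> \<psi>'. smooth \<psi> \<Longrightarrow> smooth \<psi>' \<Longrightarrow>
     (\<integral>\<^sup>+x. ennreal ((\<psi> x - \<psi>' x)\<^sup>2) \<partial>facet_measure F)
       \<le> ennreal K * H1_error (interior T) w \<psi> + ennreal K * H1_error (interior T) w \<psi>'"
proof -
  let ?D = "interior T"
  have T: "convex T" "closed T" using facet_cell_compact[OF fd] by (auto simp: compact_imp_closed)
  obtain K where K: "\<And>\<psi>. smooth \<psi> \<Longrightarrow> (\<integral>\<^sup>+x. ennreal ((\<psi> x)\<^sup>2) \<partial>facet_measure F)
     \<le> ennreal K * ((\<integral>\<^sup>+x. ennreal ((\<psi> x)\<^sup>2) \<partial>lebesgue_on T) +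
        (\<Sum>i\<in>UNIV. \<integral>\<^sup>+x. ennreal ((pderivative i \<psi> x)\<^sup>2) \<partial>lebesgue_on T))"
    by (rule facet_trace_inequality[OF fd]) (rule that)
  note wD = sobolev_1_weak_pderivative[OF open_interior w]
  have m: "w \<in> borel_measurable (lebesgue_on ?D)" "weak_pderivative ?D i w \<in> borel_measurable (lebesgue_on ?D)" for i
    using wD by (auto simp: square_integrable_def)
  have sm: "\<psi> \<in> borel_measurable (lebesgue_on ?D)" if "smooth \<psi>" for \<psi>
    using that by (intro borel_measurable_lebesgue_on_borel smooth_borel_measurable)
  show thesis
  proof (rule that)
    fix \<psi> \<psi>' :: "real^'n \<Rightarrow> real" assume s: "smooth \<psi>" "smooth \<psi>'"
    have "(\<integral>\<^sup>+x. ennreal ((\<psi> x - \<psi>' x)\<^sup>2) \<partial>facet_measure F)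
      \<le> ennreal K * ((\<integral>\<^sup>+x. ennreal ((\<psi> x - \<psi>' x)\<^sup>2) \<partial>lebesgue_on T) +
        (\<Sum>i\<in>UNIV. \<integral>\<^sup>+x. ennreal ((pderivative i (\<lambda>x. \<psi> x - \<psi>' x) x)\<^sup>2) \<partial>lebesgue_on T))"
      by (rule K[OF smooth_diff[OF s]])
    also have "\<dots> = ennreal K * ((\<integral>\<^sup>+x. ennreal ((\<psi> x - \<psi>' x)\<^sup>2) \<partial>lebesgue_on ?D) +
        (\<Sum>i\<in>UNIV. \<integral>\<^sup>+x. ennreal ((pderivative i \<psi> x - pderivative i \<psi>' x)\<^sup>2) \<partial>lebesgue_on ?D))"
      by (simp add: pderivative_diff[OF s] nn_integral_lebesgue_on_interior[OF T])
    also have "\<dots> \<le> ennreal K * ((2 * (\<integral>\<^sup>+x. ennreal ((\<psi> x - w x)\<^sup>2) \<partial>lebesgue_on ?D) +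
          2 * (\<integral>\<^sup>+x. ennreal ((\<psi>' x - w x)\<^sup>2) \<partial>lebesgue_on ?D)) +
        (\<Sum>i\<in>UNIV. 2 * (\<integral>\<^sup>+x. ennreal ((pderivative i \<psi> x - weak_pderivative ?D i w x)\<^sup>2) \<partial>lebesgue_on ?D) +
          2 * (\<integral>\<^sup>+x. ennreal ((pderivative i \<psi>' x - weak_pderivative ?D i w x)\<^sup>2) \<partial>lebesgue_on ?D)))"
      by (intro mult_left_mono add_mono sum_mono nn_integral_add_squares_le m sm s smooth_pderivative) simp
    also have "\<dots> = ennreal K * (2 * (H1_error ?D w \<psi> + H1_error ?D w \<psi>'))"
      by (simp add: H1_error_def distrib_left sum.distrib sum_distrib_left add_ac)
    also have "\<dots> = ennreal (2 * K) * H1_error ?D w \<psi> + ennreal (2 * K) * H1_error ?D w \<psi>'"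
    proof -
      have "ennreal (2 * K) = 2 * ennreal K" using ennreal_mult'[of 2 K] by simp
      then show ?thesis by (simp only: distrib_left mult_ac)
    qed
    finally show "(\<integral>\<^sup>+x. ennreal ((\<psi> x - \<psi>' x)\<^sup>2) \<partial>facet_measure F)
       \<le> ennreal (2 * K) * H1_error ?D w \<psi> + ennreal (2 * K) * H1_error ?D w \<psi>'" .
  qed
qed

lemma ennreal_cmult_tendsto_0:
  "f \<longlonglongrightarrow> 0 \<Longrightarrow> (\<lambda>j. ennreal K * f j) \<longlonglongrightarrow> 0"
  using ennreal_tendsto_cmult[of "ennreal K" f 0 sequentially] by simp

lemma facet_trace_exists:
  fixes T :: "(real^'n) set"
  assumes fd: "facet_data T F a n c" and w: "sobolev 1 (interior T) w" and \<phi>: "smooth_H1_approx (interior T) \<phi> w"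
  shows "\<exists>g. square_integrable (facet_measure F) g \<and>
     (\<lambda>j. \<integral>\<^sup>+x. ennreal ((\<phi> j x - g x)\<^sup>2) \<partial>facet_measure F) \<longlonglongrightarrow> 0"
proof -
  obtain K where K: "\<And>\<psi> \<psi>'. smooth \<psi> \<Longrightarrow> smooth \<psi>' \<Longrightarrow>
     (\<integral>\<^sup>+x. ennreal ((\<psi> x - \<psi>' x)\<^sup>2) \<partial>facet_measure F)
       \<le> ennreal K * H1_error (interior T) w \<psi> + ennreal K * H1_error (interior T) w \<psi>'"
    by (rule facet_trace_difference[OF fd w]) (rule that)
  have \<phi>': "smooth (\<phi> j)" "(\<lambda>j. H1_error (interior T) w (\<phi> j)) \<longlonglongrightarrow> 0" for j
    using \<phi> by (auto simp: smooth_H1_approx_H1_error)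
  show ?thesis
    by (rule L2_complete[where b = "\<lambda>j. ennreal K * H1_error (interior T) w (\<phi> j)"])
      (auto intro!: facet_finite_measure[OF fd] facet_smooth_square_integrable[OF fd] K \<phi>' ennreal_cmult_tendsto_0)
qed

text \<open>\<open>has_trace\<close> provides just one approximating sequence. Any other one has the
  same limit on the facet, because two functions close to \<open>w\<close> in H1 are close to each
  other on the facet.\<close>

lemma facet_trace_limit:
  fixes T :: "(real^'n) set"
  assumes fd: "facet_data T F a n c" and g: "has_trace (interior T) F w g" and \<phi>: "smooth_H1_approx (interior T) \<phi> w"
  shows "(\<lambda>j. \<integral>\<^sup>+x. ennreal ((\<phi> j x - g x)\<^sup>2) \<partial>facet_measure F) \<longlonglongrightarrow> 0"
proof -
  let ?M = "facet_measure F"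
  have w: "sobolev 1 (interior T) w" using g by (simp add: has_trace_def)
  have gm: "g \<in> borel_measurable ?M" using g by (simp add: has_trace_def square_integrable_def)
  obtain K where K: "\<And>\<psi> \<psi>'. smooth \<psi> \<Longrightarrow> smooth \<psi>' \<Longrightarrow>
     (\<integral>\<^sup>+x. ennreal ((\<psi> x - \<psi>' x)\<^sup>2) \<partial>facet_measure F)
       \<le> ennreal K * H1_error (interior T) w \<psi> + ennreal K * H1_error (interior T) w \<psi>'"
    by (rule facet_trace_difference[OF fd w]) (rule that)
  obtain \<theta> where \<theta>: "smooth_H1_approx (interior T) \<theta> w"
    "(\<lambda>j. \<integral>\<^sup>+x. ennreal ((\<theta> j x - g x)\<^sup>2) \<partial>?M) \<longlonglongrightarrow> 0"
    using g by (auto simp: has_trace_def)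
  have s: "smooth (\<phi> j)" "smooth (\<theta> j)" for j using \<phi> \<theta> by (auto simp: smooth_H1_approx_def)
  have e: "(\<lambda>j. H1_error (interior T) w (\<phi> j)) \<longlonglongrightarrow> 0" "(\<lambda>j. H1_error (interior T) w (\<theta> j)) \<longlonglongrightarrow> 0"
    using \<phi> \<theta> by (auto simp: smooth_H1_approx_H1_error)
  have "(\<lambda>j. 2 * (ennreal K * H1_error (interior T) w (\<phi> j) + ennreal K * H1_error (interior T) w (\<theta> j))
      + 2 * (\<integral>\<^sup>+x. ennreal ((\<theta> j x - g x)\<^sup>2) \<partial>?M)) \<longlonglongrightarrow> 0"
    unfolding ennreal_add_tendsto_0_iff
    using ennreal_cmult_tendsto_0[OF \<theta>(2), of 2] ennreal_cmult_tendsto_0[of _ 2]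
      e[THEN ennreal_cmult_tendsto_0, of K] by (simp add: ennreal_add_tendsto_0_iff)
  then show ?thesis
  proof (rule tendsto_sandwich[rotated 3])
    have sq: "\<psi> \<in> borel_measurable ?M" if "smooth \<psi>" for \<psi>
      using that by (intro facet_borel_measurable[OF fd] smooth_borel_measurable)
    have "(\<integral>\<^sup>+x. ennreal ((\<phi> j x - g x)\<^sup>2) \<partial>?M)
      \<le> 2 * (\<integral>\<^sup>+x. ennreal ((\<phi> j x - \<theta> j x)\<^sup>2) \<partial>?M) + 2 * (\<integral>\<^sup>+x. ennreal ((g x - \<theta> j x)\<^sup>2) \<partial>?M)" for j
      by (rule nn_integral_add_squares_le) (intro sq s gm)+
    also have "\<dots> j \<le> 2 * (ennreal K * H1_error (interior T) w (\<phi> j) + ennreal K * H1_error (interior T) w (\<theta> j))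
      + 2 * (\<integral>\<^sup>+x. ennreal ((\<theta> j x - g x)\<^sup>2) \<partial>?M)" for j
      unfolding power2_commute[of "g _"] by (intro add_mono mult_left_mono K s) auto
    finally show "eventually (\<lambda>j. (\<integral>\<^sup>+x. ennreal ((\<phi> j x - g x)\<^sup>2) \<partial>?M)
       \<le> 2 * (ennreal K * H1_error (interior T) w (\<phi> j) + ennreal K * H1_error (interior T) w (\<theta> j))
      + 2 * (\<integral>\<^sup>+x. ennreal ((\<theta> j x - g x)\<^sup>2) \<partial>?M)) sequentially" by simp
  qed auto
qed

text \<open>By independence of the sequence, a single approximating sequence converges on the facet
  to both traces.\<close>

lemma facet_trace_unique:
  fixes T :: "(real^'n) set"
  assumes fd: "facet_data T F a n c" and g: "has_trace (interior T) F w g" "has_trace (interior T) F w g'"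
  shows "AE x in facet_measure F. g x = g' x"
proof -
  let ?M = "facet_measure F"
  have gm [measurable]: "g \<in> borel_measurable ?M" "g' \<in> borel_measurable ?M"
    using g by (auto simp: has_trace_def square_integrable_def)
  obtain \<theta> where \<theta>: "smooth_H1_approx (interior T) \<theta> w" using g by (auto simp: has_trace_def)
  have s: "\<theta> j \<in> borel_measurable ?M" for j
    using \<theta> by (intro facet_borel_measurable[OF fd] smooth_borel_measurable) (auto simp: smooth_H1_approx_def)
  have l: "(\<lambda>j. \<integral>\<^sup>+x. ennreal ((\<theta> j x - g x)\<^sup>2) \<partial>?M) \<longlonglongrightarrow> 0" "(\<lambda>j. \<integral>\<^sup>+x. ennreal ((\<theta> j x - g' x)\<^sup>2) \<partial>?M) \<longlonglongrightarrow> 0"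
    using facet_trace_limit[OF fd _ \<theta>] g by auto
  have "(\<lambda>j. 2 * (\<integral>\<^sup>+x. ennreal ((\<theta> j x - g x)\<^sup>2) \<partial>?M) + 2 * (\<integral>\<^sup>+x. ennreal ((\<theta> j x - g' x)\<^sup>2) \<partial>?M)) \<longlonglongrightarrow> 0"
    unfolding ennreal_add_tendsto_0_iff using l[THEN ennreal_cmult_tendsto_0, of 2] by simp
  then have "(\<integral>\<^sup>+x. ennreal ((g x - g' x)\<^sup>2) \<partial>?M) \<le> 0"
  proof (rule tendsto_lowerbound)
    have "(\<integral>\<^sup>+x. ennreal ((g x - g' x)\<^sup>2) \<partial>?M)
      \<le> 2 * (\<integral>\<^sup>+x. ennreal ((\<theta> j x - g x)\<^sup>2) \<partial>?M) + 2 * (\<integral>\<^sup>+x. ennreal ((\<theta> j x - g' x)\<^sup>2) \<partial>?M)" for j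
      using nn_integral_add_squares_le[OF gm s, of j]
      unfolding power2_commute[of "g _" "\<theta> j _"] power2_commute[of "g' _" "\<theta> j _"] by simp
    then show "eventually (\<lambda>j. (\<integral>\<^sup>+x. ennreal ((g x - g' x)\<^sup>2) \<partial>?M)
      \<le> 2 * (\<integral>\<^sup>+x. ennreal ((\<theta> j x - g x)\<^sup>2) \<partial>?M) + 2 * (\<integral>\<^sup>+x. ennreal ((\<theta> j x - g' x)\<^sup>2) \<partial>?M)) sequentially"
      by simp
  qed simp
  then have "AE x in ?M. ennreal ((g x - g' x)\<^sup>2) = 0" by (subst (asm) le_zero_eq, subst (asm) nn_integral_0_iff_AE) auto
  then show ?thesis by eventually_elim simp
qed

lemma has_trace_trace_on: "has_trace D F w g \<Longrightarrow> has_trace D F w (trace_on D F w)"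
  unfolding trace_on_def by (rule someI[of "has_trace D F w"])

lemma facet_trace_on_AE_eq:
  "facet_data T F a n c \<Longrightarrow> has_trace (interior T) F w g \<Longrightarrow> AE x in facet_measure F. trace_on (interior T) F w x = g x"
  using facet_trace_unique has_trace_trace_on by blast

text \<open>The interior of a cell is convex, so a smooth approximating sequence exists; its
  restrictions form a Cauchy sequence on the facet, and their limit is a trace for
  \<open>trace_on\<close> to choose.\<close>

lemma facet_has_trace_trace_on:
  fixes T :: "(real^'n) set"
  assumes fd: "facet_data T F a n c" and w: "sobolev 1 (interior T) w"
  shows "has_trace (interior T) F w (trace_on (interior T) F w)"
proof -
  have conv: "convex (interior T)" "bounded (interior T)"
    using facet_cell_compact[OF fd] by (auto intro: convex_interior bounded_subset[OF compact_imp_bounded interior_subset])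
  have "\<exists>\<phi>. smooth_H1_approx (interior T) \<phi> w"
  proof (cases "interior T = {}")
    case True
    then show ?thesis
      by (auto simp: smooth_H1_approx_def nn_integral_restrict_space intro!: exI[of _ "\<lambda>_ _. 0"] smooth_const)
  next
    case False
    then show ?thesis using smooth_dense_H1_convex[OF conv(1) open_interior conv(2) _ w] by blast
  qed
  then obtain \<phi> where \<phi>: "smooth_H1_approx (interior T) \<phi> w" by blast
  then obtain g where "has_trace (interior T) F w g"
    using facet_trace_exists[OF fd w \<phi>] w by (auto simp: has_trace_def)
  then show ?thesis by (rule has_trace_trace_on)
qed

lemma simplex_interior_nonempty:
  fixes T :: "(real^'n) set"
  assumes T: "int CARD('n) simplex T"
  shows "interior T \<noteq> {}"
proof -
  have "aff_dim T = int CARD('n)" using T by (rule aff_dim_simplex)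
  then have "affine hull T = UNIV" using aff_dim_eq_full[of T] by simp
  then have "interior T = rel_interior T" by (simp add: rel_interior_interior)
  moreover have "T \<noteq> {}" using T by auto
  ultimately show ?thesis using T by (simp add: rel_interior_eq_empty convex_simplex)
qed

text \<open>The formula for smooth functions passes to the limit along one approximating sequence:
  volume terms by convergence in H1, facet terms by the definition of the trace, all against factors
  that are bounded on \<open>T\<close>.\<close>

lemma simplex_integration_by_parts:
  fixes T :: "(real^'n) set"
  assumes T: "int CARD('n) simplex T" and w: "sobolev 1 (interior T) w" and p: "smooth p"
  shows "(LINT x|lebesgue_on T. weak_pderivative (interior T) i w x * p x)
      + (LINT x|lebesgue_on T. w x * pderivative i p x)
    = (\<Sum>F | F facet_of T. (outward_normal T F $ i) * (LINT x|facet_measure F. trace_on (interior T) F w x * p x))"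
proof -
  let ?D = "interior T"
  have Tc: "compact T" "convex T" using T by (auto simp: compact_simplex convex_simplex)
  have Tcl: "convex T" "closed T" using Tc by (auto simp: compact_imp_closed)
  have fin: "finite_measure (lebesgue_on ?D)"
    using Tc by (intro bounded_lebesgue_finite_measure bounded_subset[OF compact_imp_bounded interior_subset]) auto
  note wD = sobolev_1_weak_pderivative[OF open_interior w]
  have bd: "bounded ?D" using Tc by (intro bounded_subset[OF compact_imp_bounded interior_subset]) auto
  have ne: "?D \<noteq> {}" by (rule simplex_interior_nonempty[OF T])
  obtain \<phi> where \<phi>: "smooth_H1_approx ?D \<phi> w"
    using smooth_dense_H1_convex[OF convex_interior[OF Tc(2)] open_interior bd ne w] by blast
  have s: "smooth (\<phi> j)" for j using \<phi> by (auto simp: smooth_H1_approx_def)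
  have bounded_on: "\<exists>C. \<forall>x\<in>T. \<bar>q x\<bar> \<le> C" if "smooth q" for q
  proof -
    have "compact (q ` T)" by (intro compact_continuous_image smooth_continuous_on that Tc)
    then show ?thesis using compact_imp_bounded bounded_iff by (metis imageI real_norm_def)
  qed
  have lim: "(\<lambda>j. LINT x|lebesgue_on T. h j x * q x) \<longlonglongrightarrow> (LINT x|lebesgue_on T. g x * q x)"
    if h: "\<And>j. smooth (h j)" "square_integrable (lebesgue_on ?D) g"
      "(\<lambda>j. \<integral>\<^sup>+x. ennreal ((h j x - g x)\<^sup>2) \<partial>lebesgue_on ?D) \<longlonglongrightarrow> 0" and q: "smooth q" for h g q
  proof -
    obtain C where C: "\<And>x. x \<in> T \<Longrightarrow> \<bar>q x\<bar> \<le> C" using bounded_on[OF q] by blast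
    show ?thesis
      unfolding integral_lebesgue_on_interior[OF Tcl]
      by (rule L2_tendsto_integral_mult[OF fin _ h(2,3), where C = C])
        (use bd C interior_subset[of T] in \<open>auto intro!: smooth_square_integrable h(1)
          borel_measurable_lebesgue_on_borel smooth_borel_measurable q\<close>)
  qed
  have "(\<lambda>j. (LINT x|lebesgue_on T. pderivative i (\<phi> j) x * p x) + (LINT x|lebesgue_on T. \<phi> j x * pderivative i p x))
    \<longlonglongrightarrow> (LINT x|lebesgue_on T. weak_pderivative ?D i w x * p x) + (LINT x|lebesgue_on T. w x * pderivative i p x)"
    using \<phi> unfolding smooth_H1_approx_iff
    by (intro tendsto_add lim smooth_pderivative s wD p) auto
  moreover have "(LINT x|lebesgue_on T. pderivative i (\<phi> j) x * p x) + (LINT x|lebesgue_on T. \<phi> j x * pderivative i p x)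
     = (\<Sum>F | F facet_of T. (outward_normal T F $ i) * (LINT x|facet_measure F. \<phi> j x * p x))" for j
  proof -
    have int: "integrable (lebesgue_on T) (\<lambda>x. q x * r x)" if "smooth q" "smooth r" for q r
    proof -
      have "continuous_on UNIV (\<lambda>x. q x * r x)" by (intro continuous_intros smooth_continuous_on that)
      from continuous_locally_integrable[OF this, of T] show ?thesis using Tc(1) by (simp add: locally_integrable_def)
    qed
    show ?thesis
      unfolding simplex_integration_by_parts_smooth[OF T s p, symmetric]
      by (intro Bochner_Integration.integral_add[symmetric] int smooth_pderivative s p)
  qed
  moreover have "(\<lambda>j. \<Sum>F | F facet_of T. (outward_normal T F $ i) * (LINT x|facet_measure F. \<phi> j x * p x))
    \<longlonglongrightarrow> (\<Sum>F | F facet_of T. (outward_normal T F $ i) * (LINT x|facet_measure F. trace_on ?D F w x * p x))"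
  proof (intro tendsto_sum tendsto_mult tendsto_const)
    fix F assume "F \<in> {F. F facet_of T}"
    then have F: "F facet_of T" by simp
    obtain a n c where fd: "facet_data T F a n c" using facet_data_facet_of[OF T F] .
    have tr: "has_trace ?D F w (trace_on ?D F w)" by (rule facet_has_trace_trace_on[OF fd w])
    obtain C where C: "\<And>x. x \<in> T \<Longrightarrow> \<bar>p x\<bar> \<le> C" using bounded_on[OF p] by blast
    show "(\<lambda>j. LINT x|facet_measure F. \<phi> j x * p x) \<longlonglongrightarrow> (LINT x|facet_measure F. trace_on ?D F w x * p x)"
      by (rule L2_tendsto_integral_mult[OF facet_finite_measure[OF fd] _ _ facet_trace_limit[OF fd tr \<phi>], where C = C])
        (use tr C facet_cell_subset[OF fd] in \<open>auto intro!: facet_smooth_square_integrable[OF fd] s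
          facet_borel_measurable[OF fd] smooth_borel_measurable p simp: has_trace_def facet_space[OF fd]\<close>)
  qed
  ultimately show ?thesis by (simp add: LIMSEQ_unique)
qed

lemma smooth_representative_weak_pderivative:
  assumes D: "open D" "bounded D" and p: "smooth p" and v: "locally_integrable D v" and eq: "AE x in lebesgue_on D. v x = p x"
  shows "sobolev 1 D v" "AE x in lebesgue_on D. weak_pderivative D i v x = pderivative i p x"
proof -
  have eq': "AE x in lebesgue_on D. p x = v x" using eq by eventually_elim simp
  show "sobolev 1 D v" by (rule sobolev_1_cong_AE[OF D(1) sobolev_1_smooth[OF D p] v eq'])
  show "AE x in lebesgue_on D. weak_pderivative D i v x = pderivative i p x"
    by (rule weak_pderivative_AE_eq[OF D(1) has_weak_pderivative_cong_AE[OF D(1) smooth_has_weak_pderivative[OF D(1) p] v eq']])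
qed

text \<open>The constant sequence \<open>p\<close> approximates \<open>v\<close> exactly. This
  identifies the trace of a discrete function, which is a polynomial only almost everywhere on the
  cell.\<close>

lemma facet_trace_smooth_representative:
  fixes T :: "(real^'n) set"
  assumes fd: "facet_data T F a n c" and p: "smooth p" and v: "locally_integrable (interior T) v"
    and eq: "AE x in lebesgue_on (interior T). v x = p x"
  shows "AE x in facet_measure F. trace_on (interior T) F v x = p x"
proof -
  let ?D = "interior T"
  have bd: "bounded ?D"
    using facet_cell_compact[OF fd] by (intro bounded_subset[OF compact_imp_bounded interior_subset]) auto
  note vp = smooth_representative_weak_pderivative[OF open_interior bd p v eq]
  have "smooth_H1_approx ?D (\<lambda>_. p) v"
  proof -
    have "(\<integral>\<^sup>+x. ennreal ((p x - v x)\<^sup>2) \<partial>lebesgue_on ?D) = (\<integral>\<^sup>+x. 0 \<partial>lebesgue_on ?D)"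
      using eq by (intro nn_integral_cong_AE) (auto elim: eventually_mono)
    moreover have "(\<integral>\<^sup>+x. ennreal ((pderivative i p x - weak_pderivative ?D i v x)\<^sup>2) \<partial>lebesgue_on ?D) = (\<integral>\<^sup>+x. 0 \<partial>lebesgue_on ?D)" for i
      using vp(2)[of i] by (intro nn_integral_cong_AE) (auto elim: eventually_mono)
    ultimately show ?thesis using p by (simp add: smooth_H1_approx_def)
  qed
  then have "has_trace ?D F v p"
    using vp(1) facet_smooth_square_integrable[OF fd p] by (auto simp: has_trace_def intro!: exI[of _ "\<lambda>_. p"])
  then show ?thesis by (rule facet_trace_on_AE_eq[OF fd])
qed

section \<open>Geometry of the mesh\<close>

text \<open>Just below the graph that describes the boundary there is an open set free of points of
  \<open>D\<close>, so no boundary point is interior to the closure. This excludes slits.\<close>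

lemma lipschitz_boundary_interior_closure:
  fixes D :: "(real^'n) set"
  assumes D: "open D" "lipschitz_boundary D"
  shows "interior (closure D) = D"
proof
  show "D \<subseteq> interior (closure D)" using D(1) by (simp add: closure_subset interior_maximal)
  show "interior (closure D) \<subseteq> D"
  proof (rule subsetI, rule ccontr)
    fix x assume x: "x \<in> interior (closure D)" "x \<notin> D"
    then have "x \<in> frontier D"
      using D(1) interior_subset[of "closure D"] by (auto simp: frontier_def interior_open)
    then obtain r e \<gamma> L where r: "r > 0" "norm e = 1" "L-lipschitz_on {y. e \<bullet> y = 0} \<gamma>"
      "\<And>y. y \<in> ball x r \<Longrightarrow> y \<in> D \<longleftrightarrow> e \<bullet> y > (\<gamma> (y - (e \<bullet> y) *\<^sub>R e) :: real)"
      using D(2) unfolding lipschitz_boundary_def by blast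
    obtain s where s: "s > 0" "ball x s \<subseteq> closure D" using x(1) by (auto simp: mem_interior)
    have ee: "e \<bullet> e = 1" using r(2) by (simp add: dot_square_norm)
    \<comment> \<open>The signed height above the graph: within the ball, \<open>D\<close> is the
      set where it is positive.\<close>
    define f where "f z = e \<bullet> z - \<gamma> (z - (e \<bullet> z) *\<^sub>R e)" for z
    have "continuous_on UNIV (\<lambda>z. \<gamma> (z - (e \<bullet> z) *\<^sub>R e))"
      by (rule continuous_on_compose2[OF lipschitz_on_continuous_on[OF r(3)]])
        (use ee in \<open>auto intro!: continuous_intros simp: inner_diff_right\<close>)
    then have fc: "continuous_on UNIV f" unfolding f_def by (intro continuous_intros)
    define t where "t = min r s / 2"
    have t: "0 < t" "t < r" "t < s" using r(1) s(1) by (auto simp: t_def)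
    \<comment> \<open>Pushing \<open>x\<close> along \<open>- e\<close> keeps its foot in the
      hyperplane and lowers \<open>f\<close> strictly below zero. As \<open>y\<close> is still in
      the closure of \<open>D\<close>, some point of \<open>D\<close> nearby has negative height, a
      contradiction.\<close>
    define y where "y = x - t *\<^sub>R e"
    have dist: "dist x y = t" using t r(2) by (simp add: y_def dist_norm)
    have "y - (e \<bullet> y) *\<^sub>R e = x - (e \<bullet> x) *\<^sub>R e"
      using ee by (simp add: y_def inner_diff_right algebra_simps)
    moreover have "\<not> e \<bullet> x > \<gamma> (x - (e \<bullet> x) *\<^sub>R e)" using r(4)[of x] r(1) x(2) by simp
    moreover have "e \<bullet> y = e \<bullet> x - t" using ee by (simp add: y_def inner_diff_right)
    ultimately have "f y < 0" using t by (simp add: f_def)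
    have "open (f -` {..<0})"
      using fc by (simp add: continuous_on_open_vimage[OF open_UNIV])
    then have op: "open (f -` {..<0} \<inter> ball x r)" by blast
    have "y \<in> f -` {..<0} \<inter> ball x r" using \<open>f y < 0\<close> dist t by simp
    moreover have "y \<in> closure D" using s(2) dist t by auto
    ultimately obtain z where z: "z \<in> D" "f z < 0" "z \<in> ball x r"
      using open_Int_closure_eq_empty[OF op, of D] by auto
    with r(4)[of z] show False by (auto simp: f_def)
  qed
qed

text \<open>A point of the cylinder over \<open>F\<close> that is off the frontier projects into the
  relative interior, and the frontier of the convex cylinder is negligible.\<close>

lemma facet_AE_rel_interior:
  fixes T :: "(real^'n) set"
  assumes fd: "facet_data T F a n c"
  shows "AE x in facet_measure F. x \<in> rel_interior F"
proof -
  note fdD = facet_dataD[OF fd]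
  have cl: "closed F" using fdD(5) by (rule compact_imp_closed)
  let ?M = "hyperplane_borel_measure n c"
  have Rb: "rel_frontier F \<in> sets borel" using closed_rel_frontier[of F] by simp
  have ri: "y \<in> rel_interior F" if x: "x \<notin> frontier {x. hyper_scale n c 0 x \<in> F}" "hyper_scale n c 0 x = y" "y \<in> F" for x y
  proof -
    let ?Z = "{x. hyper_scale n c 0 x \<in> F}"
    have "x \<in> ?Z" using x by simp
    then have "x \<in> interior ?Z" using x(1) closure_subset[of ?Z] unfolding frontier_def by blast
    then obtain e where e: "e > 0" "\<And>z. dist z y < e \<Longrightarrow> n \<bullet> z = c \<Longrightarrow> z \<in> F"
      using interior_cylinder[OF fdD(1), of x c F] x(2) by metis
    then have "ball y e \<inter> affine hull F \<subseteq> F" by (auto simp: fdD(2) dist_commute)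
    then show ?thesis using e(1) x(3) by (auto simp: mem_rel_interior_ball)
  qed
  have "emeasure ?M (rel_frontier F) = emeasure lborel {x \<in> slab n c. hyper_scale n c 0 x \<in> rel_frontier F}"
    by (rule emeasure_hyperplane_borel[OF Rb])
  also have "\<dots> = 0"
  proof -
    have "AE x in lborel. \<not> (x \<in> slab n c \<and> hyper_scale n c 0 x \<in> rel_frontier F)"
      using AE_cylinder_frontier[OF fdD(4) cl, of n c]
    proof eventually_elim
      case (elim x)
      show ?case
      proof
        assume "x \<in> slab n c \<and> hyper_scale n c 0 x \<in> rel_frontier F"
        then have y: "hyper_scale n c 0 x \<in> F" "hyper_scale n c 0 x \<notin> rel_interior F"
          using cl by (auto simp: rel_frontier_def)
        with ri[OF elim refl] show False by blast
      qed
    qed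
    from emeasure_eq_0_AE[OF this] show ?thesis by simp
  qed
  finally have "rel_frontier F \<in> null_sets ?M" using Rb by (auto simp: null_sets_def)
  then have "AE x in ?M. x \<notin> rel_frontier F" by (rule AE_not_in)
  then have "AE x in hyperplane_measure n c. x \<notin> rel_frontier F"
    unfolding hyperplane_measure_eq_completion by (rule AE_completion)
  then show ?thesis
    unfolding facet_measure_data[OF fd] using facet_sets[OF fd] cl
    by (subst AE_restrict_space_iff) (auto simp: rel_frontier_def elim: eventually_mono)
qed

text \<open>The central projection from the opposite vertex is continuous near \<open>x\<close> and
  fixes \<open>x\<close>, so nearby points project into \<open>F\<close>; those below the hyperplane
  then lie on a segment from the vertex to \<open>F\<close>.\<close>

lemma facet_half_ball:
  fixes T :: "(real^'n) set"
  assumes fd: "facet_data T F a n c" and x: "x \<in> rel_interior F"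
  obtains r where "r > 0" "\<And>y. dist y x < r \<Longrightarrow> n \<bullet> y \<le> c \<Longrightarrow> y \<in> T"
proof -
  note fdD = facet_dataD[OF fd]
  define h where "h = c - n \<bullet> a"
  have h: "h > 0" using fdD(3) by (simp add: h_def)
  have xF: "x \<in> F" using x rel_interior_subset by blast
  obtain e where e: "e > 0" "ball x e \<inter> affine hull F \<subseteq> F" using x by (auto simp: mem_rel_interior_ball)
  have xh: "n \<bullet> (x - a) = h" using facet_level[OF fd xF] by (simp add: h_def inner_diff_right)
  have cx: "cproj a n h x = x" using xh h by (simp add: cproj_def)
  have lim: "(cproj a n h \<longlongrightarrow> cproj a n h x) (nhds x)"
    unfolding cproj_def using xh h by (intro tendsto_intros filterlim_ident) auto
  have "eventually (\<lambda>y. dist (cproj a n h y) x < e) (nhds x)"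
    using tendstoD[OF lim e(1)] by (simp add: cx)
  moreover have "eventually (\<lambda>y. 0 < n \<bullet> (y - a)) (nhds x)"
  proof (rule order_tendstoD(1))
    show "((\<lambda>y. n \<bullet> (y - a)) \<longlongrightarrow> n \<bullet> (x - a)) (nhds x)" by (intro tendsto_intros filterlim_ident)
  qed (use xh h in simp)
  ultimately have "eventually (\<lambda>y. dist (cproj a n h y) x < e \<and> 0 < n \<bullet> (y - a)) (nhds x)"
    by (rule eventually_conj)
  then obtain r where r: "r > 0" "\<And>y. dist y x < r \<Longrightarrow> dist (cproj a n h y) x < e \<and> 0 < n \<bullet> (y - a)"
    unfolding eventually_nhds_metric by auto
  show thesis
  proof (rule that[OF r(1)])
    fix y assume y: "dist y x < r" "n \<bullet> y \<le> c"
    have p: "0 < n \<bullet> (y - a)" "n \<bullet> (y - a) \<le> h" using r(2)[OF y(1)] y(2) by (auto simp: h_def inner_diff_right)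
    have "n \<bullet> cproj a n h y = c" using p by (subst inner_cproj) (auto simp: h_def)
    then have "cproj a n h y \<in> affine hull F" by (simp add: fdD(2))
    then have "cproj a n h y \<in> F" using e(2) r(2)[OF y(1)] by (auto simp: dist_commute)
    moreover have "y = a + (n \<bullet> (y - a) / h) *\<^sub>R (cproj a n h y - a)" using p h by (simp add: cproj_def)
    moreover have "0 \<le> n \<bullet> (y - a) / h" "n \<bullet> (y - a) / h \<le> 1" using p h by (auto simp: divide_le_eq)
    ultimately show "y \<in> T" using facet_cell_cases[OF fd] by blast
  qed
qed

section \<open>Cells and interfaces of a conforming mesh\<close>

locale mesh =
  fixes D :: "(real^'n) set" and \<T> :: "(real^'n) set set"
  assumes D: "open D" "lipschitz_boundary D" "bounded D" and \<T>: "conforming_mesh D \<T>"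
begin

lemma finite_mesh: "finite \<T>"
  using \<T> by (auto simp: conforming_mesh_def triangulation_def)

lemma cell_simplex: "T \<in> \<T> \<Longrightarrow> int CARD('n) simplex T"
  using \<T> by (auto simp: conforming_mesh_def)

lemma cell_Int_face: "T \<in> \<T> \<Longrightarrow> T' \<in> \<T> \<Longrightarrow> (T \<inter> T') face_of T"
  using \<T> by (auto simp: conforming_mesh_def triangulation_def)

lemma cells_cover: "\<Union>\<T> = closure D"
  using \<T> by (auto simp: conforming_mesh_def)

lemma cell_compact: "T \<in> \<T> \<Longrightarrow> compact T" "T \<in> \<T> \<Longrightarrow> convex T" "T \<in> \<T> \<Longrightarrow> closed T"
  using cell_simplex by (auto intro: compact_simplex convex_simplex compact_imp_closed)

lemma cell_aff_dim: "T \<in> \<T> \<Longrightarrow> aff_dim T = int CARD('n)"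
  using cell_simplex by (rule aff_dim_simplex)

lemma interior_closure: "interior (closure D) = D"
  using D by (intro lipschitz_boundary_interior_closure)

lemma cell_interior_subset: "T \<in> \<T> \<Longrightarrow> interior T \<subseteq> D"
  using cells_cover interior_mono[of T "closure D"] interior_closure by auto

lemma cell_eq_if_face: "T \<in> \<T> \<Longrightarrow> T' \<in> \<T> \<Longrightarrow> T face_of T' \<Longrightarrow> T = T'"
  using face_of_aff_dim_lt[of T' T] cell_aff_dim[of T] cell_aff_dim[of T'] cell_compact(2)[of T'] by linarith

lemma cells_interior_disjoint:
  assumes "T \<in> \<T>" "T' \<in> \<T>" "T \<noteq> T'"
  shows "interior T \<inter> interior T' = {}"
proof (rule ccontr)
  assume "interior T \<inter> interior T' \<noteq> {}"
  then obtain x where x: "x \<in> interior T" "x \<in> interior T'" by blast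
  then have "x \<in> T \<inter> T'" using interior_subset by blast
  then have "T \<inter> T' = T"
    using face_of_disjoint_interior[OF cell_Int_face[OF assms(1,2)]] x by blast
  then have "T face_of T'" using cell_Int_face[OF assms(2,1)] by (simp add: Int_commute)
  with assms cell_eq_if_face show False by blast
qed

lemma facet_cell: "T \<in> \<T> \<Longrightarrow> F facet_of T \<Longrightarrow> F face_of T \<and> F \<noteq> {} \<and> aff_dim F = int CARD('n) - 1"
  using cell_aff_dim by (auto simp: facet_of_def)

text \<open>Unless the cells coincide, their intersection is a proper face of \<open>T\<close>, of
  dimension at most \<open>d - 1\<close>. It has the face \<open>F\<close> of that dimension, so it
  equals \<open>F\<close>, and by conformity it is a face of \<open>T'\<close> too.\<close>

lemma facet_of_other_cell:
  assumes T: "T \<in> \<T>" "T' \<in> \<T>" and F: "F facet_of T" "F \<subseteq> T'"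
  shows "F facet_of T'"
proof (cases "T \<inter> T' = T")
  case True
  then have "T face_of T'" using cell_Int_face[OF T(2,1)] by (simp add: Int_commute)
  then show ?thesis using cell_eq_if_face T F(1) by blast
next
  case False
  note f = facet_cell[OF T(1) F(1)]
  have sub: "F \<subseteq> T \<inter> T'" using f F(2) face_of_imp_subset by blast
  have I: "(T \<inter> T') face_of T" by (rule cell_Int_face[OF T])
  have "aff_dim (T \<inter> T') < aff_dim T"
    using face_of_aff_dim_lt[OF cell_compact(2)[OF T(1)] I False] .
  moreover have "F face_of T \<inter> T'" using face_of_subset[OF conjunct1[OF f] sub Int_lower1] .
  ultimately have "F = T \<inter> T'"
    using face_of_aff_dim_lt[of "T \<inter> T'" F] convex_Int[OF cell_compact(2)[OF T(1)] cell_compact(2)[OF T(2)]]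
      f cell_aff_dim[OF T(1)] by linarith
  then have "F face_of T'" using cell_Int_face[OF T(2,1)] by (simp add: Int_commute)
  then show ?thesis using f cell_aff_dim[OF T(2)] by (simp add: facet_of_def)
qed

text \<open>By definition \<open>interfaces_of\<close> also admits facets of other cells that lie in
  the frontier of \<open>T\<close>; conformity makes these facets of \<open>T\<close>.\<close>

lemma interfaces_of_eq:
  assumes T: "T \<in> \<T>"
  shows "interfaces_of \<T> T = {F. F facet_of T}"
proof safe
  fix F assume F: "F \<in> interfaces_of \<T> T"
  then obtain T' where "T' \<in> \<T>" "F facet_of T'" by (auto simp: interfaces_of_def interfaces_def)
  moreover have "F \<subseteq> T" using F cell_compact(3)[OF T] by (auto simp: interfaces_of_def frontier_def)
  ultimately show "F facet_of T" using facet_of_other_cell T by blast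
next
  fix F assume F: "F facet_of T"
  then have "F face_of T" "F \<noteq> T" using facet_of_irrefl by (auto simp: facet_of_def)
  then have "F \<subseteq> frontier T"
    using face_of_disjoint_interior[of F T] face_of_imp_subset[of F T] cell_compact(3)[OF T] by (auto simp: frontier_def)
  then show "F \<in> interfaces_of \<T> T" using F T by (auto simp: interfaces_of_def interfaces_def)
qed

lemma interface_cell:
  assumes "F \<in> interfaces \<T>"
  obtains T a n c where "T \<in> \<T>" "F facet_of T" "facet_data T F a n c"
proof -
  obtain T where T: "T \<in> \<T>" "F facet_of T" using assms by (auto simp: interfaces_def)
  obtain a n c where "facet_data T F a n c" using facet_data_facet_of[OF cell_simplex[OF T(1)] T(2)] .
  with T that show thesis by blast
qed

lemma finite_interfaces: "finite (interfaces \<T>)"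
proof -
  have "interfaces \<T> = (\<Union>T\<in>\<T>. {F. F facet_of T})" by (auto simp: interfaces_def)
  moreover have "finite {F. F facet_of T}" if "T \<in> \<T>" for T
    using cell_simplex[OF that] by (intro finite_polytope_facets simplex_imp_polytope)
  ultimately show ?thesis using finite_mesh by auto
qed

text \<open>The intersection is a proper face of \<open>F\<close>, for equal dimensions would force
  \<open>F = F'\<close>. So it misses the relative interior of \<open>F\<close>, which has full
  surface measure.\<close>

lemma interfaces_AE_disjoint:
  assumes F: "F \<in> interfaces \<T>" "F' \<in> interfaces \<T>" "F \<noteq> F'"
  shows "AE x in facet_measure F. x \<notin> F'"
proof -
  obtain T a n c where T: "T \<in> \<T>" "F facet_of T" "facet_data T F a n c" using interface_cell[OF F(1)] .
  obtain T' a' n' c' where T': "T' \<in> \<T>" "F' facet_of T'" "facet_data T' F' a' n' c'" using interface_cell[OF F(2)] .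
  note f = facet_cell[OF T(1,2)] and f' = facet_cell[OF T'(1,2)]
  have "(T \<inter> T') face_of T'" using cell_Int_face[OF T'(1) T(1)] by (simp add: Int_commute)
  then have faces: "(F \<inter> F') face_of F" "(F \<inter> F') face_of F'"
    using face_of_Int_subface[OF cell_Int_face[OF T(1) T'(1)]] f f' by blast+
  have "F \<inter> F' \<noteq> F"
  proof
    assume e: "F \<inter> F' = F"
    then have "F face_of F'" using faces by simp
    then have "F = F'"
      using face_of_aff_dim_lt[of F' F] f f' facet_dataD(4)[OF T'(3)] by linarith
    with F(3) show False by simp
  qed
  then have "(F \<inter> F') \<inter> rel_interior F = {}" by (rule face_of_disjoint_rel_interior[OF faces(1)])
  then show ?thesis
    using facet_AE_rel_interior[OF T(3)] rel_interior_subset[of F] by (auto elim!: eventually_mono)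
qed

text \<open>A single relatively interior point \<open>x\<close> in \<open>D\<close> decides for all
  of \<open>F\<close>: it produces a second cell with facet \<open>F\<close> on the opposite side,
  and the half balls of the two cells fill a neighbourhood of every relatively interior
  point.\<close>

lemma interface_rel_interior_cases:
  assumes F: "F \<in> interfaces \<T>"
  shows "F \<subseteq> frontier D \<or> rel_interior F \<subseteq> D"
proof (cases "rel_interior F \<inter> D = {}")
  case True
  obtain T a n c where T: "T \<in> \<T>" "F facet_of T" "facet_data T F a n c" using interface_cell[OF F] .
  note fdD = facet_dataD[OF T(3)]
  have "F \<subseteq> closure D" using facet_cell_subset[OF T(3)] T(1) cells_cover by blast
  then have "rel_interior F \<subseteq> frontier D"
    using True rel_interior_subset[of F] D(1) by (auto simp: frontier_def interior_open)
  then have "closure (rel_interior F) \<subseteq> frontier D" by (intro closure_minimal) auto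
  then show ?thesis
    using convex_closure_rel_interior[OF fdD(4)] fdD(5) by (simp add: compact_imp_closed closure_closed)
next
  case False
  then obtain x where x: "x \<in> rel_interior F" "x \<in> D" by blast
  obtain T a n c where T: "T \<in> \<T>" "F facet_of T" "facet_data T F a n c" using interface_cell[OF F] .
  note fdD = facet_dataD[OF T(3)]
  have nn: "n \<bullet> n = 1" using fdD(1) by (simp add: dot_square_norm)
  have xF: "x \<in> F" using x rel_interior_subset by blast
  \<comment> \<open>Points just beyond \<open>F\<close> are in \<open>D\<close> but not in
    \<open>T\<close>, so they lie in \<open>U\<close>. Finitely many closed cells have a closed
    union, hence \<open>x\<close> itself lies in another cell.\<close>
  define U where "U = \<Union>(\<T> - {T})"
  have "closed U" unfolding U_def using finite_mesh cell_compact(3) by (intro closed_Union) auto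
  define y where "y m = x + inverse (real (Suc m)) *\<^sub>R n" for m
  have ylim: "y \<longlonglongrightarrow> x"
  proof -
    have "y \<longlonglongrightarrow> x + 0 *\<^sub>R n" unfolding y_def by (intro tendsto_intros LIMSEQ_inverse_real_of_nat)
    then show ?thesis by simp
  qed
  have "eventually (\<lambda>m. y m \<in> U) sequentially"
    using topological_tendstoD[OF ylim D(1) x(2)]
  proof eventually_elim
    case (elim m)
    have "n \<bullet> y m = c + inverse (real (Suc m))"
      using nn facet_level[OF T(3) xF] by (simp add: y_def inner_add_right)
    moreover have "inverse (real (Suc m)) > 0" by simp
    ultimately have "\<not> n \<bullet> y m \<le> c" by linarith
    then have "y m \<notin> T" using facet_cell_le[OF T(3)] by blast
    moreover have "y m \<in> \<Union>\<T>" using elim closure_subset cells_cover by blast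
    ultimately show ?case by (auto simp: U_def)
  qed
  then have "x \<in> U" by (intro Lim_in_closed_set[OF \<open>closed U\<close> _ _ ylim]) auto
  then obtain T' where T': "T' \<in> \<T>" "T' \<noteq> T" "x \<in> T'" by (auto simp: U_def)
  have "F \<subseteq> T \<inter> T'"
    by (rule subset_of_face_of[OF cell_Int_face[OF T(1) T'(1)] facet_cell_subset[OF T(3)]])
      (use x xF T' facet_cell_subset[OF T(3)] in auto)
  then have F': "F facet_of T'" using facet_of_other_cell[OF T(1) T'(1) T(2)] by blast
  obtain a' n' c' where fd': "facet_data T' F a' n' c'"
    using facet_data_facet_of[OF cell_simplex[OF T'(1)] F'] .
  have "n' = n \<or> n' = - n"
    by (rule unit_normal_unique[OF fdD(1) facet_dataD(1)[OF fd'] fdD(2)]) (simp add: facet_level[OF fd'])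
  \<comment> \<open>With equal normals both cells would contain the same half ball at
    \<open>x\<close>, against the disjointness of their interiors.\<close>
  moreover have "n' \<noteq> n"
  proof
    assume eq: "n' = n"
    then have ceq: "c' = c" using facet_level[OF fd' xF] facet_level[OF T(3) xF] by simp
    obtain r where r: "r > 0" "\<And>y. dist y x < r \<Longrightarrow> n \<bullet> y \<le> c \<Longrightarrow> y \<in> T"
      using facet_half_ball[OF T(3) x(1)] by metis
    obtain r' where r': "r' > 0" "\<And>y. dist y x < r' \<Longrightarrow> n \<bullet> y \<le> c \<Longrightarrow> y \<in> T'"
      using facet_half_ball[OF fd' x(1)] unfolding eq ceq by metis
    define V where "V = ball x (min r r') \<inter> {y. n \<bullet> y < c}"
    have V: "open V" "V \<subseteq> T" "V \<subseteq> T'"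
      using r(2) r'(2) by (auto simp: V_def dist_commute open_halfspace_lt intro!: open_Int)
    have "x - (min r r' / 2) *\<^sub>R n \<in> V"
      using r(1) r'(1) fdD(1) nn facet_level[OF T(3) xF] by (auto simp: V_def dist_norm inner_diff_right min_def)
    then have "interior T \<inter> interior T' \<noteq> {}" using V interior_maximal by blast
    then show False using cells_interior_disjoint[OF T(1) T'(1)] T'(2) by blast
  qed
  ultimately have n': "n' = - n" by blast
  then have c': "c' = - c" using facet_level[OF fd' xF] facet_level[OF T(3) xF] by simp
  \<comment> \<open>The two half balls place \<open>z\<close> in the interior of the closure of
    \<open>D\<close>, which is \<open>D\<close> by the Lipschitz boundary.\<close>
  have "rel_interior F \<subseteq> D"
  proof
    fix z assume z: "z \<in> rel_interior F"
    obtain r where r: "r > 0" "\<And>y. dist y z < r \<Longrightarrow> n \<bullet> y \<le> c \<Longrightarrow> y \<in> T"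
      using facet_half_ball[OF T(3) z] by metis
    obtain r' where r': "r' > 0" "\<And>y. dist y z < r' \<Longrightarrow> (- n) \<bullet> y \<le> - c \<Longrightarrow> y \<in> T'"
      using facet_half_ball[OF fd' z] unfolding n' c' by metis
    have "ball z (min r r') \<subseteq> T \<union> T'"
    proof
      fix y assume "y \<in> ball z (min r r')"
      then have "dist y z < r" "dist y z < r'" by (auto simp: dist_commute)
      then show "y \<in> T \<union> T'" using r(2)[of y] r'(2)[of y] by (cases "n \<bullet> y \<le> c") auto
    qed
    also have "\<dots> \<subseteq> closure D" using T(1) T'(1) cells_cover by blast
    finally have "z \<in> interior (closure D)" using r(1) r'(1) by (auto simp: mem_interior intro!: exI[of _ "min r r'"])
    then show "z \<in> D" by (simp add: interior_closure)
  qed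
  then show ?thesis ..
qed

lemma interface_cases:
  assumes F: "F \<in> interfaces \<T>"
  shows "F \<in> boundary_interfaces D \<T> \<or> (AE x in facet_measure F. x \<in> D)"
proof -
  obtain T a n c where T: "T \<in> \<T>" "F facet_of T" "facet_data T F a n c" using interface_cell[OF F] .
  from interface_rel_interior_cases[OF F] show ?thesis
  proof
    assume "rel_interior F \<subseteq> D"
    with facet_AE_rel_interior[OF T(3)] have "AE x in facet_measure F. x \<in> D" by (auto elim: eventually_mono)
    then show ?thesis ..
  qed (use F in \<open>simp add: boundary_interfaces_def\<close>)
qed

lemma AE_cells_interior: "AE x in lebesgue. \<forall>T\<in>\<T>. x \<in> T \<longleftrightarrow> x \<in> interior T"
  using finite_mesh by (intro AE_finite_allI AE_interior_convex cell_compact) auto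

text \<open>Each cell carries its own representative \<open>gT T\<close>, since the coefficient and
  the weak gradients are identified cell by cell and only almost everywhere. Overlaps of cells are
  null, being confined to their frontiers.\<close>

lemma integral_split_cells:
  fixes g :: "real^'n \<Rightarrow> real"
  assumes eq: "\<And>T. T \<in> \<T> \<Longrightarrow> AE x in lebesgue_on T. g x = gT T x"
    and int: "\<And>T. T \<in> \<T> \<Longrightarrow> integrable (lebesgue_on T) (gT T)"
  shows "(LINT x|lebesgue_on D. g x) = (\<Sum>T\<in>\<T>. LINT x|lebesgue_on T. gT T x)"
proof -
  have sT: "T \<in> sets lebesgue" if "T \<in> \<T>" for T using cell_compact(3)[OF that] by auto
  have "AE x in lebesgue. \<forall>T\<in>\<T>. x \<in> T \<longrightarrow> g x = gT T x"
    using finite_mesh eq sT by (intro AE_finite_allI) (auto simp: AE_lebesgue_on)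
  with AE_cells_interior have "AE x in lebesgue. indicator D x * g x = (\<Sum>T\<in>\<T>. indicator T x * gT T x)"
  proof eventually_elim
    case (elim x)
    show ?case
    proof (cases "x \<in> D")
      case True
      then have "x \<in> \<Union>\<T>" using closure_subset cells_cover by blast
      then obtain T where T: "T \<in> \<T>" "x \<in> T" by blast
      have "indicator S x * gT S x = (if S = T then g x else 0)" if "S \<in> \<T>" for S
      proof (cases "S = T")
        case True
        then show ?thesis using T elim by simp
      next
        case False
        have "x \<in> interior T" using T elim by blast
        then have "x \<notin> interior S" using cells_interior_disjoint[OF that T(1) False] by blast
        then have "x \<notin> S" using elim that by blast
        with False show ?thesis by simp
      qed
      then have "(\<Sum>S\<in>\<T>. indicator S x * gT S x) = (\<Sum>S\<in>\<T>. if S = T then g x else 0)" by (intro sum.cong) auto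
      also have "\<dots> = g x" using T finite_mesh by simp
      finally show ?thesis using True by simp
    next
      case False
      have "x \<notin> T" if "T \<in> \<T>" for T
        using elim(1)[rule_format, OF that] cell_interior_subset[OF that] False by blast
      then have "(\<Sum>T\<in>\<T>. indicator T x * gT T x) = 0" by (intro sum.neutral) simp
      then show ?thesis using False by simp
    qed
  qed
  then have "(LINT x|lebesgue. indicator D x * g x) = (LINT x|lebesgue. (\<Sum>T\<in>\<T>. indicator T x * gT T x))"
    by (rule integral_lebesgue_cong_AE)
  also have "\<dots> = (\<Sum>T\<in>\<T>. LINT x|lebesgue. indicator T x * gT T x)"
    using int sT by (intro Bochner_Integration.integral_sum) (simp add: lebesgue_on_integrable_eq)
  finally show ?thesis using D(1) sT by (simp add: lebesgue_on_integral_eq)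
qed

lemma broken_grad_eq:
  assumes "T \<in> \<T>" "x \<in> interior T"
  shows "broken_grad \<T> w x = weak_grad (interior T) w x"
proof -
  have "(if x \<in> interior S then weak_grad (interior S) w x else 0) = (if S = T then weak_grad (interior T) w x else 0)"
    if "S \<in> \<T>" for S using that assms cells_interior_disjoint[OF that assms(1)] by auto
  then have "broken_grad \<T> w x = (\<Sum>S\<in>\<T>. if S = T then weak_grad (interior T) w x else 0)"
    unfolding broken_grad_def by (intro sum.cong) auto
  then show ?thesis using assms finite_mesh by simp
qed

text \<open>\<open>cell_value\<close> is a definite description; it denotes because a cell has
  positive volume, so two different constants cannot both hold almost everywhere.\<close>

lemma AE_cell_value:
  assumes \<kappa>: "piecewise_constant \<T> \<kappa>" and T: "T \<in> \<T>"
  shows "AE x in lebesgue_on T. \<kappa> x = cell_value \<kappa> T"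
proof -
  obtain M where M: "AE x in lebesgue_on T. \<kappa> x = M" using \<kappa> T by (auto simp: piecewise_constant_def)
  have nz: "\<not> (AE x in lebesgue_on T. False)"
  proof
    assume "AE x in lebesgue_on T. False"
    then have "AE x in lebesgue. x \<notin> interior T"
      using cell_compact(3)[OF T] interior_subset[of T] by (auto simp: AE_lebesgue_on elim: eventually_mono)
    then have "negligible (interior T)"
      unfolding negligible_iff_null_sets using AE_iff_null_sets[of "interior T" lebesgue] by simp
    then show False
      using open_not_negligible[OF open_interior simplex_interior_nonempty[OF cell_simplex[OF T]]] by simp
  qed
  have "M' = M" if "AE x in lebesgue_on T. \<kappa> x = M'" for M'
  proof (rule ccontr)
    assume "M' \<noteq> M"
    from that M have "AE x in lebesgue_on T. \<kappa> x = M' \<and> \<kappa> x = M" by (rule AE_conjI)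
    then have "AE x in lebesgue_on T. False" by (rule eventually_mono) (use \<open>M' \<noteq> M\<close> in auto)
    with nz show False by blast
  qed
  then have "cell_value \<kappa> T = M" unfolding cell_value_def by (rule the_equality[of "\<lambda>M. AE x in lebesgue_on T. \<kappa> x = M", OF M])
  with M show ?thesis by simp
qed

end

section \<open>Green's formula for the flux on a cell\<close>

lemma integrable_lebesgue_on_subset:
  fixes g :: "'a::euclidean_space \<Rightarrow> real"
  assumes S: "S \<in> sets lebesgue" "K \<in> sets lebesgue" "K \<subseteq> S" and g: "integrable (lebesgue_on S) g"
  shows "integrable (lebesgue_on K) g"
proof -
  have "integrable lebesgue (\<lambda>x. indicator K x *\<^sub>R (indicator S x * g x))"
    using g S by (intro integrable_mult_indicator) (auto simp: lebesgue_on_integrable_eq)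
  moreover have "indicator K x *\<^sub>R (indicator S x * g x) = indicator K x * g x" for x
    using S(3) by (auto simp: indicator_def)
  ultimately have "integrable lebesgue (\<lambda>x. indicator K x * g x)" by (simp only:)
  then show ?thesis using S by (simp add: lebesgue_on_integrable_eq)
qed

lemma integrable_imp_locally_integrable:
  assumes "integrable (lebesgue_on D) g" "D \<in> sets lebesgue"
  shows "locally_integrable D g"
  unfolding locally_integrable_def
  using integrable_lebesgue_on_subset[OF assms(2) _ _ assms(1)] by (auto simp: compact_imp_closed)

lemma integrable_lebesgue_on_interior:
  fixes T :: "'a::euclidean_space set" and f :: "'a \<Rightarrow> real"
  assumes T: "convex T" "closed T" and f: "integrable (lebesgue_on (interior T)) f"
  shows "integrable (lebesgue_on T) f"
proof -
  have i: "integrable lebesgue (\<lambda>x. indicator (interior T) x * f x)"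
    using f by (simp add: lebesgue_on_integrable_eq)
  have eq: "AE x in lebesgue. indicator (interior T) x * f x = indicator T x * f x"
    using AE_interior_convex[OF T] by eventually_elim (simp add: indicator_def)
  have "(\<lambda>x. indicator T x * f x) \<in> borel_measurable lebesgue"
    by (rule measurable_completion_cong_AE[OF borel_measurable_integrable[OF i] eq]) simp
  then have "integrable lebesgue (\<lambda>x. indicator T x * f x)"
    by (rule Bochner_Integration.integrable_cong_AE_imp[OF i]) (rule eq)
  then show ?thesis using T by (simp add: lebesgue_on_integrable_eq)
qed

lemma integral_lebesgue_on_cong_AE:
  fixes f g :: "'a::euclidean_space \<Rightarrow> real"
  assumes S: "S \<in> sets lebesgue" and eq: "AE x in lebesgue_on S. f x = g x"
  shows "(LINT x|lebesgue_on S. f x) = (LINT x|lebesgue_on S. g x)"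
proof -
  have "AE x in lebesgue. indicator S x * f x = indicator S x * g x"
    using eq S by (auto simp: AE_lebesgue_on indicator_def elim: eventually_mono)
  from integral_lebesgue_cong_AE[OF this] show ?thesis by (simp add: lebesgue_on_integral_eq S)
qed

lemma square_integrable_cmult: "square_integrable M f \<Longrightarrow> square_integrable M (\<lambda>x. c * f x)"
  by (auto simp: square_integrable_def power_mult_distrib)

lemma square_integrable_zero: "square_integrable M (\<lambda>x. 0)"
  by (simp add: square_integrable_def)

lemma square_integrable_add:
  assumes "square_integrable M f" "square_integrable M g"
  shows "square_integrable M (\<lambda>x. f x + g x)"
  using square_integrable_diff[OF assms(1) square_integrable_cmult[OF assms(2), of "-1"]] by simp

lemma square_integrable_sum:
  "(\<And>i. i \<in> I \<Longrightarrow> square_integrable M (f i)) \<Longrightarrow> square_integrable M (\<lambda>x. \<Sum>i\<in>I. f i x)"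
  by (induction I rule: infinite_finite_induct) (auto intro: square_integrable_zero square_integrable_add)

lemma matrix_vector_inner:
  fixes K :: "real^'n^'n"
  shows "(K *v g) \<bullet> y = (\<Sum>i\<in>UNIV. \<Sum>j\<in>UNIV. K $ i $ j * (g $ j * y $ i))"
  by (simp add: inner_vec_def matrix_vector_mult_def sum_distrib_right mult.assoc)

text \<open>The divergence of \<open>K\<close> times the gradient of \<open>u\<close>, for a
  constant matrix \<open>K\<close>, written entry by entry so that only weak derivatives of scalar
  functions occur.\<close>

definition flux_divergence :: "real^'n^'n \<Rightarrow> (real^'n) set \<Rightarrow> (real^'n \<Rightarrow> real) \<Rightarrow> real^'n \<Rightarrow> real" where
  "flux_divergence K T u x = (\<Sum>i\<in>UNIV. \<Sum>j\<in>UNIV. K $ i $ j *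
     weak_pderivative (interior T) i (weak_pderivative (interior T) j u) x)"

definition normal_flux :: "(real^'n \<Rightarrow> real^'n^'n) \<Rightarrow> (real^'n \<Rightarrow> real) \<Rightarrow> (real^'n) set \<Rightarrow> (real^'n) set \<Rightarrow> real^'n \<Rightarrow> real" where
  "normal_flux \<kappa> u T F x = cell_flux \<kappa> u T F x \<bullet> outward_normal T F"

lemma flux_divergence_square_integrable:
  assumes u: "sobolev 2 (interior T) u"
  shows "square_integrable (lebesgue_on (interior T)) (flux_divergence K T u)"
  unfolding flux_divergence_def
  by (intro square_integrable_sum square_integrable_cmult sobolev_1_weak_pderivative(3)[OF open_interior]
      sobolev_2_imp_sobolev_1(2)[OF open_interior u])

lemma normal_flux_square_integrable:
  assumes fd: "facet_data T F a n c" and u: "sobolev 2 (interior T) u"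
  shows "square_integrable (facet_measure F) (normal_flux \<kappa> u T F)"
  unfolding normal_flux_def cell_flux_def matrix_vector_inner
proof (intro square_integrable_sum square_integrable_cmult)
  fix i j
  have "square_integrable (facet_measure F) (trace_on (interior T) F (weak_pderivative (interior T) j u))"
    using facet_has_trace_trace_on[OF fd sobolev_2_imp_sobolev_1(2)[OF open_interior u]] by (auto simp: has_trace_def)
  from square_integrable_cmult[OF this, of "outward_normal T F $ i"]
  show "square_integrable (facet_measure F) (\<lambda>x.
      (\<chi> i. trace_on (interior T) F (weak_pderivative (interior T) i u) x) $ j * outward_normal T F $ i)"
    by (simp add: mult.commute)
qed

lemma square_integrable_interior_mult_smooth:
  fixes T :: "(real^'n) set"
  assumes T: "int CARD('n) simplex T" and g: "square_integrable (lebesgue_on (interior T)) g" and p: "smooth p"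
  shows "integrable (lebesgue_on T) (\<lambda>x. g x * p x)"
proof -
  have Tc: "convex T" "closed T" "bounded T"
    using T compact_simplex[of _ T] by (auto simp: convex_simplex compact_imp_closed compact_imp_bounded)
  have "integrable (lebesgue_on (interior T)) (\<lambda>x. g x * p x)"
    using Tc bounded_subset[OF Tc(3) interior_subset] by (intro square_integrable_mult g smooth_square_integrable p) auto
  then show ?thesis by (rule integrable_lebesgue_on_interior[OF Tc(1,2)])
qed

lemma facet_square_integrable_mult_smooth:
  assumes fd: "facet_data T F a n c" and g: "square_integrable (facet_measure F) g" and p: "smooth p"
  shows "integrable (facet_measure F) (\<lambda>x. g x * p x)"
  by (intro square_integrable_mult g facet_smooth_square_integrable[OF fd p])

text \<open>Integration by parts in direction \<open>i\<close> is applied to each first derivative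
  \<open>?G j\<close>, which is in H1, and the results are added with the constant weights
  \<open>?K $ i $ j\<close>.\<close>

lemma simplex_green:
  fixes T :: "(real^'n) set"
  assumes T: "int CARD('n) simplex T" and u: "sobolev 2 (interior T) u" and p: "smooth p"
  shows "(LINT x|lebesgue_on T. (cell_value \<kappa> T *v weak_grad (interior T) u x) \<bullet> pgrad p x)
    = - (LINT x|lebesgue_on T. flux_divergence (cell_value \<kappa> T) T u x * p x)
      + (\<Sum>F | F facet_of T. LINT x|facet_measure F. normal_flux \<kappa> u T F x * p x)"
    "integrable (lebesgue_on T) (\<lambda>x. (cell_value \<kappa> T *v weak_grad (interior T) u x) \<bullet> pgrad p x)"
proof -
  let ?I = "interior T" and ?K = "cell_value \<kappa> T"
  let ?G = "\<lambda>j. weak_pderivative ?I j u"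
  have G: "sobolev 1 ?I (?G j)" for j by (rule sobolev_2_imp_sobolev_1(2)[OF open_interior u])
  note GD = sobolev_1_weak_pderivative[OF open_interior G]
  have i1: "integrable (lebesgue_on T) (\<lambda>x. ?G j x * pderivative i p x)" for i j
    by (intro square_integrable_interior_mult_smooth[OF T] GD smooth_pderivative p)
  have i2: "integrable (lebesgue_on T) (\<lambda>x. weak_pderivative ?I i (?G j) x * p x)" for i j
    by (intro square_integrable_interior_mult_smooth[OF T] GD p)
  have tr: "integrable (facet_measure F) (\<lambda>x. trace_on ?I F (?G j) x * p x)" if F: "F facet_of T" for F j
  proof -
    obtain a n c where fd: "facet_data T F a n c" using facet_data_facet_of[OF T F] .
    have "square_integrable (facet_measure F) (trace_on ?I F (?G j))"
      using facet_has_trace_trace_on[OF fd G] by (simp add: has_trace_def)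
    then show ?thesis by (rule facet_square_integrable_mult_smooth[OF fd _ p])
  qed
  have e1: "(?K *v weak_grad ?I u x) \<bullet> pgrad p x = (\<Sum>i\<in>UNIV. \<Sum>j\<in>UNIV. ?K $ i $ j * (?G j x * pderivative i p x))" for x
    by (simp add: matrix_vector_inner weak_grad_def pgrad_def)
  show "integrable (lebesgue_on T) (\<lambda>x. (?K *v weak_grad ?I u x) \<bullet> pgrad p x)"
    unfolding e1 by (intro Bochner_Integration.integrable_sum integrable_mult_right i1)
  have "(LINT x|lebesgue_on T. (?K *v weak_grad ?I u x) \<bullet> pgrad p x)
    = (\<Sum>i\<in>UNIV. \<Sum>j\<in>UNIV. ?K $ i $ j * (LINT x|lebesgue_on T. ?G j x * pderivative i p x))"
    unfolding e1
    by (subst Bochner_Integration.integral_sum, (intro Bochner_Integration.integrable_sum integrable_mult_right i1),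
      intro sum.cong refl, subst Bochner_Integration.integral_sum, (intro integrable_mult_right i1), simp)
  also have "\<dots> = (\<Sum>i\<in>UNIV. \<Sum>j\<in>UNIV. ?K $ i $ j *
     (- (LINT x|lebesgue_on T. weak_pderivative ?I i (?G j) x * p x)
      + (\<Sum>F | F facet_of T. outward_normal T F $ i * (LINT x|facet_measure F. trace_on ?I F (?G j) x * p x))))"
  proof (intro sum.cong refl arg_cong2[where f = "(*)"])
    fix i j
    show "(LINT x|lebesgue_on T. ?G j x * pderivative i p x) = - (LINT x|lebesgue_on T. weak_pderivative ?I i (?G j) x * p x)
      + (\<Sum>F | F facet_of T. outward_normal T F $ i * (LINT x|facet_measure F. trace_on ?I F (?G j) x * p x))"
      using simplex_integration_by_parts[OF T G p, of i j] by simp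
  qed
  also have "\<dots> = - (\<Sum>i\<in>UNIV. \<Sum>j\<in>UNIV. ?K $ i $ j * (LINT x|lebesgue_on T. weak_pderivative ?I i (?G j) x * p x))
      + (\<Sum>i\<in>UNIV. \<Sum>j\<in>UNIV. \<Sum>F | F facet_of T. ?K $ i $ j * (outward_normal T F $ i * (LINT x|facet_measure F. trace_on ?I F (?G j) x * p x)))"
    by (simp add: right_diff_distrib sum_subtractf sum_distrib_left)
  also have "(\<Sum>i\<in>UNIV. \<Sum>j\<in>UNIV. ?K $ i $ j * (LINT x|lebesgue_on T. weak_pderivative ?I i (?G j) x * p x))
     = (LINT x|lebesgue_on T. flux_divergence ?K T u x * p x)"
  proof -
    have e: "flux_divergence ?K T u x * p x = (\<Sum>i\<in>UNIV. \<Sum>j\<in>UNIV. ?K $ i $ j * (weak_pderivative ?I i (?G j) x * p x))" for x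
      by (simp add: flux_divergence_def sum_distrib_right mult.assoc)
    show ?thesis unfolding e
      by (subst Bochner_Integration.integral_sum, (intro Bochner_Integration.integrable_sum integrable_mult_right i2),
        intro sum.cong refl, subst Bochner_Integration.integral_sum, (intro integrable_mult_right i2), simp)
  qed
  also have "(\<Sum>i\<in>UNIV. \<Sum>j\<in>UNIV. \<Sum>F | F facet_of T. ?K $ i $ j * (outward_normal T F $ i * (LINT x|facet_measure F. trace_on ?I F (?G j) x * p x)))
     = (\<Sum>F | F facet_of T. \<Sum>i\<in>UNIV. \<Sum>j\<in>UNIV. ?K $ i $ j * (outward_normal T F $ i * (LINT x|facet_measure F. trace_on ?I F (?G j) x * p x)))"
    by (subst (2) sum.swap, subst sum.swap) simp
  also have "\<dots> = (\<Sum>F | F facet_of T. LINT x|facet_measure F. normal_flux \<kappa> u T F x * p x)"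
  proof (rule sum.cong[OF refl])
    fix F assume "F \<in> {F. F facet_of T}"
    then have F: "F facet_of T" by simp
    have e: "normal_flux \<kappa> u T F x * p x = (\<Sum>i\<in>UNIV. \<Sum>j\<in>UNIV. (?K $ i $ j * outward_normal T F $ i) * (trace_on ?I F (?G j) x * p x))" for x
      by (simp add: normal_flux_def cell_flux_def matrix_vector_inner sum_distrib_left sum_distrib_right mult_ac)
    show "(\<Sum>i\<in>UNIV. \<Sum>j\<in>UNIV. ?K $ i $ j * (outward_normal T F $ i * (LINT x|facet_measure F. trace_on ?I F (?G j) x * p x)))
      = (LINT x|facet_measure F. normal_flux \<kappa> u T F x * p x)"
      unfolding e
      by (subst Bochner_Integration.integral_sum, (intro Bochner_Integration.integrable_sum integrable_mult_right tr F),
        intro sum.cong refl, subst Bochner_Integration.integral_sum, (intro integrable_mult_right tr F), simp add: mult.assoc)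
  qed
  finally show "(LINT x|lebesgue_on T. (?K *v weak_grad ?I u x) \<bullet> pgrad p x)
    = - (LINT x|lebesgue_on T. flux_divergence ?K T u x * p x)
      + (\<Sum>F | F facet_of T. LINT x|facet_measure F. normal_flux \<kappa> u T F x * p x)" .
qed

section \<open>Consistency of the hybridized method\<close>

text \<open>The constant sequence is an exact approximation; it vanishes on the frontier because
  \<open>D\<close> is open and the support lies in \<open>D\<close>.\<close>

lemma test_function_sobolev0:
  assumes D: "open D" "bounded D" and \<phi>: "test_function D \<phi>"
  shows "sobolev0 1 D \<phi>" "AE x in lebesgue_on D. weak_grad D \<phi> x = pgrad \<phi> x"
proof -
  have s: "smooth \<phi>" by (rule test_function_smooth[OF \<phi>])
  have wp: "AE x in lebesgue_on D. weak_pderivative D i \<phi> x = pderivative i \<phi> x" for i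
    by (rule weak_pderivative_AE_eq[OF D(1) smooth_has_weak_pderivative[OF D(1) s]])
  then have "AE x in lebesgue_on D. \<forall>i\<in>UNIV. weak_pderivative D i \<phi> x = pderivative i \<phi> x"
    by (intro AE_finite_allI) auto
  then show "AE x in lebesgue_on D. weak_grad D \<phi> x = pgrad \<phi> x"
    by eventually_elim (simp add: weak_grad_def pgrad_def)
  have s1: "sobolev 1 D \<phi>" by (rule sobolev_1_smooth[OF D s])
  have "(\<integral>\<^sup>+x. ennreal ((pderivative i \<phi> x - weak_pderivative D i \<phi> x)\<^sup>2) \<partial>lebesgue_on D) = (\<integral>\<^sup>+x. 0 \<partial>lebesgue_on D)" for i
    using wp[of i] by (intro nn_integral_cong_AE) (auto elim: eventually_mono)
  then have ap: "smooth_H1_approx D (\<lambda>_. \<phi>) \<phi>" using s by (simp add: smooth_H1_approx_def)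
  have z: "\<phi> x = 0" if "x \<in> frontier D" for x
    using that D(1) test_function_eq_0[OF \<phi>] by (auto simp: frontier_def interior_open)
  have "(\<integral>\<^sup>+x. ennreal ((\<phi> x)\<^sup>2) \<partial>restrict_space (hyperplane_measure n c) (frontier D)) = 0" for n c
  proof -
    have "(\<integral>\<^sup>+x. ennreal ((\<phi> x)\<^sup>2) \<partial>restrict_space (hyperplane_measure n c) (frontier D))
      = (\<integral>\<^sup>+x. 0 \<partial>restrict_space (hyperplane_measure n c) (frontier D))"
      using z by (intro nn_integral_cong) (simp add: space_restrict_space)
    then show ?thesis by simp
  qed
  then have "zero_boundary_trace D \<phi>"
    unfolding zero_boundary_trace_def using s1 ap by (intro conjI exI[of _ "\<lambda>_. \<phi>"]) auto
  with s1 show "sobolev0 1 D \<phi>" by (simp add: sobolev0_def)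
qed

context mesh
begin

text \<open>The sequence contained in \<open>zero_boundary_trace\<close> approximates
  \<open>u\<close> on the whole domain and hence on the cell. The existence of a trace for the cell
  shows that it converges on \<open>F\<close>, so \<open>trace_on D\<close> has a trace to choose;
  this choice is also a trace for the cell, where traces are unique.\<close>

lemma trace_on_domain_eq_cell:
  assumes u: "zero_boundary_trace D u" and T: "T \<in> \<T>" "F facet_of T"
  shows "AE x in facet_measure F. trace_on D F u x = trace_on (interior T) F u x"
proof -
  obtain a n c where fd: "facet_data T F a n c" using facet_data_facet_of[OF cell_simplex[OF T(1)] T(2)] .
  note sub = D(1) open_interior cell_interior_subset[OF T(1)]
  obtain \<phi> where \<phi>: "sobolev 1 D u" "smooth_H1_approx D \<phi> u" using u by (auto simp: zero_boundary_trace_def)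
  have \<phi>T: "smooth_H1_approx (interior T) \<phi> u" by (rule smooth_H1_approx_subset[OF sub \<phi>])
  have uT: "sobolev 1 (interior T) u" by (rule sobolev_1_subset(1)[OF sub \<phi>(1)])
  obtain g where g: "square_integrable (facet_measure F) g"
     "(\<lambda>j. \<integral>\<^sup>+x. ennreal ((\<phi> j x - g x)\<^sup>2) \<partial>facet_measure F) \<longlonglongrightarrow> 0"
    using facet_trace_exists[OF fd uT \<phi>T] by blast
  then have "has_trace D F u g" using \<phi> by (auto simp: has_trace_def)
  then have "has_trace D F u (trace_on D F u)" by (rule has_trace_trace_on)
  then obtain \<theta> where "smooth_H1_approx D \<theta> u" "square_integrable (facet_measure F) (trace_on D F u)"
     "(\<lambda>j. \<integral>\<^sup>+x. ennreal ((\<theta> j x - trace_on D F u x)\<^sup>2) \<partial>facet_measure F) \<longlonglongrightarrow> 0"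
    by (auto simp: has_trace_def)
  then have "has_trace (interior T) F u (trace_on D F u)"
    using smooth_H1_approx_subset[OF sub \<phi>(1)] uT by (auto simp: has_trace_def)
  from facet_trace_on_AE_eq[OF fd this] show ?thesis by eventually_elim simp
qed

text \<open>Test functions have zero trace and are thus admissible in the weak problem; on each cell
  the weak gradients over \<open>D\<close> and over the cell agree almost everywhere, and the
  coefficient equals its cell value.\<close>

lemma weak_form_on_cells:
  assumes \<kappa>: "piecewise_constant \<T> \<kappa>" and u: "weak_solution D \<kappa> f u" and u2: "broken_H2 \<T> u"
    and f: "square_integrable (lebesgue_on D) f" and \<phi>: "test_function D \<phi>"
  shows "(\<Sum>T\<in>\<T>. LINT x|lebesgue_on T. (cell_value \<kappa> T *v weak_grad (interior T) u x) \<bullet> pgrad \<phi> x)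
    = (\<Sum>T\<in>\<T>. LINT x|lebesgue_on T. f x * \<phi> x)"
proof -
  have s: "smooth \<phi>" by (rule test_function_smooth[OF \<phi>])
  have u1: "sobolev 1 D u" using u by (simp add: weak_solution_def sobolev0_def zero_boundary_trace_def)
  have sT: "T \<in> sets lebesgue" if "T \<in> \<T>" for T using cell_compact(3)[OF that] by auto
  have toT: "AE x in lebesgue_on T. P x" if T: "T \<in> \<T>" and P: "AE x in lebesgue_on (interior T). P x" for T P
  proof -
    have "AE x in lebesgue. x \<in> interior T \<longrightarrow> P x" using P by (simp add: AE_lebesgue_on)
    with AE_interior_convex[OF cell_compact(2)[OF T] cell_compact(3)[OF T]]
    have "AE x in lebesgue. x \<in> T \<longrightarrow> P x" by eventually_elim blast
    then show ?thesis using sT[OF T] by (simp add: AE_lebesgue_on)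
  qed
  have "(LINT x|lebesgue_on D. (\<kappa> x *v weak_grad D u x) \<bullet> weak_grad D \<phi> x)
    = (\<Sum>T\<in>\<T>. LINT x|lebesgue_on T. (cell_value \<kappa> T *v weak_grad (interior T) u x) \<bullet> pgrad \<phi> x)"
  proof (rule integral_split_cells)
    fix T assume T: "T \<in> \<T>"
    note sub = D(1) open_interior cell_interior_subset[OF T]
    show "integrable (lebesgue_on T) (\<lambda>x. (cell_value \<kappa> T *v weak_grad (interior T) u x) \<bullet> pgrad \<phi> x)"
      using u2 T by (intro simplex_green(2) cell_simplex s) (auto simp: broken_H2_def)
    have "AE x in lebesgue_on (interior T). \<forall>i\<in>UNIV. weak_pderivative (interior T) i u x = weak_pderivative D i u x"
      using sobolev_1_subset(2)[OF sub u1] by (intro AE_finite_allI) auto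
    then have 1: "AE x in lebesgue_on (interior T). weak_grad D u x = weak_grad (interior T) u x"
      by eventually_elim (simp add: weak_grad_def)
    have "AE x in lebesgue. x \<in> D \<longrightarrow> weak_grad D \<phi> x = pgrad \<phi> x"
      using test_function_sobolev0(2)[OF D(1,3) \<phi>] D(1) by (simp add: AE_lebesgue_on)
    then have "AE x in lebesgue. x \<in> interior T \<longrightarrow> weak_grad D \<phi> x = pgrad \<phi> x"
      by eventually_elim (use sub in blast)
    then have 2: "AE x in lebesgue_on (interior T). weak_grad D \<phi> x = pgrad \<phi> x" by (simp add: AE_lebesgue_on)
    from toT[OF T 1] toT[OF T 2] AE_cell_value[OF \<kappa> T]
    show "AE x in lebesgue_on T. (\<kappa> x *v weak_grad D u x) \<bullet> weak_grad D \<phi> x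
       = (cell_value \<kappa> T *v weak_grad (interior T) u x) \<bullet> pgrad \<phi> x"
      by eventually_elim simp
  qed
  moreover have "(LINT x|lebesgue_on D. f x * \<phi> x) = (\<Sum>T\<in>\<T>. LINT x|lebesgue_on T. f x * \<phi> x)"
  proof (rule integral_split_cells)
    fix T assume T: "T \<in> \<T>"
    have "integrable (lebesgue_on D) (\<lambda>x. f x * \<phi> x)"
      using D by (intro square_integrable_mult f smooth_square_integrable s) auto
    then have "integrable (lebesgue_on (interior T)) (\<lambda>x. f x * \<phi> x)"
      by (rule integrable_lebesgue_on_subset[rotated 3]) (use D(1) cell_interior_subset[OF T] in auto)
    then show "integrable (lebesgue_on T) (\<lambda>x. f x * \<phi> x)"
      by (rule integrable_lebesgue_on_interior[OF cell_compact(2)[OF T] cell_compact(3)[OF T]])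
  qed simp
  moreover have "(LINT x|lebesgue_on D. (\<kappa> x *v weak_grad D u x) \<bullet> weak_grad D \<phi> x) = (LINT x|lebesgue_on D. f x * \<phi> x)"
    using u test_function_sobolev0(1)[OF D(1,3) \<phi>] by (simp add: weak_solution_def)
  ultimately show ?thesis by simp
qed

lemma square_integrable_cell_interior:
  assumes f: "square_integrable (lebesgue_on D) f" and T: "T \<in> \<T>"
  shows "square_integrable (lebesgue_on (interior T)) f"
proof -
  have E: "lebesgue_on (interior T) = restrict_space (lebesgue_on D) (interior T)"
    using D(1) cell_interior_subset[OF T] by (subst restrict_restrict_space) (auto simp: Int_absorb1)
  have "f \<in> borel_measurable (lebesgue_on (interior T))"
  proof -
    have "f \<in> borel_measurable (lebesgue_on D)" using f by (simp add: square_integrable_def)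
    then show ?thesis unfolding E by (rule measurable_restrict_space1)
  qed
  moreover have "integrable (lebesgue_on (interior T)) (\<lambda>x. (f x)\<^sup>2)"
    by (rule integrable_lebesgue_on_subset[OF _ _ cell_interior_subset[OF T]])
      (use f D(1) in \<open>simp_all add: square_integrable_def\<close>)
  ultimately show ?thesis by (simp add: square_integrable_def)
qed

lemma strong_equation_on_cell:
  assumes \<kappa>: "piecewise_constant \<T> \<kappa>" and u: "weak_solution D \<kappa> f u" and u2: "broken_H2 \<T> u"
    and f: "square_integrable (lebesgue_on D) f" and T: "T \<in> \<T>"
  shows "AE x in lebesgue_on (interior T). - flux_divergence (cell_value \<kappa> T) T u x = f x"
proof -
  let ?I = "interior T" and ?d = "flux_divergence (cell_value \<kappa> T) T u"
  have uT: "sobolev 2 (interior S) u" if "S \<in> \<T>" for S using u2 that by (auto simp: broken_H2_def)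
  have bd: "bounded ?I" using cell_compact(1)[OF T] by (intro bounded_subset[OF compact_imp_bounded interior_subset])
  have fin: "finite_measure (lebesgue_on ?I)" by (rule bounded_lebesgue_finite_measure[OF bd]) simp
  have sq: "square_integrable (lebesgue_on ?I) ?d" "square_integrable (lebesgue_on ?I) f"
    using flux_divergence_square_integrable[OF uT[OF T]] square_integrable_cell_interior[OF f T] by auto
  have "AE x in lebesgue_on ?I. ?d x + f x = 0"
  proof (rule AE_lebesgue_zero_if_test_integrals_zero[OF open_interior])
    show "locally_integrable ?I (\<lambda>x. ?d x + f x)"
      using square_integrable_imp_integrable_finite[OF fin square_integrable_add[OF sq]]
      by (intro integrable_imp_locally_integrable) auto
    fix \<phi> assume \<phi>: "test_function ?I \<phi>"
    have s: "smooth \<phi>" by (rule test_function_smooth[OF \<phi>])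
    have \<phi>D: "test_function D \<phi>" by (rule test_function_mono[OF \<phi> cell_interior_subset[OF T]])
    \<comment> \<open>The intersection with another cell is a proper face of \<open>T\<close> and so
      misses the interior of \<open>T\<close>, where \<open>\<phi>\<close> is supported. Only the
      integrals over \<open>T\<close> survive.\<close>
    have zero: "\<phi> x = 0" if "S \<in> \<T>" "S \<noteq> T" "x \<in> S" for S x
    proof (rule test_function_eq_0[OF \<phi>])
      have "T \<inter> S \<noteq> T" using that(1,2) T cell_Int_face[OF that(1) T] cell_eq_if_face by (metis Int_commute)
      then have "(T \<inter> S) \<inter> interior T = {}" by (rule face_of_disjoint_interior[OF cell_Int_face[OF T that(1)]])
      then show "x \<notin> ?I" using that(3) interior_subset by blast
    qed
    have facet0: "(\<Sum>F | F facet_of T. LINT x|facet_measure F. normal_flux \<kappa> u T F x * \<phi> x) = 0"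
    proof (rule sum.neutral, rule ballI)
      fix F assume "F \<in> {F. F facet_of T}"
      then have F: "F facet_of T" by simp
      then have "F \<inter> ?I = {}" by (intro face_of_disjoint_interior) (auto simp: facet_of_def)
      then have z: "\<phi> x = 0" if "x \<in> F" for x using that test_function_eq_0[OF \<phi>] by blast
      obtain a n c where fd: "facet_data T F a n c" using facet_data_facet_of[OF cell_simplex[OF T] F] .
      show "(LINT x|facet_measure F. normal_flux \<kappa> u T F x * \<phi> x) = 0"
        by (rule integral_eq_zero_AE, rule AE_I2) (simp add: z facet_space[OF fd])
    qed
    have L: "(\<Sum>S\<in>\<T>. LINT x|lebesgue_on S. (cell_value \<kappa> S *v weak_grad (interior S) u x) \<bullet> pgrad \<phi> x)
       = (LINT x|lebesgue_on T. (cell_value \<kappa> T *v weak_grad ?I u x) \<bullet> pgrad \<phi> x)"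
    proof -
      have "(LINT x|lebesgue_on S. (cell_value \<kappa> S *v weak_grad (interior S) u x) \<bullet> pgrad \<phi> x) = 0"
        if S: "S \<in> \<T> - {T}" for S
      proof -
        have "pgrad \<phi> x = 0" if "x \<in> interior S" for x
        proof -
          have "pderivative i \<phi> x = 0" for i
            by (rule pderivative_eq_0_open[OF open_interior that]) (use zero S interior_subset in blast)
          then show ?thesis by (simp add: pgrad_def vec_eq_iff)
        qed
        then show ?thesis
          unfolding integral_lebesgue_on_interior[OF cell_compact(2) cell_compact(3), OF DiffD1[OF S] DiffD1[OF S]]
          by (intro integral_eq_zero_AE AE_I2) simp
      qed
      then show ?thesis using sum.remove[OF finite_mesh T, of "\<lambda>S. LINT x|lebesgue_on S. (cell_value \<kappa> S *v weak_grad (interior S) u x) \<bullet> pgrad \<phi> x"] by simp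
    qed
    have R: "(\<Sum>S\<in>\<T>. LINT x|lebesgue_on S. f x * \<phi> x) = (LINT x|lebesgue_on T. f x * \<phi> x)"
    proof -
      have "(LINT x|lebesgue_on S. f x * \<phi> x) = 0" if S: "S \<in> \<T> - {T}" for S
        using zero S by (intro integral_eq_zero_AE AE_I2) auto
      then show ?thesis using sum.remove[OF finite_mesh T, of "\<lambda>S. LINT x|lebesgue_on S. f x * \<phi> x"] by simp
    qed
    have "- (LINT x|lebesgue_on T. ?d x * \<phi> x) = (LINT x|lebesgue_on T. f x * \<phi> x)"
      using weak_form_on_cells[OF \<kappa> u u2 f \<phi>D] simplex_green(1)[OF cell_simplex[OF T] uT[OF T] s, of \<kappa>] facet0
      unfolding L R by simp
    moreover have "(LINT x|lebesgue_on T. (?d x + f x) * \<phi> x) = (LINT x|lebesgue_on T. ?d x * \<phi> x) + (LINT x|lebesgue_on T. f x * \<phi> x)"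
      unfolding distrib_right
      by (intro Bochner_Integration.integral_add square_integrable_interior_mult_smooth[OF cell_simplex[OF T]] sq s)
    ultimately have "(LINT x|lebesgue_on T. (?d x + f x) * \<phi> x) = 0" by simp
    then show "(LINT x|lebesgue_on ?I. (?d x + f x) * \<phi> x) = 0"
      by (simp add: integral_lebesgue_on_interior[OF cell_compact(2)[OF T] cell_compact(3)[OF T]])
  qed
  then show ?thesis by eventually_elim simp
qed

text \<open>The equation inside the cell replaces the divergence by \<open>f\<close>, whatever the
  values of \<open>p\<close> on the facets. It is used with test functions that cross an interface
  and with the polynomial pieces of a discrete function.\<close>

lemma green_on_cell:
  assumes \<kappa>: "piecewise_constant \<T> \<kappa>" and u: "weak_solution D \<kappa> f u" and u2: "broken_H2 \<T> u"
    and f: "square_integrable (lebesgue_on D) f" and T: "T \<in> \<T>" and p: "smooth p"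
  shows "(LINT x|lebesgue_on T. (cell_value \<kappa> T *v weak_grad (interior T) u x) \<bullet> pgrad p x)
    = (LINT x|lebesgue_on T. f x * p x)
      + (\<Sum>F | F facet_of T. LINT x|facet_measure F. normal_flux \<kappa> u T F x * p x)"
proof -
  have uT: "sobolev 2 (interior T) u" using u2 T by (auto simp: broken_H2_def)
  have "(LINT x|lebesgue_on T. flux_divergence (cell_value \<kappa> T) T u x * p x) = (LINT x|lebesgue_on T. - (f x * p x))"
    unfolding integral_lebesgue_on_interior[OF cell_compact(2)[OF T] cell_compact(3)[OF T]]
  proof (rule integral_lebesgue_on_cong_AE)
    show "AE x in lebesgue_on (interior T). flux_divergence (cell_value \<kappa> T) T u x * p x = - (f x * p x)"
      using strong_equation_on_cell[OF \<kappa> u u2 f T]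
    proof eventually_elim
      case (elim x)
      then have "flux_divergence (cell_value \<kappa> T) T u x = - f x" by linarith
      then show ?case by simp
    qed
  qed simp
  then show ?thesis using simplex_green(1)[OF cell_simplex[OF T] uT p, of \<kappa>] by simp
qed

lemma sum_cells_facets_swap:
  "(\<Sum>T\<in>\<T>. \<Sum>F | F facet_of T. g T F) = (\<Sum>F\<in>interfaces \<T>. \<Sum>T | T \<in> \<T> \<and> F facet_of T. g T F)"
proof -
  have "(\<Sum>T\<in>\<T>. \<Sum>F | F facet_of T. g T F) = (\<Sum>T\<in>\<T>. \<Sum>F | F \<in> interfaces \<T> \<and> F facet_of T. g T F)"
    by (intro sum.cong refl) (auto simp: interfaces_def)
  also have "\<dots> = (\<Sum>F\<in>interfaces \<T>. \<Sum>T | T \<in> \<T> \<and> F facet_of T. g T F)"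
    by (rule sum.swap_restrict[OF finite_mesh finite_interfaces])
  finally show ?thesis .
qed

text \<open>Testing with functions supported away from all other interfaces isolates the flux jump on
  \<open>F\<close>.\<close>

lemma normal_flux_continuity:
  assumes \<kappa>: "piecewise_constant \<T> \<kappa>" and u: "weak_solution D \<kappa> f u" and u2: "broken_H2 \<T> u"
    and f: "square_integrable (lebesgue_on D) f" and F: "F \<in> interfaces \<T>" "F \<notin> boundary_interfaces D \<T>"
  shows "AE x in facet_measure F. (\<Sum>T | T \<in> \<T> \<and> F facet_of T. normal_flux \<kappa> u T F x) = 0"
proof -
  let ?q = "normal_flux \<kappa> u"
  define Q where "Q x = (\<Sum>T | T \<in> \<T> \<and> F facet_of T. ?q T F x)" for x
  obtain T0 a n c where T0: "T0 \<in> \<T>" "F facet_of T0" "facet_data T0 F a n c" using interface_cell[OF F(1)] .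
  have fin: "finite_measure (facet_measure F)" by (rule facet_finite_measure[OF T0(3)])
  have uT: "sobolev 2 (interior S) u" if "S \<in> \<T>" for S using u2 that by (auto simp: broken_H2_def)
  have q: "square_integrable (facet_measure F) (?q T F)" if T: "T \<in> \<T>" "F facet_of T" for T
  proof -
    obtain a n c where "facet_data T F a n c" using facet_data_facet_of[OF cell_simplex[OF T(1)] T(2)] .
    then show ?thesis by (rule normal_flux_square_integrable[OF _ uT[OF T(1)]])
  qed
  have Qs: "square_integrable (facet_measure F) Q"
    unfolding Q_def by (intro square_integrable_sum q) auto
  \<comment> \<open>Finitely many closed interfaces are removed, so \<open>U\<close> is open, and a
    test function on it sees the flux on \<open>F\<close> alone.\<close>
  define U where "U = D - \<Union>(interfaces \<T> - {F})"
  have cl: "closed F'" if F': "F' \<in> interfaces \<T>" for F'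
  proof -
    obtain T' a' n' c' where "facet_data T' F' a' n' c'" using interface_cell[OF F'] .
    from facet_dataD(5)[OF this] show ?thesis by (rule compact_imp_closed)
  qed
  have "closed (\<Union>(interfaces \<T> - {F}))" using finite_interfaces cl by (intro closed_Union) auto
  then have U: "open U" unfolding U_def using D(1) by (rule open_Diff[rotated])
  have M: "hyperplane_measure n c = completion (hyperplane_borel_measure n c)" by (rule hyperplane_measure_eq_completion)
  have Fs: "F \<in> sets (hyperplane_measure n c)" by (rule facet_sets[OF T0(3)])
  have fm: "facet_measure F = restrict_space (hyperplane_measure n c) F" by (rule facet_measure_data[OF T0(3)])
  \<comment> \<open>The fundamental lemma is applied to surface measure on the whole hyperplane of
    \<open>F\<close>, with the flux sum extended by zero off \<open>F\<close> and tested by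
    functions of the ambient space.\<close>
  have "AE x in completion (hyperplane_borel_measure n c). x \<in> U \<longrightarrow> indicator F x * Q x = 0"
  proof (rule AE_zero_if_test_integrals_zero[OF sets_hyperplane_borel_measure U])
    fix K assume K: "compact K" "K \<subseteq> U"
    have "integrable (facet_measure F) Q" by (rule square_integrable_imp_integrable_finite[OF fin Qs])
    then have "integrable (hyperplane_measure n c) (\<lambda>x. indicator F x *\<^sub>R Q x)"
      unfolding fm using Fs by (subst (asm) integrable_restrict_space) auto
    moreover have "K \<in> sets (hyperplane_measure n c)"
      unfolding M using K(1) by (simp add: compact_imp_closed)
    ultimately have "integrable (hyperplane_measure n c) (\<lambda>x. indicator K x *\<^sub>R (indicator F x *\<^sub>R Q x))"
      by (rule integrable_mult_indicator[rotated])
    then show "integrable (completion (hyperplane_borel_measure n c)) (\<lambda>x. indicator K x * (indicator F x * Q x))"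
      unfolding M by simp
  next
    fix \<phi> assume \<phi>: "test_function U \<phi>"
    have s: "smooth \<phi>" by (rule test_function_smooth[OF \<phi>])
    have \<phi>D: "test_function D \<phi>" by (rule test_function_mono[OF \<phi>]) (auto simp: U_def)
    \<comment> \<open>Summing Green's formula over the cells and subtracting the weak form leaves
      only the facet terms.\<close>
    have "(\<Sum>T\<in>\<T>. \<Sum>F' | F' facet_of T. LINT x|facet_measure F'. ?q T F' x * \<phi> x) = 0"
      using weak_form_on_cells[OF \<kappa> u u2 f \<phi>D] green_on_cell[OF \<kappa> u u2 f _ s] by (simp add: sum.distrib)
    then have "(\<Sum>F'\<in>interfaces \<T>. \<Sum>T | T \<in> \<T> \<and> F' facet_of T. LINT x|facet_measure F'. ?q T F' x * \<phi> x) = 0"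
      by (simp add: sum_cells_facets_swap)
    moreover have "(\<Sum>T | T \<in> \<T> \<and> F' facet_of T. LINT x|facet_measure F'. ?q T F' x * \<phi> x) = 0"
      if F': "F' \<in> interfaces \<T> - {F}" for F'
    proof (rule sum.neutral, rule ballI)
      fix T
      obtain T' a' n' c' where fd': "facet_data T' F' a' n' c'" using interface_cell[OF DiffD1[OF F']] .
      have "\<phi> x = 0" if "x \<in> F'" for x using that F' by (intro test_function_eq_0[OF \<phi>]) (auto simp: U_def)
      then show "(LINT x|facet_measure F'. ?q T F' x * \<phi> x) = 0"
        by (intro integral_eq_zero_AE AE_I2) (simp add: facet_space[OF fd'])
    qed
    ultimately have "(\<Sum>T | T \<in> \<T> \<and> F facet_of T. LINT x|facet_measure F. ?q T F x * \<phi> x) = 0"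
      using sum.remove[OF finite_interfaces F(1), of "\<lambda>F'. \<Sum>T | T \<in> \<T> \<and> F' facet_of T. LINT x|facet_measure F'. ?q T F' x * \<phi> x"] by simp
    then have "(LINT x|facet_measure F. (\<Sum>T | T \<in> \<T> \<and> F facet_of T. ?q T F x * \<phi> x)) = 0"
      by (subst Bochner_Integration.integral_sum)
        (auto intro!: facet_square_integrable_mult_smooth[OF T0(3)] q s)
    then have "(LINT x|facet_measure F. Q x * \<phi> x) = 0" by (simp add: Q_def sum_distrib_right)
    then have "(LINT x|hyperplane_measure n c. indicator F x *\<^sub>R (Q x * \<phi> x)) = 0"
      unfolding fm using Fs by (subst (asm) integral_restrict_space) auto
    then show "(LINT x|completion (hyperplane_borel_measure n c). indicator F x * Q x * \<phi> x) = 0"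
      unfolding M by (simp add: mult.assoc)
  qed
  then have "AE x in hyperplane_measure n c. x \<in> F \<longrightarrow> (x \<in> U \<longrightarrow> Q x = 0)"
    unfolding M by eventually_elim (auto simp: indicator_def)
  then have 1: "AE x in facet_measure F. x \<in> U \<longrightarrow> Q x = 0"
    unfolding fm using Fs by (subst AE_restrict_space_iff) auto
  have 2: "AE x in facet_measure F. x \<in> D" using interface_cases[OF F(1)] F(2) by blast
  have 3: "AE x in facet_measure F. \<forall>F'\<in>interfaces \<T> - {F}. x \<notin> F'"
    using finite_interfaces interfaces_AE_disjoint[OF F(1)] by (intro AE_finite_allI) auto
  \<comment> \<open>Almost every point of \<open>F\<close> is in \<open>U\<close>: \<open>F\<close>
    is not a boundary interface, so it lies in \<open>D\<close> up to a null set, and the other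
    interfaces meet it in null sets.\<close>
  from 1 2 3 have "AE x in facet_measure F. Q x = 0" by eventually_elim (auto simp: U_def)
  then show ?thesis by (simp add: Q_def)
qed

end

theorem lemma3p1:
  fixes \<Omega> :: "(real^'n) set" and \<T> :: "(real^'n) set set"
    and \<kappa> :: "real^'n \<Rightarrow> real^'n^'n" and f u uh :: "real^'n \<Rightarrow> real"
    and k :: nat and \<epsilon> s \<delta> \<alpha>0 C_tr :: real
  assumes "CARD('n) \<ge> 2"
    and "polyhedral_lipschitz_domain \<Omega>"
    and "admissible_coefficient \<Omega> \<kappa>"
    and "square_integrable (lebesgue_on \<Omega>) f"
    and "conforming_mesh \<Omega> \<T>" and "0 < mesh_size \<T>" and "mesh_size \<T> \<le> 1"
    and "piecewise_constant \<T> \<kappa>"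
    and "\<alpha>0 > 0" and "C_tr > 0" and "discrete_trace_constant k \<T> C_tr"
    and "\<epsilon> \<in> {0, 1, -1}"
    and "s > 3 / 2"
    and "weak_solution \<Omega> \<kappa> f u"
    and "(u, uh) \<in> continuous_space s \<Omega> \<T>"
    and "is_skeleton_restriction \<Omega> \<T> u uh"
  shows "\<forall>v \<in> hybrid_space k \<Omega> \<T>.
    bilinear_form \<T> \<kappa> (penalty \<alpha>0 C_tr \<delta> \<kappa>) \<epsilon> (u, uh) v = mesh_integral \<T> (\<lambda>x. f x * fst v x)"
proof
  fix v assume v: "v \<in> hybrid_space k \<Omega> \<T>"
  interpret mesh \<Omega> \<T>
    using assms(2,5) by unfold_locales (auto simp: polyhedral_lipschitz_domain_def)
  note \<kappa> = assms(8) and f = assms(4) and weak = assms(14)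
  have u2: "broken_H2 \<T> u" using assms(15) by (simp add: continuous_space_def)
  have u0: "zero_boundary_trace \<Omega> u" using weak by (simp add: weak_solution_def sobolev0_def)
  obtain vc vh where vv: "v = (vc, vh)" by (cases v)
  have vc: "square_integrable (lebesgue_on \<Omega>) vc"
    "\<And>T. T \<in> \<T> \<Longrightarrow> \<exists>p. polynomial_le k p \<and> (AE x in lebesgue_on T. vc x = p x)"
    and vh: "\<And>F. F \<in> interfaces \<T> \<Longrightarrow> square_integrable (facet_measure F) vh"
    "\<And>F. F \<in> boundary_interfaces \<Omega> \<T> \<Longrightarrow> AE x in facet_measure F. vh x = 0"
    using v by (auto simp: vv hybrid_space_def cell_space_def skeleton_space_def L2_skeleton_def)
  \<comment> \<open>A smooth representative of the discrete function on each cell, through which its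
    weak gradient and its traces are computed.\<close>
  obtain p where p: "\<And>T. T \<in> \<T> \<Longrightarrow> smooth (p T)" "\<And>T. T \<in> \<T> \<Longrightarrow> AE x in lebesgue_on T. vc x = p T x"
    using vc(2) polynomial_le_smooth by metis
  have fd: "\<exists>a n c. facet_data T F a n c" if "T \<in> \<T>" "F facet_of T" for T F
    using facet_data_facet_of[OF cell_simplex[OF that(1)] that(2)] by metis
  have iface: "F \<in> interfaces \<T>" if "T \<in> \<T>" "F facet_of T" for T F
    using that by (auto simp: interfaces_def)
  have sT: "T \<in> sets lebesgue" "interior T \<in> sets lebesgue" if "T \<in> \<T>" for T
    using cell_compact(3)[OF that] by auto
  have toI: "AE x in lebesgue_on (interior T). P x" if T: "T \<in> \<T>" and P: "AE x in lebesgue_on T. P x" for T P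
    using P sT[OF T] interior_subset[of T] by (auto simp: AE_lebesgue_on elim!: eventually_mono)
  have bdI: "bounded (interior T)" if "T \<in> \<T>" for T
    using cell_compact(1)[OF that] by (intro bounded_subset[OF compact_imp_bounded interior_subset])
  have vloc: "locally_integrable (interior T) vc" if T: "T \<in> \<T>" for T
  proof -
    have "integrable (lebesgue_on (interior T)) vc"
      by (intro square_integrable_imp_integrable_finite square_integrable_cell_interior[OF vc(1) T]
          bounded_lebesgue_finite_measure bdI[OF T]) simp
    then show ?thesis by (rule integrable_imp_locally_integrable) simp
  qed
  let ?q = "normal_flux \<kappa> u"
  have q: "square_integrable (facet_measure F) (?q T F)" if T: "T \<in> \<T>" "F facet_of T" for T F
    using fd[OF T] normal_flux_square_integrable u2 T(1) by (metis broken_H2_def)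
  \<comment> \<open>The skeleton part of \<open>u\<close> is its trace from the whole domain,
    whereas the jump uses the trace from the cell; the two agree almost everywhere on the
    facet.\<close>
  have jump_u: "AE x in facet_measure F. jump (u, uh) T F x = 0" if T: "T \<in> \<T>" "F facet_of T" for T F
  proof -
    have "AE x in facet_measure F. uh x = trace_on \<Omega> F u x"
      using assms(16) iface[OF T] by (simp add: is_skeleton_restriction_def)
    with trace_on_domain_eq_cell[OF u0 T] show ?thesis
      by eventually_elim (simp add: jump_def)
  qed
  \<comment> \<open>All almost-everywhere identifications take place in the interior of the cell,
    where \<open>broken_grad\<close> has a single nonzero summand.\<close>
  have volume: "(LINT x|lebesgue_on T. (\<kappa> x *v broken_grad \<T> u x) \<bullet> broken_grad \<T> vc x)
     = (LINT x|lebesgue_on T. f x * vc x) + (\<Sum>F | F facet_of T. LINT x|facet_measure F. ?q T F x * p T x)"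
    if T: "T \<in> \<T>" for T
  proof -
    have "AE x in lebesgue_on (interior T). \<forall>i\<in>UNIV. weak_pderivative (interior T) i vc x = pderivative i (p T) x"
      by (intro AE_finite_allI smooth_representative_weak_pderivative(2) open_interior bdI p vloc toI T) auto
    then have "AE x in lebesgue_on (interior T). weak_grad (interior T) vc x = pgrad (p T) x"
      by eventually_elim (simp add: weak_grad_def pgrad_def)
    moreover have "AE x in lebesgue_on (interior T). x \<in> interior T" by (rule AE_I2) simp
    moreover note toI[OF T AE_cell_value[OF \<kappa> T]]
    ultimately have "AE x in lebesgue_on (interior T). (\<kappa> x *v broken_grad \<T> u x) \<bullet> broken_grad \<T> vc x
        = (cell_value \<kappa> T *v weak_grad (interior T) u x) \<bullet> pgrad (p T) x"
      by eventually_elim (simp add: broken_grad_eq[OF T])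
    then have "(LINT x|lebesgue_on T. (\<kappa> x *v broken_grad \<T> u x) \<bullet> broken_grad \<T> vc x)
       = (LINT x|lebesgue_on T. (cell_value \<kappa> T *v weak_grad (interior T) u x) \<bullet> pgrad (p T) x)"
      unfolding integral_lebesgue_on_interior[OF cell_compact(2)[OF T] cell_compact(3)[OF T]]
      by (intro integral_lebesgue_on_cong_AE) simp_all
    also have "\<dots> = (LINT x|lebesgue_on T. f x * p T x) + (\<Sum>F | F facet_of T. LINT x|facet_measure F. ?q T F x * p T x)"
      by (rule green_on_cell[OF \<kappa> weak u2 f T p(1)[OF T]])
    also have "(LINT x|lebesgue_on T. f x * p T x) = (LINT x|lebesgue_on T. f x * vc x)"
    proof (rule integral_lebesgue_on_cong_AE[OF sT(1)[OF T]])
      show "AE x in lebesgue_on T. f x * p T x = f x * vc x" using p(2)[OF T] by eventually_elim simp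
    qed
    finally show ?thesis .
  qed
  \<comment> \<open>The jump splits into the cell unknown, whose trace is \<open>p T\<close>, and
    the skeleton unknown. The first integral is the one produced by \<open>volume\<close>.\<close>
  have flux: "(LINT x|facet_measure F. cell_flux \<kappa> u T F x \<bullet> jump (vc, vh) T F x)
     = (LINT x|facet_measure F. ?q T F x * p T x) - (LINT x|facet_measure F. ?q T F x * vh x)"
    if T: "T \<in> \<T>" "F facet_of T" for T F
  proof -
    obtain a n c where fdT: "facet_data T F a n c" using fd[OF T] by blast
    have vI: "AE x in lebesgue_on (interior T). vc x = p T x" by (rule toI[OF T(1) p(2)[OF T(1)]])
    have tr: "AE x in facet_measure F. trace_on (interior T) F vc x = p T x"
      by (rule facet_trace_smooth_representative[OF fdT p(1)[OF T(1)] vloc[OF T(1)] vI])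
    have trm: "trace_on (interior T) F vc \<in> borel_measurable (facet_measure F)"
      using facet_has_trace_trace_on[OF fdT smooth_representative_weak_pderivative(1)[OF open_interior bdI[OF T(1)]
        p(1)[OF T(1)] vloc[OF T(1)] vI]] by (simp add: has_trace_def square_integrable_def)
    have qm: "?q T F \<in> borel_measurable (facet_measure F)" using q[OF T] by (simp add: square_integrable_def)
    have vhs: "square_integrable (facet_measure F) vh" by (rule vh(1)[OF iface[OF T]])
    have i: "integrable (facet_measure F) (\<lambda>x. ?q T F x * p T x)" "integrable (facet_measure F) (\<lambda>x. ?q T F x * vh x)"
      by (intro facet_square_integrable_mult_smooth[OF fdT] square_integrable_mult q T p vhs)+
    have "cell_flux \<kappa> u T F x \<bullet> jump (vc, vh) T F x = ?q T F x * (trace_on (interior T) F vc x - vh x)" for x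
      by (simp add: jump_def normal_flux_def mult.commute)
    then have "(LINT x|facet_measure F. cell_flux \<kappa> u T F x \<bullet> jump (vc, vh) T F x)
       = (LINT x|facet_measure F. ?q T F x * (trace_on (interior T) F vc x - vh x))" by simp
    also have "\<dots> = (LINT x|facet_measure F. ?q T F x * p T x - ?q T F x * vh x)"
    proof (rule integral_cong_AE)
      show "(\<lambda>x. ?q T F x * (trace_on (interior T) F vc x - vh x)) \<in> borel_measurable (facet_measure F)"
        using vhs by (intro borel_measurable_times borel_measurable_diff qm trm) (simp add: square_integrable_def)
      show "(\<lambda>x. ?q T F x * p T x - ?q T F x * vh x) \<in> borel_measurable (facet_measure F)" using i by auto
      show "AE x in facet_measure F. ?q T F x * (trace_on (interior T) F vc x - vh x) = ?q T F x * p T x - ?q T F x * vh x"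
        using tr by eventually_elim (simp add: right_diff_distrib)
    qed
    also have "\<dots> = (LINT x|facet_measure F. ?q T F x * p T x) - (LINT x|facet_measure F. ?q T F x * vh x)"
      using i by (rule Bochner_Integration.integral_diff)
    finally show ?thesis .
  qed
  \<comment> \<open>Regrouped by interfaces, the skeleton unknown is a common factor of the normal
    fluxes from the adjacent cells. It vanishes on boundary interfaces, and on all others the flux
    sum does.\<close>
  have skeleton: "(\<Sum>T\<in>\<T>. \<Sum>F | F facet_of T. LINT x|facet_measure F. ?q T F x * vh x) = 0"
    unfolding sum_cells_facets_swap
  proof (rule sum.neutral, rule ballI)
    fix F assume F: "F \<in> interfaces \<T>"
    have "(\<Sum>T | T \<in> \<T> \<and> F facet_of T. LINT x|facet_measure F. ?q T F x * vh x)
       = (LINT x|facet_measure F. (\<Sum>T | T \<in> \<T> \<and> F facet_of T. ?q T F x * vh x))"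
      by (intro Bochner_Integration.integral_sum[symmetric] square_integrable_mult q vh(1) F) auto
    also have "\<dots> = 0"
    proof (rule integral_eq_zero_AE)
      show "AE x in facet_measure F. (\<Sum>T | T \<in> \<T> \<and> F facet_of T. ?q T F x * vh x) = 0"
      proof (cases "F \<in> boundary_interfaces \<Omega> \<T>")
        case True
        from vh(2)[OF this] show ?thesis by eventually_elim simp
      next
        case False
        from normal_flux_continuity[OF \<kappa> weak u2 f F this] show ?thesis
          by eventually_elim (simp flip: sum_distrib_right)
      qed
    qed
    finally show "(\<Sum>T | T \<in> \<T> \<and> F facet_of T. LINT x|facet_measure F. ?q T F x * vh x) = 0" .
  qed
  have mbi: "mesh_boundary_integral \<T> g = (\<Sum>T\<in>\<T>. \<Sum>F | F facet_of T. LINT x|facet_measure F. g T F x)" for g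
    unfolding mesh_boundary_integral_def by (intro sum.cong refl) (simp add: interfaces_of_eq)
  have pen: "mesh_boundary_integral \<T> (\<lambda>T F x. penalty \<alpha>0 C_tr \<delta> \<kappa> T F * (jump (u, uh) T F x \<bullet> jump v T F x)) = 0"
    unfolding mbi
  proof (intro sum.neutral ballI integral_eq_zero_AE)
    fix T F assume "T \<in> \<T>" "F \<in> {F. F facet_of T}"
    then have "AE x in facet_measure F. jump (u, uh) T F x = 0" using jump_u by simp
    then show "AE x in facet_measure F. penalty \<alpha>0 C_tr \<delta> \<kappa> T F * (jump (u, uh) T F x \<bullet> jump v T F x) = 0"
      by eventually_elim simp
  qed
  have sym: "mesh_boundary_integral \<T> (\<lambda>T F x. cell_flux \<kappa> (fst v) T F x \<bullet> jump (u, uh) T F x) = 0"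
    unfolding mbi
  proof (intro sum.neutral ballI integral_eq_zero_AE)
    fix T F assume "T \<in> \<T>" "F \<in> {F. F facet_of T}"
    then have "AE x in facet_measure F. jump (u, uh) T F x = 0" using jump_u by simp
    then show "AE x in facet_measure F. cell_flux \<kappa> (fst v) T F x \<bullet> jump (u, uh) T F x = 0"
      by eventually_elim simp
  qed
  have vol: "mesh_integral \<T> (\<lambda>x. (\<kappa> x *v broken_grad \<T> u x) \<bullet> broken_grad \<T> vc x)
     = mesh_integral \<T> (\<lambda>x. f x * vc x) + (\<Sum>T\<in>\<T>. \<Sum>F | F facet_of T. LINT x|facet_measure F. ?q T F x * p T x)"
    unfolding mesh_integral_def by (simp add: volume sum.distrib)
  \<comment> \<open>After \<open>skeleton\<close> removes its part, the consistency term is the same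
    facet sum as in \<open>vol\<close> and enters the form with the opposite sign.\<close>
  have con: "mesh_boundary_integral \<T> (\<lambda>T F x. cell_flux \<kappa> u T F x \<bullet> jump v T F x)
     = (\<Sum>T\<in>\<T>. \<Sum>F | F facet_of T. LINT x|facet_measure F. ?q T F x * p T x)"
    using skeleton unfolding mbi vv by (simp add: flux sum_subtractf)
  show "bilinear_form \<T> \<kappa> (penalty \<alpha>0 C_tr \<delta> \<kappa>) \<epsilon> (u, uh) v = mesh_integral \<T> (\<lambda>x. f x * fst v x)"
    using pen sym vol con unfolding bilinear_form_def by (simp add: vv)
qed

end
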